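(* Let $\beta\in\{1,2\}$ and $0<d<1$ be fixed. For each $n$ let $W=W_{n,\beta,d}$ be the $\beta$-Wishart matrix and let $\mathbf b=\mathbf b^{(n)}$ be a (possibly random) vector with $\|\mathbf b\|_2=1$, independent of $W$. Apply the conjugate gradient algorithm with $\mathbf x_0=\mathbf 0$ to $W\mathbf x=\mathbf b$, with error vectors $\mathbf e_k=\mathbf x-\mathbf x_k$, $k=0,1,2,\dots$. Then for $\ell\in\mathbb Z$ $$\|\mathbf e_k\|_{W^\ell}\to\mathfrak e_{\ell,k,d}\quad\text{almost surely as } n\to\infty,$$ and there is a constant $C_{\ell,d,k}>0$, independent of $n$, such that for $n>1$ $$\mathbb E\left[\left|\,\|\mathbf e_k\|_{W^\ell}-\mathfrak e_{\ell,k,d}\right|\right]\le C_{\ell,d,k}\frac{\log n}{\sqrt n}.$$ If $d=1$, these relations hold for $\ell\ge2$.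
   Context: Wishart matrices: for $\beta\in\{1,2\}$, $0<d\le 1$, put $m=\lfloor n/d\rfloor$. Let $X$ be an $n\times m$ matrix of iid real standard normal variables if $\beta=1$, and $X=X_1+\mathrm i X_2$ with $X_1,X_2$ independent $n\times m$ matrices of iid real standard normals if $\beta=2$. Then $W_{n,\beta,d}=\frac1{\beta m}XX^*$ (positive definite almost surely). The vectors $\mathbf b$ are in $\mathbb R^n$ if $\beta=1$ and in $\mathbb C^n$ if $\beta=2$. For almost sure convergence, the pairs $(W_{n,\beta,d},\mathbf b^{(n)})$ are understood to be defined on a common probability space. Conjugate gradient algorithm for $W\mathbf x=\mathbf b$, $W>0$, with $\mathbf x_0=\mathbf 0$, in exact arithmetic: $\mathbf x_k$ is the unique minimizer of $\|\mathbf y-\mathbf x\|_W$ over $\mathbf y\in\mathrm{span}\{\mathbf b,W\mathbf b,\dots,W^{k-1}\mathbf b\}$. For $\ell\in\mathbb Z$, $\|\mathbf y\|_{W^\ell}^2=\mathbf y^*W^\ell\mathbf y$. $\mathfrak e_{\ell,k,d}\ge0$ is defined by $\mathfrak e_{\ell,k,d}^2=\int\lambda^{\ell-2}\det(\mathbb T_{k,d}-\lambda I)^2\mu_{\mathrm{MP},d}(\mathrm d\lambda)$ (with the determinant equal to $1$ when $k=0$), where $\mu_{\mathrm{MP},d}$ is the probability measure with density $\frac1{2\pi d}\frac{\sqrt{|(d_+-x)(x-d_-)|}}{x}\mathbf 1_{[d_-,d_+]}(x)$, $d_\pm=(1\pm\sqrt d)^2$, and $\mathbb T_{k,d}$ is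 the upper-left $k\times k$ block of $\mathbb H_d\mathbb H_d^*$, $\mathbb H_d$ being the infinite lower bidiagonal matrix with diagonal entries $1$ and first-subdiagonal entries $\sqrt d$. Constants carry their dependencies as subscripts, except that dependence on $\beta$ is suppressed.
   Formalization: The bound is stated for those n>1 with finite expectation (proved for all large n, and all n>1 if ℓ≥2), as it can be infinite: β=1, ℓ=1, k=0, n=2, d=0.9. C is formally chosen per type of sample space; passing to the law of the matrices and vectors makes it universal. *)

theory Defs
  imports
    "HOL-Probability.Probability"
    "Jordan_Normal_Form.Gauss_Jordan_Elimination"
    "Jordan_Normal_Form.Determinant"
begin

text \<open>Vectors and matrices whose dimension varies with \<open>n\<close> are those of
  \<^theory>\<open>Jordan_Normal_Form.Matrix\<close>, not the type-indexed ones of HOL-Analysis.\<close>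

no_notation vec_nth (infixl \<open>$\<close> 90)

hide_const (open) Finite_Cartesian_Product.vec Finite_Cartesian_Product.mat Determinants.det
  Finite_Cartesian_Product.row Finite_Cartesian_Product.column

text \<open>Both values of \<open>\<beta>\<close> are treated inside the complex numbers; for \<open>\<beta> = 1\<close> all scalars
  (vector entries, Krylov coefficients) are restricted to the subset of real numbers.\<close>

definition scalars :: "nat \<Rightarrow> complex set" where
  "scalars \<beta> = (if \<beta> = 1 then \<real> else UNIV)"

definition adjoint_mat :: "complex mat \<Rightarrow> complex mat" where
  "adjoint_mat A = mat (dim_col A) (dim_row A) (\<lambda>(i, j). cnj (A $$ (j, i)))"

definition pos_def :: "complex mat \<Rightarrow> bool" where
  "pos_def A \<longleftrightarrow> adjoint_mat A = A \<and>
     (\<forall>v \<in> carrier_vec (dim_row A). v \<noteq> 0\<^sub>v (dim_row A) \<longrightarrow> 0 < Re ((A *\<^sub>v v) \<bullet>c v))"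

text \<open>\<open>mat_inverse\<close> is partial; \<open>mat_powi\<close> is only meaningful at negative exponents
  when \<open>A\<close> is invertible.\<close>

definition mat_powi :: "complex mat \<Rightarrow> int \<Rightarrow> complex mat" where
  "mat_powi A l =
     (if 0 \<le> l then A ^\<^sub>m nat l else the (mat_inverse A) ^\<^sub>m nat (- l))"

definition energy_norm :: "complex mat \<Rightarrow> complex vec \<Rightarrow> real" where
  "energy_norm A y = sqrt (Re ((A *\<^sub>v y) \<bullet>c y))"

definition krylov :: "nat \<Rightarrow> complex mat \<Rightarrow> complex vec \<Rightarrow> nat \<Rightarrow> complex vec set" where
  "krylov \<beta> W b k =
     {vec (dim_vec b) (\<lambda>i. \<Sum>j<k. c j * (W ^\<^sub>m j *\<^sub>v b) $ i) | c. \<forall>j<k. c j \<in> scalars \<beta>}"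

definition cg_solution :: "complex mat \<Rightarrow> complex vec \<Rightarrow> complex vec" where
  "cg_solution W b = the (mat_inverse W) *\<^sub>v b"

definition cg_iterate :: "nat \<Rightarrow> complex mat \<Rightarrow> complex vec \<Rightarrow> nat \<Rightarrow> complex vec" where
  "cg_iterate \<beta> W b k =
     (THE y. y \<in> krylov \<beta> W b k \<and>
        (\<forall>z \<in> krylov \<beta> W b k.
           energy_norm W (y - cg_solution W b) \<le> energy_norm W (z - cg_solution W b)))"

definition cg_error :: "nat \<Rightarrow> complex mat \<Rightarrow> complex vec \<Rightarrow> nat \<Rightarrow> complex vec" where
  "cg_error \<beta> W b k = cg_solution W b - cg_iterate \<beta> W b k"

text \<open>The algorithm is only defined for positive definite \<open>W\<close>, which a Wishart matrix is
  almost surely.  The value 0 on the exceptional null set makes the error norm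
  a measurable function of \<open>W\<close> and \<open>b\<close>.\<close>

definition cg_error_norm ::
    "nat \<Rightarrow> int \<Rightarrow> complex mat \<Rightarrow> complex vec \<Rightarrow> nat \<Rightarrow> real" where
  "cg_error_norm \<beta> l W b k =
     (if pos_def W then energy_norm (mat_powi W l) (cg_error \<beta> W b k) else 0)"

definition wishart_cols :: "real \<Rightarrow> nat \<Rightarrow> nat" where
  "wishart_cols d n = nat \<lfloor>real n / d\<rfloor>"

definition wishart :: "nat \<Rightarrow> nat \<Rightarrow> complex mat \<Rightarrow> complex mat" where
  "wishart \<beta> m X = complex_of_real (1 / (real \<beta> * real m)) \<cdot>\<^sub>m (X * adjoint_mat X)"

text \<open>The index \<open>p < \<beta>\<close> selects the real part (\<open>p = 0\<close>) or the imaginary part (\<open>p = 1\<close>)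
  of an entry, so for \<open>\<beta> = 2\<close> this is \<open>X = X\<^sub>1 + \<i> X\<^sub>2\<close>.  Each part has variance 1.\<close>

definition gaussian_matrix ::
    "'a measure \<Rightarrow> nat \<Rightarrow> nat \<Rightarrow> nat \<Rightarrow> ('a \<Rightarrow> complex mat) \<Rightarrow> bool" where
  "gaussian_matrix M \<beta> n m X \<longleftrightarrow>
     (\<forall>\<omega> \<in> space M. X \<omega> \<in> carrier_mat n m \<and> (\<forall>i<n. \<forall>j<m. X \<omega> $$ (i, j) \<in> scalars \<beta>)) \<and>
     (let part = (\<lambda>(p, i, j) \<omega>. if p = (0::nat) then Re (X \<omega> $$ (i, j)) else Im (X \<omega> $$ (i, j)));
          I = {..<\<beta>} \<times> {..<n} \<times> {..<m}
      in prob_space.indep_vars M (\<lambda>_. borel) part I \<and>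
         (\<forall>q \<in> I. distributed M lborel (part q) std_normal_density))"

text \<open>The whole sequence lives on one probability space, with arbitrary dependence between
  different values of \<open>n\<close>.  For each \<open>n\<close>, the \<open>\<sigma>\<close>-algebras generated by \<open>W n\<close> and by
  \<open>b n\<close> are independent.\<close>

definition wishart_cg_model ::
    "'a measure \<Rightarrow> nat \<Rightarrow> real \<Rightarrow> (nat \<Rightarrow> 'a \<Rightarrow> complex mat) \<Rightarrow> (nat \<Rightarrow> 'a \<Rightarrow> complex mat) \<Rightarrow>
       (nat \<Rightarrow> 'a \<Rightarrow> complex vec) \<Rightarrow> bool" where
  "wishart_cg_model M \<beta> d X W b \<longleftrightarrow>
     prob_space M \<and>
     (\<forall>n \<ge> 1.
        gaussian_matrix M \<beta> n (wishart_cols d n) (X n) \<and>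
        (\<forall>\<omega> \<in> space M. W n \<omega> = wishart \<beta> (wishart_cols d n) (X n \<omega>)) \<and>
        (\<forall>\<omega> \<in> space M. b n \<omega> \<in> carrier_vec n \<and> (\<forall>i<n. b n \<omega> $ i \<in> scalars \<beta>)) \<and>
        (AE \<omega> in M. L2_set (\<lambda>i. cmod (b n \<omega> $ i)) {..<n} = 1) \<and>
        (\<forall>i<n. (\<lambda>\<omega>. b n \<omega> $ i) \<in> borel_measurable M) \<and>
        prob_space.indep_set M
          (sets (vimage_algebra (space M)
             (\<lambda>\<omega>. restrict (\<lambda>(i, j). W n \<omega> $$ (i, j)) ({..<n} \<times> {..<n}))
             (PiM ({..<n} \<times> {..<n}) (\<lambda>_. borel))))
          (sets (vimage_algebra (space M)
             (\<lambda>\<omega>. restrict (\<lambda>i. b n \<omega> $ i) {..<n})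
             (PiM {..<n} (\<lambda>_. borel)))))"

definition d_plus :: "real \<Rightarrow> real" where "d_plus d = (1 + sqrt d)\<^sup>2"
definition d_minus :: "real \<Rightarrow> real" where "d_minus d = (1 - sqrt d)\<^sup>2"

definition marchenko_pastur :: "real \<Rightarrow> real measure" where
  "marchenko_pastur d = density lborel (\<lambda>x. ennreal
     (1 / (2 * pi * d) * (sqrt \<bar>(d_plus d - x) * (x - d_minus d)\<bar> / x)
        * indicator {d_minus d..d_plus d} x))"

definition bidiag :: "real \<Rightarrow> nat \<Rightarrow> nat \<Rightarrow> real" where
  "bidiag d i j = (if i = j then 1 else if i = Suc j then sqrt d else 0)"

text \<open>Upper-left block of \<open>H H\<^sup>*\<close>; the series has at most two nonzero terms.\<close>

definition jacobi_block :: "real \<Rightarrow> nat \<Rightarrow> real mat" where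
  "jacobi_block d k = mat k k (\<lambda>(i, j). \<Sum>r. bidiag d i r * bidiag d j r)"

definition limit_error :: "int \<Rightarrow> nat \<Rightarrow> real \<Rightarrow> real" where
  "limit_error l k d = sqrt (\<integral>x. x powi (l - 2) *
     (det (jacobi_block d k - x \<cdot>\<^sub>m 1\<^sub>m k))\<^sup>2 \<partial>marchenko_pastur d)"

end

theory Submission
  imports Defs
begin

text \<open>
  The law of the error norm is invariant under \<open>W \<mapsto> U W U\<^sup>*\<close>, \<open>b \<mapsto> U b\<close> for unitary \<open>U\<close>, so by
  independence \<open>b\<close> may be replaced by the first unit vector.  Alternating reflections from the right and from
  the left, which preserve the Gaussian law of \<open>X\<close>, make \<open>X\<close> lower bidiagonal; the squared entries are then
  independent scaled chi-square variables, of mean close to \<open>1\<close> (diagonal) and \<open>d\<close> (subdiagonal).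
  For the resulting Jacobi matrix the error norm is explicit:
  its square is the integral of \<open>\<lambda>\<^bsup>l - 2\<^esup> p\<^sub>k(\<lambda>)\<^sup>2\<close> against the spectral measure of the first unit vector, divided by
  \<open>p\<^sub>k(0)\<^sup>2\<close>, where \<open>p\<^sub>k\<close> is the characteristic polynomial of the leading \<open>k\<close> by \<open>k\<close> block.  The spectral moments, also those of
  negative order, obey a convolution recursion over the trailing blocks, and for constant entries \<open>1\<close> and \<open>d\<close> this
  is the recursion of the Marchenko-Pastur moments.  For positive orders the recursion is
  finite; for negative orders it is a random affine recursion with multiplier \<open>s / a\<close>, close to \<open>d < 1\<close>, hence contracting in every
  moment.  Thus all even moments of the deviation from the limit are of order \<open>n\<^sup>-\<^sup>p\<close>: the second moments give the
  rate, the fourth moments almost sure convergence.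
\<close>

subsection \<open>Moments of the Marchenko-Pastur law\<close>

text \<open>\<open>mp_pos d j\<close> and \<open>mp_neg d j\<close> are the moments of order \<open>j\<close> and \<open>-j\<close>; the convolution recursions are
  the quadratic equation of the Stieltjes transform, expanded at infinity and at zero.\<close>

fun mp_pos :: "real \<Rightarrow> nat \<Rightarrow> real" where
  "mp_pos d 0 = 1"
| "mp_pos d (Suc j) = mp_pos d j + d * (\<Sum>i<j. mp_pos d (Suc i) * mp_pos d (j - Suc i))"

fun mp_neg :: "real \<Rightarrow> nat \<Rightarrow> real" where
  "mp_neg d 0 = 1"
| "mp_neg d (Suc j) =
     (mp_neg d j + d * (\<Sum>i<j. mp_neg d (Suc i) * mp_neg d (j - i))) / (1 - d)"

declare mp_pos.simps(2) [simp del] mp_neg.simps(2) [simp del]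

section \<open>Three-term recurrences from quadratic equations for power series\<close>

lemma quadratic_fps_deriv:
  fixes Y R :: "'a :: {idom, ring_char_0} fps"
  assumes "Y * Y = R"
  shows "2 * (R * fps_deriv Y) = fps_deriv R * Y"
proof -
  have "fps_deriv R = 2 * (Y * fps_deriv Y)"
    unfolding assms[symmetric] by (simp add: algebra_simps)
  then show ?thesis by (simp add: assms[symmetric] algebra_simps)
qed

text \<open>A square root \<open>Y\<close> of a quadratic polynomial \<open>R\<close> satisfies the
  linear differential equation \<open>2 R Y' = R' Y\<close>; comparing coefficients of order
  \<open>n + 2\<close> gives the recurrence. It makes the convolution recursions linear, and in this
  form they can be compared with integrals.\<close>

lemma fps_quadratic_coeff:
  fixes Y :: "real fps"
  assumes "Y * Y = fps_const a + fps_const b * fps_X + fps_const c * (fps_X * fps_X)"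
  shows "2 * (a * (real n + 3) * fps_nth Y (n + 3) + b * (real n + 2) * fps_nth Y (n + 2)
      + c * (real n + 1) * fps_nth Y (n + 1)) = b * fps_nth Y (n + 2) + 2 * c * fps_nth Y (n + 1)"
proof -
  note q = quadratic_fps_deriv[OF assms]
  have nm: "n + 3 = Suc (Suc (Suc n))" "n + 2 = Suc (Suc n)" "n + 1 = Suc n" by simp_all
  have "fps_nth (2 * ((fps_const a + fps_const b * fps_X + fps_const c * (fps_X * fps_X)) * fps_deriv Y)) (n+2)
     = fps_nth (fps_deriv (fps_const a + fps_const b * fps_X + fps_const c * (fps_X * fps_X)) * Y) (n+2)"
    using q by simp
  moreover have "(2::real fps) = fps_const 2" by (simp add: numeral_fps_const)
  moreover have "fps_deriv (fps_const a + fps_const b * fps_X + fps_const c * (fps_X * fps_X)) * Y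
      = fps_const b * Y + fps_const (2 * c) * (fps_X * Y)"
    by (simp add: algebra_simps fps_const_add[symmetric] del: fps_const_add)
  ultimately show ?thesis
    unfolding nm by (simp add: distrib_right mult.assoc) (simp add: algebra_simps)
qed

lemma mp_pos_fps:
  "Abs_fps (mp_pos d) = 1 + fps_X * Abs_fps (mp_pos d)
     + fps_const d * fps_X * ((Abs_fps (mp_pos d) - 1) * Abs_fps (mp_pos d))" (is "?K = ?R")
proof (rule fps_ext)
  fix n show "fps_nth ?K n = fps_nth ?R n"
  proof (cases n)
    case (Suc j)
    have "fps_nth ((?K - 1) * ?K) j = (\<Sum>i=0..j. (if i = 0 then 0 else mp_pos d i) * mp_pos d (j - i))"
      unfolding fps_mult_nth by (intro sum.cong) auto
    also have "\<dots> = (\<Sum>i=1..j. mp_pos d i * mp_pos d (j - i))"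
      by (rule sum.mono_neutral_cong_right) auto
    also have "\<dots> = (\<Sum>i<j. mp_pos d (Suc i) * mp_pos d (j - Suc i))"
      by (rule sum.reindex_bij_witness[of _ Suc "\<lambda>i. i - 1"]) auto
    finally show ?thesis using Suc by (simp add: mult.assoc mp_pos.simps(2)[of d j])
  qed simp
qed

lemma mp_pos_linear:
  assumes "d > 0"
  shows "(real j + 3) * mp_pos d (j + 2) = (2 * real j + 3) * (1 + d) * mp_pos d (j + 1)
     - real j * (1 - d)\<^sup>2 * mp_pos d j"
proof (cases j)
  case 0
  then show ?thesis using mp_pos.simps(2)[of d 0] mp_pos.simps(2)[of d 1] by (simp add: numeral_2_eq_2 algebra_simps)
next
  case (Suc i)
  define K where "K = Abs_fps (mp_pos d)"
  define D where "D = fps_const d"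
  \<comment> \<open>\<open>Y\<close> is the derivative with respect to \<open>K\<close> of the
    quadratic polynomial whose root is \<open>K\<close>, so \<open>Y * Y\<close> is its
    discriminant.\<close>
  define Y where "Y = 2 * D * (fps_X * K) + (1 - D) * fps_X - 1"
  have K: "D * fps_X * (K * K) + (1 - D) * fps_X * K - K = - 1"
  proof -
    have "D * fps_X * (K * K) + (1 - D) * fps_X * K - K
        = (1 + fps_X * K + D * fps_X * ((K - 1) * K)) - K - 1"
      by (simp add: algebra_simps)
    then show ?thesis using mp_pos_fps[of d] unfolding K_def[symmetric] D_def[symmetric] by simp
  qed
  have "Y * Y = 1 + (- 2 * (1 + D)) * fps_X + (1 - D)\<^sup>2 * (fps_X * fps_X)"
  proof -
    have "Y * Y = ((1 - D) * fps_X - 1)\<^sup>2 + 4 * D * fps_X * (D * fps_X * (K * K) + (1 - D) * fps_X * K - K)"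
      unfolding Y_def by (simp add: algebra_simps power2_eq_square)
    then show ?thesis unfolding K by (simp add: algebra_simps power2_eq_square)
  qed
  also have "\<dots> = fps_const 1 + fps_const (- 2 * (1 + d)) * fps_X + fps_const ((1 - d)\<^sup>2) * (fps_X * fps_X)"
    unfolding D_def by (simp only: fps_const_mult[symmetric] fps_const_add[symmetric] fps_const_sub[symmetric] fps_const_neg[symmetric]
        fps_const_1_eq_1 numeral_fps_const[symmetric] fps_const_power[symmetric])
  finally have YY: "Y * Y = \<dots>" .
  have Y: "fps_nth Y (Suc (Suc i)) = 2 * d * mp_pos d (Suc i)" for i
    by (simp add: Y_def D_def K_def numeral_fps_const mult.assoc algebra_simps)
  define e where "e = (1 - d)\<^sup>2"
  have E: "2 * (1 * (real j + 3) * (2 * d * mp_pos d (j + 2)) + - 2 * (1 + d) * (real j + 2) * (2 * d * mp_pos d (j + 1))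
      + (1 - d)\<^sup>2 * (real j + 1) * (2 * d * mp_pos d j))
      = - 2 * (1 + d) * (2 * d * mp_pos d (j + 1)) + 2 * (1 - d)\<^sup>2 * (2 * d * mp_pos d j)"
    using fps_quadratic_coeff[OF YY, of j] Y[of "j + 1"] Y[of j] Y[of i] Suc
    by (simp add: numeral_3_eq_3 numeral_2_eq_2)
  have "4 * d * ((real j + 3) * mp_pos d (j + 2) - (2 * real j + 3) * (1 + d) * mp_pos d (j + 1)
     + real j * (1 - d)\<^sup>2 * mp_pos d j) = 0"
    using E unfolding e_def[symmetric] by (simp add: algebra_simps)
  then show ?thesis using assms by simp
qed

lemma mp_neg_fps:
  assumes "d < 1"
  shows "Abs_fps (mp_neg d) = 1 + fps_X * Abs_fps (mp_neg d)
     + fps_const d * ((Abs_fps (mp_neg d) - 1) * Abs_fps (mp_neg d))" (is "?K = ?R")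
proof (rule fps_ext)
  fix n show "fps_nth ?K n = fps_nth ?R n"
  proof (cases n)
    case (Suc j)
    have "fps_nth ((?K - 1) * ?K) n = (\<Sum>i=0..n. (if i = 0 then 0 else mp_neg d i) * mp_neg d (n - i))"
      unfolding fps_mult_nth by (intro sum.cong) auto
    also have "\<dots> = (\<Sum>i=1..n. mp_neg d i * mp_neg d (n - i))"
      by (rule sum.mono_neutral_cong_right) auto
    also have "\<dots> = (\<Sum>i<Suc j. mp_neg d (Suc i) * mp_neg d (n - Suc i))"
      by (rule sum.reindex_bij_witness[of _ Suc "\<lambda>i. i - 1"]) (auto simp: Suc)
    also have "\<dots> = mp_neg d (Suc j) + (\<Sum>i<j. mp_neg d (Suc i) * mp_neg d (j - i))"
      by (simp add: Suc) 
    finally have e: "fps_nth ((?K - 1) * ?K) n = \<dots>" .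
    have "mp_neg d (Suc j) * (1 - d) = mp_neg d j + d * (\<Sum>i<j. mp_neg d (Suc i) * mp_neg d (j - i))"
      using assms mp_neg.simps(2)[of d j] by simp
    then show ?thesis using e Suc by (simp add: algebra_simps)
  qed simp
qed

lemma mp_neg_linear:
  assumes "0 < d" "d < 1"
  shows "(1 - d)\<^sup>2 * (real j + 2) * mp_neg d (j + 2) = (1 + d) * (2 * real j + 1) * mp_neg d (j + 1)
     + (1 - real j) * mp_neg d j"
proof -
  define K where "K = Abs_fps (mp_neg d)"
  define D where "D = fps_const d"
  \<comment> \<open>Again the derivative of the quadratic polynomial in \<open>K\<close>. Its part
    free of \<open>K\<close> alters the coefficients of order 0 and 1, which is why
    \<open>j = 0\<close> and \<open>j = 1\<close> are treated apart.\<close>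
  define Y where "Y = 2 * D * K - (1 + D) + fps_X"
  have K: "D * (K * K) - (1 + D) * K + fps_X * K = - 1"
  proof -
    have "D * (K * K) - (1 + D) * K + fps_X * K = (1 + fps_X * K + D * ((K - 1) * K)) - K - 1"
      by (simp add: algebra_simps)
    then show ?thesis using mp_neg_fps[OF assms(2)] unfolding K_def[symmetric] D_def[symmetric] by simp
  qed
  have "Y * Y = (1 - D)\<^sup>2 + (- 2 * (1 + D)) * fps_X + 1 * (fps_X * fps_X)"
  proof -
    have "Y * Y = (fps_X - (1 + D))\<^sup>2 + 4 * D * (D * (K * K) - (1 + D) * K + fps_X * K)"
      unfolding Y_def by (simp add: algebra_simps power2_eq_square)
    then show ?thesis unfolding K by (simp add: algebra_simps power2_eq_square)
  qed
  also have "\<dots> = fps_const ((1 - d)\<^sup>2) + fps_const (- 2 * (1 + d)) * fps_X + fps_const 1 * (fps_X * fps_X)"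
    unfolding D_def by (simp only: fps_const_mult[symmetric] fps_const_add[symmetric] fps_const_sub[symmetric] fps_const_neg[symmetric]
        fps_const_1_eq_1 numeral_fps_const[symmetric] fps_const_power[symmetric])
  finally have YY: "Y * Y = \<dots>" .
  have Y: "fps_nth Y (Suc (Suc i)) = 2 * d * mp_neg d (Suc (Suc i))" for i
    by (simp add: Y_def D_def K_def numeral_fps_const mult.assoc fps_X_def)
  have Y1: "fps_nth Y (Suc 0) = 2 * d * mp_neg d (Suc 0) + 1"
    by (simp add: Y_def D_def K_def numeral_fps_const mult.assoc fps_X_def)
  consider "j = 0" | "j = 1" | i where "j = Suc (Suc i)" by (metis One_nat_def old.nat.exhaust)
  then show ?thesis
  proof cases
    case 1
    define u where "u = mp_neg d (Suc 0)"
    have u: "(1 - d) * u = 1" using assms mp_neg.simps(2)[of d 0] by (simp add: u_def)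
    have "(1 - d) * mp_neg d (Suc (Suc 0)) = u + d * (u * u)"
      using assms mp_neg.simps(2)[of d 1] by (simp add: u_def)
    then have "(1 - d)\<^sup>2 * 2 * mp_neg d (Suc (Suc 0)) = (1 + d) * u + 1"
    proof -
      have m: "(1 - d) * mp_neg d (Suc (Suc 0)) = u + d * (u * u)" by fact
      have "(1 - d)\<^sup>2 * 2 * mp_neg d (Suc (Suc 0)) = 2 * ((1 - d) * ((1 - d) * mp_neg d (Suc (Suc 0))))"
        by (simp add: power2_eq_square)
      also have "\<dots> = 2 * ((1 - d) * u + d * ((1 - d) * u * u))" unfolding m by (simp add: algebra_simps)
      also have "\<dots> = 2 * (1 + d * u)" unfolding u by simp
      also have "\<dots> = (1 + d) * u + 1" using u by (simp add: algebra_simps)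
      finally show ?thesis .
    qed
    then show ?thesis using 1 by (simp add: u_def numeral_2_eq_2)
  next
    case 2
    define e where "e = (1 - d)\<^sup>2"
    have E: "2 * ((1 - d)\<^sup>2 * 3 * (2 * d * mp_neg d 3) + - 2 * (1 + d) * 2 * (2 * d * mp_neg d 2)
      + (2 * d * mp_neg d 1 + 1)) = - 2 * (1 + d) * (2 * d * mp_neg d 2) + 2 * (2 * d * mp_neg d 1 + 1)"
      using fps_quadratic_coeff[OF YY, of 0] Y[of 1] Y[of 0] Y1
      by (simp add: numeral_3_eq_3 numeral_2_eq_2)
    have "4 * d * ((1 - d)\<^sup>2 * 3 * mp_neg d 3 - (1 + d) * 3 * mp_neg d 2) = 0"
      using E unfolding e_def[symmetric] by (simp add: algebra_simps)
    then show ?thesis using assms 2 by (simp add: numeral_3_eq_3 numeral_2_eq_2)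
  next
    case (3 i)
    define e where "e = (1 - d)\<^sup>2"
    have E: "2 * ((1 - d)\<^sup>2 * (real j + 2) * (2 * d * mp_neg d (j + 2)) + - 2 * (1 + d) * (real j + 1) * (2 * d * mp_neg d (j + 1))
      + real j * (2 * d * mp_neg d j)) = - 2 * (1 + d) * (2 * d * mp_neg d (j + 1)) + 2 * (2 * d * mp_neg d j)"
      using fps_quadratic_coeff[OF YY, of "Suc i"] Y[of "Suc (Suc i)"] Y[of "Suc i"] Y[of i] 3
      by (simp add: numeral_3_eq_3 numeral_2_eq_2 add.commute)
    have "4 * d * ((1 - d)\<^sup>2 * (real j + 2) * mp_neg d (j + 2) - (1 + d) * (2 * real j + 1) * mp_neg d (j + 1)
     - (1 - real j) * mp_neg d j) = 0"
      using E unfolding e_def[symmetric] by (simp add: algebra_simps)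
    then show ?thesis using assms by simp
  qed
qed

section \<open>The two elementary integrals of the square-root density\<close>

definition mp_root :: "real \<Rightarrow> real \<Rightarrow> real" where
  "mp_root d x = sqrt ((d_plus d - x) * (x - d_minus d))"

lemma mp_edges_sum: "d_plus d + d_minus d = 2 * (1 + d)" if "0 \<le> d"
  using that by (simp add: d_plus_def d_minus_def power2_eq_square algebra_simps)

lemma mp_edges_prod: "d_plus d * d_minus d = (1 - d)\<^sup>2" if "0 \<le> d"
proof -
  have "d_plus d * d_minus d = ((1 + sqrt d) * (1 - sqrt d))\<^sup>2"
    by (simp add: d_plus_def d_minus_def power_mult_distrib)
  also have "(1 + sqrt d) * (1 - sqrt d) = 1 - d"
    using that by (simp add: algebra_simps)
  finally show ?thesis .
qed

lemma mp_root_sq_poly: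
  assumes "0 \<le> d"
  shows "(d_plus d - x) * (x - d_minus d) = - x\<^sup>2 + 2 * (1 + d) * x - (1 - d)\<^sup>2"
proof -
  have "(d_plus d - x) * (x - d_minus d) = - x\<^sup>2 + (d_plus d + d_minus d) * x - d_plus d * d_minus d"
    by (simp add: algebra_simps power2_eq_square)
  then show ?thesis using assms by (simp add: mp_edges_sum mp_edges_prod)
qed

lemma mp_edges_pos:
  assumes "0 < d" "d \<le> 1"
  shows "0 \<le> d_minus d" "d_minus d < d_plus d" "d < 1 \<Longrightarrow> 0 < d_minus d"
proof -
  show "0 \<le> d_minus d" by (simp add: d_minus_def)
  show "d_minus d < d_plus d" using assms
    by (simp add: d_minus_def d_plus_def power2_eq_square algebra_simps)
  show "0 < d_minus d" if "d < 1"
    using that by (simp add: d_minus_def)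
qed

lemma mp_root_sq:
  assumes "0 \<le> d" "x \<in> {d_minus d..d_plus d}"
  shows "(mp_root d x)\<^sup>2 = - x\<^sup>2 + 2 * (1 + d) * x - (1 - d)\<^sup>2"
  using assms unfolding mp_root_def mp_root_sq_poly[OF assms(1), symmetric] by simp

lemma mp_root_pos: "x \<in> {d_minus d<..<d_plus d} \<Longrightarrow> 0 < mp_root d x"
  by (simp add: mp_root_def)

lemma mp_root_edge [simp]: "mp_root d (d_minus d) = 0" "mp_root d (d_plus d) = 0"
  by (simp_all add: mp_root_def)

lemma continuous_mp_root [continuous_intros]: "continuous_on S (mp_root d)"
  unfolding mp_root_def by (intro continuous_intros)

lemma mp_root_deriv:
  assumes "0 \<le> d" "x \<in> {d_minus d<..<d_plus d}"
  shows "(mp_root d has_real_derivative (1 + d - x) / mp_root d x) (at x)"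
proof -
  have "0 < (d_plus d - x) * (x - d_minus d)" using assms by simp
  then have "((\<lambda>x. sqrt ((d_plus d - x) * (x - d_minus d))) has_real_derivative
     ((d_plus d - x) - (x - d_minus d)) * (inverse (sqrt ((d_plus d - x) * (x - d_minus d))) / 2)) (at x)"
    by (auto intro!: derivative_eq_intros simp: field_simps)
  moreover have "((d_plus d - x) - (x - d_minus d)) = 2 * (1 + d - x)"
    using mp_edges_sum[OF assms(1)] by simp
  ultimately show ?thesis
    unfolding mp_root_def[abs_def] divide_inverse
    by (metis (no_types, lifting) mult.assoc mult.commute divide_inverse nonzero_mult_div_cancel_left zero_neq_numeral)
qed

text \<open>The affine map of the support onto the interval from -1 to 1. On the open support
  \<open>arcsin (mp_arg d x)\<close> is a primitive of \<open>1 / mp_root d x\<close>.\<close>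

definition mp_arg :: "real \<Rightarrow> real \<Rightarrow> real" where
  "mp_arg d x = (x - 1 - d) / (2 * sqrt d)"

lemma mp_arg_sq:
  assumes "0 < d" "x \<in> {d_minus d..d_plus d}"
  shows "1 - (mp_arg d x)\<^sup>2 = (mp_root d x / (2 * sqrt d))\<^sup>2"
proof -
  have "4 * d * (1 - (mp_arg d x)\<^sup>2) = 4 * d - (x - 1 - d)\<^sup>2"
    using assms by (simp add: mp_arg_def power_divide power_mult_distrib divide_simps)
  also have "\<dots> = (mp_root d x)\<^sup>2"
    using assms by (subst mp_root_sq) (auto simp: power2_eq_square algebra_simps)
  finally have "1 - (mp_arg d x)\<^sup>2 = (mp_root d x)\<^sup>2 / (4 * d)"
    using assms by (metis mult_eq_0_iff nonzero_mult_div_cancel_left less_numeral_extra(3) zero_neq_numeral)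
  then show ?thesis using assms by (simp add: power_divide power_mult_distrib)
qed

lemma mp_arg_edge:
  assumes "0 < d"
  shows "mp_arg d (d_minus d) = -1" "mp_arg d (d_plus d) = 1"
  using assms by (simp_all add: mp_arg_def d_minus_def d_plus_def divide_simps power2_eq_square algebra_simps)

lemma mp_arg_bound:
  assumes "0 < d" "x \<in> {d_minus d..d_plus d}"
  shows "\<bar>mp_arg d x\<bar> \<le> 1"
proof -
  have "(mp_arg d x)\<^sup>2 \<le> 1"
    using mp_arg_sq[OF assms] zero_le_power2[of "mp_root d x / (2 * sqrt d)"] by linarith
  then show ?thesis by (simp add: abs_square_le_1)
qed

lemma arcsin_mp_arg_deriv:
  assumes "0 < d" "x \<in> {d_minus d<..<d_plus d}"
  shows "((\<lambda>x. arcsin (mp_arg d x)) has_real_derivative 1 / mp_root d x) (at x)"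
proof -
  have x: "x \<in> {d_minus d..d_plus d}" using assms by simp
  have pos: "0 < mp_root d x / (2 * sqrt d)" using mp_root_pos[OF assms(2)] assms by simp
  have s: "sqrt (1 - (mp_arg d x)\<^sup>2) = mp_root d x / (2 * sqrt d)"
    unfolding mp_arg_sq[OF assms(1) x] using pos by (simp only: real_sqrt_abs abs_of_pos)
  have lt: "(mp_arg d x)\<^sup>2 < 1" using mp_arg_sq[OF assms(1) x] zero_less_power[OF pos, of 2] by linarith
  then have "\<bar>mp_arg d x\<bar> < 1" by (simp add: abs_square_less_1)
  then have b: "-1 < mp_arg d x" "mp_arg d x < 1" by auto
  have "(mp_arg d has_real_derivative 1 / (2 * sqrt d)) (at x)"
    unfolding mp_arg_def[abs_def] using assms by (auto intro!: derivative_eq_intros simp: field_simps)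
  from DERIV_chain2[OF DERIV_arcsin[OF b] this]
  show ?thesis unfolding s using assms mp_root_pos[OF assms(2)]
    by (simp add: field_simps)
qed

lemma continuous_arcsin_mp_arg:
  assumes "0 < d"
  shows "continuous_on {d_minus d..d_plus d} (\<lambda>x. arcsin (mp_arg d x))"
  apply (rule continuous_on_arcsin)
   subgoal unfolding mp_arg_def using assms by (intro continuous_intros) auto
  using mp_arg_bound[OF assms] by (fastforce simp: abs_le_iff)

text \<open>At the edges only the arcsine part of the primitive survives and contributes
  \<open>2 * d\<close> times \<open>pi\<close>. The fundamental theorem is used in its interior form
  because the derivative of \<open>mp_root\<close> is unbounded at both edges.\<close>

lemma mp_root_integral:
  assumes "0 < d" "d \<le> 1"
  shows "(mp_root d has_integral (2 * pi * d)) {d_minus d..d_plus d}"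
proof -
  define F where "F x = (x - 1 - d) / 2 * mp_root d x + 2 * d * arcsin (mp_arg d x)" for x
  have "((\<lambda>x. mp_root d x) has_integral (F (d_plus d) - F (d_minus d))) {d_minus d..d_plus d}"
  proof (rule fundamental_theorem_of_calculus_interior)
    show "continuous_on {d_minus d..d_plus d} F" unfolding F_def
      by (intro continuous_intros continuous_arcsin_mp_arg assms) auto
    fix x assume x: "x \<in> {d_minus d<..<d_plus d}"
    let ?w = "mp_root d x"
    have w: "0 < ?w" by (rule mp_root_pos[OF x])
    have "(F has_real_derivative (1 / 2 * ?w + (1 + d - x) / ?w * ((x - 1 - d) / 2)) + 2 * d * (1 / ?w)) (at x)"
      unfolding F_def using assms x
      by (intro DERIV_add DERIV_mult DERIV_cmult mp_root_deriv arcsin_mp_arg_deriv)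
        (auto intro!: derivative_eq_intros)
    moreover have "(1 / 2 * ?w + (1 + d - x) / ?w * ((x - 1 - d) / 2)) + 2 * d * (1 / ?w)
       = (?w\<^sup>2 - (x - 1 - d)\<^sup>2 + 4 * d) / (2 * ?w)"
      using w by (simp add: field_simps power2_eq_square)
    moreover have "?w\<^sup>2 - (x - 1 - d)\<^sup>2 + 4 * d = 2 * ?w\<^sup>2"
      using mp_root_sq[of d x] assms x by (simp add: power2_eq_square algebra_simps)
    ultimately have "(F has_real_derivative 2 * ?w\<^sup>2 / (2 * ?w)) (at x)" by simp
    then show "(F has_vector_derivative ?w) (at x)"
      using w by (simp add: has_real_derivative_iff_has_vector_derivative power2_eq_square)
  qed (use mp_edges_pos[OF assms] in auto)
  moreover have "F (d_plus d) - F (d_minus d) = 2 * pi * d"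
    using assms by (simp add: F_def mp_arg_edge)
  ultimately show ?thesis by simp
qed

text \<open>Chosen so that \<open>(1 - d) * arcsin (mp_arg' d x)\<close> is a primitive of
  \<open>(1 - d)^2 / (x * mp_root d x)\<close>. The factor \<open>1 - d\<close> lets the formula
  persist at \<open>d = 1\<close>, where both expressions vanish.\<close>

definition mp_arg' :: "real \<Rightarrow> real \<Rightarrow> real" where
  "mp_arg' d x = ((1 + d) * x - (1 - d)\<^sup>2) / (2 * sqrt d * x)"

lemma mp_arg'_sq:
  assumes "0 < d" "x \<in> {d_minus d..d_plus d}" "0 < x"
  shows "1 - (mp_arg' d x)\<^sup>2 = ((1 - d) * mp_root d x / (2 * sqrt d * x))\<^sup>2"
proof -
  have "(2 * sqrt d * x)\<^sup>2 * (1 - (mp_arg' d x)\<^sup>2) = (2 * sqrt d * x)\<^sup>2 - ((1 + d) * x - (1 - d)\<^sup>2)\<^sup>2"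
    using assms unfolding mp_arg'_def by (simp add: power_divide right_diff_distrib)
  also have "\<dots> = 4 * d * x\<^sup>2 - ((1 + d) * x - (1 - d)\<^sup>2)\<^sup>2"
    using assms by (simp add: power_mult_distrib)
  also have "\<dots> = (1 - d)\<^sup>2 * (- x\<^sup>2 + 2 * (1 + d) * x - (1 - d)\<^sup>2)"
    by (simp add: power2_eq_square algebra_simps)
  also have "\<dots> = ((1 - d) * mp_root d x)\<^sup>2"
    using assms by (simp add: mp_root_sq power_mult_distrib)
  finally have "(2 * sqrt d * x)\<^sup>2 * (1 - (mp_arg' d x)\<^sup>2) = ((1 - d) * mp_root d x)\<^sup>2" .
  moreover have "2 * sqrt d * x \<noteq> 0" using assms by simp
  ultimately show ?thesis unfolding power_divide by (simp only: eq_divide_eq power_eq_0_iff mult.commute) simp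
qed

lemma mp_arg'_edge:
  assumes "0 < d" "d < 1"
  shows "mp_arg' d (d_minus d) = -1" "mp_arg' d (d_plus d) = 1"
proof -
  have p: "0 < d_minus d" "0 < d_plus d" using mp_edges_pos[of d] assms by auto
  have "(1 + d) * d_minus d - (1 - d)\<^sup>2 = (1 + d - d_plus d) * d_minus d"
    using mp_edges_prod[of d] assms by (simp add: algebra_simps)
  also have "1 + d - d_plus d = - 2 * sqrt d" using assms by (simp add: d_plus_def power2_eq_square algebra_simps)
  finally show "mp_arg' d (d_minus d) = -1" using p assms by (simp add: mp_arg'_def)
  have "(1 + d) * d_plus d - (1 - d)\<^sup>2 = (1 + d - d_minus d) * d_plus d"
    using mp_edges_prod[of d] assms by (simp add: algebra_simps)
  also have "1 + d - d_minus d = 2 * sqrt d" using assms by (simp add: d_minus_def power2_eq_square algebra_simps)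
  finally show "mp_arg' d (d_plus d) = 1" using p assms by (simp add: mp_arg'_def)
qed

text \<open>Writing the integrand as \<open>mp_root^2 / (x * mp_root)\<close> and inserting the
  quadratic \<open>mp_root^2\<close> splits it into three parts with known primitives. After
  normalization the value is the total mass 1 of the law.\<close>

lemma mp_root_over_integral:
  assumes "0 < d" "d \<le> 1"
  shows "((\<lambda>x. mp_root d x / x) has_integral (2 * pi * d)) {d_minus d..d_plus d}"
proof -
  note e = mp_edges_pos[OF assms]
  define F where "F x = mp_root d x + (1 + d) * arcsin (mp_arg d x) - (1 - d) * arcsin (mp_arg' d x)" for x
  have "((\<lambda>x. mp_root d x / x) has_integral (F (d_plus d) - F (d_minus d))) {d_minus d..d_plus d}"
  proof (rule fundamental_theorem_of_calculus_interior)
    have cA: "continuous_on {d_minus d..d_plus d} (\<lambda>x. (1 - d) * arcsin (mp_arg' d x))"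
    proof (cases "d = 1")
      case False
      then have x0: "0 < x" if "x \<in> {d_minus d..d_plus d}" for x using that e assms by auto
      have "\<bar>mp_arg' d x\<bar> \<le> 1" if x: "x \<in> {d_minus d..d_plus d}" for x
      proof -
        have "(mp_arg' d x)\<^sup>2 \<le> 1"
          using mp_arg'_sq[OF assms(1) x x0[OF x]] zero_le_power2[of "(1 - d) * mp_root d x / (2 * sqrt d * x)"]
          by linarith
        then show ?thesis by (simp add: abs_square_le_1)
      qed
      moreover have "continuous_on {d_minus d..d_plus d} (mp_arg' d)"
        unfolding mp_arg'_def using assms x0 by (intro continuous_intros) fastforce
      ultimately show ?thesis
        by (intro continuous_on_mult continuous_on_const continuous_on_arcsin) (fastforce simp: abs_le_iff)+
    qed simp
    show "continuous_on {d_minus d..d_plus d} F" unfolding F_def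
      by (rule continuous_on_diff[OF _ cA])
        (intro continuous_on_add continuous_on_mult continuous_on_const
          continuous_mp_root continuous_arcsin_mp_arg assms)
    fix x assume x: "x \<in> {d_minus d<..<d_plus d}"
    then have xc: "x \<in> {d_minus d..d_plus d}" and x0: "0 < x" using e by auto
    let ?w = "mp_root d x"
    have w: "0 < ?w" by (rule mp_root_pos[OF x])
    have D: "((\<lambda>x. (1 - d) * arcsin (mp_arg' d x)) has_real_derivative (1 - d)\<^sup>2 / (x * ?w)) (at x)"
    proof (cases "d = 1")
      case False
      then have d1: "0 < 1 - d" using assms by simp
      define q where "q = (1 - d) * ?w / (2 * sqrt d * x)"
      have pos: "0 < q" unfolding q_def using w d1 x0 assms by simp
      have sq: "1 - (mp_arg' d x)\<^sup>2 = q\<^sup>2" using mp_arg'_sq[OF assms(1) xc x0] by (simp add: q_def)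
      have s: "sqrt (1 - (mp_arg' d x)\<^sup>2) = q"
        unfolding sq using pos by simp
      have lt: "(mp_arg' d x)\<^sup>2 < 1" using sq zero_less_power[OF pos, of 2] by linarith
      then have "\<bar>mp_arg' d x\<bar> < 1" by (simp add: abs_square_less_1)
      then have b: "-1 < mp_arg' d x" "mp_arg' d x < 1" by auto
      have "(mp_arg' d has_real_derivative ((1 + d) * (2 * sqrt d * x) - ((1 + d) * x - (1 - d)\<^sup>2) * (2 * sqrt d))
           / ((2 * sqrt d * x) * (2 * sqrt d * x))) (at x)"
        unfolding mp_arg'_def[abs_def] using assms x0 by (auto intro!: derivative_eq_intros)
      also have "((1 + d) * (2 * sqrt d * x) - ((1 + d) * x - (1 - d)\<^sup>2) * (2 * sqrt d)) = (1 - d)\<^sup>2 * (2 * sqrt d)"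
        by (simp add: algebra_simps)
      also have "(1 - d)\<^sup>2 * (2 * sqrt d) / ((2 * sqrt d * x) * (2 * sqrt d * x)) = (1 - d)\<^sup>2 / (2 * sqrt d * x * x)"
        using assms x0 by (simp add: divide_simps)
      finally have "(mp_arg' d has_real_derivative (1 - d)\<^sup>2 / (2 * sqrt d * x * x)) (at x)" .
      from DERIV_cmult[OF DERIV_chain2[OF DERIV_arcsin[OF b] this], of "1 - d"]
      have "((\<lambda>x. (1 - d) * arcsin (mp_arg' d x)) has_real_derivative
         (1 - d) * (inverse q * ((1 - d)\<^sup>2 / (2 * sqrt d * x * x)))) (at x)" unfolding s .
      also have "(1 - d) * (inverse q * ((1 - d)\<^sup>2 / (2 * sqrt d * x * x))) = (1 - d)\<^sup>2 / (x * ?w)"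
        unfolding q_def using assms x0 w d1 by (simp add: divide_simps power2_eq_square)
      finally show ?thesis .
    qed simp
    have "(F has_real_derivative (1 + d - x) / ?w + (1 + d) * (1 / ?w) - (1 - d)\<^sup>2 / (x * ?w)) (at x)"
      unfolding F_def using assms x
      by (intro DERIV_diff DERIV_add DERIV_cmult mp_root_deriv arcsin_mp_arg_deriv D) auto
    moreover have "(1 + d - x) / ?w + (1 + d) * (1 / ?w) - (1 - d)\<^sup>2 / (x * ?w) =
       (- x\<^sup>2 + 2 * (1 + d) * x - (1 - d)\<^sup>2) / (x * ?w)"
      using w x0 by (simp add: divide_simps) (simp add: algebra_simps power2_eq_square)
    ultimately have "(F has_real_derivative ?w\<^sup>2 / (x * ?w)) (at x)"
      using mp_root_sq[of d x] xc assms by simp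
    then show "(F has_vector_derivative ?w / x) (at x)"
      using w by (simp add: has_real_derivative_iff_has_vector_derivative power2_eq_square)
  qed (use e in auto)
  moreover have "F (d_plus d) - F (d_minus d) = 2 * pi * d"
  proof (cases "d = 1")
    case True
    then show ?thesis using assms by (simp add: F_def mp_arg_edge)
  next
    case False
    then show ?thesis using assms by (simp add: F_def mp_arg_edge mp_arg'_edge algebra_simps)
  qed
  ultimately show ?thesis by simp
qed

section \<open>Moments of all integer orders\<close>

definition mp_integral :: "real \<Rightarrow> int \<Rightarrow> real" where
  "mp_integral d i = integral {d_minus d..d_plus d} (\<lambda>x. x powi (i - 1) * mp_root d x)"

lemma mp_integrable_on:
  assumes "0 < d" "d \<le> 1" "0 \<le> i \<or> d < 1"
  shows "((\<lambda>x. x powi (i - 1) * mp_root d x) has_integral mp_integral d i) {d_minus d..d_plus d}"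
proof -
  have "(\<lambda>x. x powi (i - 1) * mp_root d x) integrable_on {d_minus d..d_plus d}"
  proof (cases "i = 0")
    case True
    then show ?thesis using has_integral_integrable[OF mp_root_over_integral[OF assms(1,2)]]
      by (simp add: field_simps)
  next
    case False
    have "continuous_on {d_minus d..d_plus d} (\<lambda>x. x powi (i - 1))"
    proof (cases "0 \<le> i")
      case True
      then show ?thesis using False by (auto simp: power_int_def intro!: continuous_intros)
    next
      case F: False
      then have "d < 1" using assms by auto
      then show ?thesis using mp_edges_pos[OF assms(1,2)]
        by (intro continuous_on_power_int continuous_on_id) auto
    qed
    then show ?thesis
      by (intro integrable_continuous_real continuous_on_mult continuous_mp_root)
  qed
  then show ?thesis unfolding mp_integral_def by (rule integrable_integral)
qed

lemma mp_integral_0: "mp_integral d 0 = 2 * pi * d" if "0 < d" "d \<le> 1"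
  using mp_root_over_integral[OF that] unfolding mp_integral_def
  by (intro integral_unique) (simp add: divide_inverse mult.commute power_int_minus)

lemma mp_integral_1: "mp_integral d 1 = 2 * pi * d" if "0 < d" "d \<le> 1"
  using mp_root_integral[OF that] unfolding mp_integral_def
  by (intro integral_unique) simp

text \<open>Integrates the derivative of \<open>x powi i * mp_root d x ^ 3\<close>, whose boundary
  values vanish. Since \<open>mp_root^2\<close> is quadratic, this derivative combines the
  integrands of three consecutive orders; the cube keeps it free of the singular factor
  \<open>1 / mp_root\<close>.\<close>

lemma mp_integral_linear:
  assumes "0 < d" "d \<le> 1" "0 \<le> i \<or> d < 1"
  shows "of_int (i + 3) * mp_integral d (i + 2) = of_int (2 * i + 3) * (1 + d) * mp_integral d (i + 1)
     - of_int i * (1 - d)\<^sup>2 * mp_integral d i"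
proof -
  note e = mp_edges_pos[OF assms(1,2)]
  define F where "F x = x powi i * mp_root d x ^ 3" for x
  define G where "G x = of_int (2 * i + 3) * (1 + d) * (x powi (i + 1 - 1) * mp_root d x)
     - of_int i * (1 - d)\<^sup>2 * (x powi (i - 1) * mp_root d x) - of_int (i + 3) * (x powi (i + 2 - 1) * mp_root d x)" for x
  have "(G has_integral (F (d_plus d) - F (d_minus d))) {d_minus d..d_plus d}"
  proof (rule fundamental_theorem_of_calculus_interior)
    have "continuous_on {d_minus d..d_plus d} (\<lambda>x. x powi i)"
    proof (cases "0 \<le> i")
      case True
      then show ?thesis by (auto simp: power_int_def intro!: continuous_intros)
    next
      case False
      then have "d < 1" using assms by auto
      then show ?thesis using e by (intro continuous_on_power_int continuous_on_id) auto
    qed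
    then show "continuous_on {d_minus d..d_plus d} F" unfolding F_def
      by (intro continuous_on_mult continuous_on_power continuous_mp_root)
    fix x assume x: "x \<in> {d_minus d<..<d_plus d}"
    then have xc: "x \<in> {d_minus d..d_plus d}" and x0: "0 < x" using e by auto
    let ?w = "mp_root d x"
    have w: "0 < ?w" by (rule mp_root_pos[OF x])
    have D3: "((\<lambda>x. mp_root d x ^ 3) has_real_derivative 3 * ?w\<^sup>2 * ((1 + d - x) / ?w)) (at x)"
      using DERIV_power[OF mp_root_deriv[of d x], of 3] x assms
      by (simp add: mult_ac del: power_Suc times_divide_eq_right times_divide_eq_left)
    have Dp: "((\<lambda>x. x powi i) has_real_derivative of_int i * x powi (i - 1)) (at x)"
      by (rule DERIV_power_int[OF DERIV_ident, THEN DERIV_cong]) (use x0 in auto)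
    have "(F has_real_derivative of_int i * x powi (i - 1) * ?w ^ 3
        + 3 * ?w\<^sup>2 * ((1 + d - x) / ?w) * x powi i) (at x)"
      unfolding F_def by (rule DERIV_mult[OF Dp D3])
    also have "of_int i * x powi (i - 1) * ?w ^ 3 + 3 * ?w\<^sup>2 * ((1 + d - x) / ?w) * x powi i
       = x powi (i - 1) * ?w * (of_int i * ?w\<^sup>2 + 3 * (1 + d - x) * x)"
    proof -
      have "x powi i = x powi (i - 1) * x" using x0 power_int_add_1[of x "i - 1"] by simp
      moreover have "3 * ?w\<^sup>2 * ((1 + d - x) / ?w) = 3 * ?w * (1 + d - x)"
        using w by (simp add: power2_eq_square)
      ultimately show ?thesis
        by (simp only:) (simp add: power2_eq_square power3_eq_cube algebra_simps)
    qed
    also have "\<dots> = G x"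
    proof -
      have 1: "x powi (i + 1 - 1) = x powi (i - 1) * x" using x0 power_int_add_1[of x "i - 1"] by simp
      have 2: "x powi (i + 2 - 1) = x powi (i - 1) * (x * x)"
        using x0 power_int_add[of x "i - 1" 2] by (simp add: power2_eq_square)
      show ?thesis unfolding G_def 1 2 mp_root_sq[OF less_imp_le[OF assms(1)] xc]
        by (simp add: algebra_simps power2_eq_square)
    qed
    finally show "(F has_vector_derivative G x) (at x)"
      by (simp add: has_real_derivative_iff_has_vector_derivative)
  qed (use e in auto)
  moreover have "(G has_integral (of_int (2 * i + 3) * (1 + d) * mp_integral d (i + 1)
     - of_int i * (1 - d)\<^sup>2 * mp_integral d i - of_int (i + 3) * mp_integral d (i + 2))) {d_minus d..d_plus d}"
    unfolding G_def using assms
    by (intro has_integral_diff has_integral_mult_right mp_integrable_on) auto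
  ultimately have "F (d_plus d) - F (d_minus d) = of_int (2 * i + 3) * (1 + d) * mp_integral d (i + 1)
     - of_int i * (1 - d)\<^sup>2 * mp_integral d i - of_int (i + 3) * mp_integral d (i + 2)"
    by (rule has_integral_unique)
  then show ?thesis by (simp add: F_def)
qed

lemma mp_integral_nat:
  assumes "0 < d" "d \<le> 1"
  shows "mp_integral d (int j) = 2 * pi * d * mp_pos d j"
proof (induction j rule: less_induct)
  case (less j)
  consider "j = 0" | "j = 1" | i where "j = i + 2" by (metis One_nat_def add_2_eq_Suc' old.nat.exhaust)
  then show ?case
  proof cases
    case 2
    then show ?thesis using assms mp_integral_1[OF assms] mp_pos.simps(2)[of d 0] by simp
  next
    case (3 i)
    have "mp_integral d (int i) = 2 * pi * d * mp_pos d i"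
      "mp_integral d (int i + 1) = 2 * pi * d * mp_pos d (i + 1)"
      using less.IH[of i] less.IH[of "i + 1"] 3 by (simp_all add: add.commute)
    then have "of_int (int i + 3) * mp_integral d (int i + 2) = 2 * pi * d * ((2 * real i + 3) * (1 + d) * mp_pos d (i + 1)
        - real i * (1 - d)\<^sup>2 * mp_pos d i)"
      using mp_integral_linear[OF assms, of "int i"] by (simp add: algebra_simps)
    also have "\<dots> = 2 * pi * d * ((real i + 3) * mp_pos d (i + 2))"
      using mp_pos_linear[OF assms(1), of i] by simp
    finally have "(real i + 3) * mp_integral d (int i + 2) = (real i + 3) * (2 * pi * d * mp_pos d (i + 2))"
      by simp
    then have "mp_integral d (int i + 2) = 2 * pi * d * mp_pos d (i + 2)"
      by (subst (asm) mult_cancel_left) (auto simp: add_eq_0_iff)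
    then show ?thesis using 3 by (simp add: add.commute)
  qed (use assms mp_integral_0 in auto)
qed

text \<open>The recurrence is read downwards: the lowest order is isolated, and its coefficient
  carries the factor \<open>(1 - d)^2\<close>. Order -1 already follows from the orders 0 and
  1.\<close>

lemma mp_integral_neg:
  assumes "0 < d" "d < 1"
  shows "mp_integral d (- int j) = 2 * pi * d * mp_neg d j"
proof (induction j rule: less_induct)
  case (less j)
  have d: "0 < d" "d \<le> 1" using assms by auto
  consider "j = 0" | "j = 1" | i where "j = i + 2" by (metis One_nat_def add_2_eq_Suc' old.nat.exhaust)
  then show ?case
  proof cases
    case 2
    have "2 * (2 * pi * d) = (1 + d) * (2 * pi * d) + (1 - d)\<^sup>2 * mp_integral d (-1)"
      using mp_integral_linear[OF d, of "-1"] assms d by (simp add: mp_integral_0 mp_integral_1)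
    then have "(1 - d) * ((1 - d) * mp_integral d (-1)) = (1 - d) * (2 * pi * d)"
      by (simp add: power2_eq_square algebra_simps)
    then have "(1 - d) * mp_integral d (-1) = 2 * pi * d" using assms by simp
    then have "mp_integral d (-1) = 2 * pi * d / (1 - d)" using assms by (simp add: eq_divide_eq mult.commute)
    then show ?thesis using 2 mp_neg.simps(2)[of d 0] by simp
  next
    case (3 i)
    have I: "mp_integral d (- int i) = 2 * pi * d * mp_neg d i"
      "mp_integral d (- int i - 1) = 2 * pi * d * mp_neg d (i + 1)"
    proof -
      have e: "- int i - 1 = - int (i + 1)" by simp
      show "mp_integral d (- int i - 1) = 2 * pi * d * mp_neg d (i + 1)"
        unfolding e by (rule less.IH) (use 3 in simp)
    qed (use less.IH[of i] 3 in simp)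
    have i1: "- int i - 2 + 1 = - int i - 1" "- int i - 2 + 2 = - int i" "- int i - 2 + 3 = 1 - int i"
        "2 * (- int i - 2) + 3 = - (2 * int i + 1)"
      by simp_all
    define A B C where "A = mp_integral d (- int i)" and "B = mp_integral d (- int i - 1)"
      and "C = mp_integral d (- int i - 2)"
    have "of_int (1 - int i) * A = of_int (- (2 * int i + 1)) * (1 + d) * B
      - of_int (- int i - 2) * (1 - d)\<^sup>2 * C"
      using mp_integral_linear[OF d, of "- int i - 2", unfolded i1] assms(2) unfolding A_def B_def C_def by simp
    then have "(1 - d)\<^sup>2 * (real i + 2) * C = (1 + d) * (2 * real i + 1) * B + (1 - real i) * A"
      by (simp add: algebra_simps)
    also have "\<dots> = 2 * pi * d * ((1 + d) * (2 * real i + 1) * mp_neg d (i + 1) + (1 - real i) * mp_neg d i)"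
      unfolding A_def B_def I by (simp add: algebra_simps)
    also have "\<dots> = (1 - d)\<^sup>2 * (real i + 2) * (2 * pi * d * mp_neg d (i + 2))"
      using mp_neg_linear[OF assms, of i] by simp
    finally have "mp_integral d (- int i - 2) = 2 * pi * d * mp_neg d (i + 2)"
      unfolding C_def by (subst (asm) mult_cancel_left) (use assms in \<open>auto simp: add_eq_0_iff\<close>)
    moreover have "- int i - 2 = - int j" using 3 by simp
    ultimately show ?thesis using 3 by (simp only:)
  qed (use d mp_integral_0 in auto)
qed

definition mp_moment :: "real \<Rightarrow> int \<Rightarrow> real" where
  "mp_moment d i = (if 0 \<le> i then mp_pos d (nat i) else mp_neg d (nat (- i)))"

lemma mp_integral_moment:
  assumes "0 < d" "d \<le> 1" "0 \<le> i \<or> d < 1"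
  shows "mp_integral d i = 2 * pi * d * mp_moment d i"
  using mp_integral_nat[OF assms(1,2), of "nat i"] mp_integral_neg[OF assms(1), of "nat (-i)"] assms
  by (auto simp: mp_moment_def)

section \<open>Integration of polynomials against the law\<close>

abbreviation mp_density :: "real \<Rightarrow> real \<Rightarrow> real" where
  "mp_density d x \<equiv> 1 / (2 * pi * d) * (sqrt \<bar>(d_plus d - x) * (x - d_minus d)\<bar> / x)
        * indicator {d_minus d..d_plus d} x"

lemma mp_density_nonneg:
  assumes "0 < d" "d \<le> 1"
  shows "0 \<le> mp_density d x"
  using assms mp_edges_pos[OF assms] by (auto simp: indicator_def)

lemma borel_measurable_powi [measurable]: "(\<lambda>x::real. x powi i) \<in> borel_measurable borel"
  by (cases "0 \<le> i") (simp_all add: power_int_def)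

lemma mp_density_measurable [measurable]: "mp_density d \<in> borel_measurable borel"
  by measurable

text \<open>The primitives yield gauge integrals over an interval; as the integrand is nonnegative,
  these are Lebesgue integrals. The point 0, which belongs to the support for \<open>d = 1\<close>,
  is discarded as a null set because the splitting of \<open>x powi i\<close> into
  \<open>x powi (i - 1)\<close> and \<open>x\<close> may fail there.\<close>

lemma has_bochner_integral_mp:
  assumes "0 < d" "d \<le> 1" "0 \<le> i \<or> d < 1"
  shows "has_bochner_integral (marchenko_pastur d) (\<lambda>x. x powi i) (mp_moment d i)"
proof -
  note e = mp_edges_pos[OF assms(1,2)]
  have pos: "0 \<le> mp_density d x * x powi i" for x
    using mp_density_nonneg[OF assms(1,2), of x] e
    by (cases "x \<in> {d_minus d..d_plus d}") (auto intro!: mult_nonneg_nonneg simp del: times_divide_eq_left)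
  have eq: "mp_density d x * x powi i = (if x \<in> {d_minus d..d_plus d} then 1 / (2 * pi * d) * (x powi (i - 1) * mp_root d x) else 0)"
    if "x \<noteq> 0" for x
  proof (cases "x \<in> {d_minus d..d_plus d}")
    case True
    have "x powi i = x powi (i - 1) * x" using that power_int_add_1[of x "i - 1"] by simp
    moreover have "mp_density d x = 1 / (2 * pi * d) * (mp_root d x / x)"
      using True by (simp add: mp_root_def)
    ultimately have "mp_density d x * x powi i = 1 / (2 * pi * d) * (mp_root d x / x * (x powi (i - 1) * x))"
      by (simp only: mult.assoc)
    also have "mp_root d x / x * (x powi (i - 1) * x) = x powi (i - 1) * mp_root d x"
      using that by simp
    finally show ?thesis using True by simp
  next
    case False
    then have "indicator {d_minus d..d_plus d} x = (0::real)" by simp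
    with False show ?thesis by (simp only: if_False mult_zero_right mult_zero_left)
  qed
  have "((\<lambda>x. 1 / (2 * pi * d) * (x powi (i - 1) * mp_root d x)) has_integral
     1 / (2 * pi * d) * mp_integral d i) {d_minus d..d_plus d}"
    by (intro has_integral_mult_right mp_integrable_on assms)
  then have "((\<lambda>x. if x \<in> {d_minus d..d_plus d} then 1 / (2 * pi * d) * (x powi (i - 1) * mp_root d x) else 0)
      has_integral 1 / (2 * pi * d) * mp_integral d i) UNIV"
    by (subst has_integral_restrict_UNIV)
  then have "((\<lambda>x. mp_density d x * x powi i) has_integral 1 / (2 * pi * d) * mp_integral d i) UNIV"
    by (rule has_integral_spike[of "{0}", rotated 2]) (simp_all only: eq negligible_sing insert_iff Diff_iff empty_iff simp_thms)
  also have "1 / (2 * pi * d) * mp_integral d i = mp_moment d i"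
    using assms by (simp add: mp_integral_moment)
  finally have I: "((\<lambda>x. mp_density d x * x powi i) has_integral mp_moment d i) UNIV" .
  have "has_bochner_integral lborel (\<lambda>x. mp_density d x * x powi i) (mp_moment d i)"
  proof (rule has_bochner_integral_nn_integral)
    show "(\<lambda>x. mp_density d x * x powi i) \<in> borel_measurable lborel" by measurable
    show "AE x in lborel. 0 \<le> mp_density d x * x powi i" using pos by simp
    show "0 \<le> mp_moment d i" using has_integral_nonneg[OF I] pos by blast
    show "(\<integral>\<^sup>+x. ennreal (mp_density d x * x powi i) \<partial>lborel) = ennreal (mp_moment d i)"
      by (rule nn_integral_has_integral_lborel[OF _ pos I]) measurable
  qed
  then show ?thesis unfolding marchenko_pastur_def
    by (intro has_bochner_integral_density) (use mp_density_nonneg[OF assms(1,2)] in \<open>auto simp: \<close>)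
qed

lemma mp_poly_integral:
  assumes "0 < d" "d \<le> 1" "0 \<le> l \<or> d < 1"
  shows "has_bochner_integral (marchenko_pastur d) (\<lambda>x. x powi l * poly p x)
      (\<Sum>i\<le>degree p. coeff p i * mp_moment d (l + int i))"
proof -
  have "has_bochner_integral (marchenko_pastur d) (\<lambda>x. \<Sum>i\<le>degree p. coeff p i * x powi (l + int i))
      (\<Sum>i\<le>degree p. coeff p i * mp_moment d (l + int i))"
    by (intro has_bochner_integral_sum has_bochner_integral_mult_right has_bochner_integral_mp assms)
       (use assms in auto)
  moreover have "AE x in marchenko_pastur d. (\<Sum>i\<le>degree p. coeff p i * x powi (l + int i)) = x powi l * poly p x"
    unfolding marchenko_pastur_def
  proof (subst AE_density, measurable, rule AE_I2, intro impI)
    fix x assume a: "0 < ennreal (mp_density d x)"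
    have "x \<noteq> 0" using a by auto
    then show "(\<Sum>i\<le>degree p. coeff p i * x powi (l + int i)) = x powi l * poly p x"
      by (simp add: poly_altdef sum_distrib_left power_int_add mult_ac)
  qed
  ultimately show ?thesis
    by (subst (asm) has_bochner_integral_cong_AE)
      (auto simp: marchenko_pastur_def power_int_def poly_altdef intro!: borel_measurable_sum borel_measurable_times)
qed

text \<open>If the integral were 0, the polynomial would vanish almost everywhere on an open
  interval, contrary to the finiteness of its roots. Strict positivity of the limit is what later
  makes the square root Lipschitz there.\<close>

lemma mp_poly_integral_pos:
  assumes "0 < d" "d \<le> 1" "0 \<le> l \<or> d < 1" "p \<noteq> 0"
  shows "0 < (\<Sum>i\<le>degree (p\<^sup>2). coeff (p\<^sup>2) i * mp_moment d (l + int i))" (is "0 < ?I")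
proof -
  note e = mp_edges_pos[OF assms(1,2)]
  note b = mp_poly_integral[OF assms(1-3), of "p\<^sup>2"]
  have nn: "0 \<le> x powi l * poly (p\<^sup>2) x" if "0 \<le> x" for x using that by simp
  have AE0: "AE x in marchenko_pastur d. 0 \<le> x powi l * poly (p\<^sup>2) x"
    unfolding marchenko_pastur_def
  proof (subst AE_density, measurable, rule AE_I2, intro impI)
    fix x assume a: "0 < ennreal (mp_density d x)"
    then have "x \<in> {d_minus d..d_plus d}" by (cases "x \<in> {d_minus d..d_plus d}") auto
    then show "0 \<le> x powi l * poly (p\<^sup>2) x" using e by (intro nn) auto
  qed
  have I: "?I = (\<integral>x. x powi l * poly (p\<^sup>2) x \<partial>marchenko_pastur d)"
    using b by (simp add: has_bochner_integral_integral_eq)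
  have int: "integrable (marchenko_pastur d) (\<lambda>x. x powi l * poly (p\<^sup>2) x)"
    using b by (simp add: has_bochner_integral_iff) 
  have "?I \<noteq> 0"
  proof
    assume "?I = 0"
    then have "AE x in marchenko_pastur d. x powi l * poly (p\<^sup>2) x = 0"
      using I integral_nonneg_eq_0_iff_AE[OF int AE0] by simp
    then have "AE x in lborel. 0 < ennreal (mp_density d x) \<longrightarrow> x powi l * poly (p\<^sup>2) x = 0"
      unfolding marchenko_pastur_def by (subst (asm) AE_density) auto
    moreover have "AE x in lborel. x \<notin> {x. poly p x = 0}"
      using poly_roots_finite[OF assms(4)] by (intro AE_not_in countable_imp_null_set_lborel countable_finite)
    ultimately have "AE x in lborel. x \<notin> {d_minus d<..<d_plus d}"
    proof eventually_elim
      case (elim x)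
      show ?case
      proof
        assume x: "x \<in> {d_minus d<..<d_plus d}"
        then have "0 < x" using e by auto
        then have "0 < mp_density d x" using x assms
          by (simp add: abs_mult)
        then show False using elim \<open>0 < x\<close> by simp
      qed
    qed
    then have "{d_minus d<..<d_plus d} \<in> null_sets lborel"
      by (subst AE_iff_null_sets) auto
    then show False using e by (simp add: null_sets_def)
  qed
  moreover have "0 \<le> ?I" unfolding I by (rule integral_nonneg_AE[OF AE0])
  ultimately show ?thesis by simp
qed

subsection \<open>Spectral moments of Jacobi matrices\<close>

fun jac_poly :: "(nat \<Rightarrow> real) \<Rightarrow> (nat \<Rightarrow> real) \<Rightarrow> nat \<Rightarrow> real poly" where
  "jac_poly a s 0 = 1"
| "jac_poly a s (Suc 0) = [:a 0, -1:]"
| "jac_poly a s (Suc (Suc k)) =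
     [:a (Suc k) + s k, -1:] * jac_poly a s (Suc k) - Polynomial.smult (a k * s k) (jac_poly a s k)"

text \<open>The value at 0 is the determinant of the leading block, and that block is the product of
  the leading block of the bidiagonal factor with its transpose.\<close>

lemma jac_poly_0: "poly (jac_poly a s k) 0 = (\<Prod>i<k. a i)"
  by (induction a s k rule: jac_poly.induct) (auto simp: algebra_simps)

definition tridiag :: "(nat \<Rightarrow> 'a) \<Rightarrow> (nat \<Rightarrow> 'a) \<Rightarrow> nat \<Rightarrow> 'a::comm_ring_1 mat" where
  "tridiag p q k = mat k k (\<lambda>(i, j). if i = j then p i else if i = Suc j then q j
     else if j = Suc i then q i else 0)"

lemma det_tridiag_rec:
  "det (tridiag p q (Suc (Suc k))) = p (Suc k) * det (tridiag p q (Suc k)) - (q k)\<^sup>2 * det (tridiag p q k)"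
proof -
  let ?M = "tridiag p q (Suc (Suc k))"
  have M: "?M \<in> carrier_mat (Suc (Suc k)) (Suc (Suc k))" by (simp add: tridiag_def)
  define N where "N = mat_delete ?M (Suc k) k"
  have N: "N \<in> carrier_mat (Suc k) (Suc k)" using M by (simp add: N_def mat_delete_def tridiag_def)
  have "det N = (\<Sum>i<Suc k. N $$ (i, k) * cofactor N i k)"
    by (rule laplace_expansion_column[OF N]) simp
  also have "\<dots> = (\<Sum>i<Suc k. if i = k then q k * cofactor N k k else 0)"
    by (rule sum.cong) (auto simp: N_def mat_delete_def tridiag_def)
  also have "\<dots> = q k * cofactor N k k" by simp
  also have "cofactor N k k = det (mat_delete N k k)" by (simp add: cofactor_def flip: mult_2)
  also have "mat_delete N k k = tridiag p q k"
    by (rule eq_matI) (auto simp: N_def mat_delete_def tridiag_def)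
  finally have dN: "det N = q k * det (tridiag p q k)" .
  have d: "mat_delete ?M (Suc k) (Suc k) = tridiag p q (Suc k)"
    by (rule eq_matI) (auto simp: mat_delete_def tridiag_def)
  have "det ?M = (\<Sum>j<Suc (Suc k). ?M $$ (Suc k, j) * cofactor ?M (Suc k) j)"
    by (rule laplace_expansion_row[OF M]) simp
  also have "\<dots> = (\<Sum>j<Suc (Suc k). (if j = Suc k then p (Suc k) * cofactor ?M (Suc k) (Suc k) else 0)
      + (if j = k then q k * cofactor ?M (Suc k) k else 0))"
    by (rule sum.cong) (auto simp: tridiag_def)
  also have "\<dots> = p (Suc k) * cofactor ?M (Suc k) (Suc k) + q k * cofactor ?M (Suc k) k"
    by (simp add: sum.distrib)
  also have "cofactor ?M (Suc k) (Suc k) = det (tridiag p q (Suc k))"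
    by (simp add: cofactor_def d flip: mult_2)
  also have "cofactor ?M (Suc k) k = - (q k * det (tridiag p q k))"
    by (simp add: cofactor_def dN flip: N_def)
  finally show ?thesis by (simp add: power2_eq_square algebra_simps)
qed

lemma det_tridiag_0_1:
  "det (tridiag p q 0) = 1" "det (tridiag p q (Suc 0)) = p 0"
  by (simp_all add: tridiag_def det_def)

lemma bidiag_series:
  "(\<Sum>r. bidiag d i r * bidiag d j r) = (if i = j then (if i = 0 then 1 else 1 + d) else if i = Suc j then sqrt d
     else if j = Suc i then sqrt d else 0)" if "0 \<le> d"
proof -
  have "(\<Sum>r. bidiag d i r * bidiag d j r) = (\<Sum>r\<in>{i, i - 1}. bidiag d i r * bidiag d j r)"
    by (rule suminf_finite) (auto simp: bidiag_def)
  also have "\<dots> = (if i = j then (if i = 0 then 1 else 1 + d) else if i = Suc j then sqrt d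
     else if j = Suc i then sqrt d else 0)"
    using that by (cases i) (auto simp: bidiag_def)
  finally show ?thesis .
qed

lemma det_jacobi_block:
  assumes "0 \<le> d"
  shows "det (jacobi_block d k - x \<cdot>\<^sub>m 1\<^sub>m k) = poly (jac_poly (\<lambda>_. 1) (\<lambda>_. d) k) x"
proof -
  have "jacobi_block d k - x \<cdot>\<^sub>m 1\<^sub>m k
      = tridiag (\<lambda>i. (if i = 0 then 1 else 1 + d) - x) (\<lambda>_. sqrt d) k" for k
    using assms by (intro eq_matI) (auto simp: jacobi_block_def tridiag_def bidiag_series)
  moreover have "det (tridiag (\<lambda>i. (if i = 0 then 1 else 1 + d) - x) (\<lambda>_. sqrt d) k)
      = poly (jac_poly (\<lambda>_. 1) (\<lambda>_. d) k) x"
    using assms by (induction "\<lambda>_::nat. 1::real" "\<lambda>_::nat. d" k rule: jac_poly.induct)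
      (simp_all add: det_tridiag_0_1 det_tridiag_rec algebra_simps)
  ultimately show ?thesis by simp
qed

text \<open>The Jacobi matrix is \<open>L * transpose L\<close> with \<open>L\<close> lower bidiagonal, diagonal entries \<open>sqrt (a i)\<close> and
  subdiagonal entries \<open>sqrt (s i)\<close>.  \<open>jac_mom a s r N j\<close> and \<open>jac_inv a s r N j\<close> are the upper left entries of the
  powers \<open>j\<close> and \<open>-j\<close> of the \<open>N * N\<close> matrix built from the entries with index at least \<open>r\<close>.\<close>

fun jac_mom :: "(nat \<Rightarrow> real) \<Rightarrow> (nat \<Rightarrow> real) \<Rightarrow> nat \<Rightarrow> nat \<Rightarrow> nat \<Rightarrow> real" where
  "jac_mom a s r 0 j = (if j = 0 then 1 else 0)"
| "jac_mom a s r (Suc N) 0 = 1"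
| "jac_mom a s r (Suc N) (Suc j) = a r * jac_mom a s r (Suc N) j
     + s r * (\<Sum>i<j. jac_mom a s r (Suc N) (Suc i) * jac_mom a s (Suc r) N (j - Suc i))"

fun jac_inv :: "(nat \<Rightarrow> real) \<Rightarrow> (nat \<Rightarrow> real) \<Rightarrow> nat \<Rightarrow> nat \<Rightarrow> nat \<Rightarrow> real" where
  "jac_inv a s r 0 j = (if j = 0 then 1 else 0)"
| "jac_inv a s r (Suc N) 0 = 1"
| "jac_inv a s r (Suc N) (Suc j) = (jac_inv a s r (Suc N) j
     + s r * (\<Sum>i<Suc j. jac_inv a s r (Suc N) i * jac_inv a s (Suc r) N (Suc j - i))) / a r"

declare jac_mom.simps(3) [simp del] jac_inv.simps(3) [simp del]

text \<open>The orbit of the first unit vector, entry by entry, so that the moment recursions can be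
  verified by multiplying with the matrix row by row. Those recursions are a Stieltjes continued
  fraction: with generating functions \<open>M\<close> of \<open>jac_mom\<close> and
  \<open>M'\<close> of the trailing block, \<open>M = 1 + a z M + s z (M - 1) M'\<close>, that is,
  \<open>M = 1 / (1 - a z / (1 - s z M'))\<close>. Expanding the same fraction in powers of
  \<open>1 / z\<close> gives \<open>jac_inv\<close>.\<close>

fun pow_vec :: "(nat \<Rightarrow> real) \<Rightarrow> (nat \<Rightarrow> real) \<Rightarrow> nat \<Rightarrow> nat \<Rightarrow> nat \<Rightarrow> nat \<Rightarrow> real" where
  "pow_vec a s r 0 j i = 0"
| "pow_vec a s r (Suc N) j 0 = jac_mom a s r (Suc N) j"
| "pow_vec a s r (Suc N) j (Suc i) = sqrt (s r / a r) *
     (\<Sum>t<j. jac_mom a s r (Suc N) (Suc t) * pow_vec a s (Suc r) N (j - Suc t) i)"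

fun inv_vec :: "(nat \<Rightarrow> real) \<Rightarrow> (nat \<Rightarrow> real) \<Rightarrow> nat \<Rightarrow> nat \<Rightarrow> nat \<Rightarrow> nat \<Rightarrow> real" where
  "inv_vec a s r 0 j i = 0"
| "inv_vec a s r (Suc N) j 0 = jac_inv a s r (Suc N) j"
| "inv_vec a s r (Suc N) j (Suc i) = - sqrt (s r / a r) *
     (\<Sum>t<j. jac_inv a s r (Suc N) t * inv_vec a s (Suc r) N (j - t) i)"

definition jac_op :: "(nat \<Rightarrow> real) \<Rightarrow> (nat \<Rightarrow> real) \<Rightarrow> nat \<Rightarrow> nat \<Rightarrow> (nat \<Rightarrow> real) \<Rightarrow> nat \<Rightarrow> real" where
  "jac_op a s r N x i = (a (r + i) + (if i = 0 then 0 else s (r + i - 1))) * x i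
     + (if i = 0 then 0 else sqrt (a (r + i - 1) * s (r + i - 1)) * x (i - 1))
     + (if Suc i < N then sqrt (a (r + i) * s (r + i)) * x (Suc i) else 0)"

text \<open>Deleting the first coordinate does not quite give the trailing operator: the matrix
  built from the entries with index at least \<open>Suc r\<close> lacks the summand
  \<open>s r\<close> in its first diagonal entry.\<close>

lemma jac_op_Suc:
  "jac_op a s r (Suc N) x (Suc i) = jac_op a s (Suc r) N (\<lambda>i. x (Suc i)) i
     + (if i = 0 then s r * x 1 + sqrt (a r * s r) * x 0 else 0)"
  by (cases i) (simp_all add: jac_op_def algebra_simps)

lemma jac_op_sum:
  "jac_op a s r N (\<lambda>i. c * (\<Sum>t\<in>A. f t * x t i)) i = c * (\<Sum>t\<in>A. f t * jac_op a s r N (x t) i)"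
  by (simp add: jac_op_def sum_distrib_left sum_distrib_right sum.distrib algebra_simps)

lemma pow_vec_0: "i < N \<Longrightarrow> pow_vec a s r N 0 i = (if i = 0 then 1 else 0)"
  by (cases N; cases i) auto

lemma inv_vec_0: "i < N \<Longrightarrow> inv_vec a s r N 0 i = (if i = 0 then 1 else 0)"
  by (cases N; cases i) auto

lemma sqrt_ratio:
  assumes "0 < (a::real)" "0 \<le> s"
  shows "sqrt (a * s) * sqrt (s / a) = s" "sqrt (a * s) = sqrt (s / a) * a"
proof -
  have "sqrt (a * s) * sqrt (s / a) = sqrt (a * s * (s / a))" by (simp only: real_sqrt_mult)
  also have "a * s * (s / a) = s * s" using assms by simp
  finally show "sqrt (a * s) * sqrt (s / a) = s" using assms by simp
  have "sqrt (s / a) * a = sqrt (s / a) * sqrt (a * a)" using assms by simp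
  also have "\<dots> = sqrt (s / a * (a * a))" by (simp only: real_sqrt_mult)
  also have "s / a * (a * a) = a * s" using assms by simp
  finally show "sqrt (a * s) = sqrt (s / a) * a" by simp
qed

lemma jac_op_pow_vec:
  assumes "\<And>i. i < N \<Longrightarrow> 0 < a (r + i)" "\<And>i. i < N \<Longrightarrow> 0 \<le> s (r + i)" "N > 0 \<Longrightarrow> s (r + N - 1) = 0" "i < N"
  shows "jac_op a s r N (pow_vec a s r N j) i = pow_vec a s r N (Suc j) i"
  using assms
proof (induction N arbitrary: r i j)
  case (Suc N)
  have ar: "0 < a r" and sr: "0 \<le> s r" using Suc.prems(1,2)[of 0] by auto
  have s0: "N = 0 \<Longrightarrow> s r = 0" using Suc.prems(3) by simp
  have IH: "jac_op a s (Suc r) N (pow_vec a s (Suc r) N j) i = pow_vec a s (Suc r) N (Suc j) i" if "i < N" for i j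
  proof (rule Suc.IH)
    show "0 < a (Suc r + i)" "0 \<le> s (Suc r + i)" if "i < N" for i
      using Suc.prems(1,2)[of "Suc i"] that by auto
  qed (use Suc.prems(3) that in auto)
  let ?x = "pow_vec a s r (Suc N) j"
  have x1: "?x 1 = sqrt (s r / a r) * (\<Sum>t<j. jac_mom a s r (Suc N) (Suc t) * jac_mom a s (Suc r) N (j - Suc t))"
    using s0 by (cases N) auto
  have row0: "a r * ?x 0 + sqrt (a r * s r) * ?x 1 = jac_mom a s r (Suc N) (Suc j)"
    unfolding x1 jac_mom.simps(3)[of a s r N j] mult.assoc[symmetric] sqrt_ratio(1)[OF ar sr] by simp
  show ?case
  proof (cases i)
    case 0
    have "jac_op a s r (Suc N) ?x 0 = a r * ?x 0 + sqrt (a r * s r) * ?x 1"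
      using s0 by (cases N) (simp_all add: jac_op_def)
    then show ?thesis using 0 row0 by simp
  next
    case (Suc i')
    then have i': "i' < N" using Suc.prems(4) by simp
    have "jac_op a s (Suc r) N (\<lambda>i. ?x (Suc i)) i' = sqrt (s r / a r) *
      (\<Sum>t<j. jac_mom a s r (Suc N) (Suc t) * pow_vec a s (Suc r) N (Suc (j - Suc t)) i')"
      by (simp add: jac_op_sum IH i')
    also have "(\<Sum>t<j. jac_mom a s r (Suc N) (Suc t) * pow_vec a s (Suc r) N (Suc (j - Suc t)) i')
      = (\<Sum>t<j. jac_mom a s r (Suc N) (Suc t) * pow_vec a s (Suc r) N (Suc j - Suc t) i')"
      by (rule sum.cong) (auto simp: Suc_diff_Suc)
    finally have 1: "jac_op a s (Suc r) N (\<lambda>i. ?x (Suc i)) i' = sqrt (s r / a r) *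
      (\<Sum>t<j. jac_mom a s r (Suc N) (Suc t) * pow_vec a s (Suc r) N (Suc j - Suc t) i')" .
    \<comment> \<open>The first column of the bidiagonal factor contributes a matrix of rank one, so
      the correction in this row is \<open>sqrt (s r / a r)\<close> times row 0.\<close>
    have "s r * ?x 1 + sqrt (a r * s r) * ?x 0 = sqrt (s r / a r) * (a r * ?x 0 + sqrt (a r * s r) * ?x 1)"
      using sqrt_ratio[OF ar sr] by (simp add: algebra_simps)
    then have 2: "s r * ?x 1 + sqrt (a r * s r) * ?x 0 = sqrt (s r / a r) * jac_mom a s r (Suc N) (Suc j)"
      unfolding row0 .
    show ?thesis unfolding Suc jac_op_Suc 1 2
      using i' by (simp add: pow_vec_0 algebra_simps)
  qed
qed simp

lemma jac_op_inv_vec: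
  assumes "\<And>i. i < N \<Longrightarrow> 0 < a (r + i)" "\<And>i. i < N \<Longrightarrow> 0 \<le> s (r + i)" "N > 0 \<Longrightarrow> s (r + N - 1) = 0" "i < N"
  shows "jac_op a s r N (inv_vec a s r N (Suc j)) i = inv_vec a s r N j i"
  using assms
proof (induction N arbitrary: r i j)
  case (Suc N)
  have ar: "0 < a r" and sr: "0 \<le> s r" using Suc.prems(1,2)[of 0] by auto
  have s0: "N = 0 \<Longrightarrow> s r = 0" using Suc.prems(3) by simp
  have IH: "jac_op a s (Suc r) N (inv_vec a s (Suc r) N (Suc j)) i = inv_vec a s (Suc r) N j i" if "i < N" for i j
  proof (rule Suc.IH)
    show "0 < a (Suc r + i)" "0 \<le> s (Suc r + i)" if "i < N" for i
      using Suc.prems(1,2)[of "Suc i"] that by auto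
  qed (use Suc.prems(3) that in auto)
  let ?x = "inv_vec a s r (Suc N) (Suc j)"
  have x1: "?x 1 = - sqrt (s r / a r) * (\<Sum>t<Suc j. jac_inv a s r (Suc N) t * jac_inv a s (Suc r) N (Suc j - t))"
    using s0 by (cases N) (auto simp del: sum.lessThan_Suc)
  have a: "a r * ?x 0 = jac_inv a s r (Suc N) j + s r * (\<Sum>t<Suc j. jac_inv a s r (Suc N) t * jac_inv a s (Suc r) N (Suc j - t))"
    using ar by (simp add: jac_inv.simps(3)[of a s r N j] del: sum.lessThan_Suc)
  have b: "sqrt (a r * s r) * ?x 1 = - (s r * (\<Sum>t<Suc j. jac_inv a s r (Suc N) t * jac_inv a s (Suc r) N (Suc j - t)))"
    unfolding x1 using sqrt_ratio(1)[OF ar sr]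
    by (metis (no_types, lifting) mult.assoc mult_minus_left mult_minus_right)
  have row0: "a r * ?x 0 + sqrt (a r * s r) * ?x 1 = jac_inv a s r (Suc N) j"
    unfolding a b by simp
  show ?case
  proof (cases i)
    case 0
    have "jac_op a s r (Suc N) ?x 0 = a r * ?x 0 + sqrt (a r * s r) * ?x 1"
      using s0 by (cases N) (simp_all add: jac_op_def)
    then show ?thesis using 0 row0 by simp
  next
    case (Suc i')
    then have i': "i' < N" using Suc.prems(4) by simp
    have "jac_op a s (Suc r) N (\<lambda>i. ?x (Suc i)) i' = - sqrt (s r / a r) *
      (\<Sum>t<Suc j. jac_inv a s r (Suc N) t * jac_op a s (Suc r) N (inv_vec a s (Suc r) N (Suc j - t)) i')"
      by (simp only: inv_vec.simps jac_op_sum)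
    also have "(\<Sum>t<Suc j. jac_inv a s r (Suc N) t * jac_op a s (Suc r) N (inv_vec a s (Suc r) N (Suc j - t)) i')
      = (\<Sum>t<Suc j. jac_inv a s r (Suc N) t * inv_vec a s (Suc r) N (j - t) i')"
      by (rule sum.cong) (auto simp: Suc_diff_le IH i')
    finally have 1: "jac_op a s (Suc r) N (\<lambda>i. ?x (Suc i)) i' = - sqrt (s r / a r) *
      (\<Sum>t<Suc j. jac_inv a s r (Suc N) t * inv_vec a s (Suc r) N (j - t) i')" .
    have "s r * ?x 1 + sqrt (a r * s r) * ?x 0 = sqrt (s r / a r) * (a r * ?x 0 + sqrt (a r * s r) * ?x 1)"
      using sqrt_ratio[OF ar sr] by (simp add: algebra_simps del: inv_vec.simps One_nat_def)
    then have 2: "s r * ?x 1 + sqrt (a r * s r) * ?x 0 = sqrt (s r / a r) * jac_inv a s r (Suc N) j"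
      unfolding row0 .
    show ?thesis unfolding Suc jac_op_Suc 1 2
      using i' by (simp add: inv_vec_0 algebra_simps)
  qed
qed simp

lemma jac_op_delta:
  assumes "Suc k < n"
  shows "jac_op a s 0 n (\<lambda>i. if i = Suc k then c else 0) i = (if i = Suc k then (a (Suc k) + s k) * c else
      if i = Suc (Suc k) then sqrt (a (Suc k) * s (Suc k)) * c else
      if i = k then sqrt (a k * s k) * c else 0)"
proof -
  consider "i = Suc k" | "i = Suc (Suc k)" | "i = k" | "i \<noteq> Suc k" "i \<noteq> k" "i \<noteq> Suc (Suc k)" by blast
  then show ?thesis
  proof cases
    case 4
    then show ?thesis by (cases i) (auto simp: jac_op_def)
  qed (use assms in \<open>auto simp: jac_op_def\<close>)
qed

section \<open>Vectors and moments of all integer orders\<close>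

definition jac_moment :: "(nat \<Rightarrow> real) \<Rightarrow> (nat \<Rightarrow> real) \<Rightarrow> nat \<Rightarrow> int \<Rightarrow> real" where
  "jac_moment a s n j = (if 0 \<le> j then jac_mom a s 0 n (nat j) else jac_inv a s 0 n (nat (- j)))"

definition jac_vec :: "(nat \<Rightarrow> real) \<Rightarrow> (nat \<Rightarrow> real) \<Rightarrow> nat \<Rightarrow> int \<Rightarrow> nat \<Rightarrow> real" where
  "jac_vec a s n j = (if 0 \<le> j then pow_vec a s 0 n (nat j) else inv_vec a s 0 n (nat (- j)))"

text \<open>The linear functional on polynomials that sends the monomial of degree \<open>i\<close>
  to \<open>f i\<close>. For a moment sequence \<open>f\<close> it is integration against the
  underlying measure, with no measure having to be constructed.\<close>

definition lin_ev :: "(nat \<Rightarrow> real) \<Rightarrow> real poly \<Rightarrow> real" where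
  "lin_ev f p = (\<Sum>i\<le>degree p. coeff p i * f i)"

lemma lin_ev_ge: "degree p \<le> N \<Longrightarrow> lin_ev f p = (\<Sum>i\<le>N. coeff p i * f i)"
  unfolding lin_ev_def by (rule sum.mono_neutral_left) (auto simp: coeff_eq_0)

lemma lin_ev_add: "lin_ev f (p + q) = lin_ev f p + lin_ev f q"
  using lin_ev_ge[of "p + q" "max (degree p) (degree q)" f] lin_ev_ge[of p "max (degree p) (degree q)" f]
    lin_ev_ge[of q "max (degree p) (degree q)" f]
  by (simp add: degree_add_le_max sum.distrib algebra_simps)

lemma lin_ev_smult: "lin_ev f (Polynomial.smult c p) = c * lin_ev f p"
  using lin_ev_ge[of "Polynomial.smult c p" "degree p" f] by (simp add: lin_ev_def sum_distrib_left mult_ac)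

lemma lin_ev_diff: "lin_ev f (p - q) = lin_ev f p - lin_ev f q"
  using lin_ev_add[of f p "Polynomial.smult (-1) q"] lin_ev_smult[of f "-1" q] by simp

lemma lin_ev_pCons: "lin_ev f (pCons c p) = c * f 0 + lin_ev (\<lambda>i. f (Suc i)) p"
proof -
  have "lin_ev f (pCons c p) = (\<Sum>i\<le>Suc (degree p). coeff (pCons c p) i * f i)"
    by (rule lin_ev_ge) (simp add: degree_pCons_le)
  also have "\<dots> = c * f 0 + lin_ev (\<lambda>i. f (Suc i)) p"
    by (subst sum.atMost_Suc_shift) (simp add: lin_ev_def)
  finally show ?thesis .
qed

lemma lin_ev_0 [simp]: "lin_ev f 0 = 0" by (simp add: lin_ev_def)

lemma lin_ev_mult: "lin_ev f (p * q) = lin_ev (\<lambda>i. lin_ev (\<lambda>j. f (i + j)) q) p"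
proof (induction p arbitrary: f)
  case (pCons c p)
  show ?case
    by (simp add: lin_ev_add lin_ev_smult lin_ev_pCons pCons.IH)
qed simp

lemma lin_ev_linear_mult:
  "lin_ev f ([:x, y:] * p) = x * lin_ev f p + y * lin_ev (\<lambda>i. f (Suc i)) p"
  by (simp only: mult_pCons_left lin_ev_add lin_ev_smult lin_ev_pCons mult_zero_left lin_ev_0 add_0_left add_0_right)

text \<open>The condition on the last \<open>s\<close> says that the last column of the square
  bidiagonal factor has no subdiagonal entry. It also cancels the conventional values that
  \<open>jac_mom\<close> and \<open>jac_inv\<close> take at size 0.\<close>

locale jacobi_data =
  fixes a s :: "nat \<Rightarrow> real" and n :: nat
  assumes n: "0 < n" and a: "\<And>i. i < n \<Longrightarrow> 0 < a i" and s: "\<And>i. i < n \<Longrightarrow> 0 \<le> s i"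
    and s_last: "s (n - 1) = 0"
begin

abbreviation "T \<equiv> jac_op a s 0 n"
abbreviation "w \<equiv> jac_vec a s n"
abbreviation "c \<equiv> jac_moment a s n"

lemma T_w: "i < n \<Longrightarrow> T (w j) i = w (j + 1) i"
proof (cases "0 \<le> j")
  case True
  assume i: "i < n"
  have "nat (j + 1) = Suc (nat j)" using True by simp
  then show ?thesis using jac_op_pow_vec[of n a 0 s i "nat j"] a s s_last i True
    by (simp add: jac_vec_def)
next
  case False
  assume i: "i < n"
  define m where "m = nat (- j - 1)"
  have m: "nat (- j) = Suc m" "j + 1 = - int m" using False by (auto simp: m_def)
  have "inv_vec a s 0 n 0 i = pow_vec a s 0 n 0 i" using i by (simp add: inv_vec_0 pow_vec_0)
  then have "w (- int m) i = inv_vec a s 0 n m i" by (cases "m = 0") (simp_all add: jac_vec_def)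
  then show ?thesis using jac_op_inv_vec[of n a 0 s i m] a s s_last i False
    by (simp add: jac_vec_def m)
qed

lemma w_0: "i < n \<Longrightarrow> w 0 i = (if i = 0 then 1 else 0)"
  by (simp add: jac_vec_def pow_vec_0)

lemma w_first: "w j 0 = c j"
  using n by (cases n) (simp_all add: jac_vec_def jac_moment_def)

lemma T_cong: "(\<And>i. i < n \<Longrightarrow> x i = y i) \<Longrightarrow> i < n \<Longrightarrow> T x i = T y i"
  by (auto simp: jac_op_def)

lemma T_sym: "(\<Sum>i<n. T x i * y i) = (\<Sum>i<n. x i * T y i)"
proof -
  obtain m where m: "n = Suc m" using n by (cases n) auto
  have A: "(\<Sum>i<n. (if i = 0 then 0 else q (i - 1) * x (i - 1)) * y i) = (\<Sum>i<m. q i * x i * y (Suc i))" for q x y :: "nat \<Rightarrow> real"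
    unfolding m by (subst sum.lessThan_Suc_shift) simp
  have B: "(\<Sum>i<n. (if Suc i < n then q i * x (Suc i) else 0) * y i) = (\<Sum>i<m. q i * x (Suc i) * y i)" for q x y :: "nat \<Rightarrow> real"
    unfolding m by simp
  have C: "(\<Sum>i<n. T x i * y i) = (\<Sum>i<n. (a i + (if i = 0 then 0 else s (i - 1))) * x i * y i)
     + (\<Sum>i<m. sqrt (a i * s i) * x i * y (Suc i)) + (\<Sum>i<m. sqrt (a i * s i) * x (Suc i) * y i)" for x y
    unfolding A[of "\<lambda>i. sqrt (a i * s i)", symmetric] B[of "\<lambda>i. sqrt (a i * s i)", symmetric]
    unfolding sum.distrib[symmetric] by (rule sum.cong) (auto simp: jac_op_def distrib_right)
  have "(\<Sum>i<n. x i * T y i) = (\<Sum>i<n. T y i * x i)" by (simp add: mult.commute)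
  then show ?thesis unfolding C by (simp add: mult_ac)
qed

text \<open>Self-adjointness moves one power at a time from one argument to the other. Negative
  orders need no inverse operator, since \<open>T\<close> carries \<open>w j\<close> to
  \<open>w (j + 1)\<close> for every integer \<open>j\<close>.\<close>

lemma w_inner: "(\<Sum>i<n. w j i * w k i) = c (j + k)"
proof -
  have step: "(\<Sum>i<n. w (j + 1) i * w k i) = (\<Sum>i<n. w j i * w (k + 1) i)" for j k
    using T_sym[of "w j" "w k"] by (simp add: T_w)
  have 0: "(\<Sum>i<n. w 0 i * w k i) = c k" for k
  proof -
    have "(\<Sum>i<n. w 0 i * w k i) = (\<Sum>i<n. if i = 0 then w k 0 else 0)"
      by (rule sum.cong) (auto simp: w_0)
    then show ?thesis using n by (simp add: w_first)
  qed
  have "\<forall>k. (\<Sum>i<n. w j i * w k i) = c (j + k)"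
  proof (induction j rule: int_induct[where k = 0])
    case (step1 j)
    show ?case
    proof
      fix k
      have "(\<Sum>i<n. w (j + 1) i * w k i) = c (j + (k + 1))" using step1 step by simp
      then show "(\<Sum>i<n. w (j + 1) i * w k i) = c (j + 1 + k)" by (simp add: algebra_simps)
    qed
  next
    case (step2 j)
    show ?case
    proof
      fix k
      have "(\<Sum>i<n. w (j - 1) i * w k i) = (\<Sum>i<n. w (j - 1) i * w (k - 1 + 1) i)" by simp
      also have "\<dots> = (\<Sum>i<n. w (j - 1 + 1) i * w (k - 1) i)" by (rule step[symmetric])
      also have "\<dots> = c (j + (k - 1))" using step2 by simp
      finally show "(\<Sum>i<n. w (j - 1) i * w k i) = c (j - 1 + k)" by (simp add: algebra_simps)
    qed
  qed (simp add: 0)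
  then show ?thesis by blast
qed

lemma w_pos_support: "i < n \<Longrightarrow> j < i \<Longrightarrow> w (int j) i = 0"
proof (induction j arbitrary: i)
  case 0
  then show ?case by (simp add: w_0)
next
  case (Suc j)
  have "w (int (Suc j)) i = T (w (int j)) i" using T_w[of i "int j"] Suc.prems by (simp add: add.commute)
  also have "\<dots> = 0" using Suc by (auto simp: jac_op_def)
  finally show ?case .
qed

lemma lin_ev_sum: "lin_ev (\<lambda>t. \<Sum>i\<in>A. f t i * g i) p = (\<Sum>i\<in>A. lin_ev (\<lambda>t. f t i) p * g i)"
  by (simp add: lin_ev_def sum_distrib_left sum_distrib_right mult_ac sum.swap[of _ A])

lemma T_lin_ev: "T (\<lambda>i. lin_ev (\<lambda>t. f t i) p) i = lin_ev (\<lambda>t. T (f t) i) p"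
  by (simp add: lin_ev_def jac_op_def sum_distrib_left sum.distrib algebra_simps)

text \<open>The recursion of \<open>jac_poly\<close> is the Lanczos recursion, so
  \<open>p_k(T)\<close> sends the first unit vector to a multiple of the unit vector with index
  \<open>k\<close>. For \<open>k = n\<close> that coordinate does not exist and the result is 0, as
  in Cayley-Hamilton.\<close>

lemma jac_poly_vec:
  assumes "k \<le> n" "i < n"
  shows "lin_ev (\<lambda>t. w (int t) i) (jac_poly a s k)
     = (if i = k then (-1) ^ k * (\<Prod>i<k. sqrt (a i * s i)) else 0)"
  using assms
proof (induction k arbitrary: i rule: induct_nat_012)
  case 0
  then show ?case by (simp add: lin_ev_def w_0)
next
  case 1
  have "w 1 i = T (w 0) i" using T_w[of i 0] 1 by simp
  also have "\<dots> = T (\<lambda>i. if i = 0 then 1 else 0) i" by (rule T_cong) (use 1 w_0 in auto)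
  also have "\<dots> = (if i = 0 then a 0 else if i = 1 then sqrt (a 0 * s 0) else 0)"
    by (auto simp: jac_op_def)
  finally show ?case using 1 by (simp add: lin_ev_pCons w_0)
next
  case (ge2 k)
  let ?K = "\<lambda>k. (-1) ^ k * (\<Prod>i<k. sqrt (a i * s i))"
  define q where "q k = sqrt (a k * s k)" for k
  define K where "K k = (-1) ^ k * (\<Prod>i<k. q i)" for k :: nat
  have K: "K (Suc k) = - (q k * K k)" for k by (simp add: K_def)
  have aq: "a k * s k = q k * q k"
    using a[of k] s[of k] ge2.prems by (simp add: q_def)
  have IH: "lin_ev (\<lambda>t. w (int t) i) (jac_poly a s (Suc k)) = (if i = Suc k then K (Suc k) else 0)"
    "lin_ev (\<lambda>t. w (int t) i) (jac_poly a s k) = (if i = k then K k else 0)" if "i < n" for i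
    using ge2.IH(1)[of i] ge2.IH(2)[of i] ge2.prems that unfolding K_def q_def by auto
  have 1: "lin_ev (\<lambda>t. w (int (Suc t)) i) (jac_poly a s (Suc k))
      = T (\<lambda>i. lin_ev (\<lambda>t. w (int t) i) (jac_poly a s (Suc k))) i"
    using ge2.prems by (simp add: T_lin_ev T_w add.commute)
  have 2: "T (\<lambda>i. lin_ev (\<lambda>t. w (int t) i) (jac_poly a s (Suc k))) i
      = T (\<lambda>i. if i = Suc k then K (Suc k) else 0) i"
    by (rule T_cong) (use IH ge2.prems in auto)
  have 3: "T (\<lambda>i. if i = Suc k then K (Suc k) else 0) i = (if i = Suc k then (a (Suc k) + s k) * K (Suc k) else
      if i = Suc (Suc k) then q (Suc k) * K (Suc k) else
      if i = k then q k * K (Suc k) else 0)"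
    unfolding q_def by (rule jac_op_delta) (use ge2.prems in simp)
  have m: "lin_ev (\<lambda>t. w (int t) i) ([:\<alpha>, -1:] * p)
     = \<alpha> * lin_ev (\<lambda>t. w (int t) i) p + (- 1) * lin_ev (\<lambda>t. w (int (Suc t)) i) p" for \<alpha> p
    by (rule lin_ev_linear_mult)
  define X where "X k = lin_ev (\<lambda>t. w (int t) i) (jac_poly a s k)" for k
  define Y where "Y = lin_ev (\<lambda>t. w (int (Suc t)) i) (jac_poly a s (Suc k))"
  have X2: "X (Suc (Suc k)) = (a (Suc k) + s k) * X (Suc k) + (- 1) * Y - a k * s k * X k"
    unfolding X_def Y_def by (subst jac_poly.simps(3), subst lin_ev_diff, subst lin_ev_smult, subst m) (rule refl)
  have Y: "Y = (if i = Suc k then (a (Suc k) + s k) * K (Suc k) else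
      if i = Suc (Suc k) then q (Suc k) * K (Suc k) else if i = k then q k * K (Suc k) else 0)"
    unfolding Y_def using 1 2 3 by (rule trans[OF _ trans])
  have X1: "X (Suc k) = (if i = Suc k then K (Suc k) else 0)" "X k = (if i = k then K k else 0)"
    unfolding X_def using IH[OF ge2.prems(2)] by blast+
  have "X (Suc (Suc k)) = (if i = Suc (Suc k) then K (Suc (Suc k)) else 0)"
  proof -
    consider "i = Suc k" | "i = Suc (Suc k)" | "i = k" | "i \<noteq> Suc k" "i \<noteq> k" "i \<noteq> Suc (Suc k)" by blast
    then show ?thesis
    proof cases
      case 2
      then show ?thesis unfolding X2 X1 Y using K[of "Suc k"] by simp
    next
      case 3
      then show ?thesis unfolding X2 X1 Y aq using K[of k] by simp
    qed (simp_all add: X2 X1 Y)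
  qed
  then show ?case unfolding X_def K_def q_def .
qed

lemma moment_poly_sq:
  "lin_ev (\<lambda>t. c (m + int t)) (p * p) = (\<Sum>i<n. lin_ev (\<lambda>t. w (m + int t) i) p * lin_ev (\<lambda>t. w (int t) i) p)"
proof -
  have "lin_ev (\<lambda>t. c (m + int t)) (p * p) = lin_ev (\<lambda>t. lin_ev (\<lambda>u. c ((m + int t) + int u)) p) p"
    unfolding lin_ev_mult by (simp add: add.assoc)
  also have "\<dots> = lin_ev (\<lambda>t. lin_ev (\<lambda>u. \<Sum>i<n. w (int u) i * w (m + int t) i) p) p"
    by (simp add: w_inner add.commute)
  also have "\<dots> = lin_ev (\<lambda>t. \<Sum>i<n. lin_ev (\<lambda>u. w (int u) i) p * w (m + int t) i) p"
    by (simp only: lin_ev_sum)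
  also have "\<dots> = (\<Sum>i<n. lin_ev (\<lambda>t. w (m + int t) i) p * lin_ev (\<lambda>t. w (int t) i) p)"
    by (subst lin_ev_sum[symmetric]) (simp add: mult.commute)
  finally show ?thesis .
qed

definition jac_size where "jac_size = (\<Sum>i<n. a i + s i)"

lemma jac_size_ge: "i < n \<Longrightarrow> a i + s i \<le> jac_size"
  unfolding jac_size_def using a s by (intro member_le_sum) (auto intro: add_nonneg_nonneg less_imp_le)

lemma jac_size_nonneg: "0 \<le> jac_size"
  unfolding jac_size_def using a s by (intro sum_nonneg) (auto intro: add_nonneg_nonneg less_imp_le)

lemma T_bound:
  assumes "\<And>i. i < n \<Longrightarrow> \<bar>x i\<bar> \<le> B" "i < n"
  shows "\<bar>T x i\<bar> \<le> 4 * jac_size * B"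
proof -
  have B: "0 \<le> B" using assms(1)[OF assms(2)] by simp
  have sq: "\<bar>sqrt (a i * s i)\<bar> \<le> jac_size" if "i < n" for i
  proof -
    have "sqrt (a i * s i) \<le> (a i + s i) / 2"
      using a[OF that] s[OF that] by (intro arith_geo_mean_sqrt) auto
    moreover have "0 \<le> a i + s i" "0 \<le> a i * s i" using a[OF that] s[OF that] by auto
    ultimately show ?thesis using jac_size_ge[OF that] by auto
  qed
  have a1: "\<bar>a i\<bar> \<le> jac_size" "\<bar>s i\<bar> \<le> jac_size" if "i < n" for i
    using a[OF that] s[OF that] jac_size_ge[OF that] by auto
  have m: "\<bar>u * x j\<bar> \<le> jac_size * B" if "\<bar>u\<bar> \<le> jac_size" "j < n" for u j
    unfolding abs_mult using that assms(1)[of j] jac_size_nonneg by (intro mult_mono) auto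
  have z: "0 \<le> jac_size * B" using jac_size_nonneg B by simp
  have T1: "\<bar>a i * x i\<bar> \<le> jac_size * B" by (intro m a1 assms)
  have T2: "\<bar>(if i = 0 then 0 else s (i - 1)) * x i\<bar> \<le> jac_size * B"
    using assms(2) jac_size_nonneg by (intro m) (auto intro!: a1)
  have T3: "\<bar>if i = 0 then 0 else sqrt (a (i - 1) * s (i - 1)) * x (i - 1)\<bar> \<le> jac_size * B"
    using assms(2) z by (auto intro!: m sq)
  have T4: "\<bar>if Suc i < n then sqrt (a i * s i) * x (Suc i) else 0\<bar> \<le> jac_size * B"
    using assms(2) z by (auto intro!: m sq)
  have "T x i = a i * x i + (if i = 0 then 0 else s (i - 1)) * x i
     + (if i = 0 then 0 else sqrt (a (i - 1) * s (i - 1)) * x (i - 1))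
     + (if Suc i < n then sqrt (a i * s i) * x (Suc i) else 0)"
    by (simp add: jac_op_def distrib_right)
  then show ?thesis using T1 T2 T3 T4 by linarith
qed

lemma jac_poly_vec_bound:
  assumes "k \<le> n" "i < n"
  shows "\<bar>lin_ev (\<lambda>t. w (int m + int t) i) (jac_poly a s k)\<bar>
     \<le> (4 * jac_size) ^ m * (\<Prod>i<k. sqrt (a i * s i))"
  using assms(2)
proof (induction m arbitrary: i)
  case 0
  have "0 \<le> (\<Prod>i<k. sqrt (a i * s i))" using a s assms(1)
    by (intro prod_nonneg) (auto intro!: mult_nonneg_nonneg intro: less_imp_le)
  then show ?case using jac_poly_vec[OF assms(1) 0] by (simp add: abs_mult power_abs)
next
  case (Suc m)
  have "lin_ev (\<lambda>t. w (int (Suc m) + int t) i) (jac_poly a s k)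
     = lin_ev (\<lambda>t. T (w (int m + int t)) i) (jac_poly a s k)"
    using Suc.prems by (simp add: T_w algebra_simps)
  also have "\<dots> = T (\<lambda>i. lin_ev (\<lambda>t. w (int m + int t) i) (jac_poly a s k)) i"
    by (simp only: T_lin_ev)
  finally have 1: "lin_ev (\<lambda>t. w (int (Suc m) + int t) i) (jac_poly a s k) = \<dots>" .
  have "\<bar>T (\<lambda>i. lin_ev (\<lambda>t. w (int m + int t) i) (jac_poly a s k)) i\<bar>
      \<le> 4 * jac_size * ((4 * jac_size) ^ m * (\<Prod>i<k. sqrt (a i * s i)))"
    by (rule T_bound) (use Suc in auto)
  then show ?case unfolding 1 by (simp only: power_Suc mult.assoc)
qed

text \<open>Expanding the polynomial would lose the factor \<open>a i * s i\<close>. Keeping it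
  matters for integrability: after division by the squared product of the \<open>a i\<close>, only
  the quotients of \<open>s i\<close> by \<open>a i\<close> remain, whose square roots are
  integrable singularities.\<close>

lemma moment_poly_sq_bound:
  assumes "k \<le> n"
  shows "\<bar>lin_ev (\<lambda>t. c (int m + int t)) ((jac_poly a s k)\<^sup>2)\<bar> \<le> (4 * jac_size) ^ m * (\<Prod>i<k. a i * s i)"
proof -
  let ?P = "\<Prod>i<k. sqrt (a i * s i)"
  have P: "0 \<le> ?P" using a s assms
    by (intro prod_nonneg) (auto intro!: mult_nonneg_nonneg intro: less_imp_le)
  have PP: "?P * ?P = (\<Prod>i<k. a i * s i)"
    unfolding prod.distrib[symmetric] using a s assms
    by (intro prod.cong refl real_sqrt_mult_self[THEN trans] abs_of_nonneg mult_nonneg_nonneg)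
      (auto intro: less_imp_le)
  let ?x = "lin_ev (\<lambda>t. w (int m + int t) k) (jac_poly a s k)"
  have "lin_ev (\<lambda>t. c (int m + int t)) ((jac_poly a s k)\<^sup>2)
    = (\<Sum>i<n. lin_ev (\<lambda>t. w (int m + int t) i) (jac_poly a s k) * lin_ev (\<lambda>t. w (int t) i) (jac_poly a s k))"
    unfolding power2_eq_square by (rule moment_poly_sq)
  also have "\<dots> = (\<Sum>i<n. if i = k then ?x * ((-1) ^ k * ?P) else 0)"
    by (rule sum.cong) (use jac_poly_vec[OF assms] in auto)
  also have "\<bar>\<dots>\<bar> \<le> (4 * jac_size) ^ m * (?P * ?P)"
  proof (cases "k < n")
    case True
    have "\<bar>?x * ((-1) ^ k * ?P)\<bar> = \<bar>?x\<bar> * ?P" using P by (simp add: abs_mult power_abs)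
    also have "\<dots> \<le> (4 * jac_size) ^ m * ?P * ?P"
      by (intro mult_right_mono jac_poly_vec_bound assms True P)
    finally show ?thesis using True by (simp add: mult.assoc)
  next
    case False
    then show ?thesis using P jac_size_nonneg by simp
  qed
  finally show ?thesis unfolding PP .
qed

end

subsection \<open>The error of the conjugate gradient method\<close>

lemma adjoint_mat_carrier [simp]: "A \<in> carrier_mat n m \<Longrightarrow> adjoint_mat A \<in> carrier_mat m n"
  by (simp add: adjoint_mat_def)

lemma adjoint_mat_dim [simp]: "dim_row (adjoint_mat A) = dim_col A" "dim_col (adjoint_mat A) = dim_row A"
  by (simp_all add: adjoint_mat_def)

lemma adjoint_mat_index [simp]:
  "i < dim_col A \<Longrightarrow> j < dim_row A \<Longrightarrow> adjoint_mat A $$ (i, j) = cnj (A $$ (j, i))"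
  by (simp add: adjoint_mat_def)

lemma adjoint_adjoint_mat [simp]: "adjoint_mat (adjoint_mat A) = A"
  by (rule eq_matI) auto

lemma mat_mult_index: "A \<in> carrier_mat n m \<Longrightarrow> B \<in> carrier_mat m k \<Longrightarrow> i < n \<Longrightarrow> j < k \<Longrightarrow>
   (A * B) $$ (i, j) = (\<Sum>t<m. A $$ (i, t) * B $$ (t, j))"
  by (auto simp: scalar_prod_def atLeast0LessThan)

lemma mat_vec_index: "A \<in> carrier_mat n m \<Longrightarrow> v \<in> carrier_vec m \<Longrightarrow> i < n \<Longrightarrow>
   (A *\<^sub>v v) $ i = (\<Sum>t<m. A $$ (i, t) * v $ t)"
  by (auto simp: scalar_prod_def atLeast0LessThan)

lemma adjoint_mat_mult:
  assumes "A \<in> carrier_mat n m" "B \<in> carrier_mat m k"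
  shows "adjoint_mat (A * B) = adjoint_mat B * adjoint_mat A"
proof (rule eq_matI)
  fix i j assume "i < dim_row (adjoint_mat B * adjoint_mat A)" "j < dim_col (adjoint_mat B * adjoint_mat A)"
  then have ij: "i < k" "j < n" using assms by auto
  have "adjoint_mat (A * B) $$ (i, j) = cnj ((A * B) $$ (j, i))" using assms ij by simp
  also have "\<dots> = (\<Sum>t<m. adjoint_mat B $$ (i, t) * adjoint_mat A $$ (t, j))"
    using assms ij by (subst mat_mult_index[OF assms]) (auto simp: mult.commute)
  also have "\<dots> = (adjoint_mat B * adjoint_mat A) $$ (i, j)"
    using assms ij by (subst mat_mult_index[of _ k m _ n]) auto
  finally show "adjoint_mat (A * B) $$ (i, j) = (adjoint_mat B * adjoint_mat A) $$ (i, j)" .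
qed (use assms in auto)

lemma cscalar_prod_sum: "y \<in> carrier_vec n \<Longrightarrow> (x \<bullet>c y :: complex) = (\<Sum>i<n. x $ i * cnj (y $ i))"
  by (auto simp: scalar_prod_def atLeast0LessThan)

lemma cscalar_adjoint:
  assumes "A \<in> carrier_mat n m" "x \<in> carrier_vec m" "y \<in> carrier_vec n"
  shows "(A *\<^sub>v x) \<bullet>c y = x \<bullet>c (adjoint_mat A *\<^sub>v y)"
proof -
  have "(A *\<^sub>v x) \<bullet>c y = (\<Sum>i<n. \<Sum>t<m. A $$ (i, t) * x $ t * cnj (y $ i))"
    using assms by (subst cscalar_prod_sum) (auto simp: mat_vec_index sum_distrib_right simp del: index_mult_mat_vec)
  also have "\<dots> = (\<Sum>t<m. \<Sum>i<n. A $$ (i, t) * x $ t * cnj (y $ i))" by (rule sum.swap)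
  also have "\<dots> = (\<Sum>t<m. x $ t * cnj ((adjoint_mat A *\<^sub>v y) $ t))"
    using assms by (intro sum.cong refl) (subst mat_vec_index[of _ m n], auto simp: sum_distrib_left mult_ac)
  also have "\<dots> = x \<bullet>c (adjoint_mat A *\<^sub>v y)"
    using assms by (subst cscalar_prod_sum[of _ m]) (auto intro!: mult_mat_vec_carrier)
  finally show ?thesis .
qed

lemma cscalar_commute: "x \<in> carrier_vec n \<Longrightarrow> y \<in> carrier_vec n \<Longrightarrow> (y \<bullet>c x :: complex) = cnj (x \<bullet>c y)"
  by (simp add: cscalar_prod_sum mult.commute)

lemma cscalar_add_left: "x \<in> carrier_vec n \<Longrightarrow> y \<in> carrier_vec n \<Longrightarrow> z \<in> carrier_vec n \<Longrightarrow>
   ((x + y) \<bullet>c z :: complex) = x \<bullet>c z + y \<bullet>c z"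
  by (simp add: cscalar_prod_sum sum.distrib distrib_right)

lemma cscalar_diff_left: "x \<in> carrier_vec n \<Longrightarrow> y \<in> carrier_vec n \<Longrightarrow> z \<in> carrier_vec n \<Longrightarrow>
   ((x - y) \<bullet>c z :: complex) = x \<bullet>c z - y \<bullet>c z"
  by (simp add: cscalar_prod_sum sum_subtractf left_diff_distrib)

lemma cscalar_add_right: "x \<in> carrier_vec n \<Longrightarrow> y \<in> carrier_vec n \<Longrightarrow> z \<in> carrier_vec n \<Longrightarrow>
   (x \<bullet>c (y + z) :: complex) = x \<bullet>c y + x \<bullet>c z"
  using cscalar_prod_sum[of "y + z" n x] by (simp add: cscalar_prod_sum sum.distrib distrib_left)

lemma pow_mat_vec_comm:
  assumes "A \<in> carrier_mat n n" "v \<in> carrier_vec n"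
  shows "A ^\<^sub>m k *\<^sub>v (A *\<^sub>v v) = A *\<^sub>v (A ^\<^sub>m k *\<^sub>v v)"
  using assms(2)
proof (induction k arbitrary: v)
  case 0
  then show ?case using assms(1) by simp
next
  case (Suc k)
  have c: "A ^\<^sub>m k \<in> carrier_mat n n" using assms(1) by simp
  have "A ^\<^sub>m Suc k *\<^sub>v (A *\<^sub>v v) = A ^\<^sub>m k *\<^sub>v (A *\<^sub>v (A *\<^sub>v v))"
    using assms(1) Suc.prems c by (simp add: assoc_mult_mat_vec[OF c assms(1)])
  also have "\<dots> = A *\<^sub>v (A ^\<^sub>m k *\<^sub>v (A *\<^sub>v v))"
    using Suc.prems assms(1) by (intro Suc.IH) auto
  also have "A ^\<^sub>m k *\<^sub>v (A *\<^sub>v v) = A ^\<^sub>m Suc k *\<^sub>v v"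
    using assms(1) Suc.prems c by (simp add: assoc_mult_mat_vec[OF c assms(1)])
  finally show ?case .
qed

lemma pow_mat_vec_Suc:
  assumes "A \<in> carrier_mat n n" "v \<in> carrier_vec n"
  shows "A ^\<^sub>m Suc k *\<^sub>v v = A *\<^sub>v (A ^\<^sub>m k *\<^sub>v v)"
  using pow_mat_vec_comm[OF assms, of k] assms assoc_mult_mat_vec[of "A ^\<^sub>m k" n n A n v] by simp

lemma pow_mat_vec_carrier: "A \<in> carrier_mat n n \<Longrightarrow> v \<in> carrier_vec n \<Longrightarrow> A ^\<^sub>m k *\<^sub>v v \<in> carrier_vec n"
  by (rule mult_mat_vec_carrier[of _ n n]) auto

text \<open>Cramer's rule presents the inverse as a total function of the entries that is visibly
  measurable; it agrees with \<open>mat_inverse\<close> wherever the determinant is nonzero.\<close>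

definition inv_mat :: "complex mat \<Rightarrow> complex mat" where
  "inv_mat W = (1 / det W) \<cdot>\<^sub>m adj_mat W"

lemma inv_mat:
  assumes "W \<in> carrier_mat n n" "det W \<noteq> 0"
  shows "inv_mat W \<in> carrier_mat n n" "W * inv_mat W = 1\<^sub>m n" "inv_mat W * W = 1\<^sub>m n"
proof -
  note a = adj_mat[OF assms(1)]
  show "inv_mat W \<in> carrier_mat n n" using a by (simp add: inv_mat_def)
  have d: "(1 / det W) \<cdot>\<^sub>m (det W \<cdot>\<^sub>m 1\<^sub>m n) = 1\<^sub>m n" using assms(2) by (intro eq_matI) auto
  show "W * inv_mat W = 1\<^sub>m n"
    unfolding inv_mat_def mult_smult_distrib[OF assms(1) a(1)] a(2) by (rule d)
  show "inv_mat W * W = 1\<^sub>m n"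
    unfolding inv_mat_def mult_smult_assoc_mat[OF a(1) assms(1)] a(3) by (rule d)
qed

lemma mat_inverse_unique:
  assumes "W \<in> carrier_mat n n" "B \<in> carrier_mat n n" "W * B = 1\<^sub>m n" "B * W = 1\<^sub>m (n::nat)"
  shows "mat_inverse W = Some (B :: complex mat)"
proof (cases "mat_inverse W")
  case None
  from mat_inverse(1)[OF assms(1) None] have "W \<notin> Units (ring_mat TYPE(complex) n ())" .
  moreover have "W \<in> Units (ring_mat TYPE(complex) n ())"
    using assms unfolding Units_def by (auto simp: ring_mat_def)
  ultimately show ?thesis by simp
next
  case (Some C)
  note C = mat_inverse(2)[OF assms(1) Some]
  have "C = C * (W * B)" unfolding assms(3) using C right_mult_one_mat[of C n n] by simp
  also have "\<dots> = B" using C assms by (subst assoc_mult_mat[symmetric, of _ n n _ n _ n]) auto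
  finally show ?thesis using Some by simp
qed

lemma the_mat_inverse:
  assumes "W \<in> carrier_mat n n" "det W \<noteq> 0"
  shows "the (mat_inverse W) = inv_mat W"
  using mat_inverse_unique[OF assms(1) inv_mat[OF assms]] by simp

lemma inv_mat_vec:
  assumes "W \<in> carrier_mat n n" "det W \<noteq> 0" "v \<in> carrier_vec n"
  shows "inv_mat W *\<^sub>v v \<in> carrier_vec n" "W *\<^sub>v (inv_mat W *\<^sub>v v) = v" "inv_mat W *\<^sub>v (W *\<^sub>v v) = v"
  using inv_mat[OF assms(1,2)] assms by (auto simp flip: assoc_mult_mat_vec)

lemma mat_powi_carrier:
  assumes "W \<in> carrier_mat n n" "det W \<noteq> 0"
  shows "mat_powi W l \<in> carrier_mat n n"
  using assms inv_mat[OF assms] the_mat_inverse[OF assms] by (simp add: mat_powi_def)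

text \<open>A two-sided orbit of \<open>W\<close> determines the action of all integer powers on its
  members, so the inverse matrix never has to be computed.\<close>

lemma mat_powi_shift:
  assumes "W \<in> carrier_mat n n" "det W \<noteq> 0" "\<And>j. v j \<in> carrier_vec n" "\<And>j. W *\<^sub>v v j = v (j + 1)"
  shows "mat_powi W l *\<^sub>v v j = v (j + l)"
proof -
  have pos: "W ^\<^sub>m k *\<^sub>v v j = v (j + int k)" for k j
  proof (induction k)
    case (Suc k)
    then show ?case using pow_mat_vec_Suc[OF assms(1) assms(3)] assms(4) by (simp add: algebra_simps)
  qed (use assms in simp)
  have i: "inv_mat W *\<^sub>v v j = v (j - 1)" for j
    using inv_mat_vec(3)[OF assms(1,2) assms(3), of "j - 1"] assms(4)[of "j - 1"] by simp
  have neg: "inv_mat W ^\<^sub>m k *\<^sub>v v j = v (j - int k)" for k j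
  proof (induction k)
    case (Suc k)
    then show ?case using pow_mat_vec_Suc[OF inv_mat(1)[OF assms(1,2)] assms(3)] i by (simp add: algebra_simps)
  qed (use assms inv_mat(1)[OF assms(1,2)] in simp)
  show ?thesis using pos neg by (auto simp: mat_powi_def the_mat_inverse[OF assms(1,2)])
qed

lemma pos_def_det:
  assumes "W \<in> carrier_mat n n" "pos_def W"
  shows "det W \<noteq> 0"
proof
  assume "det W = 0"
  then obtain v where v: "v \<in> carrier_vec n" "v \<noteq> 0\<^sub>v n" "W *\<^sub>v v = 0\<^sub>v n"
    using det_0_iff_vec_prod_zero_field[OF assms(1)] by blast
  then have "0 < Re (0\<^sub>v n \<bullet>c v)" using assms unfolding pos_def_def by fastforce
  then show False using v by simp
qed

section \<open>Galerkin orthogonality and conjugate directions\<close>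

abbreviation kry_comb :: "complex mat \<Rightarrow> complex vec \<Rightarrow> nat \<Rightarrow> (nat \<Rightarrow> complex) \<Rightarrow> complex vec" where
  "kry_comb W b k c \<equiv> vec (dim_vec b) (\<lambda>i. \<Sum>j<k. c j * (W ^\<^sub>m j *\<^sub>v b) $ i)"

lemma scalars_closed:
  "0 \<in> scalars \<beta>" "1 \<in> scalars \<beta>" "x \<in> scalars \<beta> \<Longrightarrow> y \<in> scalars \<beta> \<Longrightarrow> x + y \<in> scalars \<beta>"
  "x \<in> scalars \<beta> \<Longrightarrow> y \<in> scalars \<beta> \<Longrightarrow> x - y \<in> scalars \<beta>"
  "x \<in> scalars \<beta> \<Longrightarrow> y \<in> scalars \<beta> \<Longrightarrow> x * y \<in> scalars \<beta>"
  "x \<in> scalars \<beta> \<Longrightarrow> y \<in> scalars \<beta> \<Longrightarrow> x / y \<in> scalars \<beta>"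
  "x \<in> scalars \<beta> \<Longrightarrow> cnj x \<in> scalars \<beta>" "complex_of_real r \<in> scalars \<beta>"
  by (auto simp: scalars_def Reals_cnj_iff)

lemma scalars_sum: "(\<And>i. i \<in> A \<Longrightarrow> f i \<in> scalars \<beta>) \<Longrightarrow> sum f A \<in> scalars \<beta>"
  by (induction A rule: infinite_finite_induct) (auto intro: scalars_closed)

lemma krylov_diff:
  assumes "y \<in> krylov \<beta> W b k" "z \<in> krylov \<beta> W b k"
  shows "y - z \<in> krylov \<beta> W b k"
proof -
  obtain c c' where c: "y = kry_comb W b k c" "\<forall>j<k. c j \<in> scalars \<beta>"
    "z = kry_comb W b k c'" "\<forall>j<k. c' j \<in> scalars \<beta>"
    using assms unfolding krylov_def by blast
  have "y - z = kry_comb W b k (\<lambda>j. c j - c' j)"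
    unfolding c by (rule eq_vecI) (auto simp: sum_subtractf left_diff_distrib)
  then show ?thesis using c unfolding krylov_def by (auto intro!: exI[of _ "\<lambda>j. c j - c' j"] scalars_closed)
qed

lemma krylov_carrier: "b \<in> carrier_vec n \<Longrightarrow> y \<in> krylov \<beta> W b k \<Longrightarrow> y \<in> carrier_vec n"
  unfolding krylov_def by auto

lemma energy_cross:
  assumes "W \<in> carrier_mat n n" "adjoint_mat W = W" "u \<in> carrier_vec n" "v \<in> carrier_vec n"
  shows "Re ((W *\<^sub>v (u + v)) \<bullet>c (u + v)) = Re ((W *\<^sub>v u) \<bullet>c u) + Re ((W *\<^sub>v v) \<bullet>c v) + 2 * Re ((W *\<^sub>v v) \<bullet>c u)"
proof -
  have "(W *\<^sub>v u) \<bullet>c v = cnj ((W *\<^sub>v v) \<bullet>c u)"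
    using cscalar_adjoint[OF assms(1,3,4)] cscalar_commute[of "W *\<^sub>v v" n u] assms by auto
  then show ?thesis using assms
    by (simp add: mult_add_distrib_mat_vec cscalar_add_left[of _ n] cscalar_add_right[of _ n])
qed

lemma pos_def_nonneg:
  assumes "W \<in> carrier_mat n n" "pos_def W" "v \<in> carrier_vec n"
  shows "0 \<le> Re ((W *\<^sub>v v) \<bullet>c v)" "Re ((W *\<^sub>v v) \<bullet>c v) \<le> 0 \<Longrightarrow> v = 0\<^sub>v n"
proof -
  have "v = 0\<^sub>v n \<Longrightarrow> Re ((W *\<^sub>v v) \<bullet>c v) = 0" using assms by (simp add: scalar_prod_def)
  then show "0 \<le> Re ((W *\<^sub>v v) \<bullet>c v)" "Re ((W *\<^sub>v v) \<bullet>c v) \<le> 0 \<Longrightarrow> v = 0\<^sub>v n"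
    using assms unfolding pos_def_def by fastforce+
qed

text \<open>Orthogonality of the residual gives Pythagoras: the squared energy error of a competitor
  \<open>z\<close> is that of \<open>y\<close> plus the energy of \<open>z - y\<close>. Definiteness
  then makes the minimizer unique, which resolves the description operator.\<close>

lemma cg_iterate_eqI:
  assumes W: "W \<in> carrier_mat n n" "pos_def W" and b: "b \<in> carrier_vec n"
    and y: "y \<in> krylov \<beta> W b k" and orth: "\<And>z. z \<in> krylov \<beta> W b k \<Longrightarrow> (b - W *\<^sub>v y) \<bullet>c z = 0"
  shows "cg_iterate \<beta> W b k = y"
proof -
  define x where "x = cg_solution W b"
  note dW = pos_def_det[OF W]
  have x: "x \<in> carrier_vec n" "W *\<^sub>v x = b"
    using inv_mat_vec[OF W(1) dW b] by (simp_all add: x_def cg_solution_def the_mat_inverse[OF W(1) dW])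
  have yc: "y \<in> carrier_vec n" using krylov_carrier[OF b y] .
  have herm: "adjoint_mat W = W" using W by (simp add: pos_def_def)
  define E where "E v = Re ((W *\<^sub>v v) \<bullet>c v)" for v
  have key: "E (z - x) = E (z - y) + E (y - x)" if z: "z \<in> krylov \<beta> W b k" for z
  proof -
    have zc: "z \<in> carrier_vec n" using krylov_carrier[OF b z] .
    have zy: "(z - y) + (y - x) = z - x" using zc yc x by (intro eq_vecI) auto
    have Wd: "W *\<^sub>v (y - x) = - (b - W *\<^sub>v y)" using W yc x b
      by (simp add: mult_minus_distrib_mat_vec) (rule eq_vecI; auto)
    have "(W *\<^sub>v (y - x)) \<bullet>c (z - y) = - ((b - W *\<^sub>v y) \<bullet>c (z - y))"
      unfolding Wd using W b yc zc by (subst scalar_prod_uminus_left) auto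
    also have "\<dots> = 0" using orth[OF krylov_diff[OF z y]] by simp
    finally show ?thesis unfolding E_def
      using energy_cross[OF W(1) herm, of "z - y" "y - x"] zc yc x zy by simp
  qed
  have En: "energy_norm W v = sqrt (E v)" for v by (simp add: energy_norm_def E_def)
  have pos: "0 \<le> E (z - y)" if "z \<in> krylov \<beta> W b k" for z
    unfolding E_def using pos_def_nonneg(1)[OF W] krylov_carrier[OF b that] yc by simp
  show ?thesis unfolding cg_iterate_def x_def[symmetric]
  proof (rule the_equality, intro conjI ballI y)
    fix z assume "z \<in> krylov \<beta> W b k"
    then show "energy_norm W (y - x) \<le> energy_norm W (z - x)" unfolding En using key pos by simp
  next
    fix z assume z: "z \<in> krylov \<beta> W b k \<and> (\<forall>za\<in>krylov \<beta> W b k. energy_norm W (z - x) \<le> energy_norm W (za - x))"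
    then have "E (z - x) \<le> E (y - x)" unfolding En using y by auto
    then have "E (z - y) \<le> 0" using key z by simp
    moreover have zc: "z \<in> carrier_vec n" using krylov_carrier[OF b] z by blast
    ultimately have "z - y = 0\<^sub>v n" using pos_def_nonneg(2)[OF W, of "z - y"] yc unfolding E_def by simp
    show "z = y"
    proof (rule eq_vecI)
      fix i assume "i < dim_vec y"
      then have "(z - y) $ i = 0" using \<open>z - y = 0\<^sub>v n\<close> yc by simp
      then show "z $ i = y $ i" using zc yc \<open>i < dim_vec y\<close> by simp
    qed (use zc yc in simp)
  qed
qed

lemma cg_error_eqI:
  assumes W: "W \<in> carrier_mat n n" "pos_def W" and b: "b \<in> carrier_vec n"
    and y: "y \<in> krylov \<beta> W b k" and orth: "\<And>z. z \<in> krylov \<beta> W b k \<Longrightarrow> (b - W *\<^sub>v y) \<bullet>c z = 0"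
    and e: "e \<in> carrier_vec n" "W *\<^sub>v e = b - W *\<^sub>v y"
  shows "cg_error \<beta> W b k = e"
proof -
  note dW = pos_def_det[OF W]
  have yc: "y \<in> carrier_vec n" using krylov_carrier[OF b y] .
  have x: "cg_solution W b = inv_mat W *\<^sub>v b" by (simp add: cg_solution_def the_mat_inverse[OF W(1) dW])
  have "e = inv_mat W *\<^sub>v (b - W *\<^sub>v y)" using inv_mat_vec(3)[OF W(1) dW e(1)] e by simp
  also have "\<dots> = inv_mat W *\<^sub>v b - y"
    using inv_mat[OF W(1) dW] b yc W inv_mat_vec(3)[OF W(1) dW yc]
    by (simp add: mult_minus_distrib_mat_vec[of _ n n])
  finally show ?thesis unfolding cg_error_def x using cg_iterate_eqI[OF W b y orth] by simp
qed

definition herm_form :: "complex mat \<Rightarrow> nat \<Rightarrow> (nat \<Rightarrow> complex) \<Rightarrow> (nat \<Rightarrow> complex) \<Rightarrow> complex" where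
  "herm_form W n x y = (\<Sum>s<n. \<Sum>t<n. W $$ (s, t) * x t * cnj (y s))"

text \<open>Division by zero makes the recursion total: a vanishing direction contributes nothing.\<close>

fun conj_dir :: "((nat \<Rightarrow> complex) \<Rightarrow> (nat \<Rightarrow> complex) \<Rightarrow> complex) \<Rightarrow> (nat \<Rightarrow> nat \<Rightarrow> complex) \<Rightarrow> nat \<Rightarrow> nat \<Rightarrow> complex" where
  "conj_dir h u i = (\<lambda>t. u i t - (\<Sum>j<i. h (u i) (conj_dir h u j) / h (conj_dir h u j) (conj_dir h u j) * conj_dir h u j t))"

declare conj_dir.simps [simp del]

definition kry_basis :: "complex mat \<Rightarrow> complex vec \<Rightarrow> nat \<Rightarrow> nat \<Rightarrow> complex" where
  "kry_basis W b i t = (W ^\<^sub>m i *\<^sub>v b) $ t"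

abbreviation cg_dir :: "complex mat \<Rightarrow> complex vec \<Rightarrow> nat \<Rightarrow> nat \<Rightarrow> nat \<Rightarrow> complex" where
  "cg_dir W b n \<equiv> conj_dir (herm_form W n) (kry_basis W b)"

text \<open>The expansion of the minimizer in mutually conjugate directions, with coefficients given
  by inner products with \<open>b\<close>. It is the explicit form of the iterate on which
  measurability rests.\<close>

definition galerkin :: "complex mat \<Rightarrow> complex vec \<Rightarrow> nat \<Rightarrow> nat \<Rightarrow> nat \<Rightarrow> complex" where
  "galerkin W b n k t = (\<Sum>i<k. (\<Sum>s<n. b $ s * cnj (cg_dir W b n i s)) / herm_form W n (cg_dir W b n i) (cg_dir W b n i)
     * cg_dir W b n i t)"

lemma herm_form_lin:
  "herm_form W n (\<lambda>t. x t - (\<Sum>j\<in>A. c j * p j t)) y = herm_form W n x y - (\<Sum>j\<in>A. c j * herm_form W n (p j) y)"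
proof -
  have "herm_form W n (\<lambda>t. x t - (\<Sum>j\<in>A. c j * p j t)) y
     = herm_form W n x y - (\<Sum>s<n. \<Sum>t<n. \<Sum>j\<in>A. W $$ (s, t) * (c j * p j t) * cnj (y s))"
    unfolding herm_form_def
    by (simp add: algebra_simps sum_subtractf sum_distrib_left sum_distrib_right)
  also have "(\<Sum>s<n. \<Sum>t<n. \<Sum>j\<in>A. W $$ (s, t) * (c j * p j t) * cnj (y s))
     = (\<Sum>j\<in>A. \<Sum>s<n. \<Sum>t<n. W $$ (s, t) * (c j * p j t) * cnj (y s))"
    by (simp only: sum.swap[of _ A])
  also have "\<dots> = (\<Sum>j\<in>A. c j * herm_form W n (p j) y)"
    unfolding herm_form_def by (simp add: sum_distrib_left mult_ac)
  finally show ?thesis .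
qed

lemma herm_form_sum:
  "herm_form W n (\<lambda>t. \<Sum>j\<in>A. c j * p j t) y = (\<Sum>j\<in>A. c j * herm_form W n (p j) y)"
proof -
  have "herm_form W n (\<lambda>t. 0 - (\<Sum>j\<in>A. (- c j) * p j t)) y = (\<Sum>j\<in>A. c j * herm_form W n (p j) y)"
    unfolding herm_form_lin by (simp add: herm_form_def sum_negf)
  then show ?thesis by (simp add: sum_negf)
qed

lemma herm_form_vec:
  assumes "W \<in> carrier_mat n n"
  shows "herm_form W n x y = (W *\<^sub>v vec n x) \<bullet>c vec n y"
  using assms by (subst cscalar_prod_sum[of _ n])
    (auto simp: herm_form_def mat_vec_index sum_distrib_right simp del: index_mult_mat_vec)

text \<open>The entries are confined to \<open>scalars \<beta>\<close> because the Krylov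
  coefficients are: in the real case the orthogonalization has to stay inside the reals.\<close>

locale pd_mat =
  fixes W :: "complex mat" and b :: "complex vec" and n \<beta> :: nat
  assumes W: "W \<in> carrier_mat n n" "pos_def W" and b: "b \<in> carrier_vec n"
    and W_scalars: "\<And>i j. i < n \<Longrightarrow> j < n \<Longrightarrow> W $$ (i, j) \<in> scalars \<beta>"
    and b_scalars: "\<And>i. i < n \<Longrightarrow> b $ i \<in> scalars \<beta>"
begin

abbreviation "h \<equiv> herm_form W n"
abbreviation "u \<equiv> kry_basis W b"
abbreviation "p \<equiv> cg_dir W b n"

lemma h_sym: "h x y = cnj (h y x)"
proof -
  have "W $$ (s, t) = cnj (W $$ (t, s))" if "s < n" "t < n" for s t
  proof -
    have "adjoint_mat W $$ (s, t) = cnj (W $$ (t, s))" using that W by simp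
    then show ?thesis using W by (simp add: pos_def_def)
  qed
  then have eq: "W $$ (s, t) * x t * cnj (y s) = cnj (W $$ (t, s)) * x t * cnj (y s)"
    if "s \<in> {..<n}" "t \<in> {..<n}" for s t
    using that by (intro arg_cong2[of _ _ _ _ "(*)"] refl) blast
  have "h x y = (\<Sum>s<n. \<Sum>t<n. cnj (W $$ (t, s)) * x t * cnj (y s))"
    unfolding herm_form_def by (intro sum.cong refl eq)
  also have "\<dots> = (\<Sum>t<n. \<Sum>s<n. cnj (W $$ (t, s)) * x t * cnj (y s))" by (rule sum.swap)
  also have "\<dots> = cnj (h y x)" by (simp add: herm_form_def mult_ac)
  finally show ?thesis .
qed

lemma h_definite: "h x x = 0 \<Longrightarrow> t < n \<Longrightarrow> x t = 0"
proof -
  assume "h x x = 0" "t < n"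
  then have "vec n x = 0\<^sub>v n"
    using pos_def_nonneg(2)[OF W, of "vec n x"] herm_form_vec[OF W(1), of x x] by simp
  then have "vec n x $ t = 0\<^sub>v n $ t" by simp
  then show "x t = 0" using \<open>t < n\<close> by simp
qed

lemma h_zero_right: "(\<And>t. t < n \<Longrightarrow> y t = 0) \<Longrightarrow> h x y = 0"
  by (simp add: herm_form_def)

lemma p_orth: "j < i \<Longrightarrow> h (p i) (p j) = 0"
proof (induction i arbitrary: j rule: less_induct)
  case (less i)
  have o: "h (p m) (p j) = 0" if "m < i" "m \<noteq> j" for m
  proof (cases "j < m")
    case True
    then show ?thesis using less.IH[OF that(1)] by simp
  next
    case False
    then have "h (p j) (p m) = 0" using less.IH[OF less.prems, of m] that by simp
    then show ?thesis using h_sym[of "p m" "p j"] by simp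
  qed
  have "h (p i) (p j) = h (u i) (p j) - (\<Sum>m<i. h (u i) (p m) / h (p m) (p m) * h (p m) (p j))"
    by (subst conj_dir.simps) (rule herm_form_lin)
  also have "(\<Sum>m<i. h (u i) (p m) / h (p m) (p m) * h (p m) (p j))
     = (\<Sum>m<i. if m = j then h (u i) (p j) / h (p j) (p j) * h (p j) (p j) else 0)"
    by (rule sum.cong) (auto simp: o)
  also have "\<dots> = h (u i) (p j) / h (p j) (p j) * h (p j) (p j)" using less.prems by simp
  \<comment> \<open>If \<open>h (p j) (p j)\<close> is 0, then \<open>p j\<close> vanishes by
    definiteness and both sides are 0, so the division by zero is harmless.\<close>
  also have "\<dots> = h (u i) (p j)"
    using h_definite[of "p j"] h_zero_right[of "p j" "u i"] by auto
  finally show ?case by simp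
qed

lemma p_orth': "j \<noteq> i \<Longrightarrow> h (p i) (p j) = 0"
  using p_orth[of j i] p_orth[of i j] h_sym[of "p i" "p j"] by (cases "j < i") auto

definition kspan :: "nat \<Rightarrow> (nat \<Rightarrow> complex) set" where
  "kspan k = {\<lambda>t. \<Sum>j<k. c j * u j t | c. \<forall>j. c j \<in> scalars \<beta>}"

lemma kspan_mono: "k \<le> m \<Longrightarrow> x \<in> kspan k \<Longrightarrow> x \<in> kspan m"
proof -
  assume "k \<le> m" "x \<in> kspan k"
  then obtain c where c: "x = (\<lambda>t. \<Sum>j<k. c j * u j t)" "\<forall>j. c j \<in> scalars \<beta>" by (auto simp: kspan_def)
  have "x t = (\<Sum>j<m. (if j < k then c j else 0) * u j t)" for t
    unfolding c using \<open>k \<le> m\<close> by (intro sum.mono_neutral_cong_left) auto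
  then show ?thesis unfolding kspan_def using c scalars_closed(1)
    by (auto intro!: exI[of _ "\<lambda>j. if j < k then c j else 0"])
qed

lemma kspan_basis: "i < k \<Longrightarrow> u i \<in> kspan k"
proof -
  assume "i < k"
  then have "u i t = (\<Sum>j<k. (if j = i then 1 else 0) * u j t)" for t
    by (simp add: if_distrib[of "\<lambda>x. x * _"] cong: if_cong)
  then show ?thesis unfolding kspan_def using scalars_closed(1,2)
    by (auto intro!: exI[of _ "\<lambda>j. if j = i then 1 else 0"])
qed

lemma kspan_sum:
  assumes "\<And>i. i \<in> A \<Longrightarrow> x i \<in> kspan k" "\<And>i. i \<in> A \<Longrightarrow> c i \<in> scalars \<beta>"
  shows "(\<lambda>t. \<Sum>i\<in>A. c i * x i t) \<in> kspan k"
proof -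
  have "\<forall>i\<in>A. \<exists>g. x i = (\<lambda>t. \<Sum>j<k. g j * u j t) \<and> (\<forall>j. g j \<in> scalars \<beta>)"
    using assms(1) by (auto simp: kspan_def)
  then obtain g where g: "\<And>i. i \<in> A \<Longrightarrow> x i = (\<lambda>t. \<Sum>j<k. g i j * u j t)" "\<And>i j. i \<in> A \<Longrightarrow> g i j \<in> scalars \<beta>"
    by metis
  have "(\<Sum>i\<in>A. c i * x i t) = (\<Sum>j<k. (\<Sum>i\<in>A. c i * g i j) * u j t)" for t
    by (simp add: g(1) sum_distrib_left sum_distrib_right mult.assoc sum.swap[of _ A])
  then show ?thesis unfolding kspan_def using g(2) assms(2)
    by (auto intro!: exI[of _ "\<lambda>j. \<Sum>i\<in>A. c i * g i j"] scalars_sum scalars_closed)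
qed

lemma kspan_diff: "x \<in> kspan k \<Longrightarrow> y \<in> kspan k \<Longrightarrow> (\<lambda>t. x t - y t) \<in> kspan k"
proof -
  assume "x \<in> kspan k" "y \<in> kspan k"
  then obtain c c' where c: "x = (\<lambda>t. \<Sum>j<k. c j * u j t)" "\<forall>j. c j \<in> scalars \<beta>"
     "y = (\<lambda>t. \<Sum>j<k. c' j * u j t)" "\<forall>j. c' j \<in> scalars \<beta>" by (auto simp: kspan_def)
  have "x t - y t = (\<Sum>j<k. (c j - c' j) * u j t)" for t
    unfolding c by (simp add: left_diff_distrib sum_subtractf)
  then show ?thesis unfolding kspan_def using c
    by (auto intro!: exI[of _ "\<lambda>j. c j - c' j"] scalars_closed)
qed

lemma u_scalars: "t < n \<Longrightarrow> u i t \<in> scalars \<beta>"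
proof (induction i arbitrary: t)
  case 0
  then show ?case using b b_scalars W by (simp add: kry_basis_def)
next
  case (Suc i)
  have c: "W ^\<^sub>m i *\<^sub>v b \<in> carrier_vec n" using pow_mat_vec_carrier W(1) b .
  have "u (Suc i) t = (\<Sum>s<n. W $$ (t, s) * u i s)"
    using Suc.prems unfolding kry_basis_def pow_mat_vec_Suc[OF W(1) b] mat_vec_index[OF W(1) c Suc.prems] by simp
  then show ?case using Suc W_scalars by (auto intro!: scalars_sum scalars_closed)
qed

lemma h_scalars: "(\<And>t. t < n \<Longrightarrow> x t \<in> scalars \<beta>) \<Longrightarrow> (\<And>t. t < n \<Longrightarrow> y t \<in> scalars \<beta>) \<Longrightarrow> h x y \<in> scalars \<beta>"
  unfolding herm_form_def using W_scalars by (auto intro!: scalars_sum scalars_closed)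

lemma kspan_scalars: "x \<in> kspan k \<Longrightarrow> t < n \<Longrightarrow> x t \<in> scalars \<beta>"
  unfolding kspan_def using u_scalars by (auto intro!: scalars_sum scalars_closed)

lemma p_span: "p i \<in> kspan (Suc i)"
proof (induction i rule: less_induct)
  case (less i)
  have a: "p j \<in> kspan (Suc i)" if "j < i" for j
    using kspan_mono[OF _ less.IH[OF that], of "Suc i"] that by simp
  have "h (u i) (p j) / h (p j) (p j) \<in> scalars \<beta>" if "j < i" for j
    using u_scalars kspan_scalars[OF a[OF that]] by (intro scalars_closed h_scalars) auto
  then show ?case
    by (subst conj_dir.simps) (intro kspan_diff kspan_basis kspan_sum a, auto)
qed

lemma galerkin_span: "galerkin W b n k \<in> kspan k"
  unfolding galerkin_def[abs_def]
proof (rule kspan_sum)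
  fix i assume "i \<in> {..<k}"
  then have i: "i < k" by simp
  show "p i \<in> kspan k" using kspan_mono[OF _ p_span, of i k] i by simp
  show "(\<Sum>s<n. b $ s * cnj (p i s)) / h (p i) (p i) \<in> scalars \<beta>"
    using kspan_scalars[OF p_span] b_scalars by (intro scalars_closed(6) scalars_sum scalars_closed(5,7) h_scalars) auto
qed

lemma galerkin_krylov: "vec n (galerkin W b n k) \<in> krylov \<beta> W b k"
proof -
  obtain c where c: "galerkin W b n k = (\<lambda>t. \<Sum>j<k. c j * u j t)" "\<forall>j. c j \<in> scalars \<beta>"
    using galerkin_span[of k] by (auto simp: kspan_def)
  have "vec n (galerkin W b n k) = kry_comb W b k c"
    unfolding c using b by (intro eq_vecI) (auto simp: kry_basis_def)
  then show ?thesis unfolding krylov_def using c(2) by blast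
qed

lemma residual_inner:
  "(b - W *\<^sub>v vec n x) \<bullet>c vec n y = (\<Sum>s<n. b $ s * cnj (y s)) - h x y"
  using W b cscalar_diff_left[of b n "W *\<^sub>v vec n x" "vec n y"] cscalar_prod_sum[of "vec n y" n b]
  by (simp add: herm_form_vec[OF W(1)])

lemma galerkin_orth_p:
  assumes "i < k"
  shows "(\<Sum>s<n. b $ s * cnj (p i s)) - h (galerkin W b n k) (p i) = 0"
proof -
  have "h (galerkin W b n k) (p i) = (\<Sum>j<k. (\<Sum>s<n. b $ s * cnj (p j s)) / h (p j) (p j) * h (p j) (p i))"
    unfolding galerkin_def[abs_def] by (rule herm_form_sum)
  also have "\<dots> = (\<Sum>j<k. if j = i then (\<Sum>s<n. b $ s * cnj (p i s)) / h (p i) (p i) * h (p i) (p i) else 0)"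
    by (rule sum.cong) (auto simp: p_orth')
  also have "\<dots> = (\<Sum>s<n. b $ s * cnj (p i s)) / h (p i) (p i) * h (p i) (p i)" using assms by simp
  also have "\<dots> = (\<Sum>s<n. b $ s * cnj (p i s))"
    using h_definite[of "p i"] by auto
  finally show ?thesis by simp
qed

lemma galerkin_orth_u:
  assumes "i < k"
  shows "(b - W *\<^sub>v vec n (galerkin W b n k)) \<bullet>c vec n (u i) = 0"
proof -
  let ?r = "b - W *\<^sub>v vec n (galerkin W b n k)"
  have po: "(\<Sum>s<n. ?r $ s * cnj (p j s)) = 0" if "j \<le> i" for j
    using galerkin_orth_p[of j k] that assms residual_inner[of "galerkin W b n k" "p j"]
      cscalar_prod_sum[of "vec n (p j)" n ?r] by simp
  have ui: "u i s = p i s + (\<Sum>j<i. h (u i) (p j) / h (p j) (p j) * p j s)" for s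
    using fun_cong[OF conj_dir.simps[of h u i], of s] by simp
  have "?r \<bullet>c vec n (u i) = (\<Sum>s<n. ?r $ s * cnj (u i s))"
    using cscalar_prod_sum[of "vec n (u i)" n ?r] by simp
  also have "\<dots> = (\<Sum>s<n. ?r $ s * cnj (p i s))
      + (\<Sum>s<n. \<Sum>j<i. cnj (h (u i) (p j) / h (p j) (p j)) * (?r $ s * cnj (p j s)))"
    by (subst ui) (simp add: distrib_left sum.distrib sum_distrib_left mult_ac)
  also have "(\<Sum>s<n. \<Sum>j<i. cnj (h (u i) (p j) / h (p j) (p j)) * (?r $ s * cnj (p j s)))
     = (\<Sum>j<i. cnj (h (u i) (p j) / h (p j) (p j)) * (\<Sum>s<n. ?r $ s * cnj (p j s)))"
    by (subst sum.swap) (simp add: sum_distrib_left)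
  also have "(\<Sum>s<n. ?r $ s * cnj (p i s)) + \<dots> = 0" using po by simp
  finally show ?thesis .
qed

lemma galerkin_orth:
  assumes "z \<in> krylov \<beta> W b k"
  shows "(b - W *\<^sub>v vec n (galerkin W b n k)) \<bullet>c z = 0"
proof -
  let ?r = "b - W *\<^sub>v vec n (galerkin W b n k)"
  obtain c where z: "z = kry_comb W b k c" using assms by (auto simp: krylov_def)
  have "?r \<bullet>c z = (\<Sum>s<n. ?r $ s * cnj (\<Sum>j<k. c j * u j s))"
    using b unfolding z by (subst cscalar_prod_sum[of _ n]) (auto simp: kry_basis_def)
  also have "\<dots> = (\<Sum>s<n. \<Sum>j<k. cnj (c j) * (?r $ s * cnj (u j s)))"
    by (simp add: sum_distrib_left mult_ac)
  also have "\<dots> = (\<Sum>j<k. cnj (c j) * (\<Sum>s<n. ?r $ s * cnj (u j s)))"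
    by (subst sum.swap) (simp add: sum_distrib_left)
  also have "\<dots> = (\<Sum>j<k. cnj (c j) * (?r \<bullet>c vec n (u j)))"
    using cscalar_prod_sum[of "vec n (u j)" n ?r for j] by simp
  also have "\<dots> = 0" using galerkin_orth_u by (intro sum.neutral) auto
  finally show ?thesis .
qed

end

text \<open>The exceptional set is described by the determinant, which is a polynomial in the
  entries, instead of by definiteness; for Gram matrices the two descriptions agree.\<close>

definition cg_formula :: "int \<Rightarrow> nat \<Rightarrow> nat \<Rightarrow> complex mat \<Rightarrow> complex vec \<Rightarrow> real" where
  "cg_formula l k n W b = (if det W = 0 then 0 else energy_norm
      (if 0 \<le> l then W ^\<^sub>m nat l else inv_mat W ^\<^sub>m nat (- l)) (inv_mat W *\<^sub>v b - vec n (galerkin W b n k)))"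

lemma cg_error_norm_formula:
  assumes W: "W \<in> carrier_mat n n" and b: "b \<in> carrier_vec n"
    and W_scalars: "\<And>i j. i < n \<Longrightarrow> j < n \<Longrightarrow> W $$ (i, j) \<in> scalars \<beta>"
    and b_scalars: "\<And>i. i < n \<Longrightarrow> b $ i \<in> scalars \<beta>"
    and pd: "det W \<noteq> 0 \<Longrightarrow> pos_def W"
  shows "cg_error_norm \<beta> l W b k = cg_formula l k n W b"
proof (cases "det W = 0")
  case True
  then have "\<not> pos_def W" using pos_def_det[OF W] by blast
  then show ?thesis using True by (simp add: cg_error_norm_def cg_formula_def)
next
  case False
  then interpret pd_mat W b n \<beta> using assms by unfold_locales auto
  have "cg_error \<beta> W b k = inv_mat W *\<^sub>v b - vec n (galerkin W b n k)"
    using cg_error_eqI[OF W(1) pd[OF False] b galerkin_krylov galerkin_orth, of k] inv_mat_vec[OF W(1) False b]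
       inv_mat(1)[OF W(1) False]
    by (metis (no_types, lifting) cg_error_def cg_iterate_eqI galerkin_krylov galerkin_orth cg_solution_def
        the_mat_inverse False assms(1) pd b)
  then show ?thesis using False pd by (simp add: cg_error_norm_def cg_formula_def mat_powi_def the_mat_inverse[OF W(1) False])
qed

section \<open>Unitary invariance of the error norm\<close>

definition unitary_mat :: "nat \<Rightarrow> complex mat \<Rightarrow> bool" where
  "unitary_mat n U \<longleftrightarrow> U \<in> carrier_mat n n \<and> adjoint_mat U * U = 1\<^sub>m n \<and> U * adjoint_mat U = 1\<^sub>m n"

lemma unitary_matI: "U \<in> carrier_mat n n \<Longrightarrow> adjoint_mat U * U = 1\<^sub>m n \<Longrightarrow> unitary_mat n U"
  using mat_mult_left_right_inverse[of "adjoint_mat U" n U] by (auto simp: unitary_mat_def)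

locale unitary_conj =
  fixes n :: nat and U W :: "complex mat"
  assumes U: "unitary_mat n U" and W: "W \<in> carrier_mat n n"
begin

lemma Uc: "U \<in> carrier_mat n n" "adjoint_mat U \<in> carrier_mat n n"
  and UU: "adjoint_mat U * U = 1\<^sub>m n" "U * adjoint_mat U = 1\<^sub>m n"
  using U by (auto simp: unitary_mat_def)

definition cj :: "complex mat \<Rightarrow> complex mat" where "cj A = U * A * adjoint_mat U"

lemma cj_carrier: "A \<in> carrier_mat n n \<Longrightarrow> cj A \<in> carrier_mat n n"
  using Uc unfolding cj_def by (intro mult_carrier_mat[of _ n n])

lemmas carr = mult_carrier_mat[of _ n n _ n]

lemma U_adj_vec: "v \<in> carrier_vec n \<Longrightarrow> adjoint_mat U *\<^sub>v (U *\<^sub>v v) = v" "v \<in> carrier_vec n \<Longrightarrow> U *\<^sub>v (adjoint_mat U *\<^sub>v v) = v"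
  using Uc UU by (auto simp: assoc_mult_mat_vec[of _ n n _ n, symmetric])

lemma cj_vec: "A \<in> carrier_mat n n \<Longrightarrow> v \<in> carrier_vec n \<Longrightarrow> cj A *\<^sub>v (U *\<^sub>v v) = U *\<^sub>v (A *\<^sub>v v)"
proof -
  assume a: "A \<in> carrier_mat n n" "v \<in> carrier_vec n"
  have "cj A *\<^sub>v (U *\<^sub>v v) = (U * A) *\<^sub>v (adjoint_mat U *\<^sub>v (U *\<^sub>v v))"
    unfolding cj_def using a Uc by (intro assoc_mult_mat_vec) auto
  also have "\<dots> = U *\<^sub>v (A *\<^sub>v v)" unfolding U_adj_vec(1)[OF a(2)] using a Uc by (intro assoc_mult_mat_vec) auto
  finally show ?thesis .
qed

lemma cj_mult: "A \<in> carrier_mat n n \<Longrightarrow> B \<in> carrier_mat n n \<Longrightarrow> cj A * cj B = cj (A * B)"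
proof -
  assume a: "A \<in> carrier_mat n n" "B \<in> carrier_mat n n"
  have "cj A * cj B = (U * A) * (adjoint_mat U * (U * (B * adjoint_mat U)))"
    unfolding cj_def using a Uc by (simp add: assoc_mult_mat[of _ n n _ n _ n] carr)
  also have "adjoint_mat U * (U * (B * adjoint_mat U)) = B * adjoint_mat U"
    using a Uc UU by (simp add: assoc_mult_mat[of _ n n _ n _ n, symmetric])
  also have "(U * A) * (B * adjoint_mat U) = cj (A * B)"
    unfolding cj_def using a Uc by (simp add: assoc_mult_mat[of _ n n _ n _ n] carr)
  finally show ?thesis .
qed

lemma cj_one: "cj (1\<^sub>m n) = 1\<^sub>m n" using Uc UU by (simp add: cj_def)

lemma cj_pow: "A \<in> carrier_mat n n \<Longrightarrow> cj A ^\<^sub>m k = cj (A ^\<^sub>m k)"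
proof (induction k)
  case 0
  then show ?case using cj_one Uc by (simp add: cj_def)
next
  case (Suc k)
  then show ?case using cj_mult[of "A ^\<^sub>m k" A] by simp
qed

lemma cj_adjoint: "A \<in> carrier_mat n n \<Longrightarrow> adjoint_mat (cj A) = cj (adjoint_mat A)"
  unfolding cj_def using Uc
  by (simp add: carr adjoint_mat_mult[of _ n n _ n] assoc_mult_mat[of _ n n _ n _ n] carr)

lemma U_inner: "x \<in> carrier_vec n \<Longrightarrow> y \<in> carrier_vec n \<Longrightarrow> (U *\<^sub>v x) \<bullet>c (U *\<^sub>v y) = x \<bullet>c y"
  using cscalar_adjoint[of U n n x "U *\<^sub>v y"] Uc U_adj_vec(1)[of y] by simp

lemma cj_energy:
  "A \<in> carrier_mat n n \<Longrightarrow> v \<in> carrier_vec n \<Longrightarrow> energy_norm (cj A) (U *\<^sub>v v) = energy_norm A v"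
  using U_inner[of "A *\<^sub>v v" v] by (simp add: energy_norm_def cj_vec)

lemma U_zero: "v \<in> carrier_vec n \<Longrightarrow> adjoint_mat U *\<^sub>v v = 0\<^sub>v n \<Longrightarrow> v = 0\<^sub>v n"
  using U_adj_vec(2)[of v] Uc by (auto simp: scalar_prod_def)

lemma cj_pos_def: "pos_def W \<Longrightarrow> pos_def (cj W)"
  unfolding pos_def_def
proof (intro conjI ballI impI)
  assume pd: "adjoint_mat W = W \<and> (\<forall>v\<in>carrier_vec (dim_row W). v \<noteq> 0\<^sub>v (dim_row W) \<longrightarrow> 0 < Re ((W *\<^sub>v v) \<bullet>c v))"
  then show "adjoint_mat (cj W) = cj W" using cj_adjoint[OF W] by simp
  fix v :: "complex vec"
  assume v: "v \<in> carrier_vec (dim_row (cj W))" "v \<noteq> 0\<^sub>v (dim_row (cj W))"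
  have vc: "v \<in> carrier_vec n" "v \<noteq> 0\<^sub>v n" using v cj_carrier[OF W] by auto
  define x where "x = adjoint_mat U *\<^sub>v v"
  have x: "x \<in> carrier_vec n" "U *\<^sub>v x = v" "x \<noteq> 0\<^sub>v n"
    using vc U_adj_vec(2)[OF vc(1)] U_zero[OF vc(1)] mult_mat_vec_carrier[OF Uc(2) vc(1)] by (auto simp: x_def)
  have "(cj W *\<^sub>v v) \<bullet>c v = (W *\<^sub>v x) \<bullet>c x"
    using U_inner[of "W *\<^sub>v x" x] cj_vec[OF W x(1)] x W by simp
  then show "0 < Re ((cj W *\<^sub>v v) \<bullet>c v)" using pd x W by auto
qed

end

lemma unitary_adjoint: "unitary_mat n U \<Longrightarrow> unitary_mat n (adjoint_mat U)"
  by (auto simp: unitary_mat_def)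

text \<open>Conjugation maps Krylov spaces onto Krylov spaces and preserves the orthogonality
  relations that characterize the error, so the error vector is multiplied by \<open>U\<close>.
  Applied to the adjoint of \<open>U\<close>, the same argument shows that definiteness cannot arise
  from conjugation.\<close>

lemma cg_error_norm_unitary:
  assumes U: "unitary_mat n U" and W: "W \<in> carrier_mat n n" and b: "b \<in> carrier_vec n"
    and W_scalars: "\<And>i j. i < n \<Longrightarrow> j < n \<Longrightarrow> W $$ (i, j) \<in> scalars \<beta>"
    and b_scalars: "\<And>i. i < n \<Longrightarrow> b $ i \<in> scalars \<beta>"
  shows "cg_error_norm \<beta> l (U * W * adjoint_mat U) (U *\<^sub>v b) k = cg_error_norm \<beta> l W b k"
proof -
  interpret unitary_conj n U W using U W by unfold_locales
  have cjW: "cj W \<in> carrier_mat n n" by (rule cj_carrier[OF W])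
  show ?thesis
  proof (cases "pos_def W")
    case False
    have "\<not> pos_def (cj W)"
    proof
      assume pd: "pos_def (cj W)"
      interpret V: unitary_conj n "adjoint_mat U" "cj W"
        using unitary_adjoint[OF U] cjW by unfold_locales
      have "V.cj (cj W) = adjoint_mat U * (U * (W * (adjoint_mat U * U)))"
        unfolding V.cj_def cj_def using Uc W by (simp add: assoc_mult_mat[of _ n n _ n _ n] carr)
      also have "\<dots> = adjoint_mat U * (U * W)" using Uc W UU by simp
      also have "\<dots> = W" using Uc UU W by (simp add: assoc_mult_mat[of _ n n _ n _ n, symmetric])
      finally show False using V.cj_pos_def[OF pd] False by simp
    qed
    then show ?thesis using False by (simp add: cg_error_norm_def cj_def)
  next
    case pd: True
    interpret P: pd_mat W b n \<beta> using assms pd by unfold_locales auto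
    note galerkin_krylov = P.galerkin_krylov and galerkin_orth = P.galerkin_orth
    note dW = pos_def_det[OF W pd]
    have pd': "pos_def (cj W)" by (rule cj_pos_def[OF pd])
    note dW' = pos_def_det[OF cjW pd']
    let ?y = "vec n (galerkin W b n k)"
    define e where "e = inv_mat W *\<^sub>v b - ?y"
    have e: "e \<in> carrier_vec n" "W *\<^sub>v e = b - W *\<^sub>v ?y"
      using inv_mat_vec[OF W dW b] W by (simp_all add: e_def mult_minus_distrib_mat_vec)
    have err: "cg_error \<beta> W b k = e"
      by (rule cg_error_eqI[OF W pd b galerkin_krylov galerkin_orth e])
    have Ub: "U *\<^sub>v b \<in> carrier_vec n" using Uc b by auto
    have pw: "cj W ^\<^sub>m j *\<^sub>v (U *\<^sub>v b) = U *\<^sub>v (W ^\<^sub>m j *\<^sub>v b)" for j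
      using cj_pow[OF W] cj_vec[OF _ b] W by simp
    have comb: "kry_comb (cj W) (U *\<^sub>v b) k c = U *\<^sub>v kry_comb W b k c" for c
    proof (rule eq_vecI)
      fix i assume "i < dim_vec (U *\<^sub>v kry_comb W b k c)"
      then have i: "i < n" using Uc by simp
      have "kry_comb (cj W) (U *\<^sub>v b) k c $ i = (\<Sum>j<k. c j * (\<Sum>t<n. U $$ (i, t) * (W ^\<^sub>m j *\<^sub>v b) $ t))"
        using i Uc b pw mat_vec_index[OF Uc(1) pow_mat_vec_carrier[OF W b] i] by simp
      also have "\<dots> = (\<Sum>t<n. U $$ (i, t) * (\<Sum>j<k. c j * (W ^\<^sub>m j *\<^sub>v b) $ t))"
        by (simp add: sum_distrib_left mult_ac sum.swap[of _ "{..<k}"])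
      also have "\<dots> = (U *\<^sub>v kry_comb W b k c) $ i"
        using b by (subst mat_vec_index[OF Uc(1) _ i]) auto
      finally show "kry_comb (cj W) (U *\<^sub>v b) k c $ i = (U *\<^sub>v kry_comb W b k c) $ i" .
    qed (use Uc in auto)
    have kry: "krylov \<beta> (cj W) (U *\<^sub>v b) k = (\<lambda>z. U *\<^sub>v z) ` krylov \<beta> W b k"
      unfolding krylov_def comb by auto
    have resid: "U *\<^sub>v b - cj W *\<^sub>v (U *\<^sub>v z) = U *\<^sub>v (b - W *\<^sub>v z)" if "z \<in> carrier_vec n" for z
      using that W b Uc cj_vec[OF W that] by (simp add: mult_minus_distrib_mat_vec)
    have err': "cg_error \<beta> (cj W) (U *\<^sub>v b) k = U *\<^sub>v e"
    proof (rule cg_error_eqI[OF cjW pd' Ub, of "U *\<^sub>v ?y"])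
      show "U *\<^sub>v ?y \<in> krylov \<beta> (cj W) (U *\<^sub>v b) k" unfolding kry using galerkin_krylov by blast
      fix z assume "z \<in> krylov \<beta> (cj W) (U *\<^sub>v b) k"
      then obtain z' where z': "z = U *\<^sub>v z'" "z' \<in> krylov \<beta> W b k" unfolding kry by blast
      then have "(U *\<^sub>v b - cj W *\<^sub>v (U *\<^sub>v ?y)) \<bullet>c z = (b - W *\<^sub>v ?y) \<bullet>c z'"
        using resid[of ?y] U_inner[of "b - W *\<^sub>v ?y" z'] krylov_carrier[OF b z'(2)] W b by simp
      then show "(U *\<^sub>v b - cj W *\<^sub>v (U *\<^sub>v ?y)) \<bullet>c z = 0" using galerkin_orth[OF z'(2)] by simp
    next
      show "U *\<^sub>v e \<in> carrier_vec n" using Uc e by auto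
      show "cj W *\<^sub>v (U *\<^sub>v e) = U *\<^sub>v b - cj W *\<^sub>v (U *\<^sub>v ?y)"
        using resid[of ?y] cj_vec[OF W e(1)] e by simp
    qed
    have inv: "inv_mat (cj W) = cj (inv_mat W)"
    proof -
      note i = inv_mat[OF W dW]
      have "mat_inverse (cj W) = Some (cj (inv_mat W))"
        using cj_mult[OF W i(1)] cj_mult[OF i(1) W] i cj_one cj_carrier[OF i(1)]
        by (intro mat_inverse_unique[OF cjW]) auto
      then show ?thesis using the_mat_inverse[OF cjW dW'] by simp
    qed
    have powi: "mat_powi (cj W) l = cj (mat_powi W l)"
      using inv_mat(1)[OF W dW] W unfolding mat_powi_def the_mat_inverse[OF W dW] the_mat_inverse[OF cjW dW'] inv
      by (simp add: cj_pow)
    have "energy_norm (mat_powi (cj W) l) (U *\<^sub>v e) = energy_norm (mat_powi W l) e"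
      unfolding powi by (rule cj_energy[OF mat_powi_carrier[OF W dW] e(1)])
    then show ?thesis using pd pd' err err' by (simp add: cg_error_norm_def cj_def)
  qed
qed

section \<open>Measurability in terms of the entries\<close>

definition meas_mat :: "'a measure \<Rightarrow> ('a \<Rightarrow> complex mat) \<Rightarrow> nat \<Rightarrow> nat \<Rightarrow> bool" where
  "meas_mat M A n m \<longleftrightarrow> (\<forall>w\<in>space M. A w \<in> carrier_mat n m) \<and>
     (\<forall>i<n. \<forall>j<m. (\<lambda>w. A w $$ (i, j)) \<in> borel_measurable M)"

definition meas_vec :: "'a measure \<Rightarrow> ('a \<Rightarrow> complex vec) \<Rightarrow> nat \<Rightarrow> bool" where
  "meas_vec M v n \<longleftrightarrow> (\<forall>w\<in>space M. v w \<in> carrier_vec n) \<and> (\<forall>i<n. (\<lambda>w. v w $ i) \<in> borel_measurable M)"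

lemma meas_matD: "meas_mat M A n m \<Longrightarrow> w \<in> space M \<Longrightarrow> A w \<in> carrier_mat n m"
  "meas_mat M A n m \<Longrightarrow> i < n \<Longrightarrow> j < m \<Longrightarrow> (\<lambda>w. A w $$ (i, j)) \<in> borel_measurable M"
  by (auto simp: meas_mat_def)

lemma meas_vecD: "meas_vec M v n \<Longrightarrow> w \<in> space M \<Longrightarrow> v w \<in> carrier_vec n"
  "meas_vec M v n \<Longrightarrow> i < n \<Longrightarrow> (\<lambda>w. v w $ i) \<in> borel_measurable M"
  by (auto simp: meas_vec_def)

lemma meas_mat_mult:
  assumes A: "meas_mat M A n m" and B: "meas_mat M B m k"
  shows "meas_mat M (\<lambda>w. A w * B w) n k"
proof -
  have "(\<lambda>w. (A w * B w) $$ (i, j)) \<in> borel_measurable M" if "i < n" "j < k" for i j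
  proof (subst measurable_cong)
    show "\<And>w. w \<in> space M \<Longrightarrow> (A w * B w) $$ (i, j) = (\<Sum>t<m. A w $$ (i, t) * B w $$ (t, j))"
      using mat_mult_index[OF meas_matD(1)[OF A] meas_matD(1)[OF B] that] by blast
    show "(\<lambda>w. \<Sum>t<m. A w $$ (i, t) * B w $$ (t, j)) \<in> borel_measurable M"
      using that by (intro borel_measurable_sum borel_measurable_times meas_matD(2)[OF A] meas_matD(2)[OF B]) auto
  qed
  then show ?thesis using mult_carrier_mat[OF meas_matD(1)[OF A] meas_matD(1)[OF B]] by (auto simp: meas_mat_def)
qed

lemma meas_mat_vec:
  assumes A: "meas_mat M A n m" and B: "meas_vec M v m"
  shows "meas_vec M (\<lambda>w. A w *\<^sub>v v w) n"
proof -
  have "(\<lambda>w. (A w *\<^sub>v v w) $ i) \<in> borel_measurable M" if "i < n" for i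
  proof (subst measurable_cong)
    show "\<And>w. w \<in> space M \<Longrightarrow> (A w *\<^sub>v v w) $ i = (\<Sum>t<m. A w $$ (i, t) * v w $ t)"
      using mat_vec_index[OF meas_matD(1)[OF A] meas_vecD(1)[OF B] that] by blast
    show "(\<lambda>w. \<Sum>t<m. A w $$ (i, t) * v w $ t) \<in> borel_measurable M"
      using that by (intro borel_measurable_sum borel_measurable_times meas_matD(2)[OF A] meas_vecD(2)[OF B]) auto
  qed
  then show ?thesis using meas_matD(1)[OF A] meas_vecD(1)[OF B]
    by (auto simp: meas_vec_def intro!: mult_mat_vec_carrier)
qed

lemma meas_mat_pow: "meas_mat M A n n \<Longrightarrow> meas_mat M (\<lambda>w. A w ^\<^sub>m k) n n"
proof (induction k)
  case 0
  have "(\<lambda>w. (1\<^sub>m (dim_row (A w)) :: complex mat) $$ (i, j)) \<in> borel_measurable M" if "i < n" "j < n" for i j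
  proof (subst measurable_cong)
    show "(1\<^sub>m (dim_row (A w)) :: complex mat) $$ (i, j) = (if i = j then 1 else 0)" if "w \<in> space M" for w
      using carrier_matD[OF meas_matD(1)[OF 0 that]] \<open>i < n\<close> \<open>j < n\<close> by simp
  qed simp
  then show ?case using carrier_matD[OF meas_matD(1)[OF 0]] by (auto simp: meas_mat_def intro!: carrier_matI)
qed (use meas_mat_mult in auto)

lemma meas_det:
  assumes A: "meas_mat M A n n"
  shows "(\<lambda>w. det (A w)) \<in> borel_measurable M"
proof (subst measurable_cong)
  show "\<And>w. w \<in> space M \<Longrightarrow> det (A w) = (\<Sum>p\<in>{p. p permutes {0..<n}}. signof p * (\<Prod>i = 0..<n. A w $$ (i, p i)))"
    using det_def'[OF meas_matD(1)[OF A]] by blast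
  show "(\<lambda>w. \<Sum>p\<in>{p. p permutes {0..<n}}. signof p * (\<Prod>i = 0..<n. A w $$ (i, p i))) \<in> borel_measurable M"
    using permutes_in_image
    by (intro borel_measurable_sum borel_measurable_times borel_measurable_prod meas_matD(2)[OF A] borel_measurable_const)
      (fastforce simp: permutes_in_image)+
qed

lemma meas_inv_mat:
  assumes A: "meas_mat M A n n"
  shows "meas_mat M (\<lambda>w. inv_mat (A w)) n n"
proof -
  have del: "meas_mat M (\<lambda>w. mat_delete (A w) j i) (n - 1) (n - 1)" if "i < n" "j < n" for i j
  proof -
    have "(\<lambda>w. mat_delete (A w) j i $$ (s, t)) \<in> borel_measurable M" if "s < n - 1" "t < n - 1" for s t
    proof (subst measurable_cong)
      show "\<And>w. w \<in> space M \<Longrightarrow> mat_delete (A w) j i $$ (s, t) = A w $$ (if s < j then s else Suc s, if t < i then t else Suc t)"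
        using meas_matD(1)[OF A] that by (fastforce simp: mat_delete_def)
      show "(\<lambda>w. A w $$ (if s < j then s else Suc s, if t < i then t else Suc t)) \<in> borel_measurable M"
        using that by (intro meas_matD(2)[OF A]) auto
    qed
    then show ?thesis using carrier_matD[OF meas_matD(1)[OF A]] by (auto simp: meas_mat_def intro!: carrier_matI)
  qed
  have "(\<lambda>w. inv_mat (A w) $$ (i, j)) \<in> borel_measurable M" if ij: "i < n" "j < n" for i j
  proof (subst measurable_cong)
    show "\<And>w. w \<in> space M \<Longrightarrow> inv_mat (A w) $$ (i, j) = 1 / det (A w) * ((-1) ^ (j + i) * det (mat_delete (A w) j i))"
    proof -
      fix w assume "w \<in> space M"
      note d = carrier_matD[OF meas_matD(1)[OF A this]]
      show "inv_mat (A w) $$ (i, j) = 1 / det (A w) * ((-1) ^ (j + i) * det (mat_delete (A w) j i))"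
        using d ij by (simp add: inv_mat_def adj_mat_def cofactor_def)
    qed
    show "(\<lambda>w. 1 / det (A w) * ((-1) ^ (j + i) * det (mat_delete (A w) j i))) \<in> borel_measurable M"
      using meas_det[OF del[OF ij]] meas_det[OF A] by measurable
  qed
  moreover have "inv_mat (A w) \<in> carrier_mat n n" if "w \<in> space M" for w
    using adj_mat(1)[OF meas_matD(1)[OF A that]] by (simp add: inv_mat_def)
  ultimately show ?thesis by (simp add: meas_mat_def)
qed

lemma meas_herm_form:
  assumes "meas_mat M W n n" "\<And>t. t < n \<Longrightarrow> (\<lambda>w. x w t) \<in> borel_measurable M" "\<And>t. t < n \<Longrightarrow> (\<lambda>w. y w t) \<in> borel_measurable M"
  shows "(\<lambda>w. herm_form (W w) n (x w) (y w)) \<in> borel_measurable M"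
proof -
  have "(\<lambda>w. cnj (y w t)) \<in> borel_measurable M" if "t < n" for t
    using measurable_compose[OF assms(3)[OF that] borel_measurable_continuous_onI[of cnj]]
    by (simp add: continuous_on_cnj)
  then show ?thesis unfolding herm_form_def
    by (intro borel_measurable_sum borel_measurable_times meas_matD(2)[OF assms(1)] assms) auto
qed

lemma meas_kry_basis:
  assumes "meas_mat M W n n" "meas_vec M b n" "t < n"
  shows "(\<lambda>w. kry_basis (W w) (b w) i t) \<in> borel_measurable M"
  unfolding kry_basis_def using meas_vecD(2)[OF meas_mat_vec[OF meas_mat_pow[OF assms(1)] assms(2)] assms(3)] .

lemma meas_cg_dir:
  assumes "meas_mat M W n n" "meas_vec M b n" "t < n"
  shows "(\<lambda>w. cg_dir (W w) (b w) n i t) \<in> borel_measurable M"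
  using assms(3)
proof (induction i arbitrary: t rule: less_induct)
  case (less i)
  note [measurable] = less.IH meas_kry_basis[OF assms(1,2)] less.prems
  show ?case
    by (subst conj_dir.simps)
      (intro borel_measurable_diff borel_measurable_sum borel_measurable_times borel_measurable_divide
        meas_herm_form[OF assms(1)] meas_kry_basis[OF assms(1,2)] less; simp add: less.IH less.prems)
qed

lemma meas_galerkin:
  assumes "meas_mat M W n n" "meas_vec M b n" "t < n"
  shows "(\<lambda>w. galerkin (W w) (b w) n k t) \<in> borel_measurable M"
proof -
  have "(\<lambda>w. cnj (cg_dir (W w) (b w) n i t)) \<in> borel_measurable M" if "t < n" for t i
    using measurable_compose[OF meas_cg_dir[OF assms(1,2) that] borel_measurable_continuous_onI[of cnj]]
    by (simp add: continuous_on_cnj)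
  then show ?thesis unfolding galerkin_def using assms(3)
    by (intro borel_measurable_sum borel_measurable_times borel_measurable_divide meas_herm_form[OF assms(1)]
      meas_cg_dir[OF assms(1,2)] meas_vecD(2)[OF assms(2)]) auto
qed

lemma meas_energy_norm:
  assumes A: "meas_mat M A n n" and v: "meas_vec M v n"
  shows "(\<lambda>w. energy_norm (A w) (v w)) \<in> borel_measurable M"
proof -
  have "(\<lambda>w. (A w *\<^sub>v v w) \<bullet>c v w) \<in> borel_measurable M"
  proof (subst measurable_cong)
    show "\<And>w. w \<in> space M \<Longrightarrow> (A w *\<^sub>v v w) \<bullet>c v w = (\<Sum>i<n. (A w *\<^sub>v v w) $ i * cnj (v w $ i))"
      using cscalar_prod_sum[OF meas_vecD(1)[OF v]] by blast
    have "(\<lambda>w. cnj (v w $ t)) \<in> borel_measurable M" if "t < n" for t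
      using measurable_compose[OF meas_vecD(2)[OF v that] borel_measurable_continuous_onI[of cnj]]
      by (simp add: continuous_on_cnj)
    then show "(\<lambda>w. \<Sum>i<n. (A w *\<^sub>v v w) $ i * cnj (v w $ i)) \<in> borel_measurable M"
      using meas_vecD(2)[OF meas_mat_vec[OF A v]] by (intro borel_measurable_sum borel_measurable_times) auto
  qed
  then show ?thesis unfolding energy_norm_def by measurable
qed

lemma meas_cg_formula:
  assumes W: "meas_mat M W n n" and b: "meas_vec M b n"
  shows "(\<lambda>w. cg_formula l k n (W w) (b w)) \<in> borel_measurable M"
proof -
  have e: "meas_vec M (\<lambda>w. inv_mat (W w) *\<^sub>v b w - vec n (galerkin (W w) (b w) n k)) n"
    using meas_mat_vec[OF meas_inv_mat[OF W] b] meas_galerkin[OF W b]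
    by (auto simp: meas_vec_def intro!: borel_measurable_diff simp del: index_mult_mat_vec)
  have p: "meas_mat M (\<lambda>w. if 0 \<le> l then W w ^\<^sub>m nat l else inv_mat (W w) ^\<^sub>m nat (- l)) n n"
    using meas_mat_pow[OF W, of "nat l"] meas_mat_pow[OF meas_inv_mat[OF W], of "nat (-l)"] by (cases "0 \<le> l") auto
  note [measurable] = meas_energy_norm[OF p e] meas_det[OF W]
  show ?thesis unfolding cg_formula_def by measurable
qed

section \<open>The Jacobi matrix with the first unit vector as right-hand side\<close>

definition jac_mat :: "(nat \<Rightarrow> real) \<Rightarrow> (nat \<Rightarrow> real) \<Rightarrow> nat \<Rightarrow> complex mat" where
  "jac_mat a s n = mat n n (\<lambda>(i, j). complex_of_real (
     if i = j then a i + (if i = 0 then 0 else s (i - 1))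
     else if j = Suc i then sqrt (a i * s i) else if i = Suc j then sqrt (a j * s j) else 0))"

abbreviation cvec :: "nat \<Rightarrow> (nat \<Rightarrow> real) \<Rightarrow> complex vec" where
  "cvec n x \<equiv> vec n (\<lambda>i. complex_of_real (x i))"

context jacobi_data
begin

abbreviation "J \<equiv> jac_mat a s n"

lemma J_carrier: "J \<in> carrier_mat n n" by (simp add: jac_mat_def)

lemma J_vec: "J *\<^sub>v cvec n x = cvec n (T x)"
proof (rule eq_vecI)
  fix i assume "i < dim_vec (cvec n (T x))"
  then have i: "i < n" by simp
  have "(J *\<^sub>v cvec n x) $ i = (\<Sum>t<n. J $$ (i, t) * complex_of_real (x t))"
    by (subst mat_vec_index[OF J_carrier _ i]) auto
  also have "\<dots> = (\<Sum>t<n. complex_of_real ((if t = i then (a i + (if i = 0 then 0 else s (i - 1))) * x i else 0)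
      + (if t = Suc i then sqrt (a i * s i) * x (Suc i) else 0)
      + (if Suc t = i then sqrt (a (i - 1) * s (i - 1)) * x (i - 1) else 0)))"
    using i by (intro sum.cong refl) (auto simp: jac_mat_def)
  also have "\<dots> = complex_of_real ((\<Sum>t<n. if t = i then (a i + (if i = 0 then 0 else s (i - 1))) * x i else 0)
      + (\<Sum>t<n. if t = Suc i then sqrt (a i * s i) * x (Suc i) else 0)
      + (\<Sum>t<n. if Suc t = i then sqrt (a (i - 1) * s (i - 1)) * x (i - 1) else 0))"
    by (simp only: of_real_sum sum.distrib[symmetric])
  also have "(\<Sum>t<n. if Suc t = i then sqrt (a (i - 1) * s (i - 1)) * x (i - 1) else 0)
     = (if i = 0 then 0 else sqrt (a (i - 1) * s (i - 1)) * x (i - 1))"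
    using i by (cases i) auto
  finally show "(J *\<^sub>v cvec n x) $ i = cvec n (T x) $ i" using i by (simp add: jac_op_def)
qed (simp add: jac_mat_def)

lemma J_w: "J *\<^sub>v cvec n (w j) = cvec n (w (j + 1))"
  unfolding J_vec by (rule eq_vecI) (auto simp: T_w)

lemma J_adjoint: "adjoint_mat J = J"
  by (rule eq_matI) (auto simp: jac_mat_def)

text \<open>The transpose of the bidiagonal factor. The quadratic form of \<open>J\<close> is the
  sum of its squared moduli, so a null vector is excluded by back substitution from the last
  coordinate.\<close>

definition bid_op :: "(nat \<Rightarrow> complex) \<Rightarrow> nat \<Rightarrow> complex" where
  "bid_op x i = complex_of_real (sqrt (a i)) * x i
     + (if Suc i < n then complex_of_real (sqrt (s i)) * x (Suc i) else 0)"

lemma J_quadratic: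
  assumes "v \<in> carrier_vec n"
  shows "Re ((J *\<^sub>v v) \<bullet>c v) = (\<Sum>i<n. (cmod (bid_op (\<lambda>i. v $ i) i))\<^sup>2)"
proof -
  obtain m where m: "n = Suc m" using n by (cases n) auto
  define x where "x i = v $ i" for i
  define q where "q i = complex_of_real (sqrt (a i))" for i
  define r where "r i = complex_of_real (sqrt (s i))" for i
  have qq: "q i * q i = complex_of_real (a i)" "r i * r i = complex_of_real (s i)"
    "q i * r i = complex_of_real (sqrt (a i * s i))" if "i < n" for i
    using a[OF that] s[OF that] unfolding q_def r_def of_real_mult[symmetric]
    by (simp_all add: real_sqrt_mult)
  have J: "(J *\<^sub>v v) $ i = (complex_of_real (a i) + (if i = 0 then 0 else complex_of_real (s (i - 1)))) * x i
      + (if Suc i < n then q i * r i * x (Suc i) else 0)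
      + (if i = 0 then 0 else q (i - 1) * r (i - 1) * x (i - 1))" if i: "i < n" for i
  proof -
    have "(J *\<^sub>v v) $ i = (\<Sum>t<n. J $$ (i, t) * x t)"
      unfolding x_def by (rule mat_vec_index[OF J_carrier assms i])
    also have "\<dots> = (\<Sum>t<n. (if t = i then (complex_of_real (a i) + (if i = 0 then 0 else complex_of_real (s (i - 1)))) * x i else 0)
        + (if t = Suc i then q i * r i * x (Suc i) else 0)
        + (if Suc t = i then q (i - 1) * r (i - 1) * x (i - 1) else 0))"
      using i by (intro sum.cong refl) (auto simp: jac_mat_def qq)
    also have "\<dots> = (\<Sum>t<n. if t = i then (complex_of_real (a i) + (if i = 0 then 0 else complex_of_real (s (i - 1)))) * x i else 0)
        + (\<Sum>t<n. if t = Suc i then q i * r i * x (Suc i) else 0)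
        + (\<Sum>t<n. if Suc t = i then q (i - 1) * r (i - 1) * x (i - 1) else 0)"
      by (simp only: sum.distrib)
    also have "(\<Sum>t<n. if Suc t = i then q (i - 1) * r (i - 1) * x (i - 1) else 0)
       = (if i = 0 then 0 else q (i - 1) * r (i - 1) * x (i - 1))"
      using i by (cases i) auto
    finally show ?thesis using i by simp
  qed
  have bid: "complex_of_real ((cmod (bid_op x i))\<^sup>2) = complex_of_real (a i) * (x i * cnj (x i))
     + (if Suc i < n then complex_of_real (s i) * (x (Suc i) * cnj (x (Suc i))) + q i * r i * (x i * cnj (x (Suc i)) + x (Suc i) * cnj (x i)) else 0)"
    if "i < n" for i
    unfolding complex_norm_square bid_op_def q_def[symmetric] r_def[symmetric] qq(1,2)[OF that, symmetric]
    by (simp add: q_def r_def algebra_simps)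
  have "(J *\<^sub>v v) \<bullet>c v = (\<Sum>i<n. (J *\<^sub>v v) $ i * cnj (x i))"
    unfolding x_def by (rule cscalar_prod_sum[OF assms])
  also have "\<dots> = (\<Sum>i<n. complex_of_real (a i) * (x i * cnj (x i))) +
      (\<Sum>i<n. if i = 0 then 0 else complex_of_real (s (i - 1)) * (x i * cnj (x i)) + q (i - 1) * r (i - 1) * (x (i - 1) * cnj (x i)))
      + (\<Sum>i<n. if Suc i < n then q i * r i * (x (Suc i) * cnj (x i)) else 0)"
    unfolding sum.distrib[symmetric] by (intro sum.cong refl) (auto simp: J algebra_simps)
  also have "(\<Sum>i<n. if i = 0 then 0 else complex_of_real (s (i - 1)) * (x i * cnj (x i)) + q (i - 1) * r (i - 1) * (x (i - 1) * cnj (x i)))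
     = (\<Sum>i<n. if Suc i < n then complex_of_real (s i) * (x (Suc i) * cnj (x (Suc i))) + q i * r i * (x i * cnj (x (Suc i))) else 0)"
    unfolding m by (subst sum.lessThan_Suc_shift) simp
  also have "(\<Sum>i<n. complex_of_real (a i) * (x i * cnj (x i))) +
      (\<Sum>i<n. if Suc i < n then complex_of_real (s i) * (x (Suc i) * cnj (x (Suc i))) + q i * r i * (x i * cnj (x (Suc i))) else 0)
      + (\<Sum>i<n. if Suc i < n then q i * r i * (x (Suc i) * cnj (x i)) else 0)
      = (\<Sum>i<n. complex_of_real ((cmod (bid_op x i))\<^sup>2))"
    unfolding sum.distrib[symmetric]
  proof (intro sum.cong refl)
    fix i assume "i \<in> {..<n}"
    then have i: "i < n" by simp
    show "complex_of_real (a i) * (x i * cnj (x i)) +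
       (if Suc i < n then complex_of_real (s i) * (x (Suc i) * cnj (x (Suc i))) + q i * r i * (x i * cnj (x (Suc i))) else 0) +
       (if Suc i < n then q i * r i * (x (Suc i) * cnj (x i)) else 0) = complex_of_real ((cmod (bid_op x i))\<^sup>2)"
      unfolding bid[OF i] by (simp add: algebra_simps)
  qed
  finally have "(J *\<^sub>v v) \<bullet>c v = (\<Sum>i<n. complex_of_real ((cmod (bid_op x i))\<^sup>2))" .
  then have "(J *\<^sub>v v) \<bullet>c v = complex_of_real (\<Sum>i<n. (cmod (bid_op x i))\<^sup>2)" by simp
  then show ?thesis unfolding x_def by simp
qed

lemma J_pos_def: "pos_def J"
  unfolding pos_def_def
proof (intro conjI ballI impI J_adjoint)
  fix v :: "complex vec" assume "v \<in> carrier_vec (dim_row J)" and v0: "v \<noteq> 0\<^sub>v (dim_row J)"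
  then have v: "v \<in> carrier_vec n" "v \<noteq> 0\<^sub>v n" using J_carrier by auto
  have "(\<Sum>i<n. (cmod (bid_op (\<lambda>i. v $ i) i))\<^sup>2) \<noteq> 0"
  proof
    assume "(\<Sum>i<n. (cmod (bid_op (\<lambda>i. v $ i) i))\<^sup>2) = 0"
    then have z: "bid_op (\<lambda>i. v $ i) i = 0" if "i < n" for i
      using that by (subst (asm) sum_nonneg_eq_0_iff) auto
    have "v $ (n - Suc j) = 0" if "j < n" for j
      using that
    proof (induction j)
      case 0
      then show ?case using z[of "n - 1"] a[of "n - 1"] n by (simp add: bid_op_def)
    next
      case (Suc j)
      then have "v $ (Suc (n - Suc (Suc j))) = 0" by (simp add: Suc_diff_Suc)
      then show ?case using z[of "n - Suc (Suc j)"] a[of "n - Suc (Suc j)"] Suc.prems by (simp add: bid_op_def split: if_splits)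
    qed
    note vz = this
    have "v $ i = 0" if "i < n" for i using vz[of "n - Suc i"] that n by simp
    then show False using v by (auto simp: vec_eq_iff)
  qed
  moreover have "0 \<le> (\<Sum>i<n. (cmod (bid_op (\<lambda>i. v $ i) i))\<^sup>2)" by (intro sum_nonneg) auto
  ultimately show "0 < Re ((J *\<^sub>v v) \<bullet>c v)" unfolding J_quadratic[OF v(1)] by linarith
qed

lemma J_powi: "mat_powi J l *\<^sub>v cvec n (w j) = cvec n (w (j + l))"
  by (rule mat_powi_shift[OF J_carrier pos_def_det[OF J_carrier J_pos_def]]) (auto simp: J_w)

lemma unit_w: "unit_vec n 0 = cvec n (w 0)"
  by (rule eq_vecI) (auto simp: w_0)

lemma J_pow_unit: "J ^\<^sub>m j *\<^sub>v unit_vec n 0 = cvec n (w (int j))"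
  using J_powi[of "int j" 0] by (simp add: mat_powi_def unit_w)

text \<open>The vector \<open>T^m p_k(T)\<close> applied to the first unit vector, divided by
  \<open>p_k(0)\<close>. Order \<open>m = 0\<close> is the residual after \<open>k\<close> steps,
  order \<open>m = -1\<close> the error, and powers of \<open>J\<close> merely shift
  \<open>m\<close>.\<close>

definition resid :: "nat \<Rightarrow> int \<Rightarrow> nat \<Rightarrow> real" where
  "resid k m i = lin_ev (\<lambda>t. w (m + int t) i) (jac_poly a s k) / (\<Prod>i<k. a i)"

lemma a_prod_pos: "k \<le> n \<Longrightarrow> 0 < (\<Prod>i<k. a i)"
  by (intro prod_pos) (auto intro: a)

lemma J_resid: "J *\<^sub>v cvec n (resid k m) = cvec n (resid k (m + 1))"
proof -
  have "T (resid k m) i = resid k (m + 1) i" if "i < n" for i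
  proof -
    have "T (resid k m) i = T (\<lambda>i. lin_ev (\<lambda>t. w (m + int t) i) (jac_poly a s k)) i / (\<Prod>i<k. a i)"
      unfolding resid_def by (simp add: jac_op_def add_divide_distrib)
    also have "\<dots> = lin_ev (\<lambda>t. T (w (m + int t)) i) (jac_poly a s k) / (\<Prod>i<k. a i)" by (simp only: T_lin_ev)
    also have "\<dots> = resid k (m + 1) i" using that by (simp add: resid_def T_w algebra_simps)
    finally show ?thesis .
  qed
  then show ?thesis unfolding J_vec by (intro eq_vecI) auto
qed

lemma J_powi_resid: "mat_powi J l *\<^sub>v cvec n (resid k j) = cvec n (resid k (j + l))"
  by (rule mat_powi_shift[OF J_carrier pos_def_det[OF J_carrier J_pos_def]]) (auto simp: J_resid)

lemma galerkin_jacobi: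
  assumes "k \<le> n"
  shows "\<exists>y \<in> krylov \<beta> J (unit_vec n 0) k. J *\<^sub>v y = unit_vec n 0 - cvec n (resid k 0)
     \<and> (\<forall>z \<in> krylov \<beta> J (unit_vec n 0) k. (unit_vec n 0 - J *\<^sub>v y) \<bullet>c z = 0)"
proof -
  define p where "p = jac_poly a s k"
  have deg: "degree p \<le> k" unfolding p_def
  proof (induction a s k rule: jac_poly.induct)
    case (3 a s k)
    have "degree ([:a (Suc k) + s k, -1:] * jac_poly a s (Suc k)) \<le> 1 + Suc k"
      using degree_mult_le[of "[:a (Suc k) + s k, -1:]" "jac_poly a s (Suc k)"] 3(1) by simp
    moreover have "degree (Polynomial.smult (a k * s k) (jac_poly a s k)) \<le> k"
      using degree_smult_le 3(2) le_trans by blast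
    ultimately show ?case by (auto intro!: degree_diff_le)
  qed auto
  \<comment> \<open>The residual polynomial is \<open>p(x) / p(0)\<close>. Hence
    \<open>1 - p(x) / p(0)\<close> is divisible by \<open>x\<close>, and the coefficients of the
    quotient are those of the iterate in the Krylov basis.\<close>
  define cc where "cc j = complex_of_real (- coeff p (Suc j) / (\<Prod>i<k. a i))" for j
  define y where "y = kry_comb J (unit_vec n 0) k cc"
  have yk: "y \<in> krylov \<beta> J (unit_vec n 0) k"
    unfolding krylov_def y_def
    by (rule CollectI, rule exI[of _ cc], intro conjI refl allI impI) (unfold cc_def, rule scalars_closed(8))
  have y: "y = cvec n (\<lambda>i. - lin_ev (\<lambda>t. if t = 0 then 0 else w (int t - 1) i) p / (\<Prod>i<k. a i))"
  proof (rule eq_vecI)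
    fix i assume "i < dim_vec (cvec n (\<lambda>i. - lin_ev (\<lambda>t. if t = 0 then 0 else w (int t - 1) i) p / (\<Prod>i<k. a i)))"
    then have i: "i < n" by simp
    have "lin_ev (\<lambda>t. if t = 0 then 0 else w (int t - 1) i) p = (\<Sum>t\<le>k. coeff p t * (if t = 0 then 0 else w (int t - 1) i))"
      by (rule lin_ev_ge[OF deg])
    also have "\<dots> = (\<Sum>t<k. coeff p (Suc t) * w (int t) i)"
      by (cases k) (simp_all add: lessThan_Suc_atMost sum.atMost_Suc_shift del: sum.atMost_Suc)
    finally have "complex_of_real (- lin_ev (\<lambda>t. if t = 0 then 0 else w (int t - 1) i) p / (\<Prod>i<k. a i))
       = (\<Sum>t<k. cc t * complex_of_real (w (int t) i))"
      by (simp add: cc_def sum_divide_distrib sum_negf)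
    then show "y $ i = cvec n (\<lambda>i. - lin_ev (\<lambda>t. if t = 0 then 0 else w (int t - 1) i) p / (\<Prod>i<k. a i)) $ i"
      using i by (simp add: y_def J_pow_unit)
  qed (simp add: y_def)
  have p0: "coeff p 0 = (\<Prod>i<k. a i)" using jac_poly_0[of a s k] by (simp add: p_def poly_0_coeff_0)
  have "T (\<lambda>i. - lin_ev (\<lambda>t. if t = 0 then 0 else w (int t - 1) i) p / (\<Prod>i<k. a i)) i
     = (if i = 0 then 1 else 0) - resid k 0 i" if i: "i < n" for i
  proof -
    have "T (\<lambda>i. - lin_ev (\<lambda>t. if t = 0 then 0 else w (int t - 1) i) p / (\<Prod>i<k. a i)) i
      = - T (\<lambda>i. lin_ev (\<lambda>t. if t = 0 then 0 else w (int t - 1) i) p) i / (\<Prod>i<k. a i)"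
      by (simp add: jac_op_def add_divide_distrib diff_divide_distrib)
    also have "T (\<lambda>i. lin_ev (\<lambda>t. if t = 0 then 0 else w (int t - 1) i) p) i
       = lin_ev (\<lambda>t. T (\<lambda>i. if t = 0 then 0 else w (int t - 1) i) i) p" by (rule T_lin_ev)
    also have "\<dots> = lin_ev (\<lambda>t. w (int t) i + (if t = 0 then - w 0 i else 0)) p"
    proof -
      have "T (\<lambda>i. if t = 0 then 0 else w (int t - 1) i) i = w (int t) i + (if t = 0 then - w 0 i else 0)" for t
        using T_w[OF i, of "int t - 1"] by (cases t) (simp_all add: jac_op_def add.commute)
      then show ?thesis by simp
    qed
    also have "\<dots> = lin_ev (\<lambda>t. w (int t) i) p - (\<Prod>i<k. a i) * w 0 i"
      unfolding lin_ev_def p0[symmetric]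
      by (simp add: distrib_left sum.distrib if_distrib[of "\<lambda>x. _ * x"] cong: if_cong)
    finally have E: "T (\<lambda>i. - lin_ev (\<lambda>t. if t = 0 then 0 else w (int t - 1) i) p / (\<Prod>i<k. a i)) i
       = - (lin_ev (\<lambda>t. w (int t) i) p - (\<Prod>i<k. a i) * w 0 i) / (\<Prod>i<k. a i)" .
    define P where "P = (\<Prod>i<k. a i)"
    have "0 < P" using a_prod_pos[OF assms] by (simp add: P_def)
    then have "- (lin_ev (\<lambda>t. w (int t) i) p - P * w 0 i) / P = w 0 i - lin_ev (\<lambda>t. w (int t) i) p / P"
      by (simp add: field_simps)
    then show ?thesis unfolding E unfolding resid_def p_def[symmetric] P_def w_0[OF i] by simp
  qed
  then have Jy: "J *\<^sub>v y = unit_vec n 0 - cvec n (resid k 0)"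
    unfolding y J_vec by (intro eq_vecI) auto
  have r: "resid k 0 i = 0" if "i < n" "i \<noteq> k" for i
    using jac_poly_vec[OF assms that(1)] that by (simp add: resid_def)
  \<comment> \<open>The residual lives on coordinate \<open>k\<close> alone, the Krylov vectors on
    the coordinates below \<open>k\<close>.\<close>
  have "(unit_vec n 0 - J *\<^sub>v y) \<bullet>c z = 0" if z: "z \<in> krylov \<beta> J (unit_vec n 0) k" for z
  proof -
    obtain g where g: "z = kry_comb J (unit_vec n 0) k g" using z by (auto simp: krylov_def)
    have "(unit_vec n 0 - J *\<^sub>v y) = cvec n (resid k 0)" unfolding Jy by (intro eq_vecI) auto
    then have "(unit_vec n 0 - J *\<^sub>v y) \<bullet>c z = (\<Sum>i<n. complex_of_real (resid k 0 i) * cnj (z $ i))"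
      using g by (subst cscalar_prod_sum[of _ n]) auto
    also have "\<dots> = 0"
    proof (intro sum.neutral ballI)
      fix i assume "i \<in> {..<n}"
      then show "complex_of_real (resid k 0 i) * cnj (z $ i) = 0"
        using r[of i] by (cases "i = k") (auto simp: g J_pow_unit w_pos_support)
    qed
    finally show ?thesis .
  qed
  then show ?thesis using yk Jy by blast
qed

text \<open>The residual polynomial of degree \<open>n\<close> annihilates the starting vector, and
  the exact solution found after \<open>n\<close> steps belongs to all later Krylov spaces.\<close>

lemma cg_error_norm_jacobi_large:
  assumes "n \<le> k"
  shows "cg_error_norm \<beta> l J (unit_vec n 0) k = 0"
proof -
  obtain y where y: "y \<in> krylov \<beta> J (unit_vec n 0) n" "J *\<^sub>v y = unit_vec n 0 - cvec n (resid n 0)"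
    using galerkin_jacobi[of n \<beta>] by blast
  have r: "resid n 0 i = 0" if "i < n" for i
    using jac_poly_vec[of n i] that by (simp add: resid_def)
  have z: "unit_vec n 0 - J *\<^sub>v y = 0\<^sub>v n" unfolding y(2) using r by (intro eq_vecI) auto
  obtain g where g: "y = kry_comb J (unit_vec n 0) n g" "\<forall>j<n. g j \<in> scalars \<beta>"
    using y(1) by (auto simp: krylov_def)
  have "y = kry_comb J (unit_vec n 0) k (\<lambda>j. if j < n then g j else 0)"
    unfolding g(1)
  proof (rule eq_vecI)
    fix i assume "i < dim_vec (kry_comb J (unit_vec n 0) k (\<lambda>j. if j < n then g j else 0))"
    then show "kry_comb J (unit_vec n 0) n g $ i = kry_comb J (unit_vec n 0) k (\<lambda>j. if j < n then g j else 0) $ i"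
      using assms by (simp del: index_mult_mat_vec) (intro sum.mono_neutral_cong_left, auto)
  qed simp
  then have yk: "y \<in> krylov \<beta> J (unit_vec n 0) k"
    unfolding krylov_def using g(2) scalars_closed(1)
    by (intro CollectI exI[of _ "\<lambda>j. if j < n then g j else 0"]) auto
  have "cg_error \<beta> J (unit_vec n 0) k = 0\<^sub>v n"
    by (rule cg_error_eqI[OF J_carrier J_pos_def unit_vec_carrier yk])
      (use J_carrier krylov_carrier[OF unit_vec_carrier] in \<open>auto simp: z intro!: scalar_prod_left_zero\<close>)
  moreover have "energy_norm A (0\<^sub>v n) = 0" if "A \<in> carrier_mat n n" for A
    using that by (simp add: energy_norm_def)
  ultimately show ?thesis
    using mat_powi_carrier[OF J_carrier pos_def_det[OF J_carrier J_pos_def], of l]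
    by (simp add: cg_error_norm_def)
qed

text \<open>The error has order -1 in each argument of the inner product, whence the shift of
  \<open>l\<close> by 2. The denominator is \<open>p_k(0)\<close>.\<close>

lemma cg_error_norm_jacobi:
  assumes "k \<le> n"
  shows "cg_error_norm \<beta> l J (unit_vec n 0) k
    = sqrt (lin_ev (\<lambda>t. c (l - 2 + int t)) ((jac_poly a s k)\<^sup>2)) / (\<Prod>i<k. a i)"
proof -
  obtain y where y: "y \<in> krylov \<beta> J (unit_vec n 0) k" "J *\<^sub>v y = unit_vec n 0 - cvec n (resid k 0)"
     "\<And>z. z \<in> krylov \<beta> J (unit_vec n 0) k \<Longrightarrow> (unit_vec n 0 - J *\<^sub>v y) \<bullet>c z = 0"
    using galerkin_jacobi[OF assms] by blast
  have "cg_error \<beta> J (unit_vec n 0) k = cvec n (resid k (-1))"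
  proof (rule cg_error_eqI[OF J_carrier J_pos_def unit_vec_carrier y(1,3)])
    show "J *\<^sub>v cvec n (resid k (-1)) = unit_vec n 0 - J *\<^sub>v y"
      unfolding y(2) J_resid by (intro eq_vecI) auto
  qed auto
  then have "cg_error_norm \<beta> l J (unit_vec n 0) k = energy_norm (mat_powi J l) (cvec n (resid k (-1)))"
    by (simp add: cg_error_norm_def J_pos_def)
  also have "\<dots> = sqrt (\<Sum>i<n. resid k (l - 1) i * resid k (-1) i)"
    unfolding energy_norm_def J_powi_resid by (subst cscalar_prod_sum[of _ n]) (simp_all add: add.commute)
  also have "(\<Sum>i<n. resid k (l - 1) i * resid k (-1) i)
     = (\<Sum>i<n. lin_ev (\<lambda>t. w (l - 1 + int t) i) (jac_poly a s k) * lin_ev (\<lambda>t. w (- 1 + int t) i) (jac_poly a s k)) / (\<Prod>i<k. a i)\<^sup>2"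
    unfolding resid_def by (simp add: sum_divide_distrib power2_eq_square)
  also have "(\<Sum>i<n. lin_ev (\<lambda>t. w (l - 1 + int t) i) (jac_poly a s k) * lin_ev (\<lambda>t. w (- 1 + int t) i) (jac_poly a s k))
     = lin_ev (\<lambda>t. c (l - 2 + int t)) ((jac_poly a s k)\<^sup>2)"
  proof -
    let ?p = "jac_poly a s k"
    have "lin_ev (\<lambda>t. c (l - 2 + int t)) (?p\<^sup>2) = lin_ev (\<lambda>t. lin_ev (\<lambda>u. c (l - 2 + int (t + u))) ?p) ?p"
      by (simp only: power2_eq_square lin_ev_mult)
    also have "\<dots> = lin_ev (\<lambda>t. lin_ev (\<lambda>u. \<Sum>i<n. w (- 1 + int u) i * w (l - 1 + int t) i) ?p) ?p"
      by (simp add: w_inner algebra_simps)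
    also have "\<dots> = lin_ev (\<lambda>t. \<Sum>i<n. lin_ev (\<lambda>u. w (- 1 + int u) i) ?p * w (l - 1 + int t) i) ?p"
      by (simp only: lin_ev_sum)
    also have "\<dots> = lin_ev (\<lambda>t. \<Sum>i<n. w (l - 1 + int t) i * lin_ev (\<lambda>u. w (- 1 + int u) i) ?p) ?p"
      by (intro arg_cong2[of _ _ _ _ lin_ev] ext sum.cong refl mult.commute)
    also have "\<dots> = (\<Sum>i<n. lin_ev (\<lambda>t. w (l - 1 + int t) i) ?p * lin_ev (\<lambda>t. w (- 1 + int t) i) ?p)"
      by (rule lin_ev_sum)
    finally show ?thesis by simp
  qed
  finally show ?thesis using a_prod_pos[OF assms] by (simp add: real_sqrt_divide)
qed

end

subsection \<open>Invariance of Gaussian matrices and bidiagonal reduction\<close>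

abbreviation gauss :: "real measure" where
  "gauss \<equiv> density lborel (\<lambda>x. ennreal (std_normal_density x))"

lemma prob_space_gauss: "prob_space gauss"
  by (rule prob_space_normal_density) simp

lemma sets_gauss [measurable_cong]: "sets gauss = sets borel" by simp

lemma nn_integral_lborel_shift:
  assumes [measurable]: "f \<in> borel_measurable (borel :: real measure)"
  shows "(\<integral>\<^sup>+x. f (x + t) \<partial>lborel) = (\<integral>\<^sup>+x. f x \<partial>lborel)"
proof -
  have "(\<integral>\<^sup>+x. f x \<partial>lborel) = (\<integral>\<^sup>+x. f x \<partial>distr lborel borel ((+) t))" by (simp add: lborel_distr_plus)
  also have "\<dots> = (\<integral>\<^sup>+x. f (t + x) \<partial>lborel)" by (rule nn_integral_distr) auto
  finally show ?thesis by (simp add: add.commute)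
qed

lemma nn_integral_shear1:
  assumes [measurable]: "case_prod f \<in> borel_measurable (borel \<Otimes>\<^sub>M borel :: (real \<times> real) measure)"
  shows "(\<integral>\<^sup>+y. \<integral>\<^sup>+x. f (x + t * y) y \<partial>lborel \<partial>lborel) = (\<integral>\<^sup>+y. \<integral>\<^sup>+x. f x y \<partial>lborel \<partial>lborel)"
  by (intro nn_integral_cong nn_integral_lborel_shift) measurable

lemma nn_integral_lborel_swap:
  assumes [measurable]: "case_prod f \<in> borel_measurable (borel \<Otimes>\<^sub>M borel :: (real \<times> real) measure)"
  shows "(\<integral>\<^sup>+y. \<integral>\<^sup>+x. f x y \<partial>lborel \<partial>lborel) = (\<integral>\<^sup>+x. \<integral>\<^sup>+y. f x y \<partial>lborel \<partial>lborel)"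
proof -
  have "case_prod f \<in> borel_measurable (lborel \<Otimes>\<^sub>M lborel)"
    using assms by (simp cong: measurable_cong_sets sets_pair_measure_cong)
  then show ?thesis by (rule lborel_pair.Fubini')
qed

lemma nn_integral_shear2:
  assumes [measurable]: "case_prod f \<in> borel_measurable (borel \<Otimes>\<^sub>M borel :: (real \<times> real) measure)"
  shows "(\<integral>\<^sup>+y. \<integral>\<^sup>+x. f x (y + t * x) \<partial>lborel \<partial>lborel) = (\<integral>\<^sup>+y. \<integral>\<^sup>+x. f x y \<partial>lborel \<partial>lborel)"
proof -
  have "(\<integral>\<^sup>+y. \<integral>\<^sup>+x. f x (y + t * x) \<partial>lborel \<partial>lborel) = (\<integral>\<^sup>+x. \<integral>\<^sup>+y. f x (y + t * x) \<partial>lborel \<partial>lborel)"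
    by (rule nn_integral_lborel_swap) measurable
  also have "\<dots> = (\<integral>\<^sup>+x. \<integral>\<^sup>+y. f x y \<partial>lborel \<partial>lborel)"
    by (intro nn_integral_cong nn_integral_lborel_shift) measurable
  also have "\<dots> = (\<integral>\<^sup>+y. \<integral>\<^sup>+x. f x y \<partial>lborel \<partial>lborel)"
    by (rule nn_integral_lborel_swap[symmetric]) measurable
  finally show ?thesis .
qed

text \<open>A rotation that is not the half turn is a product of three shears.\<close>

lemma nn_integral_rotation:
  assumes f [measurable]: "case_prod f \<in> borel_measurable (borel \<Otimes>\<^sub>M borel :: (real \<times> real) measure)"
    and cs: "c\<^sup>2 + s\<^sup>2 = 1"
  shows "(\<integral>\<^sup>+y. \<integral>\<^sup>+x. f (c * x - s * y) (s * x + c * y) \<partial>lborel \<partial>lborel) = (\<integral>\<^sup>+y. \<integral>\<^sup>+x. f x y \<partial>lborel \<partial>lborel)"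
proof -
  have main: "(\<integral>\<^sup>+y. \<integral>\<^sup>+x. f (c * x - s * y) (s * x + c * y) \<partial>lborel \<partial>lborel) = (\<integral>\<^sup>+y. \<integral>\<^sup>+x. f x y \<partial>lborel \<partial>lborel)"
    if "c\<^sup>2 + s\<^sup>2 = 1" "c \<noteq> -1" and [measurable]: "case_prod f \<in> borel_measurable (borel \<Otimes>\<^sub>M borel)"
    for c s :: real and f :: "real \<Rightarrow> real \<Rightarrow> ennreal"
  proof -
    \<comment> \<open>With \<open>c\<close> and \<open>s\<close> the cosine and sine of an angle,
      \<open>t\<close> is minus the tangent of half the angle, which is undefined only for the half
      turn.\<close>
    define t where "t = - s / (1 + c)"
    have c1: "1 + c \<noteq> 0" using that by auto
    have t: "t * (1 + c) = - s" using c1 by (simp add: t_def)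
    have ss: "s * s = (1 - c) * (1 + c)" using that(1) by (simp add: power2_eq_square algebra_simps)
    have ts: "t * s = c - 1"
    proof -
      have "(1 + c) * (t * s) = (1 + c) * (c - 1)" using t ss by (simp add: algebra_simps)
      then show ?thesis using c1 by simp
    qed
    have "(\<integral>\<^sup>+y. \<integral>\<^sup>+x. f x y \<partial>lborel \<partial>lborel) = (\<integral>\<^sup>+y. \<integral>\<^sup>+x. f (x + t * y) y \<partial>lborel \<partial>lborel)"
      by (rule nn_integral_shear1[symmetric]) measurable
    also have "\<dots> = (\<integral>\<^sup>+y. \<integral>\<^sup>+x. f (x + t * (y + s * x)) (y + s * x) \<partial>lborel \<partial>lborel)"
      by (rule nn_integral_shear2[of "\<lambda>x y. f (x + t * y) y", symmetric]) measurable
    also have "\<dots> = (\<integral>\<^sup>+y. \<integral>\<^sup>+x. f ((x + t * y) + t * (y + s * (x + t * y))) (y + s * (x + t * y)) \<partial>lborel \<partial>lborel)"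
      by (rule nn_integral_shear1[of "\<lambda>x y. f (x + t * (y + s * x)) (y + s * x)", symmetric]) measurable
    also have "\<dots> = (\<integral>\<^sup>+y. \<integral>\<^sup>+x. f (c * x - s * y) (s * x + c * y) \<partial>lborel \<partial>lborel)"
    proof (intro nn_integral_cong)
      fix x y :: real
      have "(x + t * y) + t * (y + s * (x + t * y)) = (1 + t * s) * x + t * (2 + t * s) * y"
        by (simp add: algebra_simps)
      also have "\<dots> = c * x - s * y" unfolding ts using t by (simp add: algebra_simps)
      moreover have "y + s * (x + t * y) = s * x + (1 + t * s) * y" by (simp add: algebra_simps)
      ultimately show "f ((x + t * y) + t * (y + s * (x + t * y))) (y + s * (x + t * y)) = f (c * x - s * y) (s * x + c * y)"
        unfolding ts by simp
    qed
    finally show ?thesis by simp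
  qed
  show ?thesis
  proof (cases "c = -1")
    case False
    then show ?thesis using main[OF cs] f by blast
  next
    case True
    \<comment> \<open>The half turn is obtained by performing a quarter turn twice.\<close>
    then have s: "s = 0" using cs by simp
    have "(\<integral>\<^sup>+y. \<integral>\<^sup>+x. f x y \<partial>lborel \<partial>lborel) = (\<integral>\<^sup>+y. \<integral>\<^sup>+x. f (- y) x \<partial>lborel \<partial>lborel)"
      using main[of 0 1 f] f by simp
    also have "\<dots> = (\<integral>\<^sup>+y. \<integral>\<^sup>+x. f (- x) (- y) \<partial>lborel \<partial>lborel)"
      using main[of 0 1 "\<lambda>x y. f (- y) x"] by simp
    finally show ?thesis using True s by simp
  qed
qed

lemma nn_integral_gauss:
  assumes [measurable]: "f \<in> borel_measurable borel"
  shows "(\<integral>\<^sup>+x. f x \<partial>gauss) = (\<integral>\<^sup>+x. ennreal (std_normal_density x) * f x \<partial>lborel)"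
  by (rule nn_integral_density) measurable

lemma gauss_rotation:
  assumes [measurable]: "case_prod f \<in> borel_measurable (borel \<Otimes>\<^sub>M borel :: (real \<times> real) measure)"
    and cs: "c\<^sup>2 + s\<^sup>2 = 1"
  shows "(\<integral>\<^sup>+y. \<integral>\<^sup>+x. f (c * x - s * y) (s * x + c * y) \<partial>gauss \<partial>gauss) = (\<integral>\<^sup>+y. \<integral>\<^sup>+x. f x y \<partial>gauss \<partial>gauss)"
proof -
  define g where "g x y = ennreal (std_normal_density x * std_normal_density y) * f x y" for x y
  have [measurable]: "case_prod g \<in> borel_measurable (borel \<Otimes>\<^sub>M borel)" unfolding g_def by measurable
  have inv: "std_normal_density (c * x - s * y) * std_normal_density (s * x + c * y) = std_normal_density x * std_normal_density y" for x y
  proof -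
    have "(c * x - s * y)\<^sup>2 + (s * x + c * y)\<^sup>2 = (c\<^sup>2 + s\<^sup>2) * (x\<^sup>2 + y\<^sup>2)"
      by (simp add: power2_eq_square algebra_simps)
    then have "(c * x - s * y)\<^sup>2 + (s * x + c * y)\<^sup>2 = x\<^sup>2 + y\<^sup>2" using cs by simp
    then have "exp (- ((c * x - s * y)\<^sup>2 / 2)) * exp (- ((s * x + c * y)\<^sup>2 / 2)) = exp (- (x\<^sup>2 / 2)) * exp (- (y\<^sup>2 / 2))"
      unfolding exp_add[symmetric] by (simp add: field_simps)
    then show ?thesis by (simp add: std_normal_density_def)
  qed
  have pull: "(\<integral>\<^sup>+y. \<integral>\<^sup>+x. h x y \<partial>gauss \<partial>gauss)
     = (\<integral>\<^sup>+y. \<integral>\<^sup>+x. ennreal (std_normal_density x * std_normal_density y) * h x y \<partial>lborel \<partial>lborel)"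
    if [measurable]: "case_prod h \<in> borel_measurable (borel \<Otimes>\<^sub>M borel)" for h
  proof -
    have "(\<integral>\<^sup>+y. \<integral>\<^sup>+x. h x y \<partial>gauss \<partial>gauss)
      = (\<integral>\<^sup>+y. ennreal (std_normal_density y) * (\<integral>\<^sup>+x. ennreal (std_normal_density x) * h x y \<partial>lborel) \<partial>lborel)"
      by (subst nn_integral_gauss) (auto simp: nn_integral_gauss)
    also have "\<dots> = (\<integral>\<^sup>+y. \<integral>\<^sup>+x. ennreal (std_normal_density y) * (ennreal (std_normal_density x) * h x y) \<partial>lborel \<partial>lborel)"
      by (intro nn_integral_cong nn_integral_cmult[symmetric]) measurable
    also have "\<dots> = (\<integral>\<^sup>+y. \<integral>\<^sup>+x. ennreal (std_normal_density x * std_normal_density y) * h x y \<partial>lborel \<partial>lborel)"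
      by (simp add: ennreal_mult' mult_ac)
    finally show ?thesis .
  qed
  have "(\<integral>\<^sup>+y. \<integral>\<^sup>+x. f (c * x - s * y) (s * x + c * y) \<partial>gauss \<partial>gauss)
     = (\<integral>\<^sup>+y. \<integral>\<^sup>+x. g (c * x - s * y) (s * x + c * y) \<partial>lborel \<partial>lborel)"
    by (subst pull) (auto simp: g_def inv)
  also have "\<dots> = (\<integral>\<^sup>+y. \<integral>\<^sup>+x. g x y \<partial>lborel \<partial>lborel)"
    by (rule nn_integral_rotation[OF _ cs]) measurable
  also have "\<dots> = (\<integral>\<^sup>+y. \<integral>\<^sup>+x. f x y \<partial>gauss \<partial>gauss)"
    unfolding g_def by (rule pull[symmetric]) measurable
  finally show ?thesis .
qed

abbreviation gauss_on :: "'i set \<Rightarrow> ('i \<Rightarrow> real) measure" where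
  "gauss_on J \<equiv> PiM J (\<lambda>_. gauss)"

lemma product_sigma_finite_gauss: "product_sigma_finite (\<lambda>_. gauss)"
  unfolding product_sigma_finite_def
  using prob_space_imp_sigma_finite[OF prob_space_gauss] by simp

definition gauss_preserving :: "'i set \<Rightarrow> (('i \<Rightarrow> real) \<Rightarrow> 'i \<Rightarrow> real) \<Rightarrow> bool" where
  "gauss_preserving J T \<longleftrightarrow> T \<in> measurable (gauss_on J) (gauss_on J) \<and>
     (\<forall>f \<in> borel_measurable (gauss_on J). (\<integral>\<^sup>+x. f (T x) \<partial>gauss_on J) = (\<integral>\<^sup>+x. f x \<partial>gauss_on J))"

lemma gauss_preserving_id: "gauss_preserving J (\<lambda>x. x)"
  by (simp add: gauss_preserving_def)

lemma gauss_preserving_comp: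
  assumes "gauss_preserving J S" "gauss_preserving J T"
  shows "gauss_preserving J (\<lambda>x. S (T x))"
proof -
  have m: "S \<in> measurable (gauss_on J) (gauss_on J)" "T \<in> measurable (gauss_on J) (gauss_on J)"
    using assms by (auto simp: gauss_preserving_def)
  have "(\<integral>\<^sup>+x. f (S (T x)) \<partial>gauss_on J) = (\<integral>\<^sup>+x. f x \<partial>gauss_on J)" if "f \<in> borel_measurable (gauss_on J)" for f
  proof -
    have "(\<lambda>x. f (S x)) \<in> borel_measurable (gauss_on J)" using m(1) that by (rule measurable_compose)
    then have "(\<integral>\<^sup>+x. f (S (T x)) \<partial>gauss_on J) = (\<integral>\<^sup>+x. f (S x) \<partial>gauss_on J)"
      using assms(2) by (auto simp: gauss_preserving_def)
    also have "\<dots> = (\<integral>\<^sup>+x. f x \<partial>gauss_on J)" using assms(1) that by (auto simp: gauss_preserving_def)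
    finally show ?thesis .
  qed
  moreover have "(\<lambda>x. S (T x)) \<in> measurable (gauss_on J) (gauss_on J)" using m(2,1) by (rule measurable_compose)
  ultimately show ?thesis by (simp add: gauss_preserving_def)
qed

lemma gauss_preserving_pair:
  assumes J: "finite J" "p \<in> J" "q \<in> J" "p \<noteq> q" and cs: "c\<^sup>2 + s\<^sup>2 = 1"
  shows "gauss_preserving J (\<lambda>x. x(p := c * x p - s * x q, q := s * x p + c * x q))"
proof -
  let ?T = "\<lambda>x. x(p := c * x p - s * x q, q := s * x p + c * x q)"
  define K where "K = J - {p, q}"
  have J_eq: "J = insert p (insert q K)" and K: "finite K" "p \<notin> insert q K" "q \<notin> K"
    using J by (auto simp: K_def)
  interpret product_sigma_finite "\<lambda>_. gauss" by (rule product_sigma_finite_gauss)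
  have comp: "(\<lambda>x. x i) \<in> borel_measurable (gauss_on J)" if "i \<in> J" for i
    using measurable_component_singleton[OF that, of "\<lambda>_. gauss"] by (simp cong: measurable_cong_sets)
  have [measurable]: "(\<lambda>x. x p) \<in> borel_measurable (gauss_on J)" "(\<lambda>x. x q) \<in> borel_measurable (gauss_on J)"
    using comp J by auto
  have T [measurable]: "?T \<in> measurable (gauss_on J) (gauss_on J)"
  proof (rule measurable_PiM_single')
    fix i assume i: "i \<in> J"
    have "(\<lambda>x. ?T x i) \<in> borel_measurable (gauss_on J)"
    proof -
      consider "i = q" | "i = p" | "i \<noteq> p" "i \<noteq> q" by blast
      then show ?thesis using comp[OF i] J by cases (simp_all, measurable)
    qed
    then show "(\<lambda>x. ?T x i) \<in> measurable (gauss_on J) gauss" by (simp cong: measurable_cong_sets)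
  next
    show "?T \<in> space (gauss_on J) \<rightarrow> J \<rightarrow>\<^sub>E space gauss"
      using J by (auto simp: space_PiM PiE_iff extensional_def)
  qed
  have "(\<integral>\<^sup>+x. f (?T x) \<partial>gauss_on J) = (\<integral>\<^sup>+x. f x \<partial>gauss_on J)" if f [measurable]: "f \<in> borel_measurable (gauss_on J)" for f
  proof -
    have split: "(\<integral>\<^sup>+x. g x \<partial>gauss_on J) = (\<integral>\<^sup>+z. \<integral>\<^sup>+y. \<integral>\<^sup>+x. g (z(q := y, p := x)) \<partial>gauss \<partial>gauss \<partial>gauss_on K)"
      if g: "g \<in> borel_measurable (gauss_on J)" for g
    proof -
      have gm: "g \<in> borel_measurable (gauss_on (insert p (insert q K)))" using g J_eq by simp
      have "(\<lambda>z. \<integral>\<^sup>+x. g (z(p := x)) \<partial>gauss) \<in> borel_measurable (gauss_on (insert q K))"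
        using measurable_compose[OF measurable_add_dim gm] 
        by (intro sigma_finite_measure.borel_measurable_nn_integral[OF prob_space_imp_sigma_finite[OF prob_space_gauss]]) (simp add: case_prod_unfold)
      then have i2: "(\<integral>\<^sup>+z. \<integral>\<^sup>+x. g (z(p := x)) \<partial>gauss \<partial>gauss_on (insert q K))
        = (\<integral>\<^sup>+z. \<integral>\<^sup>+y. \<integral>\<^sup>+x. g (z(q := y, p := x)) \<partial>gauss \<partial>gauss \<partial>gauss_on K)"
        by (intro product_nn_integral_insert) (use K in auto)
      have "(\<integral>\<^sup>+x. g x \<partial>gauss_on J) = (\<integral>\<^sup>+z. \<integral>\<^sup>+x. g (z(p := x)) \<partial>gauss \<partial>gauss_on (insert q K))"
        unfolding J_eq by (rule product_nn_integral_insert) (use K gm in auto)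
      then show ?thesis unfolding i2 .
    qed
    have upd: "?T (z(q := y, p := x)) = z(q := s * x + c * y, p := c * x - s * y)" for z :: "'a \<Rightarrow> real" and x y
      using J by (auto simp: fun_eq_iff)
    have "(\<integral>\<^sup>+x. f (?T x) \<partial>gauss_on J) = (\<integral>\<^sup>+z. \<integral>\<^sup>+y. \<integral>\<^sup>+x. f (z(q := s * x + c * y, p := c * x - s * y)) \<partial>gauss \<partial>gauss \<partial>gauss_on K)"
      using split[OF measurable_compose[OF T f]] unfolding upd .
    also have "\<dots> = (\<integral>\<^sup>+z. \<integral>\<^sup>+y. \<integral>\<^sup>+x. f (z(q := y, p := x)) \<partial>gauss \<partial>gauss \<partial>gauss_on K)"
    proof (rule nn_integral_cong)
      fix z assume z: "z \<in> space (gauss_on K)"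
      have "(\<lambda>w. z(q := snd w, p := fst w)) \<in> measurable (borel \<Otimes>\<^sub>M borel) (gauss_on J)"
      proof (rule measurable_PiM_single')
        fix i assume i: "i \<in> J"
        consider "i = q" | "i = p" | "i \<noteq> p" "i \<noteq> q" by blast
        then have "(\<lambda>w. (z(q := snd w, p := fst w)) i) \<in> borel_measurable (borel \<Otimes>\<^sub>M borel)"
          using J by cases simp_all
        then show "(\<lambda>w. (z(q := snd w, p := fst w)) i) \<in> measurable (borel \<Otimes>\<^sub>M borel) gauss"
          by (simp cong: measurable_cong_sets)
      next
        show "(\<lambda>w. z(q := snd w, p := fst w)) \<in> space (borel \<Otimes>\<^sub>M borel) \<rightarrow> J \<rightarrow>\<^sub>E space gauss"
          using z J K_def by (auto simp: space_PiM PiE_iff extensional_def)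
      qed
      from measurable_compose[OF this f]
      have "case_prod (\<lambda>x y. f (z(q := y, p := x))) \<in> borel_measurable (borel \<Otimes>\<^sub>M borel)"
        by (simp add: case_prod_unfold)
      from gauss_rotation[OF this cs]
      show "(\<integral>\<^sup>+y. \<integral>\<^sup>+x. f (z(q := s * x + c * y, p := c * x - s * y)) \<partial>gauss \<partial>gauss)
        = (\<integral>\<^sup>+y. \<integral>\<^sup>+x. f (z(q := y, p := x)) \<partial>gauss \<partial>gauss)" .
    qed
    also have "\<dots> = (\<integral>\<^sup>+x. f x \<partial>gauss_on J)" by (rule split[OF f, symmetric])
    finally show ?thesis .
  qed
  then show ?thesis using T by (simp add: gauss_preserving_def)
qed

text \<open>A sign change in one variable is read off from the half turn of the plane, the other
  variable being integrated out.\<close>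

lemma gauss_uminus:
  assumes [measurable]: "f \<in> borel_measurable borel"
  shows "(\<integral>\<^sup>+x. f (- x) \<partial>gauss) = (\<integral>\<^sup>+x. f x \<partial>gauss)"
proof -
  interpret prob_space gauss by (rule prob_space_gauss)
  show ?thesis using gauss_rotation[of "\<lambda>x y. f x" "-1" 0] by (simp add: emeasure_space_1[simplified])
qed

lemma gauss_preserving_neg:
  assumes J: "finite J" "p \<in> J"
  shows "gauss_preserving J (\<lambda>x. x(p := - x p))"
proof -
  let ?T = "\<lambda>x. x(p := - x p)"
  define K where "K = J - {p}"
  have J_eq: "J = insert p K" and K: "finite K" "p \<notin> K"
    using J by (auto simp: K_def)
  interpret product_sigma_finite "\<lambda>_. gauss" by (rule product_sigma_finite_gauss)
  have comp: "(\<lambda>x. x i) \<in> borel_measurable (gauss_on J)" if "i \<in> J" for i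
    using measurable_component_singleton[OF that, of "\<lambda>_. gauss"] by (simp cong: measurable_cong_sets)
  have T [measurable]: "?T \<in> measurable (gauss_on J) (gauss_on J)"
  proof (rule measurable_PiM_single')
    fix i assume i: "i \<in> J"
    have "(\<lambda>x. ?T x i) \<in> borel_measurable (gauss_on J)"
      using comp[OF i] by (cases "i = p") simp_all
    then show "(\<lambda>x. ?T x i) \<in> measurable (gauss_on J) gauss" by (simp cong: measurable_cong_sets)
  next
    show "?T \<in> space (gauss_on J) \<rightarrow> J \<rightarrow>\<^sub>E space gauss"
      using J by (auto simp: space_PiM PiE_iff extensional_def)
  qed
  have "(\<integral>\<^sup>+x. f (?T x) \<partial>gauss_on J) = (\<integral>\<^sup>+x. f x \<partial>gauss_on J)" if f [measurable]: "f \<in> borel_measurable (gauss_on J)" for f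
  proof -
    have split: "(\<integral>\<^sup>+x. g x \<partial>gauss_on J) = (\<integral>\<^sup>+z. \<integral>\<^sup>+x. g (z(p := x)) \<partial>gauss \<partial>gauss_on K)"
      if g: "g \<in> borel_measurable (gauss_on J)" for g
      using g unfolding J_eq by (intro product_nn_integral_insert) (use K in auto)
    have upd: "?T (z(p := x)) = z(p := - x)" for z :: "'a \<Rightarrow> real" and x by auto
    have "(\<integral>\<^sup>+x. f (?T x) \<partial>gauss_on J) = (\<integral>\<^sup>+z. \<integral>\<^sup>+x. f (z(p := - x)) \<partial>gauss \<partial>gauss_on K)"
      using split[OF measurable_compose[OF T f]] unfolding upd .
    also have "\<dots> = (\<integral>\<^sup>+z. \<integral>\<^sup>+x. f (z(p := x)) \<partial>gauss \<partial>gauss_on K)"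
    proof (rule nn_integral_cong)
      fix z assume z: "z \<in> space (gauss_on K)"
      have "(\<lambda>w. z(p := w)) \<in> measurable borel (gauss_on J)"
      proof (rule measurable_PiM_single')
        fix i assume i: "i \<in> J"
        have "(\<lambda>w. (z(p := w)) i) \<in> borel_measurable borel"
          by (cases "i = p") simp_all
        then show "(\<lambda>w. (z(p := w)) i) \<in> measurable borel gauss"
          by (simp cong: measurable_cong_sets)
      next
        show "(\<lambda>w. z(p := w)) \<in> space borel \<rightarrow> J \<rightarrow>\<^sub>E space gauss"
          using z J K_def by (auto simp: space_PiM PiE_iff extensional_def)
      qed
      from measurable_compose[OF this f]
      show "(\<integral>\<^sup>+x. f (z(p := - x)) \<partial>gauss) = (\<integral>\<^sup>+x. f (z(p := x)) \<partial>gauss)"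
        by (rule gauss_uminus)
    qed
    also have "\<dots> = (\<integral>\<^sup>+x. f x \<partial>gauss_on J)" by (rule split[OF f, symmetric])
    finally show ?thesis .
  qed
  then show ?thesis using T by (simp add: gauss_preserving_def)
qed

lemma gauss_preserving_negs:
  assumes J: "finite J" and B: "finite B" "B \<subseteq> J"
  shows "\<exists>T. gauss_preserving J T \<and> (\<forall>x i. T x i = (if i \<in> B then - x i else x i))"
  using B
proof (induction B rule: finite_induct)
  case empty
  then show ?case using gauss_preserving_id by (intro exI[of _ "\<lambda>x. x"]) auto
next
  case (insert p B)
  then obtain T where T: "gauss_preserving J T" "\<And>x i. T x i = (if i \<in> B then - x i else x i)" by auto
  define T' where "T' x = (\<lambda>x. x(p := - x p)) (T x)" for x
  have "gauss_preserving J T'" unfolding T'_def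
    by (rule gauss_preserving_comp[OF gauss_preserving_neg[OF J] T(1)]) (use insert.prems in auto)
  moreover have "T' x i = (if i \<in> insert p B then - x i else x i)" for x i
    using insert.hyps by (simp add: T'_def T(2))
  ultimately show ?case by blast
qed

text \<open>One rotation acts on many disjoint pairs at once, since an operation on two columns
  involves one pair in each row.\<close>

lemma gauss_preserving_pairs:
  assumes J: "finite J" and S: "finite S" "P ` S \<subseteq> J" "Q ` S \<subseteq> J" "inj_on P S" "inj_on Q S" "P ` S \<inter> Q ` S = {}"
    and cs: "c\<^sup>2 + s\<^sup>2 = 1"
  shows "\<exists>T. gauss_preserving J T \<and> (\<forall>x. (\<forall>l\<in>S. T x (P l) = c * x (P l) - s * x (Q l) \<and> T x (Q l) = s * x (P l) + c * x (Q l))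
     \<and> (\<forall>i. i \<notin> P ` S \<longrightarrow> i \<notin> Q ` S \<longrightarrow> T x i = x i))"
  using S
proof (induction S rule: finite_induct)
  case empty
  then show ?case using gauss_preserving_id by (intro exI[of _ "\<lambda>x. x"]) auto
next
  case (insert l S)
  then obtain T where T: "gauss_preserving J T" "\<And>x l. l \<in> S \<Longrightarrow> T x (P l) = c * x (P l) - s * x (Q l)"
     "\<And>x l. l \<in> S \<Longrightarrow> T x (Q l) = s * x (P l) + c * x (Q l)" "\<And>x i. i \<notin> P ` S \<Longrightarrow> i \<notin> Q ` S \<Longrightarrow> T x i = x i"
    by auto
  have neq: "P l \<noteq> Q l" using insert.prems by auto
  have nl: "P l \<notin> P ` S" "Q l \<notin> Q ` S" "P l \<notin> Q ` S" "Q l \<notin> P ` S"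
    using insert.prems insert.hyps by (auto simp: inj_on_def)
  define T' where "T' x = (\<lambda>x. x(P l := c * x (P l) - s * x (Q l), Q l := s * x (P l) + c * x (Q l))) (T x)" for x
  have "gauss_preserving J T'" unfolding T'_def
    by (rule gauss_preserving_comp[OF gauss_preserving_pair[OF J _ _ neq cs] T(1)]) (use insert.prems in auto)
  moreover have "T' x (P l) = c * x (P l) - s * x (Q l)" "T' x (Q l) = s * x (P l) + c * x (Q l)" for x
    unfolding T'_def using neq T(4)[OF nl(1,3)] T(4)[OF nl(4,2)] by auto
  moreover have "T' x (P l') = c * x (P l') - s * x (Q l')" "T' x (Q l') = s * x (P l') + c * x (Q l')" if "l' \<in> S" for x l'
    unfolding T'_def using that nl T(2,3)[OF that] by (auto simp: image_iff)
  moreover have "T' x i = x i" if "i \<notin> P ` insert l S" "i \<notin> Q ` insert l S" for x i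
    unfolding T'_def using that T(4) by auto
  ultimately show ?case by (intro exI[of _ T']) auto
qed

section \<open>Isometries acting on Gaussian rows\<close>

definition gauss_entry :: "nat \<Rightarrow> (nat \<times> nat \<times> nat \<Rightarrow> real) \<Rightarrow> nat \<times> nat \<Rightarrow> complex" where
  "gauss_entry \<beta> w ij = Complex (w (0, ij)) (if \<beta> = 2 then w (1, ij) else 0)"

text \<open>A family of independent Gaussian rows with passive index \<open>t\<close> and active index \<open>j\<close>; taking
  \<open>e t j = (t, j)\<close> or \<open>e t j = (j, t)\<close> covers right and left multiplication of a matrix.\<close>

locale gauss_rows =
  fixes \<beta> :: nat and R A :: "nat set" and e :: "nat \<Rightarrow> nat \<Rightarrow> nat \<times> nat"
  assumes beta: "\<beta> \<in> {1, 2}" and R: "finite R" and A: "finite A"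
    and e_inj: "e t j = e t' j' \<Longrightarrow> t = t' \<and> j = j'"
begin

definition idx :: "(nat \<times> nat \<times> nat) set" where
  "idx = (\<lambda>(p, t, j). (p, e t j)) ` ({..<\<beta>} \<times> R \<times> A)"

lemma finite_idx: "finite idx" using R A by (simp add: idx_def)

lemma in_idx: "p < \<beta> \<Longrightarrow> t \<in> R \<Longrightarrow> j \<in> A \<Longrightarrow> (p, e t j) \<in> idx"
  by (force simp: idx_def)

text \<open>An orthogonal or unitary change of the active coordinates that comes with its lift to
  the Gaussian coordinates of all rows. The lift belongs to the notion so that both are composed
  together; it is never constructed for a general isometry.\<close>

definition row_map :: "((nat \<Rightarrow> complex) \<Rightarrow> nat \<Rightarrow> complex) \<Rightarrow> bool" where
  "row_map L \<longleftrightarrow> (\<exists>Q. \<forall>x. \<forall>j\<in>A. L x j = (\<Sum>i\<in>A. x i * Q i j)) \<and>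
     (\<forall>x y. (\<Sum>j\<in>A. L x j * cnj (L y j)) = (\<Sum>j\<in>A. x j * cnj (y j))) \<and>
     (\<forall>x. (\<forall>j\<in>A. x j \<in> scalars \<beta>) \<longrightarrow> (\<forall>j\<in>A. L x j \<in> scalars \<beta>)) \<and>
     (\<exists>T. gauss_preserving idx T \<and>
       (\<forall>w. \<forall>t\<in>R. \<forall>j\<in>A. gauss_entry \<beta> (T w) (e t j) = L (\<lambda>j. gauss_entry \<beta> w (e t j)) j))"

lemma row_map_id: "row_map (\<lambda>x. x)"
proof -
  have "(x j :: complex) = (\<Sum>i\<in>A. x i * (if i = j then 1 else 0))" if "j \<in> A" for x j
    using that A by (simp add: if_distrib[of "\<lambda>c. _ * c"] cong: if_cong)
  then show ?thesis unfolding row_map_def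
    using gauss_preserving_id by (intro conjI exI[of _ "\<lambda>i j. if i = j then 1 else 0"]) auto
qed

lemma row_map_comp:
  assumes K: "row_map K" and L: "row_map L"
  shows "row_map (\<lambda>x. K (L x))"
proof -
  obtain P where P: "\<And>x j. j \<in> A \<Longrightarrow> K x j = (\<Sum>i\<in>A. x i * P i j)" using K by (auto simp: row_map_def)
  obtain Q where Q: "\<And>x j. j \<in> A \<Longrightarrow> L x j = (\<Sum>i\<in>A. x i * Q i j)" using L by (auto simp: row_map_def)
  have cong: "K x j = K y j" if "\<And>i. i \<in> A \<Longrightarrow> x i = y i" "j \<in> A" for x y j
    using that by (simp add: P)
  have "K (L x) j = (\<Sum>i\<in>A. x i * (\<Sum>k\<in>A. Q i k * P k j))" if "j \<in> A" for x j
    using that by (simp add: P Q sum_distrib_left sum_distrib_right mult.assoc) (rule sum.swap)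
  moreover have "(\<Sum>j\<in>A. K (L x) j * cnj (K (L y) j)) = (\<Sum>j\<in>A. x j * cnj (y j))" for x y
    using K L by (simp add: row_map_def)
  moreover have "\<forall>x. (\<forall>j\<in>A. x j \<in> scalars \<beta>) \<longrightarrow> (\<forall>j\<in>A. K (L x) j \<in> scalars \<beta>)"
  proof -
    have "\<forall>x. (\<forall>j\<in>A. x j \<in> scalars \<beta>) \<longrightarrow> (\<forall>j\<in>A. K x j \<in> scalars \<beta>)"
      "\<forall>x. (\<forall>j\<in>A. x j \<in> scalars \<beta>) \<longrightarrow> (\<forall>j\<in>A. L x j \<in> scalars \<beta>)"
      using K L unfolding row_map_def by simp_all
    then show ?thesis by simp
  qed
  moreover obtain S where S: "gauss_preserving idx S"
    "\<And>w t j. t \<in> R \<Longrightarrow> j \<in> A \<Longrightarrow> gauss_entry \<beta> (S w) (e t j) = K (\<lambda>j. gauss_entry \<beta> w (e t j)) j"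
    using K unfolding row_map_def by blast
  moreover obtain T where T: "gauss_preserving idx T"
    "\<And>w t j. t \<in> R \<Longrightarrow> j \<in> A \<Longrightarrow> gauss_entry \<beta> (T w) (e t j) = L (\<lambda>j. gauss_entry \<beta> w (e t j)) j"
    using L unfolding row_map_def by blast
  moreover have "gauss_entry \<beta> (S (T w)) (e t j) = K (L (\<lambda>j. gauss_entry \<beta> w (e t j))) j" if "t \<in> R" "j \<in> A" for w t j
    unfolding S(2)[OF that] by (rule cong) (use T(2) that in auto)
  ultimately show ?thesis unfolding row_map_def
    using gauss_preserving_comp[OF S(1) T(1)]
    by (intro conjI exI[of _ "\<lambda>i j. \<Sum>k\<in>A. Q i k * P k j"] exI[of _ "\<lambda>w. S (T w)"]) auto
qed

text \<open>A rotation with real coefficients acts separately on the real and the imaginary parts,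
  hence pairs coordinates of the same part.\<close>

lemma row_map_givens:
  assumes "j0 \<in> A" "j1 \<in> A" "j0 \<noteq> j1" and cs: "c\<^sup>2 + s\<^sup>2 = (1::real)"
  shows "row_map (\<lambda>x. x(j0 := c * x j0 - s * x j1, j1 := s * x j0 + c * x j1))" (is "row_map ?L")
proof -
  define S where "S = {..<\<beta>} \<times> R"
  define P where "P = (\<lambda>(p, t). (p, e t j0) :: nat \<times> nat \<times> nat)"
  define Q where "Q = (\<lambda>(p, t). (p, e t j1) :: nat \<times> nat \<times> nat)"
  have "\<exists>T. gauss_preserving idx T \<and> (\<forall>x. (\<forall>l\<in>S. T x (P l) = c * x (P l) - s * x (Q l) \<and> T x (Q l) = s * x (P l) + c * x (Q l))
     \<and> (\<forall>i. i \<notin> P ` S \<longrightarrow> i \<notin> Q ` S \<longrightarrow> T x i = x i))"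
  proof (rule gauss_preserving_pairs[OF finite_idx _ _ _ _ _ _ cs])
    show "finite S" using R by (simp add: S_def)
    show "P ` S \<subseteq> idx" "Q ` S \<subseteq> idx" using assms in_idx by (auto simp: S_def P_def Q_def)
    show "inj_on P S" "inj_on Q S" using e_inj by (auto simp: inj_on_def P_def Q_def S_def)
    have "e t j0 \<noteq> e t' j1" for t t' using e_inj[of t j0 t' j1] assms(3) by auto
    then show "P ` S \<inter> Q ` S = {}" by (auto simp: S_def P_def Q_def simp del: prod.inject) (metis prod.inject)+
  qed
  then obtain T where T: "gauss_preserving idx T" "\<And>x l. l \<in> S \<Longrightarrow> T x (P l) = c * x (P l) - s * x (Q l)"
     "\<And>x l. l \<in> S \<Longrightarrow> T x (Q l) = s * x (P l) + c * x (Q l)" "\<And>x i. i \<notin> P ` S \<Longrightarrow> i \<notin> Q ` S \<Longrightarrow> T x i = x i"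
    by auto
  have T0: "T w (p, e t j0) = c * w (p, e t j0) - s * w (p, e t j1)"
    and T1: "T w (p, e t j1) = s * w (p, e t j0) + c * w (p, e t j1)" if "p < \<beta>" "t \<in> R" for p t w
    using T(2,3)[of "(p, t)" w] that by (auto simp: S_def P_def Q_def)
  have T2: "T w (p, e t j) = w (p, e t j)" if "j \<noteq> j0" "j \<noteq> j1" for p t w j
    by (rule T(4)) (use that e_inj in \<open>auto simp: P_def Q_def\<close>)
  have b: "0 < \<beta>" "\<beta> = 2 \<Longrightarrow> 1 < \<beta>" using beta by auto
  have ge: "gauss_entry \<beta> (T w) (e t j) = ?L (\<lambda>j. gauss_entry \<beta> w (e t j)) j" if t: "t \<in> R" and j: "j \<in> A" for w t j
  proof -
    consider "j = j0" | "j = j1" | "j \<noteq> j0" "j \<noteq> j1" by blast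
    then show ?thesis
      using T0[OF b(1) t] T1[OF b(1) t] T0[OF b(2) t] T1[OF b(2) t] assms(3)
      by cases (auto simp: gauss_entry_def T2 complex_eq_iff)
  qed
  have lin: "?L x j = (\<Sum>i\<in>A. x i * (if j = j0 then (if i = j0 then c else if i = j1 then - s else 0) else
     if j = j1 then (if i = j0 then s else if i = j1 then c else 0) else if i = j then 1 else 0))" if "j \<in> A" for x j
  proof -
    have two: "(\<Sum>i\<in>A. x i * complex_of_real (if i = j0 then a else if i = j1 then b else 0)) = x j0 * a + x j1 * b" for a b :: real
    proof -
      have "(\<Sum>i\<in>A. x i * complex_of_real (if i = j0 then a else if i = j1 then b else 0))
        = (\<Sum>i\<in>A. (if i = j0 then x j0 * a else 0) + (if i = j1 then x j1 * b else 0))"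
        using assms(3) by (intro sum.cong) auto
      then show ?thesis using A assms by (simp add: sum.distrib)
    qed
    have one: "(\<Sum>i\<in>A. x i * complex_of_real (if i = j then 1 else 0)) = x j"
      using A that by (simp add: if_distrib[of "\<lambda>c. _ * c"] if_distrib[of complex_of_real] cong: if_cong)
    show ?thesis using two[of c "-s"] two[of s c] one assms(3) by (auto simp: mult.commute)
  qed
  have iso: "(\<Sum>j\<in>A. ?L x j * cnj (?L y j)) = (\<Sum>j\<in>A. x j * cnj (y j))" for x y
  proof -
    have A_eq: "A = insert j0 (insert j1 (A - {j0, j1}))" using assms by auto
    have d: "(\<Sum>j\<in>A. f j) = f j0 + f j1 + (\<Sum>j\<in>A - {j0, j1}. f j)" for f :: "nat \<Rightarrow> complex"
      using A assms(3) by (subst A_eq) (simp add: add.assoc)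
    have cs': "complex_of_real c * complex_of_real c + complex_of_real s * complex_of_real s = 1"
      using cs by (metis of_real_1 of_real_add of_real_mult power2_eq_square)
    have "(c * x j0 - s * x j1) * cnj (c * y j0 - s * y j1) + (s * x j0 + c * x j1) * cnj (s * y j0 + c * y j1)
       = (complex_of_real c * complex_of_real c + complex_of_real s * complex_of_real s) * (x j0 * cnj (y j0) + x j1 * cnj (y j1))"
      by (simp add: algebra_simps)
    then show ?thesis unfolding d[of "\<lambda>j. ?L x j * cnj (?L y j)"] d[of "\<lambda>j. x j * cnj (y j)"] cs'
      using assms(3) by simp
  qed
  show ?thesis unfolding row_map_def
  proof (intro conjI)
    show "\<exists>Q. \<forall>x. \<forall>j\<in>A. ?L x j = (\<Sum>i\<in>A. x i * Q i j)"
      by (intro exI[of _ "\<lambda>i j. complex_of_real (if j = j0 then (if i = j0 then c else if i = j1 then - s else 0) else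
     if j = j1 then (if i = j0 then s else if i = j1 then c else 0) else if i = j then 1 else 0)"] allI ballI lin)
    show "\<exists>T. gauss_preserving idx T \<and>
       (\<forall>w. \<forall>t\<in>R. \<forall>j\<in>A. gauss_entry \<beta> (T w) (e t j) = ?L (\<lambda>j. gauss_entry \<beta> w (e t j)) j)"
      using T(1) ge by blast
    show "\<forall>x. (\<forall>j\<in>A. x j \<in> scalars \<beta>) \<longrightarrow> (\<forall>j\<in>A. ?L x j \<in> scalars \<beta>)"
      using assms by (auto simp: scalars_def)
  qed (use iso in blast)
qed

text \<open>For \<open>\<beta> = 2\<close> multiplication by a unit scalar rotates the real against
  the imaginary part of an entry; for \<open>\<beta> = 1\<close> it is a sign.\<close>

lemma row_map_phase:
  assumes j0: "j0 \<in> A" and u: "u \<in> scalars \<beta>" "cmod u = 1"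
  shows "row_map (\<lambda>x. x(j0 := u * x j0))" (is "row_map ?L")
proof -
  have "\<exists>T. gauss_preserving idx T \<and>
       (\<forall>w. \<forall>t\<in>R. \<forall>j\<in>A. gauss_entry \<beta> (T w) (e t j) = ?L (\<lambda>j. gauss_entry \<beta> w (e t j)) j)"
  proof (cases "\<beta> = 2")
    case b2: True
    define c s where "c = Re u" and "s = Im u"
    have cs: "c\<^sup>2 + s\<^sup>2 = 1" using u(2) by (simp add: c_def s_def cmod_def)
    define P where "P = (\<lambda>t. (0, e t j0) :: nat \<times> nat \<times> nat)"
    define Q where "Q = (\<lambda>t. (1, e t j0) :: nat \<times> nat \<times> nat)"
    have "\<exists>T. gauss_preserving idx T \<and> (\<forall>x. (\<forall>l\<in>R. T x (P l) = c * x (P l) - s * x (Q l) \<and> T x (Q l) = s * x (P l) + c * x (Q l))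
       \<and> (\<forall>i. i \<notin> P ` R \<longrightarrow> i \<notin> Q ` R \<longrightarrow> T x i = x i))"
    proof (rule gauss_preserving_pairs[OF finite_idx R _ _ _ _ _ cs])
      show "P ` R \<subseteq> idx" "Q ` R \<subseteq> idx" using j0 in_idx b2 by (auto simp: P_def Q_def)
      show "inj_on P R" "inj_on Q R" using e_inj by (auto simp: inj_on_def P_def Q_def)
      show "P ` R \<inter> Q ` R = {}" by (auto simp: P_def Q_def)
    qed
    then obtain T where T: "gauss_preserving idx T" "\<And>x l. l \<in> R \<Longrightarrow> T x (P l) = c * x (P l) - s * x (Q l)"
       "\<And>x l. l \<in> R \<Longrightarrow> T x (Q l) = s * x (P l) + c * x (Q l)" "\<And>x i. i \<notin> P ` R \<Longrightarrow> i \<notin> Q ` R \<Longrightarrow> T x i = x i"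
      by auto
    have T2: "T w (p, e t j) = w (p, e t j)" if "j \<noteq> j0" for p t w j
      by (rule T(4)) (use that e_inj in \<open>auto simp: P_def Q_def\<close>)
    have "gauss_entry \<beta> (T w) (e t j) = ?L (\<lambda>j. gauss_entry \<beta> w (e t j)) j" if t: "t \<in> R" and j: "j \<in> A" for w t j
      using T(2,3)[OF t, of w] b2
      by (cases "j = j0") (auto simp: gauss_entry_def P_def Q_def c_def s_def T2 complex_eq_iff)
    then show ?thesis using T(1) by blast
  next
    case False
    then have b1: "\<beta> = 1" using beta by auto
    then have "u \<in> \<real>" using u by (simp add: scalars_def)
    then obtain r where r: "u = complex_of_real r" by (auto elim: Reals_cases)
    then have r1: "r = 1 \<or> r = -1" using u(2) by auto
    have "\<exists>T. gauss_preserving idx T \<and> (\<forall>w q. T w q = (if q \<in> (\<lambda>t. (0, e t j0)) ` R then r * w q else w q))"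
    proof (cases "r = 1")
      case True
      then show ?thesis using gauss_preserving_id by (intro exI[of _ "\<lambda>x. x"]) auto
    next
      case False
      have "(\<lambda>t. (0, e t j0)) ` R \<subseteq> idx" using in_idx j0 b1 by auto
      from gauss_preserving_negs[OF finite_idx _ this] obtain T where "gauss_preserving idx T"
        "\<And>x i. T x i = (if i \<in> (\<lambda>t. (0, e t j0)) ` R then - x i else x i)" using R by blast
      then show ?thesis using False r1 by (intro exI[of _ T]) auto
    qed
    then obtain T where T: "gauss_preserving idx T" "\<And>w q. T w q = (if q \<in> (\<lambda>t. (0, e t j0)) ` R then r * w q else w q)" by blast
    have "gauss_entry \<beta> (T w) (e t j) = ?L (\<lambda>j. gauss_entry \<beta> w (e t j)) j" if t: "t \<in> R" and j: "j \<in> A" for w t j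
      using T(2)[of w "(0, e t j)"] t e_inj b1 r
      by (cases "j = j0") (auto simp: gauss_entry_def complex_eq_iff)
    then show ?thesis using T(1) by blast
  qed
  moreover have "?L x j = (\<Sum>i\<in>A. x i * (if i = j then (if j = j0 then u else 1) else 0))" if "j \<in> A" for x j
    using A that by (simp add: if_distrib[of "\<lambda>c. _ * c"] cong: if_cong)
  moreover have "(\<Sum>j\<in>A. ?L x j * cnj (?L y j)) = (\<Sum>j\<in>A. x j * cnj (y j))" for x y
  proof (intro sum.cong refl)
    fix j
    have "u * cnj u = 1" using u(2) by (simp add: complex_norm_square[symmetric])
    then have "(u * x j0) * cnj (u * y j0) = x j0 * cnj (y j0)"
    proof -
      have "(u * x j0) * cnj (u * y j0) = (u * cnj u) * (x j0 * cnj (y j0))" by (simp add: mult_ac)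
      then show ?thesis unfolding \<open>u * cnj u = 1\<close> by simp
    qed
    then show "?L x j * cnj (?L y j) = x j * cnj (y j)" by auto
  qed
  moreover have "\<forall>x. (\<forall>j\<in>A. x j \<in> scalars \<beta>) \<longrightarrow> (\<forall>j\<in>A. ?L x j \<in> scalars \<beta>)"
    using u(1) j0 by (auto simp: scalars_def)
  ultimately show ?thesis unfolding row_map_def
    by (intro conjI exI[of _ "\<lambda>i j. if i = j then (if j = j0 then u else 1) else 0"]) blast+
qed

text \<open>This replaces a Householder reflection: a phase makes a coordinate nonnegative, and a
  rotation folds it into coordinate \<open>j0\<close>. Only these two kinds of elementary maps
  require a Gaussian lift.\<close>

lemma row_map_collapse:
  assumes j0: "j0 \<in> A" and x: "\<And>j. j \<in> A \<Longrightarrow> x j \<in> scalars \<beta>"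
  shows "\<exists>L. row_map L \<and> (\<forall>j\<in>A. L x j = (if j = j0 then complex_of_real (sqrt (\<Sum>j\<in>A. (cmod (x j))\<^sup>2)) else 0))"
proof -
  have phase: "\<exists>L. row_map L \<and> (\<forall>j. L y j = (if j = j1 then complex_of_real (cmod (y j1)) else y j))"
    if "j1 \<in> A" "y j1 \<in> scalars \<beta>" for j1 y
  proof (cases "y j1 = 0")
    case True
    then show ?thesis using row_map_id by (intro exI[of _ "\<lambda>x. x"]) auto
  next
    case False
    define u where "u = cnj (y j1) / complex_of_real (cmod (y j1))"
    have "u \<in> scalars \<beta>" using that(2) by (auto simp: u_def scalars_def Reals_cnj_iff)
    moreover have "cmod u = 1" using False by (simp add: u_def norm_divide)
    moreover have "u * y j1 = complex_of_real (cmod (y j1))"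
    proof -
      have "cnj (y j1) * y j1 = complex_of_real (cmod (y j1)) * complex_of_real (cmod (y j1))"
        using complex_norm_square[of "y j1"] by (simp add: power2_eq_square mult.commute)
      then show ?thesis using False by (simp add: u_def)
    qed
    ultimately show ?thesis using row_map_phase[OF that(1), of u]
      by (intro exI[of _ "\<lambda>x. x(j1 := u * x j1)"]) auto
  qed
  have "\<exists>L. row_map L \<and> (\<forall>j\<in>A. L x j = (if j = j0 then complex_of_real (sqrt (\<Sum>j\<in>insert j0 S. (cmod (x j))\<^sup>2)) else if j \<in> S then 0 else x j))"
    if "finite S" "S \<subseteq> A - {j0}" for S
    using that
  proof (induction S rule: finite_induct)
    case empty
    obtain L where "row_map L" "\<And>j. L x j = (if j = j0 then complex_of_real (cmod (x j0)) else x j)"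
      using phase[of j0 x] j0 x by auto
    then show ?case by (intro exI[of _ L]) auto
  next
    case (insert j1 S)
    then obtain L where L: "row_map L" "\<And>j. j \<in> A \<Longrightarrow> L x j = (if j = j0 then complex_of_real (sqrt (\<Sum>j\<in>insert j0 S. (cmod (x j))\<^sup>2)) else if j \<in> S then 0 else x j)"
      by auto
    have j1: "j1 \<in> A" "j1 \<noteq> j0" "j1 \<notin> S" using insert by auto
    have Lj1: "L x j1 = x j1" using L(2)[OF j1(1)] j1 by simp
    obtain K where K: "row_map K" "\<And>j. K (L x) j = (if j = j1 then complex_of_real (cmod (x j1)) else L x j)"
      using phase[of j1 "L x"] j1 x Lj1 by auto
    define p q where "p = sqrt (\<Sum>j\<in>insert j0 S. (cmod (x j))\<^sup>2)" and "q = cmod (x j1)"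
    define r where "r = sqrt (\<Sum>j\<in>insert j0 (insert j1 S). (cmod (x j))\<^sup>2)"
    have p0: "0 \<le> p" unfolding p_def by (intro real_sqrt_ge_zero sum_nonneg) auto
    have pp: "p\<^sup>2 = (\<Sum>j\<in>insert j0 S. (cmod (x j))\<^sup>2)" unfolding p_def by (intro real_sqrt_pow2 sum_nonneg) auto
    have rr: "r\<^sup>2 = p\<^sup>2 + q\<^sup>2"
    proof -
      have "r\<^sup>2 = (\<Sum>j\<in>insert j0 (insert j1 S). (cmod (x j))\<^sup>2)" unfolding r_def by (intro real_sqrt_pow2 sum_nonneg) auto
      also have "insert j0 (insert j1 S) = insert j1 (insert j0 S)" by auto
      also have "(\<Sum>j\<in>insert j1 (insert j0 S). (cmod (x j))\<^sup>2) = q\<^sup>2 + p\<^sup>2"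
        unfolding pp q_def using j1 insert.hyps by (subst sum.insert) auto
      finally show ?thesis by simp
    qed
    have vals: "K (L x) j0 = complex_of_real p" "K (L x) j1 = complex_of_real q"
      "\<And>j. j \<in> A \<Longrightarrow> j \<noteq> j0 \<Longrightarrow> j \<noteq> j1 \<Longrightarrow> K (L x) j = (if j \<in> S then 0 else x j)"
      using K(2) L(2) j0 j1 by (auto simp: p_def q_def)
    show ?case
    proof (cases "r = 0")
      case True
      then have "p = 0" "q = 0" using rr by (auto simp: sum_power2_eq_zero_iff)
      have "K (L x) j = (if j = j0 then complex_of_real r else if j \<in> insert j1 S then 0 else x j)" if "j \<in> A" for j
        using vals(1,2) vals(3)[OF that] True \<open>p = 0\<close> \<open>q = 0\<close> j1 by (cases "j = j0"; cases "j = j1") auto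
      then show ?thesis unfolding r_def
        by (intro exI[of _ "\<lambda>x. K (L x)"] conjI row_map_comp[OF K(1) L(1)]) blast
    next
      case False
      \<comment> \<open>The rotation that takes the pair \<open>(p, q)\<close> to
        \<open>(r, 0)\<close>.\<close>
      define c s where "c = p / r" and "s = - q / r"
      have cs: "c\<^sup>2 + s\<^sup>2 = 1" using False by (simp add: c_def s_def power_divide add_divide_distrib[symmetric] rr[symmetric])
      have e0: "c * p - s * q = r" "s * p + c * q = 0"
        using False rr by (simp_all add: c_def s_def field_simps power2_eq_square)
      define G where "G = (\<lambda>x::nat \<Rightarrow> complex. x(j0 := complex_of_real c * x j0 - complex_of_real s * x j1, j1 := complex_of_real s * x j0 + complex_of_real c * x j1))"
      have G: "row_map G" unfolding G_def by (rule row_map_givens[OF j0 j1(1) j1(2)[symmetric] cs])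
      have "G (K (L x)) j0 = complex_of_real r" "G (K (L x)) j1 = 0"
        using j1(2) unfolding G_def vals e0(1)[symmetric]
        by (simp_all flip: of_real_mult of_real_diff of_real_add add: e0)
      moreover have "G (K (L x)) j = (if j \<in> S then 0 else x j)" if "j \<in> A" "j \<noteq> j0" "j \<noteq> j1" for j
        using that vals(3) by (simp add: G_def)
      ultimately have "G (K (L x)) j = (if j = j0 then complex_of_real r else if j \<in> insert j1 S then 0 else x j)" if "j \<in> A" for j
        using that j1 by (cases "j = j0"; cases "j = j1") auto
      then show ?thesis unfolding r_def
        by (intro exI[of _ "\<lambda>x. G (K (L x))"] conjI row_map_comp[OF G row_map_comp[OF K(1) L(1)]]) blast
    qed
  qed
  from this[of "A - {j0}"] show ?thesis using A j0 by (auto simp: insert_absorb)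
qed

end

context gauss_rows
begin

definition extend_map :: "((nat \<Rightarrow> complex) \<Rightarrow> nat \<Rightarrow> complex) \<Rightarrow> (nat \<Rightarrow> complex) \<Rightarrow> nat \<Rightarrow> complex" where
  "extend_map L v i = (if i \<in> A then L v i else v i)"

lemma row_map_cong:
  assumes "row_map L" "\<And>i. i \<in> A \<Longrightarrow> x i = y i" "j \<in> A"
  shows "L x j = L y j"
proof -
  obtain Q where "\<And>x j. j \<in> A \<Longrightarrow> L x j = (\<Sum>i\<in>A. x i * Q i j)" using assms(1) by (auto simp: row_map_def)
  then show ?thesis using assms by simp
qed

lemma row_map_zero: "row_map L \<Longrightarrow> (\<And>i. i \<in> A \<Longrightarrow> x i = 0) \<Longrightarrow> j \<in> A \<Longrightarrow> L x j = 0"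
  unfolding row_map_def by auto

lemma extend_inner:
  assumes "row_map L" "A \<subseteq> {..<N}"
  shows "(\<Sum>j<N. extend_map L x j * cnj (extend_map L y j)) = (\<Sum>j<N. x j * cnj (y j))"
proof -
  have d: "(\<Sum>j<N. f j) = (\<Sum>j\<in>A. f j) + (\<Sum>j\<in>{..<N} - A. f j)" for f :: "nat \<Rightarrow> complex"
    using sum.subset_diff[OF assms(2), of f] by (simp add: add.commute)
  have "(\<Sum>j\<in>A. L x j * cnj (L y j)) = (\<Sum>j\<in>A. x j * cnj (y j))" using assms(1) by (simp add: row_map_def)
  then show ?thesis unfolding d by (simp add: extend_map_def)
qed

definition row_mat :: "((nat \<Rightarrow> complex) \<Rightarrow> nat \<Rightarrow> complex) \<Rightarrow> nat \<Rightarrow> complex mat" where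
  "row_mat L n = mat n n (\<lambda>(i, i'). extend_map L (\<lambda>t. if t = i' then 1 else 0) i)"

lemma extend_linear:
  assumes "row_map L" "A \<subseteq> {..<n}" "i < n"
  shows "(\<Sum>t<n. extend_map L (\<lambda>s. if s = t then 1 else 0) i * v t) = extend_map L v i"
proof (cases "i \<in> A")
  case True
  obtain Q where Q: "\<And>x j. j \<in> A \<Longrightarrow> L x j = (\<Sum>i\<in>A. x i * Q i j)" using assms(1) by (auto simp: row_map_def)
  have "(\<Sum>t<n. L (\<lambda>s. if s = t then 1 else 0) i * v t) = (\<Sum>t<n. if t \<in> A then v t * Q t i else 0)"
    using A True by (intro sum.cong refl) (auto simp: Q if_distrib[of "\<lambda>c. c * _"] cong: if_cong)
  also have "\<dots> = (\<Sum>t\<in>A. v t * Q t i)"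
    using assms(2) by (intro sum.mono_neutral_cong_right) auto
  finally show ?thesis using True by (simp add: extend_map_def Q)
next
  case False
  then show ?thesis using assms(3) by (simp add: extend_map_def if_distrib[of "\<lambda>c. c * _"] cong: if_cong)
qed

lemma row_mat_unitary:
  assumes "row_map L" "A \<subseteq> {..<n}"
  shows "unitary_mat n (row_mat L n)"
proof (rule unitary_matI)
  show c: "row_mat L n \<in> carrier_mat n n" by (simp add: row_mat_def)
  show "adjoint_mat (row_mat L n) * row_mat L n = 1\<^sub>m n"
  proof (rule eq_matI)
    fix i j assume "i < dim_row (1\<^sub>m n :: complex mat)" "j < dim_col (1\<^sub>m n :: complex mat)"
    then have ij: "i < n" "j < n" by auto
    have "(adjoint_mat (row_mat L n) * row_mat L n) $$ (i, j) = (\<Sum>t<n. adjoint_mat (row_mat L n) $$ (i, t) * row_mat L n $$ (t, j))"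
      by (rule mat_mult_index[OF adjoint_mat_carrier[OF c] c ij])
    also have "\<dots> = (\<Sum>t<n. extend_map L (\<lambda>s. if s = j then 1 else 0) t * cnj (extend_map L (\<lambda>s. if s = i then 1 else 0) t))"
      using ij by (intro sum.cong refl) (simp add: row_mat_def mult.commute)
    also have "\<dots> = (\<Sum>t<n. (if t = j then 1 else 0) * cnj (if t = i then 1 else 0))"
      by (rule extend_inner[OF assms])
    also have "\<dots> = (if i = j then 1 else 0)"
      using ij by (simp add: if_distrib[of "\<lambda>c. c * _"] cong: if_cong)
    finally show "(adjoint_mat (row_mat L n) * row_mat L n) $$ (i, j) = 1\<^sub>m n $$ (i, j)" using ij by simp
  qed (use c in auto)
qed

lemma row_mat_vec:
  assumes "row_map L" "A \<subseteq> {..<n}"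
  shows "row_mat L n *\<^sub>v vec n v = vec n (extend_map L v)"
proof (rule eq_vecI)
  fix i assume "i < dim_vec (vec n (extend_map L v))"
  then have i: "i < n" by simp
  have c: "row_mat L n \<in> carrier_mat n n" by (simp add: row_mat_def)
  have "(row_mat L n *\<^sub>v vec n v) $ i = (\<Sum>t<n. row_mat L n $$ (i, t) * vec n v $ t)"
    by (rule mat_vec_index[OF c _ i]) simp
  also have "\<dots> = extend_map L v i" using extend_linear[OF assms i, of v] i by (simp add: row_mat_def)
  finally show "(row_mat L n *\<^sub>v vec n v) $ i = vec n (extend_map L v) $ i" using i by simp
qed (simp add: row_mat_def)

lemma row_mat_mult:
  assumes "row_map L" "A \<subseteq> {..<n}"
  shows "row_mat L n * mat n m (\<lambda>(i, j). M i j) = mat n m (\<lambda>(i, j). extend_map L (\<lambda>i. M i j) i)"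
proof (rule eq_matI)
  fix i j assume "i < dim_row (mat n m (\<lambda>(i, j). extend_map L (\<lambda>i. M i j) i))" "j < dim_col (mat n m (\<lambda>(i, j). extend_map L (\<lambda>i. M i j) i))"
  then have ij: "i < n" "j < m" by auto
  have c: "row_mat L n \<in> carrier_mat n n" by (simp add: row_mat_def)
  have "(row_mat L n * mat n m (\<lambda>(i, j). M i j)) $$ (i, j) = (\<Sum>t<n. row_mat L n $$ (i, t) * mat n m (\<lambda>(i, j). M i j) $$ (t, j))"
    by (rule mat_mult_index[OF c _ ij]) simp
  also have "\<dots> = extend_map L (\<lambda>i. M i j) i" using extend_linear[OF assms ij(1), of "\<lambda>i. M i j"] ij by (simp add: row_mat_def)
  finally show "(row_mat L n * mat n m (\<lambda>(i, j). M i j)) $$ (i, j) = mat n m (\<lambda>(i, j). extend_map L (\<lambda>i. M i j) i) $$ (i, j)" using ij by simp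
qed (simp_all add: row_mat_def)

text \<open>Fubini with the coordinates outside \<open>idx\<close> held fixed; a new map
  \<open>T\<close> is chosen for each of their values.\<close>

lemma gauss_integral_transform:
  assumes I: "finite I" "idx \<subseteq> I"
    and f: "f \<in> borel_measurable (gauss_on I)" and g: "g \<in> borel_measurable (gauss_on I)"
    and T: "\<And>x. x \<in> space (gauss_on (I - idx)) \<Longrightarrow> \<exists>T. gauss_preserving idx T \<and>
      (\<forall>y. f (merge (I - idx) idx (x, y)) = g (merge (I - idx) idx (x, T y)))"
  shows "(\<integral>\<^sup>+w. f w \<partial>gauss_on I) = (\<integral>\<^sup>+w. g w \<partial>gauss_on I)"
proof -
  interpret product_sigma_finite "\<lambda>_. gauss" by (rule product_sigma_finite_gauss)
  have I_eq: "I = (I - idx) \<union> idx" using I by auto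
  have fold: "(\<integral>\<^sup>+w. h w \<partial>gauss_on I) = (\<integral>\<^sup>+x. \<integral>\<^sup>+y. h (merge (I - idx) idx (x, y)) \<partial>gauss_on idx \<partial>gauss_on (I - idx))"
    if "h \<in> borel_measurable (gauss_on I)" for h
    by (subst I_eq, rule product_nn_integral_fold) (use I that I_eq finite_idx in auto)
  show ?thesis unfolding fold[OF f] fold[OF g]
  proof (rule nn_integral_cong)
    fix x assume x: "x \<in> space (gauss_on (I - idx))"
    obtain T where T: "gauss_preserving idx T"
      "\<And>y. f (merge (I - idx) idx (x, y)) = g (merge (I - idx) idx (x, T y))" using T[OF x] by blast
    have "(\<lambda>y. merge (I - idx) idx (x, y)) \<in> measurable (gauss_on idx) (gauss_on ((I - idx) \<union> idx))"
      using x by (intro measurable_compose[OF _ measurable_merge] measurable_Pair) auto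
    then have "(\<lambda>y. g (merge (I - idx) idx (x, y))) \<in> borel_measurable (gauss_on idx)"
      using g I_eq by (intro measurable_compose[OF _ g]) auto
    then show "(\<integral>\<^sup>+y. f (merge (I - idx) idx (x, y)) \<partial>gauss_on idx) = (\<integral>\<^sup>+y. g (merge (I - idx) idx (x, y)) \<partial>gauss_on idx)"
      unfolding T(2) using T(1) by (auto simp: gauss_preserving_def)
  qed
qed

end

section \<open>Gram matrices and their bidiagonal reduction\<close>

lemma gram_pos_def:
  assumes M: "M \<in> carrier_mat n m" and k: "0 < \<kappa>"
    and det: "det (complex_of_real \<kappa> \<cdot>\<^sub>m (M * adjoint_mat M)) \<noteq> 0"
  shows "pos_def (complex_of_real \<kappa> \<cdot>\<^sub>m (M * adjoint_mat M))"
proof -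
  let ?A = "complex_of_real \<kappa> \<cdot>\<^sub>m (M * adjoint_mat M)"
  have MM: "M * adjoint_mat M \<in> carrier_mat n n" using M by (intro mult_carrier_mat[OF M]) simp
  then have A: "?A \<in> carrier_mat n n" by simp
  have herm: "adjoint_mat ?A = ?A"
  proof -
    have "adjoint_mat (M * adjoint_mat M) = M * adjoint_mat M"
      using adjoint_mat_mult[OF M adjoint_mat_carrier[OF M]] by simp
    then have "cnj ((M * adjoint_mat M) $$ (j, i)) = (M * adjoint_mat M) $$ (i, j)" if "i < n" "j < n" for i j
      using that MM adjoint_mat_index[of i "M * adjoint_mat M" j] by auto
    then show ?thesis using MM by (intro eq_matI) auto
  qed
  have q: "Re ((?A *\<^sub>v v) \<bullet>c v) = \<kappa> * (\<Sum>j<m. (cmod ((adjoint_mat M *\<^sub>v v) $ j))\<^sup>2)"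
    and Av: "?A *\<^sub>v v = complex_of_real \<kappa> \<cdot>\<^sub>v (M *\<^sub>v (adjoint_mat M *\<^sub>v v))" if v: "v \<in> carrier_vec n" for v
  proof -
    have Mv: "adjoint_mat M *\<^sub>v v \<in> carrier_vec m" using mult_mat_vec_carrier[OF adjoint_mat_carrier[OF M] v] .
    have MMv: "M *\<^sub>v (adjoint_mat M *\<^sub>v v) \<in> carrier_vec n" using mult_mat_vec_carrier[OF M Mv] .
    show av: "?A *\<^sub>v v = complex_of_real \<kappa> \<cdot>\<^sub>v (M *\<^sub>v (adjoint_mat M *\<^sub>v v))"
    proof (rule eq_vecI)
      fix i assume "i < dim_vec (complex_of_real \<kappa> \<cdot>\<^sub>v (M *\<^sub>v (adjoint_mat M *\<^sub>v v)))"
      then have i: "i < n" using carrier_vecD[OF MMv] by simp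
      have "(?A *\<^sub>v v) $ i = complex_of_real \<kappa> * ((M * adjoint_mat M) *\<^sub>v v) $ i"
        unfolding mat_vec_index[OF A v i] mat_vec_index[OF MM v i] sum_distrib_left
        using carrier_matD[OF MM] i by (intro sum.cong refl) (simp add: index_smult_mat mult.assoc del: index_mult_mat)
      then show "(?A *\<^sub>v v) $ i = (complex_of_real \<kappa> \<cdot>\<^sub>v (M *\<^sub>v (adjoint_mat M *\<^sub>v v))) $ i"
        unfolding assoc_mult_mat_vec[OF M adjoint_mat_carrier[OF M] v] using carrier_matD[OF M] i by simp
    qed (use MMv A in auto)
    have "(?A *\<^sub>v v) \<bullet>c v = complex_of_real \<kappa> * ((M *\<^sub>v (adjoint_mat M *\<^sub>v v)) \<bullet>c v)"
      unfolding av cscalar_prod_sum[OF v] sum_distrib_left using carrier_matD[OF M]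
      by (intro sum.cong refl) (auto simp: mult.assoc simp del: index_mult_mat_vec)
    also have "(M *\<^sub>v (adjoint_mat M *\<^sub>v v)) \<bullet>c v = (adjoint_mat M *\<^sub>v v) \<bullet>c (adjoint_mat M *\<^sub>v v)"
      by (rule cscalar_adjoint[OF M Mv v])
    also have "\<dots> = complex_of_real (\<Sum>j<m. (cmod ((adjoint_mat M *\<^sub>v v) $ j))\<^sup>2)"
      unfolding cscalar_prod_sum[OF Mv] by (simp only: of_real_sum complex_norm_square)
    finally show "Re ((?A *\<^sub>v v) \<bullet>c v) = \<kappa> * (\<Sum>j<m. (cmod ((adjoint_mat M *\<^sub>v v) $ j))\<^sup>2)"
      by (simp flip: of_real_mult)
  qed
  show ?thesis unfolding pos_def_def
  proof (intro conjI herm ballI impI)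
    fix v :: "complex vec" assume "v \<in> carrier_vec (dim_row ?A)" and v0: "v \<noteq> 0\<^sub>v (dim_row ?A)"
    then have v: "v \<in> carrier_vec n" "v \<noteq> 0\<^sub>v n" using A by auto
    have Mv: "adjoint_mat M *\<^sub>v v \<in> carrier_vec m" using mult_mat_vec_carrier[OF adjoint_mat_carrier[OF M] v(1)] .
    have "(\<Sum>j<m. (cmod ((adjoint_mat M *\<^sub>v v) $ j))\<^sup>2) \<noteq> 0"
    proof
      assume "(\<Sum>j<m. (cmod ((adjoint_mat M *\<^sub>v v) $ j))\<^sup>2) = 0"
      then have "(adjoint_mat M *\<^sub>v v) $ j = 0" if "j < m" for j
        using that by (subst (asm) sum_nonneg_eq_0_iff) auto
      then have "adjoint_mat M *\<^sub>v v = 0\<^sub>v m" using carrier_matD[OF M] by (intro eq_vecI) (auto simp del: index_mult_mat_vec)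
      then have "?A *\<^sub>v v = 0\<^sub>v n" unfolding Av[OF v(1)] using M by (intro eq_vecI) (auto simp: scalar_prod_def)
      then have "det ?A = 0" using det_0_iff_vec_prod_zero_field[OF A] v by blast
      then show False using det by simp
    qed
    moreover have "0 \<le> (\<Sum>j<m. (cmod ((adjoint_mat M *\<^sub>v v) $ j))\<^sup>2)" by (intro sum_nonneg) auto
    ultimately show "0 < Re ((?A *\<^sub>v v) \<bullet>c v)" unfolding q[OF v(1)] using k by simp
  qed
qed

lemma gauss_entry_scalars: "\<beta> \<in> {1, 2} \<Longrightarrow> gauss_entry \<beta> w ij \<in> scalars \<beta>"
  by (auto simp: gauss_entry_def scalars_def complex_is_Real_iff)

locale gauss_gram =
  fixes \<beta> n m :: nat and \<kappa> :: real
  assumes beta: "\<beta> \<in> {1, 2}" and n: "0 < n" "n \<le> m" and kappa: "0 < \<kappa>"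
begin

definition I :: "(nat \<times> nat \<times> nat) set" where "I = {..<\<beta>} \<times> {..<n} \<times> {..<m}"

text \<open>The entries are the original Gaussian ones. The steps before step \<open>r\<close>
  change the remaining block only by measure-preserving maps, so in law the original entries may
  stand for the transformed ones.\<close>

definition row_sq :: "(nat \<times> nat \<times> nat \<Rightarrow> real) \<Rightarrow> nat \<Rightarrow> real" where
  "row_sq w r = (\<Sum>q\<in>{..<\<beta>} \<times> {r} \<times> {r..<m}. (w q)\<^sup>2)"

definition col_sq :: "(nat \<times> nat \<times> nat \<Rightarrow> real) \<Rightarrow> nat \<Rightarrow> real" where
  "col_sq w r = (\<Sum>q\<in>{..<\<beta>} \<times> {r<..<n} \<times> {r}. (w q)\<^sup>2)"

lemma row_sq_nonneg: "0 \<le> row_sq w r" and col_sq_nonneg: "0 \<le> col_sq w r"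
  unfolding row_sq_def col_sq_def by (auto intro: sum_nonneg)

lemma cmod_gauss_entry: "(cmod (gauss_entry \<beta> w ij))\<^sup>2 = (\<Sum>p<\<beta>. (w (p, ij))\<^sup>2)"
proof -
  have two: "{..<2::nat} = {0, 1}" by auto
  consider "\<beta> = 1" | "\<beta> = 2" using beta by auto
  then show ?thesis
  proof cases
    case 1
    then show ?thesis by (simp add: gauss_entry_def cmod_power2)
  next
    case 2
    show ?thesis unfolding 2 two by (simp add: gauss_entry_def cmod_power2)
  qed
qed

lemma row_sq_eq: "row_sq w r = (\<Sum>j\<in>{r..<m}. (cmod (gauss_entry \<beta> w (r, j)))\<^sup>2)"
proof -
  have "row_sq w r = (\<Sum>p<\<beta>. \<Sum>j\<in>{r..<m}. (w (p, r, j))\<^sup>2)"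
    unfolding row_sq_def sum.cartesian_product by (rule sum.reindex_bij_witness[of _ "\<lambda>(p, j). (p, r, j)" "\<lambda>(p, i, j). (p, j)"]) auto
  then show ?thesis unfolding cmod_gauss_entry by (subst sum.swap) simp
qed

lemma col_sq_eq: "col_sq w r = (\<Sum>i\<in>{r<..<n}. (cmod (gauss_entry \<beta> w (i, r)))\<^sup>2)"
proof -
  have "col_sq w r = (\<Sum>p<\<beta>. \<Sum>i\<in>{r<..<n}. (w (p, i, r))\<^sup>2)"
    unfolding col_sq_def sum.cartesian_product by (rule sum.reindex_bij_witness[of _ "\<lambda>(p, j). (p, j, r)" "\<lambda>(p, i, j). (p, i)"]) auto
  then show ?thesis unfolding cmod_gauss_entry by (subst sum.swap) simp
qed

text \<open>The Gaussian matrix after \<open>r\<close> bidiagonalization steps; in \<open>red' r\<close> row \<open>r\<close> is already reduced, too.\<close>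

definition red :: "nat \<Rightarrow> (nat \<times> nat \<times> nat \<Rightarrow> real) \<Rightarrow> nat \<Rightarrow> nat \<Rightarrow> complex" where
  "red r w i j = (if j < r then (if i = j then complex_of_real (sqrt (row_sq w j))
       else if i = Suc j then complex_of_real (sqrt (col_sq w j)) else 0)
     else if i < r then 0 else gauss_entry \<beta> w (i, j))"

definition red' :: "nat \<Rightarrow> (nat \<times> nat \<times> nat \<Rightarrow> real) \<Rightarrow> nat \<Rightarrow> nat \<Rightarrow> complex" where
  "red' r w i j = (if i = r \<and> r \<le> j then (if j = r then complex_of_real (sqrt (row_sq w r)) else 0) else red r w i j)"

definition gram :: "(nat \<Rightarrow> nat \<Rightarrow> complex) \<Rightarrow> complex mat" where
  "gram M = complex_of_real \<kappa> \<cdot>\<^sub>m (mat n m (\<lambda>(i, j). M i j) * adjoint_mat (mat n m (\<lambda>(i, j). M i j)))"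

lemma gram_carrier: "gram M \<in> carrier_mat n n"
  unfolding gram_def by (intro smult_carrier_mat mult_carrier_mat[of _ n m]) auto

lemma gram_index:
  assumes "i < n" "i' < n"
  shows "gram M $$ (i, i') = complex_of_real \<kappa> * (\<Sum>j<m. M i j * cnj (M i' j))"
proof -
  let ?M = "mat n m (\<lambda>(i, j). M i j)"
  have c: "?M \<in> carrier_mat n m" by simp
  have "(?M * adjoint_mat ?M) $$ (i, i') = (\<Sum>j<m. M i j * cnj (M i' j))"
    using assms by (subst mat_mult_index[OF c adjoint_mat_carrier[OF c]]) auto
  moreover have "?M * adjoint_mat ?M \<in> carrier_mat n n" by (rule mult_carrier_mat[OF c]) simp
  ultimately show ?thesis using assms unfolding gram_def by simp
qed

lemma gram_scalars:
  assumes "\<And>i j. i < n \<Longrightarrow> j < m \<Longrightarrow> M i j \<in> scalars \<beta>" "i < n" "i' < n"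
  shows "gram M $$ (i, i') \<in> scalars \<beta>"
  unfolding gram_index[OF assms(2,3)] using assms by (intro scalars_closed scalars_sum) auto

lemma gram_unitary:
  assumes U: "U \<in> carrier_mat n n" and UM: "U * mat n m (\<lambda>(i, j). M i j) = mat n m (\<lambda>(i, j). N i j)"
  shows "gram N = U * gram M * adjoint_mat U"
proof -
  let ?M = "mat n m (\<lambda>(i, j). M i j)"
  have c: "?M \<in> carrier_mat n m" "adjoint_mat ?M \<in> carrier_mat m n" "adjoint_mat U \<in> carrier_mat n n" using U by auto
  have MM: "?M * adjoint_mat ?M \<in> carrier_mat n n" by (rule mult_carrier_mat[OF c(1,2)])
  have "gram N = complex_of_real \<kappa> \<cdot>\<^sub>m ((U * ?M) * (adjoint_mat ?M * adjoint_mat U))"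
    unfolding gram_def UM[symmetric] adjoint_mat_mult[OF U c(1)] ..
  also have "(U * ?M) * (adjoint_mat ?M * adjoint_mat U) = U * (?M * (adjoint_mat ?M * adjoint_mat U))"
    by (rule assoc_mult_mat[OF U c(1) mult_carrier_mat[OF c(2,3)]])
  also have "?M * (adjoint_mat ?M * adjoint_mat U) = ?M * adjoint_mat ?M * adjoint_mat U"
    by (rule assoc_mult_mat[OF c(1,2,3), symmetric])
  also have "U * (?M * adjoint_mat ?M * adjoint_mat U) = U * (?M * adjoint_mat ?M) * adjoint_mat U"
    by (rule assoc_mult_mat[OF U MM c(3), symmetric])
  also have "complex_of_real \<kappa> \<cdot>\<^sub>m (U * (?M * adjoint_mat ?M) * adjoint_mat U) = U * gram M * adjoint_mat U"
    unfolding gram_def mult_smult_distrib[OF U MM]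
    by (rule mult_smult_assoc_mat[OF mult_carrier_mat[OF U MM] c(3), symmetric])
  finally show ?thesis .
qed

lemma gram_right:
  assumes "\<And>i i'. i < n \<Longrightarrow> i' < n \<Longrightarrow> (\<Sum>j<m. M i j * cnj (M i' j)) = (\<Sum>j<m. N i j * cnj (N i' j))"
  shows "gram M = gram N"
  by (rule eq_matI) (simp_all add: carrier_matD[OF gram_carrier] gram_index assms)

lemma gram_pd: "det (gram M) \<noteq> 0 \<Longrightarrow> pos_def (gram M)"
  unfolding gram_def by (rule gram_pos_def[OF _ kappa]) auto

lemma finite_I: "finite I" by (simp add: I_def)

lemma coord_measurable: "q \<in> I \<Longrightarrow> (\<lambda>w. w q) \<in> borel_measurable (gauss_on I)"
  using measurable_component_singleton[of q I "\<lambda>_. gauss"] by (simp cong: measurable_cong_sets)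

lemma row_sq_measurable: "r < n \<Longrightarrow> (\<lambda>w. row_sq w r) \<in> borel_measurable (gauss_on I)"
  unfolding row_sq_def by (intro borel_measurable_sum borel_measurable_power coord_measurable) (auto simp: I_def)

lemma col_sq_measurable: "r < n \<Longrightarrow> (\<lambda>w. col_sq w r) \<in> borel_measurable (gauss_on I)"
  unfolding col_sq_def using n by (intro borel_measurable_sum borel_measurable_power coord_measurable) (auto simp: I_def)

lemma gauss_entry_measurable:
  assumes "i < n" "j < m"
  shows "(\<lambda>w. gauss_entry \<beta> w (i, j)) \<in> borel_measurable (gauss_on I)"
proof -
  have [measurable]: "(\<lambda>w. w (0, i, j)) \<in> borel_measurable (gauss_on I)"
    by (rule coord_measurable) (use assms beta in \<open>auto simp: I_def\<close>)
  have eq: "gauss_entry \<beta> w (i, j) = complex_of_real (w (0, i, j)) + \<i> * complex_of_real (if \<beta> = 2 then w (1, i, j) else 0)" for w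
    by (simp add: gauss_entry_def complex_eq_iff)
  show ?thesis
  proof (cases "\<beta> = 2")
    case True
    have [measurable]: "(\<lambda>w. w (1, i, j)) \<in> borel_measurable (gauss_on I)"
      by (rule coord_measurable, unfold I_def) (use assms True in auto)
    have "(if \<beta> = 2 then w (1, i, j) else 0) = w (1, i, j)" for w :: "nat \<times> nat \<times> nat \<Rightarrow> real"
      using True by simp
    then show ?thesis unfolding eq by (simp only:) measurable
  next
    case False
    then show ?thesis unfolding eq by simp
  qed
qed

lemma red_measurable: "r \<le> n \<Longrightarrow> i < n \<Longrightarrow> j < m \<Longrightarrow> (\<lambda>w. red r w i j) \<in> borel_measurable (gauss_on I)"
  unfolding red_def using row_sq_measurable[of j] col_sq_measurable[of j] gauss_entry_measurable[of i j]
  by (cases "j < r"; cases "i = j"; cases "i = Suc j"; cases "i < r") auto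

lemma red'_measurable: "r < n \<Longrightarrow> i < n \<Longrightarrow> j < m \<Longrightarrow> (\<lambda>w. red' r w i j) \<in> borel_measurable (gauss_on I)"
  unfolding red'_def using red_measurable[of r i j] row_sq_measurable[of r]
  by (cases "i = r \<and> r \<le> j"; cases "j = r") auto

lemma red_scalars: "red r w i j \<in> scalars \<beta>"
  unfolding red_def using gauss_entry_scalars[OF beta] scalars_closed by auto

lemma red'_scalars: "red' r w i j \<in> scalars \<beta>"
  unfolding red'_def using red_scalars scalars_closed by auto

lemma meas_gram:
  assumes "\<And>i j. i < n \<Longrightarrow> j < m \<Longrightarrow> (\<lambda>w. M w i j) \<in> borel_measurable N"
  shows "meas_mat N (\<lambda>w. gram (M w)) n n"
proof -
  have "(\<lambda>w. cnj (M w i j)) \<in> borel_measurable N" if "i < n" "j < m" for i j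
    using measurable_compose[OF assms[OF that] borel_measurable_continuous_onI[of cnj]]
    by (simp add: continuous_on_cnj)
  then show ?thesis unfolding meas_mat_def using gram_carrier assms
    by (auto simp: gram_index intro!: borel_measurable_times borel_measurable_sum)
qed

lemma cg_gram_formula:
  assumes "\<And>i j. i < n \<Longrightarrow> j < m \<Longrightarrow> M i j \<in> scalars \<beta>" "b \<in> carrier_vec n" "\<And>i. i < n \<Longrightarrow> b $ i \<in> scalars \<beta>"
  shows "cg_error_norm \<beta> l (gram M) b k = cg_formula l k n (gram M) b"
  by (rule cg_error_norm_formula[OF gram_carrier assms(2) _ assms(3)])
    (use assms gram_scalars gram_pd in auto)

lemma cg_gram_measurable:
  assumes "\<And>i j. i < n \<Longrightarrow> j < m \<Longrightarrow> (\<lambda>w. M w i j) \<in> borel_measurable N"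
    "\<And>w i j. i < n \<Longrightarrow> j < m \<Longrightarrow> M w i j \<in> scalars \<beta>" "b \<in> carrier_vec n" "\<And>i. i < n \<Longrightarrow> b $ i \<in> scalars \<beta>"
  shows "(\<lambda>w. cg_error_norm \<beta> l (gram (M w)) b k) \<in> borel_measurable N"
proof -
  have "meas_vec N (\<lambda>_. b) n" using assms by (simp add: meas_vec_def)
  then have "(\<lambda>w. cg_formula l k n (gram (M w)) b) \<in> borel_measurable N"
    by (intro meas_cg_formula meas_gram assms(1))
  then show ?thesis using cg_gram_formula[OF assms(2,3,4)] by simp
qed

abbreviation e1 :: "complex vec" where "e1 \<equiv> unit_vec n 0"

lemma e1: "e1 \<in> carrier_vec n" "\<And>i. i < n \<Longrightarrow> e1 $ i \<in> scalars \<beta>"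
  using scalars_closed(1,2) by (auto simp: unit_vec_def)

lemma merge_in: "q \<in> J \<Longrightarrow> q \<notin> I - J \<Longrightarrow> merge (I - J) J (x, y) q = y q"
  and merge_out: "q \<in> I \<Longrightarrow> q \<notin> J \<Longrightarrow> merge (I - J) J (x, y) q = x q"
  by (simp_all add: merge_def)

lemma gauss_entry_cong: "(\<And>p. p < \<beta> \<Longrightarrow> w (p, ij) = w' (p, ij)) \<Longrightarrow> gauss_entry \<beta> w ij = gauss_entry \<beta> w' ij"
  using beta by (auto simp: gauss_entry_def)

text \<open>With row \<open>r\<close> frozen, an isometry of the columns from \<open>r\<close> on
  collapses it into its diagonal position. In these columns the rows above are zero and stay zero,
  while the rows below keep their Gaussian law; multiplication from the right does not change the
  Gram matrix.\<close>

lemma step_right: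
  assumes r: "r < n" and H: "H \<in> borel_measurable (borel :: real measure)"
  shows "(\<integral>\<^sup>+w. H (cg_error_norm \<beta> l (gram (red r w)) e1 k) \<partial>gauss_on I)
     = (\<integral>\<^sup>+w. (H (cg_error_norm \<beta> l (gram (red' r w)) e1 k) :: ennreal) \<partial>gauss_on I)"
proof -
  interpret G: gauss_rows \<beta> "{r<..<n}" "{r..<m}" Pair
    using beta by unfold_locales auto
  have idx: "G.idx = {..<\<beta>} \<times> {r<..<n} \<times> {r..<m}" by (auto simp: G.idx_def image_iff)
  show ?thesis
  proof (rule G.gauss_integral_transform[OF finite_I])
    show "G.idx \<subseteq> I" by (auto simp: idx I_def)
    show "(\<lambda>w. H (cg_error_norm \<beta> l (gram (red r w)) e1 k)) \<in> borel_measurable (gauss_on I)"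
      using r by (intro measurable_compose[OF _ H] cg_gram_measurable red_measurable red_scalars e1) auto
    show "(\<lambda>w. H (cg_error_norm \<beta> l (gram (red' r w)) e1 k)) \<in> borel_measurable (gauss_on I)"
      using r by (intro measurable_compose[OF _ H] cg_gram_measurable red'_measurable red'_scalars e1) auto
    fix x assume "x \<in> space (gauss_on (I - G.idx))"
    define xr where "xr j = gauss_entry \<beta> x (r, j)" for j
    obtain L where L: "G.row_map L"
      "\<And>j. j \<in> {r..<m} \<Longrightarrow> L xr j = (if j = r then complex_of_real (sqrt (\<Sum>j\<in>{r..<m}. (cmod (xr j))\<^sup>2)) else 0)"
      using G.row_map_collapse[of r xr] r n gauss_entry_scalars[OF beta] unfolding xr_def by auto
    obtain T where T: "gauss_preserving G.idx T"
      "\<And>w t j. t \<in> {r<..<n} \<Longrightarrow> j \<in> {r..<m} \<Longrightarrow> gauss_entry \<beta> (T w) (t, j) = L (\<lambda>j. gauss_entry \<beta> w (t, j)) j"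
      using L(1) unfolding G.row_map_def by blast
    define mg where "mg y = merge (I - G.idx) G.idx (x, y)" for y
    have out: "mg y (p, i, j) = x (p, i, j)" if "p < \<beta>" "i < n" "j < m" "i \<le> r \<or> j < r" for y p i j
      unfolding mg_def using that by (intro merge_out) (auto simp: I_def idx)
    have inn: "mg y (p, i, j) = y (p, i, j)" if "p < \<beta>" "r < i" "i < n" "r \<le> j" "j < m" for y p i j
      unfolding mg_def using that by (intro merge_in) (auto simp: I_def idx)
    have rowx: "row_sq (mg y) i = row_sq x i" if "i \<le> r" for y i
      unfolding row_sq_def using that r by (intro sum.cong refl) (auto simp: out)
    have colx: "col_sq (mg y) i = col_sq x i" if "i < r" for y i
      unfolding col_sq_def using that r n by (intro sum.cong refl) (auto simp: out)
    have gx: "gauss_entry \<beta> (mg y) (i, j) = gauss_entry \<beta> x (i, j)" if "i < n" "j < m" "i \<le> r \<or> j < r" for y i j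
      by (rule gauss_entry_cong) (use out that in auto)
    have gy: "gauss_entry \<beta> (mg y) (i, j) = gauss_entry \<beta> y (i, j)" if "r < i" "i < n" "r \<le> j" "j < m" for y i j
      by (rule gauss_entry_cong) (use inn that in auto)
    have key: "red' r (mg (T y)) i j = G.extend_map L (red r (mg y) i) j" if ij: "i < n" "j < m" for y i j
    proof (cases "j < r")
      case True
      then show ?thesis using ij r by (simp add: red'_def red_def G.extend_map_def rowx colx)
    next
      case jr: False
      then have jA: "j \<in> {r..<m}" using ij by simp
      consider "i < r" | "i = r" | "r < i" by linarith
      then show ?thesis
      proof cases
        case 1
        then have "L (red r (mg y) i) j = 0"
          by (intro G.row_map_zero[OF L(1) _ jA]) (auto simp: red_def)
        then show ?thesis using 1 jr jA by (simp add: red'_def red_def G.extend_map_def)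
      next
        case 2
        have "L (red r (mg y) i) j = L xr j"
          by (rule G.row_map_cong[OF L(1) _ jA]) (use 2 gx r in \<open>auto simp: red_def xr_def\<close>)
        then show ?thesis using 2 jr jA L(2)[OF jA]
          using rowx[of r] by (simp add: red'_def G.extend_map_def row_sq_eq[of x] xr_def)
      next
        case 3
        have "L (red r (mg y) i) j = L (\<lambda>j. gauss_entry \<beta> y (i, j)) j"
          by (rule G.row_map_cong[OF L(1) _ jA]) (use 3 gy ij in \<open>auto simp: red_def\<close>)
        then show ?thesis using 3 jr jA T(2)[of i j y] ij gy[of i j "T y"]
          by (simp add: red'_def red_def G.extend_map_def)
      qed
    qed
    have "gram (red r (mg y)) = gram (red' r (mg (T y)))" for y
    proof (rule gram_right)
      fix i i' assume i: "i < n" "i' < n"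
      have "(\<Sum>j<m. red' r (mg (T y)) i j * cnj (red' r (mg (T y)) i' j))
         = (\<Sum>j<m. G.extend_map L (red r (mg y) i) j * cnj (G.extend_map L (red r (mg y) i') j))"
        by (rule sum.cong) (auto simp: key i)
      also have "\<dots> = (\<Sum>j<m. red r (mg y) i j * cnj (red r (mg y) i' j))"
        by (rule G.extend_inner[OF L(1)]) auto
      finally show "(\<Sum>j<m. red r (mg y) i j * cnj (red r (mg y) i' j)) =
         (\<Sum>j<m. red' r (mg (T y)) i j * cnj (red' r (mg (T y)) i' j))" by simp
    qed
    then show "\<exists>T. gauss_preserving G.idx T \<and> (\<forall>y. H (cg_error_norm \<beta> l (gram (red r (merge (I - G.idx) G.idx (x, y)))) e1 k) =
      H (cg_error_norm \<beta> l (gram (red' r (merge (I - G.idx) G.idx (x, T y)))) e1 k))"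
      using T(1) unfolding mg_def by auto
  qed
qed

text \<open>With column \<open>r\<close> frozen, an isometry of the rows below \<open>r\<close>
  collapses its lower part into row \<open>Suc r\<close>. In these rows the earlier columns are zero
  and stay zero. The Gram matrix is conjugated by a unitary matrix that fixes the first unit vector,
  because index 0 is never active.\<close>

lemma step_left:
  assumes r: "r < n" and H: "H \<in> borel_measurable (borel :: real measure)"
  shows "(\<integral>\<^sup>+w. H (cg_error_norm \<beta> l (gram (red' r w)) e1 k) \<partial>gauss_on I)
     = (\<integral>\<^sup>+w. (H (cg_error_norm \<beta> l (gram (red (Suc r) w)) e1 k) :: ennreal) \<partial>gauss_on I)"
proof (cases "Suc r = n")
  case True
  have "gram (red' r w) = gram (red (Suc r) w)" for w
    by (rule gram_right, rule sum.cong) (use True in \<open>auto simp: red'_def red_def less_Suc_eq\<close>)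
  then show ?thesis by simp
next
  case False
  interpret G: gauss_rows \<beta> "{r<..<m}" "{r<..<n}" "\<lambda>t j. (j, t)"
    using beta by unfold_locales auto
  have idx: "G.idx = {..<\<beta>} \<times> {r<..<n} \<times> {r<..<m}" by (auto simp: G.idx_def image_iff)
  show ?thesis
  proof (rule G.gauss_integral_transform[OF finite_I])
    show "G.idx \<subseteq> I" by (auto simp: idx I_def)
    show "(\<lambda>w. H (cg_error_norm \<beta> l (gram (red (Suc r) w)) e1 k)) \<in> borel_measurable (gauss_on I)"
      using r by (intro measurable_compose[OF _ H] cg_gram_measurable red_measurable red_scalars e1) auto
    show "(\<lambda>w. H (cg_error_norm \<beta> l (gram (red' r w)) e1 k)) \<in> borel_measurable (gauss_on I)"
      using r by (intro measurable_compose[OF _ H] cg_gram_measurable red'_measurable red'_scalars e1) auto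
    fix x assume "x \<in> space (gauss_on (I - G.idx))"
    define xr where "xr i = gauss_entry \<beta> x (i, r)" for i
    have sr: "Suc r \<in> {r<..<n}" using False r by auto
    obtain L where L: "G.row_map L"
      "\<And>i. i \<in> {r<..<n} \<Longrightarrow> L xr i = (if i = Suc r then complex_of_real (sqrt (\<Sum>i\<in>{r<..<n}. (cmod (xr i))\<^sup>2)) else 0)"
      using G.row_map_collapse[OF sr, of xr] gauss_entry_scalars[OF beta] unfolding xr_def by auto
    obtain T where T: "gauss_preserving G.idx T"
      "\<And>w t j. t \<in> {r<..<m} \<Longrightarrow> j \<in> {r<..<n} \<Longrightarrow> gauss_entry \<beta> (T w) (j, t) = L (\<lambda>j. gauss_entry \<beta> w (j, t)) j"
      using L(1) unfolding G.row_map_def by blast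
    define mg where "mg y = merge (I - G.idx) G.idx (x, y)" for y
    have out: "mg y (p, i, j) = x (p, i, j)" if "p < \<beta>" "i < n" "j < m" "i \<le> r \<or> j \<le> r" for y p i j
      unfolding mg_def using that by (intro merge_out) (auto simp: I_def idx)
    have inn: "mg y (p, i, j) = y (p, i, j)" if "p < \<beta>" "r < i" "i < n" "r < j" "j < m" for y p i j
      unfolding mg_def using that by (intro merge_in) (auto simp: I_def idx)
    have rowx: "row_sq (mg y) i = row_sq x i" if "i \<le> r" for y i
      unfolding row_sq_def using that r by (intro sum.cong refl) (auto simp: out)
    have colx: "col_sq (mg y) i = col_sq x i" if "i \<le> r" for y i
      unfolding col_sq_def using that r n by (intro sum.cong refl) (auto simp: out)
    have gx: "gauss_entry \<beta> (mg y) (i, j) = gauss_entry \<beta> x (i, j)" if "i < n" "j < m" "i \<le> r \<or> j \<le> r" for y i j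
      by (rule gauss_entry_cong) (use out that in auto)
    have gy: "gauss_entry \<beta> (mg y) (i, j) = gauss_entry \<beta> y (i, j)" if "r < i" "i < n" "r < j" "j < m" for y i j
      by (rule gauss_entry_cong) (use inn that in auto)
    have key: "red (Suc r) (mg (T y)) i j = G.extend_map L (\<lambda>i. red' r (mg y) i j) i" if ij: "i < n" "j < m" for y i j
    proof (cases "i \<le> r")
      case True
      then have "j < r \<or> r < j \<or> j = r" "i = j \<longrightarrow> j \<le> r" by auto
      with True show ?thesis using ij by (auto simp: red_def red'_def G.extend_map_def rowx colx less_Suc_eq)
    next
      case ir: False
      then have iA: "i \<in> {r<..<n}" using ij by simp
      consider "j < r" | "j = r" | "r < j" by linarith
      then show ?thesis
      proof cases
        case 1
        then have "L (\<lambda>i. red' r (mg y) i j) i = 0"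
          by (intro G.row_map_zero[OF L(1) _ iA]) (auto simp: red'_def red_def)
        then show ?thesis using 1 ir iA by (simp add: red_def G.extend_map_def)
      next
        case 2
        have "L (\<lambda>i. red' r (mg y) i j) i = L xr i"
          by (rule G.row_map_cong[OF L(1) _ iA]) (use 2 gx r n in \<open>auto simp: red_def red'_def xr_def\<close>)
        then show ?thesis using 2 ir iA L(2)[OF iA]
          using colx[of r] by (simp add: red_def G.extend_map_def col_sq_eq[of x] xr_def)
      next
        case 3
        have "L (\<lambda>i. red' r (mg y) i j) i = L (\<lambda>i. gauss_entry \<beta> y (i, j)) i"
          by (rule G.row_map_cong[OF L(1) _ iA]) (use 3 gy ij in \<open>auto simp: red_def red'_def\<close>)
        then show ?thesis using 3 ir iA T(2)[of j i y] ij gy[of i j "T y"]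
          by (simp add: red_def G.extend_map_def)
      qed
    qed
    define U where "U = G.row_mat L n"
    have A: "{r<..<n} \<subseteq> {..<n}" by auto
    have U: "unitary_mat n U" "U \<in> carrier_mat n n"
      unfolding U_def using G.row_mat_unitary[OF L(1) A] by (auto simp: G.row_mat_def)
    have Ue: "U *\<^sub>v e1 = e1"
    proof -
      have e: "e1 = vec n (\<lambda>i. if i = 0 then 1 else 0)" by (rule eq_vecI) auto
      have "L (\<lambda>i. if i = 0 then 1 else 0) i = 0" if "i \<in> {r<..<n}" for i
        by (rule G.row_map_zero[OF L(1) _ that]) auto
      then show ?thesis unfolding e U_def G.row_mat_vec[OF L(1) A]
        by (intro eq_vecI) (auto simp: G.extend_map_def)
    qed
    have "cg_error_norm \<beta> l (gram (red' r (mg y))) e1 k = cg_error_norm \<beta> l (gram (red (Suc r) (mg (T y)))) e1 k" for y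
    proof -
      have "U * mat n m (\<lambda>(i, j). red' r (mg y) i j) = mat n m (\<lambda>(i, j). red (Suc r) (mg (T y)) i j)"
        unfolding U_def G.row_mat_mult[OF L(1) A] by (rule eq_matI) (auto simp: key)
      from gram_unitary[OF U(2) this]
      have "cg_error_norm \<beta> l (gram (red (Suc r) (mg (T y)))) e1 k
        = cg_error_norm \<beta> l (U * gram (red' r (mg y)) * adjoint_mat U) (U *\<^sub>v e1) k" by (simp add: Ue)
      also have "\<dots> = cg_error_norm \<beta> l (gram (red' r (mg y))) e1 k"
        by (rule cg_error_norm_unitary[OF U(1) gram_carrier e1(1) gram_scalars e1(2)]) (auto intro: red'_scalars)
      finally show ?thesis by simp
    qed
    then show "\<exists>T. gauss_preserving G.idx T \<and> (\<forall>y. H (cg_error_norm \<beta> l (gram (red' r (merge (I - G.idx) G.idx (x, y)))) e1 k) =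
      H (cg_error_norm \<beta> l (gram (red (Suc r) (merge (I - G.idx) G.idx (x, T y)))) e1 k))"
      using T(1) unfolding mg_def by auto
  qed
qed

definition full :: "(nat \<times> nat \<times> nat \<Rightarrow> real) \<Rightarrow> nat \<Rightarrow> nat \<Rightarrow> complex" where
  "full w i j = gauss_entry \<beta> w (i, j)"

text \<open>Here every Gaussian coordinate is active, and the vector that is collapsed is the
  deterministic \<open>b\<close> instead of a part of the matrix.\<close>

lemma step_start:
  assumes b: "b \<in> carrier_vec n" "\<And>i. i < n \<Longrightarrow> b $ i \<in> scalars \<beta>" "L2_set (\<lambda>i. cmod (b $ i)) {..<n} = 1"
    and H: "H \<in> borel_measurable (borel :: real measure)"
  shows "(\<integral>\<^sup>+w. H (cg_error_norm \<beta> l (gram (full w)) b k) \<partial>gauss_on I)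
     = (\<integral>\<^sup>+w. (H (cg_error_norm \<beta> l (gram (full w)) e1 k) :: ennreal) \<partial>gauss_on I)"
proof -
  interpret G: gauss_rows \<beta> "{..<m}" "{..<n}" "\<lambda>t j. (j, t)"
    using beta by unfold_locales auto
  have idx: "G.idx = I" by (auto simp: G.idx_def I_def image_iff)
  have m: "(\<lambda>w. full w i j) \<in> borel_measurable (gauss_on I)" "full w i j \<in> scalars \<beta>" if "i < n" "j < m" for w i j
    unfolding full_def using gauss_entry_measurable[OF that] gauss_entry_scalars[OF beta] by auto
  show ?thesis
  proof (rule G.gauss_integral_transform[OF finite_I])
    show "(\<lambda>w. H (cg_error_norm \<beta> l (gram (full w)) b k)) \<in> borel_measurable (gauss_on I)"
      by (intro measurable_compose[OF _ H] cg_gram_measurable m b)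
    show "(\<lambda>w. H (cg_error_norm \<beta> l (gram (full w)) e1 k)) \<in> borel_measurable (gauss_on I)"
      by (intro measurable_compose[OF _ H] cg_gram_measurable m e1)
    fix x assume "x \<in> space (gauss_on (I - G.idx))"
    obtain L where L: "G.row_map L"
      "\<And>i. i \<in> {..<n} \<Longrightarrow> L (\<lambda>i. b $ i) i = (if i = 0 then complex_of_real (sqrt (\<Sum>i\<in>{..<n}. (cmod (b $ i))\<^sup>2)) else 0)"
      using G.row_map_collapse[of 0 "\<lambda>i. b $ i"] n b(2) by auto
    obtain T where T: "gauss_preserving G.idx T"
      "\<And>w t j. t \<in> {..<m} \<Longrightarrow> j \<in> {..<n} \<Longrightarrow> gauss_entry \<beta> (T w) (j, t) = L (\<lambda>j. gauss_entry \<beta> w (j, t)) j"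
      using L(1) unfolding G.row_map_def by blast
    define mg where "mg y = merge (I - G.idx) G.idx (x, y)" for y
    have inn: "mg y (p, i, j) = y (p, i, j)" if "p < \<beta>" "i < n" "j < m" for y p i j
      unfolding mg_def using that by (intro merge_in) (auto simp: I_def idx)
    have gy: "gauss_entry \<beta> (mg y) (i, j) = gauss_entry \<beta> y (i, j)" if "i < n" "j < m" for y i j
      by (rule gauss_entry_cong) (use inn that in auto)
    define U where "U = G.row_mat L n"
    have U: "unitary_mat n U" "U \<in> carrier_mat n n"
      unfolding U_def using G.row_mat_unitary[OF L(1) subset_refl] by (auto simp: G.row_mat_def)
    have Ub: "U *\<^sub>v b = e1"
    proof -
      have e: "b = vec n (\<lambda>i. b $ i)" using b by (intro eq_vecI) auto
      have "U *\<^sub>v vec n (\<lambda>i. b $ i) = e1"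
        unfolding U_def G.row_mat_vec[OF L(1) subset_refl] using b(3)
        by (intro eq_vecI) (auto simp: G.extend_map_def L(2) L2_set_def)
      then show ?thesis using e by simp
    qed
    have "cg_error_norm \<beta> l (gram (full (mg y))) b k = cg_error_norm \<beta> l (gram (full (mg (T y)))) e1 k" for y
    proof -
      have key: "full (mg (T y)) i j = G.extend_map L (\<lambda>i. full (mg y) i j) i" if "i < n" "j < m" for i j
      proof -
        have "L (\<lambda>i. full (mg y) i j) i = L (\<lambda>i. gauss_entry \<beta> y (i, j)) i"
          by (rule G.row_map_cong[OF L(1)]) (use gy that in \<open>auto simp: full_def\<close>)
        then show ?thesis using T(2)[of j i y] that gy[of i j "T y"] by (simp add: full_def G.extend_map_def)
      qed
      have "U * mat n m (\<lambda>(i, j). full (mg y) i j) = mat n m (\<lambda>(i, j). full (mg (T y)) i j)"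
        unfolding U_def G.row_mat_mult[OF L(1) subset_refl] by (rule eq_matI) (auto simp: key)
      from gram_unitary[OF U(2) this]
      have "cg_error_norm \<beta> l (gram (full (mg (T y)))) e1 k
        = cg_error_norm \<beta> l (U * gram (full (mg y)) * adjoint_mat U) (U *\<^sub>v b) k" by (simp add: Ub)
      also have "\<dots> = cg_error_norm \<beta> l (gram (full (mg y))) b k"
        by (rule cg_error_norm_unitary[OF U(1) gram_carrier b(1) gram_scalars b(2)]) (auto intro: m)
      finally show ?thesis by simp
    qed
    then show "\<exists>T. gauss_preserving G.idx T \<and> (\<forall>y. H (cg_error_norm \<beta> l (gram (full (merge (I - G.idx) G.idx (x, y)))) b k) =
      H (cg_error_norm \<beta> l (gram (full (merge (I - G.idx) G.idx (x, T y)))) e1 k))"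
      using T(1) unfolding mg_def by auto
  qed (simp add: idx)
qed

lemma gram_final: "gram (red n w) = jac_mat (\<lambda>i. \<kappa> * row_sq w i) (\<lambda>i. \<kappa> * col_sq w i) n"
proof (rule eq_matI)
  fix i i' assume "i < dim_row (jac_mat (\<lambda>i. \<kappa> * row_sq w i) (\<lambda>i. \<kappa> * col_sq w i) n)"
    "i' < dim_col (jac_mat (\<lambda>i. \<kappa> * row_sq w i) (\<lambda>i. \<kappa> * col_sq w i) n)"
  then have i: "i < n" "i' < n" by (auto simp: jac_mat_def)
  define p q where "p i = sqrt (row_sq w i)" and "q i = sqrt (col_sq w i)" for i
  have pp: "p i * p i = row_sq w i" "q i * q i = col_sq w i" for i
    using row_sq_nonneg col_sq_nonneg by (auto simp: p_def q_def)
  have pq: "\<kappa> * (p i * q i) = sqrt (\<kappa> * row_sq w i * (\<kappa> * col_sq w i))" for i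
  proof -
    have "\<kappa> * row_sq w i * (\<kappa> * col_sq w i) = (\<kappa> * (p i * q i))\<^sup>2" by (simp add: pp[symmetric] power2_eq_square mult_ac)
    then show ?thesis using kappa row_sq_nonneg col_sq_nonneg by (simp add: p_def q_def)
  qed
  define h where "h i j = (if j < n then (if i = j then p j else if i = Suc j then q j else 0) else 0)" for i j
  have red: "red n w i j = complex_of_real (h i j)" if "i < n" for i j
    using that by (simp add: red_def h_def p_def q_def)
  have "gram (red n w) $$ (i, i') = complex_of_real (\<kappa> * (\<Sum>j<m. h i j * h i' j))"
    unfolding gram_index[OF i] by (simp add: red i)
  also have "(\<Sum>j<m. h i j * h i' j) = (\<Sum>j\<in>{i, i - 1}. h i j * h i' j)"
    using i n by (intro sum.mono_neutral_right) (auto simp: h_def)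
  also have "\<kappa> * \<dots> = (if i = i' then \<kappa> * row_sq w i + (if i = 0 then 0 else \<kappa> * col_sq w (i - 1))
     else if i' = Suc i then \<kappa> * (p i * q i) else if i = Suc i' then \<kappa> * (p i' * q i') else 0)"
    using i by (cases i) (auto simp: h_def pp distrib_left)
  finally show "gram (red n w) $$ (i, i') = jac_mat (\<lambda>i. \<kappa> * row_sq w i) (\<lambda>i. \<kappa> * col_sq w i) n $$ (i, i')"
    using i by (simp add: jac_mat_def pq)
qed (use gram_carrier in \<open>auto simp: jac_mat_def\<close>)

text \<open>With \<open>H\<close> ranging over all nonnegative measurable test functions this is
  equality of laws.\<close>

theorem cg_law:
  assumes b: "b \<in> carrier_vec n" "\<And>i. i < n \<Longrightarrow> b $ i \<in> scalars \<beta>" "L2_set (\<lambda>i. cmod (b $ i)) {..<n} = 1"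
    and H: "H \<in> borel_measurable (borel :: real measure)"
  shows "(\<integral>\<^sup>+w. H (cg_error_norm \<beta> l (gram (full w)) b k) \<partial>gauss_on I)
     = (\<integral>\<^sup>+w. (H (cg_error_norm \<beta> l (jac_mat (\<lambda>i. \<kappa> * row_sq w i) (\<lambda>i. \<kappa> * col_sq w i) n) e1 k) :: ennreal) \<partial>gauss_on I)"
proof -
  have "(\<integral>\<^sup>+w. H (cg_error_norm \<beta> l (gram (red 0 w)) e1 k) \<partial>gauss_on I)
     = (\<integral>\<^sup>+w. H (cg_error_norm \<beta> l (gram (red r w)) e1 k) \<partial>gauss_on I)" if "r \<le> n" for r
    using that
  proof (induction r)
    case (Suc r)
    then show ?case using step_right[OF _ H, of r] step_left[OF _ H, of r] by simp
  qed simp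
  note steps = this
  have "red 0 = full" by (intro ext) (simp add: red_def full_def)
  from steps[of n] show ?thesis using step_start[OF b H, of l k] \<open>red 0 = full\<close> gram_final by simp
qed

end

subsection \<open>Moments of chi-square variables\<close>

locale gauss_space =
  fixes I :: "'i set"
  assumes finite_I: "finite I"
begin

sublocale product_sigma_finite "\<lambda>_::'i. gauss" by (rule product_sigma_finite_gauss)

lemma prob_space_on: "prob_space (gauss_on J)" for J :: "'i set"
  by (rule prob_space_PiM) (rule prob_space_gauss)

sublocale P: prob_space "gauss_on I" by (rule prob_space_on)

definition sq :: "'i set \<Rightarrow> ('i \<Rightarrow> real) \<Rightarrow> real" where "sq J z = (\<Sum>q\<in>J. (z q)\<^sup>2)"

lemma sq_nonneg: "0 \<le> sq J z" by (simp add: sq_def sum_nonneg)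

lemma coord_measurable: "q \<in> I \<Longrightarrow> (\<lambda>z. z q) \<in> borel_measurable (gauss_on I)"
  using measurable_component_singleton[of q I "\<lambda>_. gauss"] by (simp cong: measurable_cong_sets)

lemma sq_measurable: "J \<subseteq> I \<Longrightarrow> sq J \<in> borel_measurable (gauss_on I)"
  unfolding sq_def[abs_def] by (intro borel_measurable_sum borel_measurable_power coord_measurable) auto

text \<open>A pointwise substitute for measurability with respect to some of the coordinates; for
  disjoint index sets it yields product formulas directly from Fubini.\<close>

definition dep :: "'i set \<Rightarrow> (('i \<Rightarrow> real) \<Rightarrow> 'b) \<Rightarrow> bool" where
  "dep J f \<longleftrightarrow> (\<forall>x y. (\<forall>i\<in>J. x i = y i) \<longrightarrow> f x = f y)"

lemma dep_sq: "dep J (\<lambda>z. h (sq J z))"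
  unfolding dep_def sq_def by (intro allI impI arg_cong[of _ _ h] sum.cong refl) simp

lemma nn_integral_indep:
  fixes f g :: "('i \<Rightarrow> real) \<Rightarrow> ennreal"
  assumes J: "J \<subseteq> I" "K \<subseteq> I" "J \<inter> K = {}" and f: "f \<in> borel_measurable (gauss_on I)" "dep J f"
    and g: "g \<in> borel_measurable (gauss_on I)" "dep K g"
  shows "(\<integral>\<^sup>+z. f z * g z \<partial>gauss_on I) = (\<integral>\<^sup>+z. f z \<partial>gauss_on I) * (\<integral>\<^sup>+z. g z \<partial>gauss_on I)"
proof -
  define J' where "J' = I - J"
  have I_eq: "I = J \<union> J'" and dj: "J \<inter> J' = {}" and fin: "finite J" "finite J'"
    using J finite_I finite_subset by (auto simp: J'_def)
  have fold: "(\<integral>\<^sup>+z. h z \<partial>gauss_on I) = (\<integral>\<^sup>+x. \<integral>\<^sup>+y. h (merge J J' (x, y)) \<partial>gauss_on J' \<partial>gauss_on J)"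
    if "h \<in> borel_measurable (gauss_on I)" for h
    using that unfolding I_eq by (intro product_nn_integral_fold dj fin)
  define x0 y0 where "x0 = restrict (\<lambda>_::'i. 0::real) J" and "y0 = restrict (\<lambda>_::'i. 0::real) J'"
  have sp: "x0 \<in> space (gauss_on J)" "y0 \<in> space (gauss_on J')"
    by (auto simp: space_PiM x0_def y0_def)
  have mm: "merge J J' \<in> measurable (gauss_on J \<Otimes>\<^sub>M gauss_on J') (gauss_on I)"
    using measurable_merge[of J J' "\<lambda>_. gauss"] I_eq by simp
  define F G where "F x = f (merge J J' (x, y0))" and "G y = g (merge J J' (x0, y))" for x y
  have Fm: "F \<in> borel_measurable (gauss_on J)" unfolding F_def[abs_def]
    using sp by (intro measurable_compose[OF measurable_compose[OF _ mm] f(1)] measurable_Pair) auto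
  have Gm: "G \<in> borel_measurable (gauss_on J')" unfolding G_def[abs_def]
    using sp by (intro measurable_compose[OF measurable_compose[OF _ mm] g(1)] measurable_Pair) auto
  have F: "f (merge J J' (x, y)) = F x" for x y
    unfolding F_def using f(2) by (auto simp: dep_def merge_def)
  have G: "g (merge J J' (x, y)) = G y" for x y
  proof -
    have "\<forall>i\<in>K. merge J J' (x, y) i = merge J J' (x0, y) i" using J by (auto simp: merge_def J'_def)
    then show ?thesis using g(2) unfolding G_def dep_def by blast
  qed
  interpret A: prob_space "gauss_on J" by (rule prob_space_on)
  interpret B: prob_space "gauss_on J'" by (rule prob_space_on)
  have 1: "(\<integral>\<^sup>+z. f z \<partial>gauss_on I) = (\<integral>\<^sup>+x. F x \<partial>gauss_on J)"
    unfolding fold[OF f(1)] F using B.emeasure_space_1 by simp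
  have 2: "(\<integral>\<^sup>+z. g z \<partial>gauss_on I) = (\<integral>\<^sup>+y. G y \<partial>gauss_on J')"
    unfolding fold[OF g(1)] G using A.emeasure_space_1 by simp
  have "(\<integral>\<^sup>+z. f z * g z \<partial>gauss_on I) = (\<integral>\<^sup>+x. \<integral>\<^sup>+y. F x * G y \<partial>gauss_on J' \<partial>gauss_on J)"
    using f(1) g(1) by (subst fold) (auto simp: F G)
  also have "\<dots> = (\<integral>\<^sup>+x. F x * (\<integral>\<^sup>+y. G y \<partial>gauss_on J') \<partial>gauss_on J)"
    using Gm by (simp add: nn_integral_cmult)
  also have "\<dots> = (\<integral>\<^sup>+x. F x \<partial>gauss_on J) * (\<integral>\<^sup>+y. G y \<partial>gauss_on J')"
    using Fm by (simp add: nn_integral_multc)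
  finally show ?thesis unfolding 1 2 .
qed

lemma nn_integral_coord:
  assumes "q \<in> I" "f \<in> borel_measurable borel"
  shows "(\<integral>\<^sup>+z. f (z q) \<partial>gauss_on I) = (\<integral>\<^sup>+x. f x \<partial>gauss)"
proof -
  interpret G: prob_space gauss by (rule prob_space_gauss)
  have "(\<integral>\<^sup>+z. (\<Prod>i\<in>I. (if i = q then f (z i) else 1)) \<partial>gauss_on I) = (\<Prod>i\<in>I. \<integral>\<^sup>+x. (if i = q then f x else 1) \<partial>gauss)"
    using assms(2) by (intro product_nn_integral_prod finite_I) (auto cong: measurable_cong_sets)
  moreover have "(\<Prod>i\<in>I. (if i = q then f (z i) else 1)) = f (z q)" for z
    using assms(1) finite_I by (simp add: prod.delta)
  moreover have "(\<Prod>i\<in>I. \<integral>\<^sup>+x. (if i = q then f x else 1) \<partial>gauss) = (\<Prod>i\<in>I. if i = q then \<integral>\<^sup>+x. f x \<partial>gauss else 1)"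
    using G.emeasure_space_1 by (intro prod.cong refl) auto
  ultimately show ?thesis using assms(1) finite_I by (simp add: prod.delta)
qed

end

section \<open>Moments and Laplace transforms of chi-square variables\<close>

lemma gauss_even_moment:
  "(\<integral>\<^sup>+x. ennreal ((x\<^sup>2) ^ k) \<partial>gauss) = ennreal (2 ^ k * pochhammer (1 / 2) k)"
proof -
  have "(\<integral>\<^sup>+x. ennreal ((x\<^sup>2) ^ k) \<partial>gauss) = (\<integral>\<^sup>+x. ennreal (std_normal_density x * x ^ (2 * k)) \<partial>lborel)"
    by (subst nn_integral_gauss) (auto simp: ennreal_mult'[symmetric] power_mult[symmetric])
  also have "\<dots> = ennreal (fact (2 * k) / (2 ^ k * fact k))"
    using std_normal_moment_even[of k] by (subst nn_integral_eq_integral) (auto simp: has_bochner_integral_iff)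
  also have "fact (2 * k) / (2 ^ k * fact k) = (2 ^ k * pochhammer (1 / 2) k :: real)"
    unfolding fact_double by (simp add: power_mult power2_eq_square flip: power_mult_distrib) (simp add: field_simps flip: power_mult_distrib)
  finally show ?thesis .
qed

text \<open>Multiplied by the standard density, the integrand is a multiple of the centered normal
  density of variance \<open>1 / (1 + 2 * t)\<close>.\<close>

lemma gauss_laplace:
  assumes "0 \<le> t"
  shows "(\<integral>\<^sup>+x. ennreal (exp (- t * x\<^sup>2)) \<partial>gauss) = ennreal ((1 + 2 * t) powr (- 1 / 2))"
proof -
  define v where "v = 1 / sqrt (1 + 2 * t)"
  have v: "0 < v" "v\<^sup>2 = 1 / (1 + 2 * t)" using assms by (auto simp: v_def power_divide)
  have "std_normal_density x * exp (- t * x\<^sup>2) = v * normal_density 0 v x" for x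
  proof -
    have "- (x\<^sup>2 / 2) + (- t * x\<^sup>2) = - (x - 0)\<^sup>2 / (2 * v\<^sup>2)"
      using assms by (simp add: v(2) field_simps)
    then have "exp (- (x\<^sup>2 / 2)) * exp (- t * x\<^sup>2) = exp (- (x - 0)\<^sup>2 / (2 * v\<^sup>2))" by (simp only: exp_add[symmetric])
    moreover have "v * (1 / sqrt (2 * pi * v\<^sup>2)) = 1 / sqrt (2 * pi)"
      using v(1) by (simp add: real_sqrt_mult)
    moreover have "std_normal_density x * exp (- t * x\<^sup>2) = 1 / sqrt (2 * pi) * (exp (- (x\<^sup>2 / 2)) * exp (- t * x\<^sup>2))"
      by (simp add: std_normal_density_def)
    moreover have "v * normal_density 0 v x = v * (1 / sqrt (2 * pi * v\<^sup>2)) * exp (- (x - 0)\<^sup>2 / (2 * v\<^sup>2))"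
      by (simp add: normal_density_def)
    ultimately show ?thesis by (simp only:)
  qed
  then have "(\<integral>\<^sup>+x. ennreal (exp (- t * x\<^sup>2)) \<partial>gauss) = (\<integral>\<^sup>+x. ennreal v * ennreal (normal_density 0 v x) \<partial>lborel)"
    using v by (subst nn_integral_gauss) (auto simp: ennreal_mult'[symmetric])
  also have "\<dots> = ennreal v * (\<integral>\<^sup>+x. ennreal (normal_density 0 v x) \<partial>lborel)" by (rule nn_integral_cmult) auto
  also have "(\<integral>\<^sup>+x. ennreal (normal_density 0 v x) \<partial>lborel) = 1"
    using prob_space.emeasure_space_1[OF prob_space_normal_density[OF v(1), of 0]]
    by (simp add: emeasure_density)
  also have "ennreal v * 1 = ennreal ((1 + 2 * t) powr (- 1 / 2))"
    using assms by (simp add: v_def powr_minus_divide powr_half_sqrt)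
  finally show ?thesis .
qed

text \<open>The moment of order \<open>q\<close> of a chi-square variable with \<open>N\<close>
  degrees of freedom, \<open>N (N + 2) ... (N + 2 q - 2)\<close>.\<close>

definition chi_mom :: "real \<Rightarrow> nat \<Rightarrow> real" where "chi_mom N q = 2 ^ q * pochhammer (N / 2) q"

lemma chi_mom_Suc: "chi_mom N (Suc q) = (N + 2 * real q) * chi_mom N q"
  by (simp add: chi_mom_def pochhammer_Suc algebra_simps)

text \<open>The operator that multiplies the derivative by the variable is dual to multiplying the
  moment of order \<open>q\<close> by \<open>q\<close>; this is integration by parts in terms of
  moments.\<close>

lemma lin_ev_pderiv: "lin_ev g (pCons 0 (pderiv f)) = lin_ev (\<lambda>q. real q * g q) f"
proof (induction f arbitrary: g)
  case (pCons a p)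
  have "lin_ev g (pCons 0 (pderiv (pCons a p))) = lin_ev (\<lambda>q. g (Suc q)) p + lin_ev (\<lambda>q. g (Suc q)) (pCons 0 (pderiv p))"
    by (simp add: pderiv_pCons lin_ev_pCons lin_ev_add)
  also have "\<dots> = lin_ev (\<lambda>q. real (Suc q) * g (Suc q)) p"
    unfolding pCons.IH by (simp add: lin_ev_def sum.distrib[symmetric] algebra_simps)
  finally show ?case by (simp add: lin_ev_pCons)
qed (simp add: pderiv_0)

text \<open>The central moment of order \<open>p\<close>, computed formally from the moment
  sequence; \<open>sq_poly_integral\<close> turns it into an integral.\<close>

definition chi_central :: "real \<Rightarrow> nat \<Rightarrow> real" where
  "chi_central N p = lin_ev (chi_mom N) ([:- N, 1:] ^ p)"

text \<open>Stein's identity \<open>E (X - N) f(X) = 2 E X f'(X)\<close> for \<open>f = (X - N)^p\<close>.\<close>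

lemma chi_central_rec:
  "chi_central N (Suc p) = 2 * real p * (chi_central N p + N * chi_central N (p - 1))"
proof -
  let ?w = "[:- N, 1:]"
  have "chi_central N (Suc p) = - N * lin_ev (chi_mom N) (?w ^ p) + lin_ev (\<lambda>q. chi_mom N (Suc q)) (?w ^ p)"
    unfolding chi_central_def power_Suc lin_ev_linear_mult by simp
  also have "lin_ev (\<lambda>q. chi_mom N (Suc q)) (?w ^ p) = N * lin_ev (chi_mom N) (?w ^ p) + 2 * lin_ev (\<lambda>q. real q * chi_mom N q) (?w ^ p)"
    by (simp add: lin_ev_def chi_mom_Suc sum_distrib_left sum.distrib[symmetric] algebra_simps)
  also have "lin_ev (\<lambda>q. real q * chi_mom N q) (?w ^ p) = lin_ev (chi_mom N) (pCons 0 (pderiv (?w ^ p)))"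
    by (rule lin_ev_pderiv[symmetric])
  also have "pCons 0 (pderiv (?w ^ p)) = Polynomial.smult (real p) (?w ^ p + Polynomial.smult N (?w ^ (p - 1)))"
  proof (cases p)
    case (Suc k)
    have "pderiv (?w ^ Suc k) = Polynomial.smult (real (Suc k)) (?w ^ k)"
      unfolding pderiv_power_Suc by (simp add: pderiv_pCons)
    moreover have "pCons 0 (Polynomial.smult x q) = Polynomial.smult x (pCons 0 q)" for x and q :: "real poly" by simp
    moreover have "pCons 0 q = ?w * q + Polynomial.smult N q" for q by simp
    ultimately show ?thesis by (simp only: Suc power_Suc diff_Suc_1)
  qed (simp add: pderiv_1)
  also have "lin_ev (chi_mom N) \<dots> = real p * (chi_central N p + N * chi_central N (p - 1))"
    by (simp add: lin_ev_smult lin_ev_add chi_central_def)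
  finally show ?thesis by (simp add: chi_central_def)
qed

text \<open>In the recursion a factor \<open>N\<close> is paid for by lowering the order by two, so
  the degree in \<open>N\<close> is at most \<open>p div 2\<close>. This expresses that the
  fluctuations have size \<open>sqrt N\<close>.\<close>

lemma chi_central_bound: "\<exists>C\<ge>0. \<forall>N\<ge>1. \<bar>chi_central N p\<bar> \<le> C * N ^ (p div 2)"
proof (induction p rule: less_induct)
  case (less p)
  show ?case
  proof (cases p)
    case 0
    then show ?thesis by (intro exI[of _ 1]) (simp add: chi_central_def lin_ev_def chi_mom_def)
  next
    case (Suc k)
    obtain C where C: "C \<ge> 0" "\<And>N. N \<ge> 1 \<Longrightarrow> \<bar>chi_central N k\<bar> \<le> C * N ^ (k div 2)" using less.IH[of k] Suc by auto
    show ?thesis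
    proof (cases k)
      case 0
      then show ?thesis using Suc by (intro exI[of _ 0]) (simp add: chi_central_rec)
    next
      case k: (Suc j)
      obtain D where D: "D \<ge> 0" "\<And>N. N \<ge> 1 \<Longrightarrow> \<bar>chi_central N j\<bar> \<le> D * N ^ (j div 2)" using less.IH[of j] Suc k by auto
      have "\<bar>chi_central N p\<bar> \<le> 2 * real k * (C + D) * N ^ (p div 2)" if N: "N \<ge> 1" for N
      proof -
        have p2: "p div 2 = Suc (j div 2)" using Suc k by simp
        have "N ^ (k div 2) \<le> N ^ (p div 2)" using N Suc by (intro power_increasing div_le_mono) auto
        then have 1: "\<bar>chi_central N k\<bar> \<le> C * N ^ (p div 2)"
          using C(2)[OF N] mult_left_mono[OF _ C(1)] order_trans by blast
        have "\<bar>N * chi_central N j\<bar> \<le> N * (D * N ^ (j div 2))"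
          using D(2)[OF N] N by (simp add: abs_mult)
        then have 2: "\<bar>N * chi_central N j\<bar> \<le> D * N ^ (p div 2)" by (simp add: p2 mult_ac)
        have "\<bar>chi_central N p\<bar> = 2 * real k * \<bar>chi_central N k + N * chi_central N j\<bar>"
          using Suc k by (simp add: chi_central_rec abs_mult)
        also have "\<dots> \<le> 2 * real k * ((C + D) * N ^ (p div 2))"
          using 1 2 by (intro mult_left_mono) (auto simp: distrib_right intro!: order_trans[OF abs_triangle_ineq] add_mono)
        finally show ?thesis by (simp add: mult.assoc)
      qed
      then show ?thesis using C(1) D(1) by (intro exI[of _ "2 * real k * (C + D)"]) auto
    qed
  qed
qed

context gauss_space
begin

text \<open>Adding one coordinate convolves the moment sequences binomially, and Vandermonde's
  identity for rising factorials evaluates the sum.\<close>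

lemma sq_moment:
  assumes "J \<subseteq> I"
  shows "(\<integral>\<^sup>+z. ennreal (sq J z ^ q) \<partial>gauss_on I) = ennreal (chi_mom (real (card J)) q)"
proof -
  have "finite J" using assms finite_I finite_subset by blast
  then show ?thesis using assms
  proof (induction J arbitrary: q rule: finite_induct)
    case empty
    show ?case using P.emeasure_space_1 by (cases q) (simp_all add: sq_def chi_mom_def pochhammer_rec)
  next
    case (insert i J)
    have iI: "i \<in> I" and J: "J \<subseteq> I" using insert.prems by auto
    have s: "sq (insert i J) z = (z i)\<^sup>2 + sq J z" for z using insert.hyps by (simp add: sq_def)
    note [measurable] = sq_measurable[OF J] coord_measurable[OF iI]
    have nn: "0 \<le> pochhammer (x::real) k" if "0 \<le> x" for x k
      unfolding pochhammer_prod using that by (intro prod_nonneg) auto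
    have cm: "0 \<le> chi_mom (real (card J)) k" for k unfolding chi_mom_def by (intro mult_nonneg_nonneg nn) auto
    have "(\<integral>\<^sup>+z. ennreal (sq (insert i J) z ^ q) \<partial>gauss_on I)
      = (\<integral>\<^sup>+z. (\<Sum>k\<le>q. ennreal (real (q choose k)) * (ennreal (((z i)\<^sup>2) ^ k) * ennreal (sq J z ^ (q - k)))) \<partial>gauss_on I)"
      unfolding s binomial_ring
      by (intro nn_integral_cong) (auto simp: ennreal_mult[symmetric] sum_ennreal sq_nonneg mult.assoc intro!: arg_cong[of _ _ ennreal])
    also have "\<dots> = (\<Sum>k\<le>q. ennreal (real (q choose k)) * (\<integral>\<^sup>+z. ennreal (((z i)\<^sup>2) ^ k) * ennreal (sq J z ^ (q - k)) \<partial>gauss_on I))"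
      by (subst nn_integral_sum) (auto simp: nn_integral_cmult)
    also have "\<dots> = (\<Sum>k\<le>q. ennreal (real (q choose k)) * (ennreal (2 ^ k * pochhammer (1 / 2) k) * ennreal (chi_mom (real (card J)) (q - k))))"
    proof (intro sum.cong refl arg_cong2[of _ _ _ _ "(*)"])
      fix k
      have "(\<integral>\<^sup>+z. ennreal (((z i)\<^sup>2) ^ k) * ennreal (sq J z ^ (q - k)) \<partial>gauss_on I)
        = (\<integral>\<^sup>+z. ennreal (((z i)\<^sup>2) ^ k) \<partial>gauss_on I) * (\<integral>\<^sup>+z. ennreal (sq J z ^ (q - k)) \<partial>gauss_on I)"
        by (rule nn_integral_indep[OF _ J _ _ _ _ dep_sq[of J "\<lambda>x. ennreal (x ^ (q - k))"], of "{i}"])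
          (use iI insert.hyps in \<open>auto simp: dep_def\<close>)
      also have "(\<integral>\<^sup>+z. ennreal (((z i)\<^sup>2) ^ k) \<partial>gauss_on I) = ennreal (2 ^ k * pochhammer (1 / 2) k)"
        using nn_integral_coord[OF iI, of "\<lambda>x. ennreal ((x\<^sup>2) ^ k)"] gauss_even_moment[of k] by simp
      also have "(\<integral>\<^sup>+z. ennreal (sq J z ^ (q - k)) \<partial>gauss_on I) = ennreal (chi_mom (real (card J)) (q - k))"
        by (rule insert.IH[OF J])
      finally show "(\<integral>\<^sup>+z. ennreal (((z i)\<^sup>2) ^ k) * ennreal (sq J z ^ (q - k)) \<partial>gauss_on I)
        = ennreal (2 ^ k * pochhammer (1 / 2) k) * ennreal (chi_mom (real (card J)) (q - k))" .
    qed
    also have "\<dots> = ennreal (\<Sum>k\<le>q. real (q choose k) * (2 ^ k * pochhammer (1 / 2) k * chi_mom (real (card J)) (q - k)))"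
      using cm nn[of "1/2"] by (subst sum_ennreal[symmetric]) (auto simp: ennreal_mult)
    also have "(\<Sum>k\<le>q. real (q choose k) * (2 ^ k * pochhammer (1 / 2) k * chi_mom (real (card J)) (q - k)))
      = 2 ^ q * (\<Sum>k\<le>q. real (q choose k) * pochhammer (1 / 2) k * pochhammer (real (card J) / 2) (q - k))"
    proof -
      have "(2::real) ^ q = 2 ^ k * 2 ^ (q - k)" if "k \<le> q" for k using that by (simp flip: power_add)
      then show ?thesis unfolding sum_distrib_left chi_mom_def by (intro sum.cong refl) simp
    qed
    also have "\<dots> = chi_mom (real (card (insert i J))) q"
      unfolding pochhammer_binomial_sum[symmetric] chi_mom_def using insert.hyps by (simp add: add_divide_distrib)
    finally show ?case .
  qed
qed

lemma sq_poly_integral: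
  assumes "J \<subseteq> I"
  shows "has_bochner_integral (gauss_on I) (\<lambda>z. poly f (sq J z)) (lin_ev (chi_mom (real (card J))) f)"
proof -
  have nn: "0 \<le> chi_mom (real (card J)) q" for q
    unfolding chi_mom_def pochhammer_prod by (intro mult_nonneg_nonneg prod_nonneg) auto
  have "has_bochner_integral (gauss_on I) (\<lambda>z. sq J z ^ q) (chi_mom (real (card J)) q)" for q
    using sq_measurable[OF assms] sq_moment[OF assms, of q] sq_nonneg nn
    by (intro has_bochner_integral_nn_integral) auto
  then show ?thesis unfolding lin_ev_def poly_altdef
    by (intro has_bochner_integral_sum has_bochner_integral_mult_right)
qed

lemma sq_central:
  assumes "J \<subseteq> I"
  shows "(\<integral>\<^sup>+z. ennreal ((sq J z - real (card J)) ^ (2 * p)) \<partial>gauss_on I) = ennreal (chi_central (real (card J)) (2 * p))"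
proof -
  have "has_bochner_integral (gauss_on I) (\<lambda>z. (sq J z - real (card J)) ^ (2 * p)) (chi_central (real (card J)) (2 * p))"
    using sq_poly_integral[OF assms, of "[:- real (card J), 1:] ^ (2 * p)"] by (simp add: chi_central_def)
  then show ?thesis
    by (subst nn_integral_eq_integral) (auto simp: has_bochner_integral_iff)
qed

lemma sq_laplace:
  assumes "J \<subseteq> I" "0 \<le> t"
  shows "(\<integral>\<^sup>+z. ennreal (exp (- t * sq J z)) \<partial>gauss_on I) = ennreal ((1 + 2 * t) powr (- real (card J) / 2))"
proof -
  interpret G: prob_space gauss by (rule prob_space_gauss)
  have fJ: "finite J" using assms finite_I finite_subset by blast
  have "(\<integral>\<^sup>+z. (\<Prod>i\<in>I. (if i \<in> J then ennreal (exp (- t * (z i)\<^sup>2)) else 1)) \<partial>gauss_on I)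
    = (\<Prod>i\<in>I. \<integral>\<^sup>+x. (if i \<in> J then ennreal (exp (- t * x\<^sup>2)) else 1) \<partial>gauss)"
    by (intro product_nn_integral_prod finite_I) (auto cong: measurable_cong_sets)
  also have "\<dots> = (\<Prod>i\<in>I. if i \<in> J then ennreal ((1 + 2 * t) powr (- 1 / 2)) else 1)"
    using G.emeasure_space_1 gauss_laplace[OF assms(2)] by (intro prod.cong refl) auto
  also have "\<dots> = (\<Prod>i\<in>J. ennreal ((1 + 2 * t) powr (- 1 / 2)))"
    using assms(1) finite_I by (simp add: prod.inter_restrict[symmetric] Int_absorb1)
  also have "\<dots> = ennreal (((1 + 2 * t) powr (- 1 / 2)) ^ card J)" by (simp add: ennreal_power)
  also have "((1 + 2 * t) powr (- 1 / 2)) ^ card J = (1 + 2 * t) powr (- real (card J) / 2)"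
    using assms(2) by (simp add: powr_realpow[symmetric] powr_powr)
  also have "(\<lambda>z. \<Prod>i\<in>I. (if i \<in> J then ennreal (exp (- t * (z i)\<^sup>2)) else 1)) = (\<lambda>z. ennreal (exp (- t * sq J z)))"
  proof
    fix z :: "'i \<Rightarrow> real"
    have "(\<Prod>i\<in>I. (if i \<in> J then ennreal (exp (- t * (z i)\<^sup>2)) else 1)) = (\<Prod>i\<in>J. ennreal (exp (- t * (z i)\<^sup>2)))"
      using assms(1) finite_I by (simp add: prod.inter_restrict[symmetric] Int_absorb1)
    also have "\<dots> = ennreal (exp (- t * sq J z))"
      using fJ by (simp add: prod_ennreal exp_sum[symmetric] sq_def sum_distrib_left sum_negf)
    finally show "(\<Prod>i\<in>I. (if i \<in> J then ennreal (exp (- t * (z i)\<^sup>2)) else 1)) = ennreal (exp (- t * sq J z))" .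
  qed
  finally show ?thesis .
qed

text \<open>Each integration of the Laplace transform in \<open>t\<close> divides by one more power of \<open>sq J\<close>.\<close>

lemma sq_inverse_laplace:
  assumes "J \<subseteq> I" "2 * q < card J" "0 \<le> t"
  shows "(\<integral>\<^sup>+z. ennreal (inverse (sq J z) ^ q * exp (- t * sq J z)) \<partial>gauss_on I)
    \<le> ennreal ((1 + 2 * t) powr (real q - real (card J) / 2) / (\<Prod>i<q. real (card J) - 2 * real (Suc i)))"
  using assms(2,3)
proof (induction q arbitrary: t)
  case 0
  then show ?case using sq_laplace[OF assms(1), of t] by simp
next
  case (Suc q)
  note [measurable] = sq_measurable[OF assms(1)]
  let ?N = "real (card J)"
  define R where "R = (\<Prod>i<q. ?N - 2 * real (Suc i))"
  have R: "0 < R" unfolding R_def using Suc.prems by (intro prod_pos) auto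
  have N: "0 < ?N - 2 * real (Suc q)" using Suc.prems(1) by linarith
  \<comment> \<open>There is equality for positive \<open>x\<close>. At 0 the left-hand side is 0 by
    the convention for \<open>inverse\<close>, so in general only an inequality is claimed.\<close>
  have pt: "ennreal (inverse x ^ Suc q * exp (- t * x)) \<le> (\<integral>\<^sup>+u\<in>{t..}. ennreal (inverse x ^ q * exp (- u * x)) \<partial>lborel)"
    if "0 \<le> x" for x
  proof (cases "x = 0")
    case False
    then have x: "0 < x" using that by simp
    have "(\<integral>\<^sup>+u\<in>{t..}. ennreal (inverse x ^ q * exp (- u * x)) \<partial>lborel) = ennreal (0 - (- (inverse x ^ Suc q * exp (- t * x))))"
    proof (rule nn_integral_FTC_atLeast)
      show "((\<lambda>u. - (inverse x ^ Suc q * exp (- u * x))) has_real_derivative inverse x ^ q * exp (- u * x)) (at u)" for u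
        using x by (auto intro!: derivative_eq_intros simp: field_simps)
      have "((\<lambda>u. exp (- u * x)) \<longlongrightarrow> 0) at_top"
        using x by real_asymp
      from tendsto_mult_left[OF this, of "- (inverse x ^ Suc q)"]
      show "((\<lambda>u. - (inverse x ^ Suc q * exp (- u * x))) \<longlongrightarrow> 0) at_top" by simp
    qed (use x in auto)
    then show ?thesis by simp
  qed simp
  have "(\<integral>\<^sup>+z. ennreal (inverse (sq J z) ^ Suc q * exp (- t * sq J z)) \<partial>gauss_on I)
    \<le> (\<integral>\<^sup>+z. (\<integral>\<^sup>+u\<in>{t..}. ennreal (inverse (sq J z) ^ q * exp (- u * sq J z)) \<partial>lborel) \<partial>gauss_on I)"
    by (intro nn_integral_mono pt sq_nonneg)
  also have "\<dots> = (\<integral>\<^sup>+u. \<integral>\<^sup>+z. ennreal (inverse (sq J z) ^ q * exp (- u * sq J z)) * indicator {t..} u \<partial>gauss_on I \<partial>lborel)"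
  proof -
    interpret Q: pair_sigma_finite "gauss_on I" lborel
      by (simp add: pair_sigma_finite_def P.sigma_finite_measure_axioms lborel.sigma_finite_measure_axioms)
    show ?thesis by (rule Q.Fubini'[symmetric]) measurable
  qed
  also have "\<dots> = (\<integral>\<^sup>+u\<in>{t..}. (\<integral>\<^sup>+z. ennreal (inverse (sq J z) ^ q * exp (- u * sq J z)) \<partial>gauss_on I) \<partial>lborel)"
    by (intro nn_integral_cong nn_integral_multc) measurable
  also have "\<dots> \<le> (\<integral>\<^sup>+u\<in>{t..}. ennreal ((1 + 2 * u) powr (real q - ?N / 2) / R) \<partial>lborel)"
    using Suc.IH Suc.prems unfolding R_def by (intro nn_integral_mono) (auto simp: indicator_def)
  also have "\<dots> = ennreal (0 - (- ((1 + 2 * t) powr (real (Suc q) - ?N / 2) / (R * (?N - 2 * real (Suc q))))))"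
  proof (rule nn_integral_FTC_atLeast)
    show "((\<lambda>u. - ((1 + 2 * u) powr (real (Suc q) - ?N / 2) / (R * (?N - 2 * real (Suc q)))))
       has_real_derivative (1 + 2 * u) powr (real q - ?N / 2) / R) (at u)" if "t \<le> u" for u
    proof -
      have u: "0 < 1 + 2 * u" using that Suc.prems by simp
      define e where "e = real q - ?N / 2"
      have e: "real (Suc q) - ?N / 2 = e + 1" "?N - 2 * real (Suc q) = - 2 * (e + 1)" by (simp_all add: e_def field_simps)
      have e1: "e + 1 < 0" using N unfolding e(2) by simp
      have "((\<lambda>u. (1 + 2 * u) powr (e + 1)) has_real_derivative (e + 1) * (1 + 2 * u) powr e * 2) (at u)"
        using u by (auto intro!: derivative_eq_intros)
      from DERIV_cmult[OF this, of "- 1 / (R * (- 2 * (e + 1)))"]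
      have "((\<lambda>u. - 1 / (R * (- 2 * (e + 1))) * (1 + 2 * u) powr (e + 1)) has_real_derivative
         - 1 / (R * (- 2 * (e + 1))) * ((e + 1) * (1 + 2 * u) powr e * 2)) (at u)" .
      moreover have "- 1 / (R * (- 2 * (e + 1))) * ((e + 1) * (1 + 2 * u) powr e * 2) = (1 + 2 * u) powr e / R"
        using R e1 by (simp add: divide_simps) (simp add: algebra_simps)
      ultimately show ?thesis unfolding e unfolding e_def[symmetric] by simp
    qed
    have "((\<lambda>u. (1 + 2 * u) powr (real (Suc q) - ?N / 2)) \<longlongrightarrow> 0) at_top"
      using N by real_asymp
    from tendsto_mult_left[OF this, of "- (1 / (R * (?N - 2 * real (Suc q))))"]
    show "((\<lambda>u. - ((1 + 2 * u) powr (real (Suc q) - ?N / 2) / (R * (?N - 2 * real (Suc q))))) \<longlongrightarrow> 0) at_top" by simp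
  qed (use R in auto)
  finally show ?case unfolding R_def by (simp add: mult.commute)
qed

lemma sq_inverse:
  assumes "J \<subseteq> I" "2 * q < card J"
  shows "(\<integral>\<^sup>+z. ennreal (inverse (sq J z) ^ q) \<partial>gauss_on I) \<le> ennreal ((1 / (real (card J) - 2 * real q)) ^ q)"
proof -
  have "(\<integral>\<^sup>+z. ennreal (inverse (sq J z) ^ q) \<partial>gauss_on I) \<le> ennreal (1 / (\<Prod>i<q. real (card J) - 2 * real (Suc i)))"
    using sq_inverse_laplace[OF assms, of 0] by simp
  also have "\<dots> \<le> ennreal (1 / (real (card J) - 2 * real q) ^ q)"
  proof (intro ennreal_leI divide_left_mono)
    have "(\<Prod>i<q. real (card J) - 2 * real q) \<le> (\<Prod>i<q. real (card J) - 2 * real (Suc i))"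
      using assms(2) by (intro prod_mono) auto
    then show "(real (card J) - 2 * real q) ^ q \<le> (\<Prod>i<q. real (card J) - 2 * real (Suc i))" by simp
    show "0 < (\<Prod>i<q. real (card J) - 2 * real (Suc i)) * (real (card J) - 2 * real q) ^ q"
      using assms(2) by (intro mult_pos_pos prod_pos zero_less_power) auto
  qed simp
  finally show ?thesis by (simp add: power_divide)
qed

end

subsection \<open>Convergence in all moments\<close>

lemma even_power_add_le: "((u::real) + v) ^ (2 * p) \<le> 4 ^ p * (u ^ (2 * p) + v ^ (2 * p))"
proof -
  have "(u + v)\<^sup>2 \<le> 4 * max (u\<^sup>2) (v\<^sup>2)"
    using sum_squares_bound[of u v] by (auto simp: power2_sum max_def)
  then have "((u + v)\<^sup>2) ^ p \<le> (4 * max (u\<^sup>2) (v\<^sup>2)) ^ p" by (intro power_mono) auto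
  also have "\<dots> = 4 ^ p * max ((u\<^sup>2) ^ p) ((v\<^sup>2) ^ p)"
    by (auto simp: power_mult_distrib max_def power_mono intro: antisym)
  also have "\<dots> \<le> 4 ^ p * ((u\<^sup>2) ^ p + (v\<^sup>2) ^ p)" by (intro mult_left_mono) auto
  finally show ?thesis by (simp add: power_mult)
qed

text \<open>The weight of \<open>u\<close> can be brought arbitrarily close to 1 at the expense of
  that of \<open>v\<close>. A contraction factor multiplying \<open>u\<close> thereby survives the
  expansion.\<close>

lemma even_power_add_le':
  assumes "0 < (t::real)"
  shows "(u + v) ^ (2 * p) \<le> (1 + t) ^ (2 * p) * u ^ (2 * p) + (1 + 1 / t) ^ (2 * p) * v ^ (2 * p)"
proof (cases "\<bar>v\<bar> \<le> t * \<bar>u\<bar>")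
  case True
  have "\<bar>u + v\<bar> \<le> (1 + t) * \<bar>u\<bar>" using True by (simp add: algebra_simps)
  then have "\<bar>u + v\<bar> ^ (2 * p) \<le> ((1 + t) * \<bar>u\<bar>) ^ (2 * p)" by (intro power_mono) auto
  then have "(u + v) ^ (2 * p) \<le> (1 + t) ^ (2 * p) * u ^ (2 * p)"
    by (simp add: power_mult_distrib power_even_abs)
  moreover have "0 \<le> (1 + 1 / t) ^ (2 * p) * v ^ (2 * p)" using assms by simp
  ultimately show ?thesis by linarith
next
  case False
  then have "\<bar>u\<bar> \<le> \<bar>v\<bar> / t" using assms by (simp add: field_simps)
  then have "\<bar>u + v\<bar> \<le> (1 + 1 / t) * \<bar>v\<bar>" by (simp add: algebra_simps)
  then have "\<bar>u + v\<bar> ^ (2 * p) \<le> ((1 + 1 / t) * \<bar>v\<bar>) ^ (2 * p)" by (intro power_mono) auto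
  then have "(u + v) ^ (2 * p) \<le> (1 + 1 / t) ^ (2 * p) * v ^ (2 * p)"
    by (simp add: power_mult_distrib power_even_abs)
  moreover have "0 \<le> (1 + t) ^ (2 * p) * u ^ (2 * p)" using assms by simp
  ultimately show ?thesis by linarith
qed

text \<open>The fluctuation \<open>1 / sqrt n\<close> plus the drift \<open>r / n\<close> of the matrix entries at depth \<open>r\<close>.\<close>

definition scale_eps :: "nat \<Rightarrow> nat \<Rightarrow> real" where
  "scale_eps n r = 1 / sqrt (real n) + real r / real n"

lemma scale_eps_pos: "1 \<le> n \<Longrightarrow> 0 < scale_eps n r"
  by (simp add: scale_eps_def add_pos_nonneg)

lemma scale_eps_le: "1 \<le> n \<Longrightarrow> r \<le> n \<Longrightarrow> scale_eps n r \<le> 2"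
  unfolding scale_eps_def using add_mono[of "1 / sqrt (real n)" 1 "real r / real n" 1] by simp

text \<open>The increment \<open>1 / n\<close> is at most the fraction \<open>1 / sqrt n\<close> of
  the scale itself. Going down one level thus costs a factor tending to 1, which a contraction can
  absorb.\<close>

lemma scale_eps_Suc: "1 \<le> n \<Longrightarrow> scale_eps n (Suc r) \<le> (1 + 1 / sqrt (real n)) * scale_eps n r"
proof -
  assume n: "1 \<le> n"
  have "scale_eps n (Suc r) = scale_eps n r + 1 / real n" by (simp add: scale_eps_def add_divide_distrib)
  also have "1 / real n = 1 / sqrt (real n) * (1 / sqrt (real n))" by simp
  also have "\<dots> \<le> 1 / sqrt (real n) * scale_eps n r" unfolding scale_eps_def by (intro mult_left_mono) auto
  finally show ?thesis by (simp add: algebra_simps)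
qed

lemma scale_eps_ge_sqrt: "1 / sqrt (real n) \<le> scale_eps n r"
  by (simp add: scale_eps_def)

lemma scale_eps_ge_1: "1 \<le> n \<Longrightarrow> 1 \<le> scale_eps n n"
  by (simp add: scale_eps_def)

lemma scale_eps_at: "1 \<le> n \<Longrightarrow> scale_eps n i \<le> (1 + real i) * scale_eps n 0"
proof -
  assume n: "1 \<le> n"
  have "sqrt (real n) \<le> real n" using n real_sqrt_le_mono[of "real n" "(real n)\<^sup>2"] by (simp add: power2_eq_square)
  then have "real i / real n \<le> real i / sqrt (real n)" using n by (intro divide_left_mono) auto
  then show ?thesis by (simp add: scale_eps_def algebra_simps add_divide_distrib)
qed

section \<open>A calculus of random variables close to constants\<close>

locale prob_family =
  fixes P :: "nat \<Rightarrow> 'w measure"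
  assumes prob: "\<And>n. prob_space (P n)"
begin

abbreviation mom :: "nat \<Rightarrow> nat \<Rightarrow> ('w \<Rightarrow> real) \<Rightarrow> ennreal" where
  "mom n p f \<equiv> \<integral>\<^sup>+x. ennreal (f x ^ p) \<partial>P n"

abbreviation small where
  "small p C n0 R Y y \<equiv> \<forall>n\<ge>n0. \<forall>r\<in>R n. Y n r \<in> borel_measurable (P n) \<and>
     mom n (2 * p) (\<lambda>x. Y n r x - y) \<le> ennreal (C * scale_eps n r ^ (2 * p))"

text \<open>\<open>good R Y y\<close>: all even moments of \<open>Y n r - y\<close>, \<open>r \<in> R n\<close>, are of the order that a deviation
  of size \<open>scale_eps n r\<close> would give.  Such families are closed under the ring operations.\<close>

definition good :: "(nat \<Rightarrow> nat set) \<Rightarrow> (nat \<Rightarrow> nat \<Rightarrow> 'w \<Rightarrow> real) \<Rightarrow> real \<Rightarrow> bool" where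
  "good R Y y \<longleftrightarrow> (\<forall>p. \<exists>C n0. small p C n0 R Y y)"

lemma goodI:
  assumes "\<And>p. \<exists>C n0. small p C n0 R Y y"
  shows "good R Y y"
  using assms by (simp add: good_def)

lemma goodE:
  assumes "good R Y y"
  obtains C n0 where "0 \<le> C" "1 \<le> n0" "\<And>n r. n \<ge> n0 \<Longrightarrow> r \<in> R n \<Longrightarrow> Y n r \<in> borel_measurable (P n)"
    "\<And>n r. n \<ge> n0 \<Longrightarrow> r \<in> R n \<Longrightarrow>
       mom n (2 * p) (\<lambda>s. Y n r s - y) \<le> ennreal (C * scale_eps n r ^ (2 * p))"
proof -
  obtain C n0 where C: "\<And>n r. n \<ge> n0 \<Longrightarrow> r \<in> R n \<Longrightarrow> Y n r \<in> borel_measurable (P n) \<and>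
     mom n (2 * p) (\<lambda>s. Y n r s - y) \<le> ennreal (C * scale_eps n r ^ (2 * p))"
    using assms unfolding good_def by blast
  have "C * scale_eps n r ^ (2 * p) \<le> max C 0 * scale_eps n r ^ (2 * p)" for n r
    by (intro mult_right_mono) (auto simp: zero_le_even_power)
  then show ?thesis
    by (intro that[of "max C 0" "max n0 1"]) (auto intro!: order_trans[OF conjunct2[OF C]] ennreal_leI dest: C)
qed

lemma good_subset: "good R Y y \<Longrightarrow> (\<And>n. R' n \<subseteq> R n) \<Longrightarrow> good R' Y y"
  unfolding good_def by (meson subsetD)

lemma good_cong:
  assumes "good R Y y" "\<And>n r s. 1 \<le> n \<Longrightarrow> r \<in> R n \<Longrightarrow> Y n r s = Z n r s"
  shows "good R Z y"
proof (rule goodI)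
  fix p
  obtain C n0 where C: "0 \<le> C" "1 \<le> n0" "\<And>n r. n \<ge> n0 \<Longrightarrow> r \<in> R n \<Longrightarrow> Y n r \<in> borel_measurable (P n)"
    "\<And>n r. n \<ge> n0 \<Longrightarrow> r \<in> R n \<Longrightarrow>
       mom n (2 * p) (\<lambda>s. Y n r s - y) \<le> ennreal (C * scale_eps n r ^ (2 * p))"
    using assms(1) by (rule goodE[where p = p]) blast
  have "Y n r = Z n r" if "n \<ge> n0" "r \<in> R n" for n r using assms(2) that C(2) by fastforce
  then show "\<exists>C n0. small p C n0 R Z y"
    using C(3,4) by (intro exI[of _ C] exI[of _ n0]) fastforce
qed

lemma good_const: "good R (\<lambda>n r s. y) y"
proof (rule goodI)
  fix p
  have "mom n (2 * p) (\<lambda>s. y - y) \<le> ennreal (1 * scale_eps n r ^ (2 * p))" for n r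
    using prob_space.emeasure_space_1[OF prob] by (cases p) auto
  then show "\<exists>C n0. small p C n0 R (\<lambda>n r s. y) y"
    by (intro exI[of _ 1] exI[of _ 0]) auto
qed

lemma good_add:
  assumes X: "good R X x" and Y: "good R Y y"
  shows "good R (\<lambda>n r s. X n r s + Y n r s) (x + y)"
proof (rule goodI)
  fix p
  obtain C n0 where C: "0 \<le> C" "1 \<le> n0" "\<And>n r. n \<ge> n0 \<Longrightarrow> r \<in> R n \<Longrightarrow> X n r \<in> borel_measurable (P n)"
    "\<And>n r. n \<ge> n0 \<Longrightarrow> r \<in> R n \<Longrightarrow>
       mom n (2 * p) (\<lambda>s. X n r s - x) \<le> ennreal (C * scale_eps n r ^ (2 * p))"
    using X by (rule goodE[where p = p]) blast
  obtain D n1 where D: "0 \<le> D" "1 \<le> n1" "\<And>n r. n \<ge> n1 \<Longrightarrow> r \<in> R n \<Longrightarrow> Y n r \<in> borel_measurable (P n)"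
    "\<And>n r. n \<ge> n1 \<Longrightarrow> r \<in> R n \<Longrightarrow>
       mom n (2 * p) (\<lambda>s. Y n r s - y) \<le> ennreal (D * scale_eps n r ^ (2 * p))"
    using Y by (rule goodE[where p = p]) blast
  have "(\<lambda>s. X n r s + Y n r s) \<in> borel_measurable (P n) \<and>
     mom n (2 * p) (\<lambda>s. X n r s + Y n r s - (x + y))
      \<le> ennreal (4 ^ p * (C + D) * scale_eps n r ^ (2 * p))"
    if n: "n \<ge> max n0 n1" and r: "r \<in> R n" for n r
  proof
    have [measurable]: "X n r \<in> borel_measurable (P n)" "Y n r \<in> borel_measurable (P n)" using C(3) D(3) n r by auto
    show "(\<lambda>s. X n r s + Y n r s) \<in> borel_measurable (P n)" by measurable
    have e: "0 \<le> scale_eps n r ^ (2 * p)" by (simp add: zero_le_even_power)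
    have "mom n (2 * p) (\<lambda>s. X n r s + Y n r s - (x + y))
      \<le> (\<integral>\<^sup>+s. ennreal (4 ^ p) * (ennreal ((X n r s - x) ^ (2 * p)) + ennreal ((Y n r s - y) ^ (2 * p))) \<partial>P n)"
    proof (rule nn_integral_mono)
      fix s
      have "(X n r s + Y n r s - (x + y)) ^ (2 * p) = ((X n r s - x) + (Y n r s - y)) ^ (2 * p)" by (simp add: algebra_simps)
      also have "\<dots> \<le> 4 ^ p * ((X n r s - x) ^ (2 * p) + (Y n r s - y) ^ (2 * p))" by (rule even_power_add_le)
      finally show "ennreal ((X n r s + Y n r s - (x + y)) ^ (2 * p)) \<le>
         ennreal (4 ^ p) * (ennreal ((X n r s - x) ^ (2 * p)) + ennreal ((Y n r s - y) ^ (2 * p)))"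
        by (simp add: ennreal_leI zero_le_even_power flip: ennreal_mult ennreal_plus)
    qed
    also have "\<dots> = ennreal (4 ^ p) * (mom n (2 * p) (\<lambda>s. X n r s - x) + mom n (2 * p) (\<lambda>s. Y n r s - y))"
      by (simp add: nn_integral_cmult nn_integral_add)
    also have "\<dots> \<le> ennreal (4 ^ p) * (ennreal (C * scale_eps n r ^ (2 * p)) + ennreal (D * scale_eps n r ^ (2 * p)))"
      using C(4) D(4) n r by (intro mult_left_mono add_mono) auto
    also have "\<dots> = ennreal (4 ^ p * (C + D) * scale_eps n r ^ (2 * p))"
      using C(1) D(1) e by (simp add: distrib_right mult.assoc flip: ennreal_mult ennreal_plus)
    finally show "mom n (2 * p) (\<lambda>s. X n r s + Y n r s - (x + y))
      \<le> ennreal (4 ^ p * (C + D) * scale_eps n r ^ (2 * p))" .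
  qed
  then show "\<exists>C n0. small p C n0 R (\<lambda>n r s. X n r s + Y n r s) (x + y)"
    by blast
qed

lemma good_cmult:
  assumes Y: "good R Y y"
  shows "good R (\<lambda>n r s. c * Y n r s) (c * y)"
proof (rule goodI)
  fix p
  obtain D n1 where D: "0 \<le> D" "1 \<le> n1" "\<And>n r. n \<ge> n1 \<Longrightarrow> r \<in> R n \<Longrightarrow> Y n r \<in> borel_measurable (P n)"
    "\<And>n r. n \<ge> n1 \<Longrightarrow> r \<in> R n \<Longrightarrow>
       mom n (2 * p) (\<lambda>s. Y n r s - y) \<le> ennreal (D * scale_eps n r ^ (2 * p))"
    using Y by (rule goodE[where p = p]) blast
  have "(\<lambda>s. c * Y n r s) \<in> borel_measurable (P n) \<and>
     mom n (2 * p) (\<lambda>s. c * Y n r s - c * y) \<le> ennreal (c ^ (2 * p) * D * scale_eps n r ^ (2 * p))"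
    if n: "n \<ge> n1" and r: "r \<in> R n" for n r
  proof
    have [measurable]: "Y n r \<in> borel_measurable (P n)" using D(3) n r by auto
    show "(\<lambda>s. c * Y n r s) \<in> borel_measurable (P n)" by measurable
    have "mom n (2 * p) (\<lambda>s. c * Y n r s - c * y)
       = (\<integral>\<^sup>+s. ennreal (c ^ (2 * p)) * ennreal ((Y n r s - y) ^ (2 * p)) \<partial>P n)"
      by (simp add: ennreal_mult[symmetric] zero_le_even_power power_mult_distrib[symmetric] right_diff_distrib)
    also have "\<dots> = ennreal (c ^ (2 * p)) * mom n (2 * p) (\<lambda>s. Y n r s - y)"
      by (rule nn_integral_cmult) measurable
    also have "\<dots> \<le> ennreal (c ^ (2 * p)) * ennreal (D * scale_eps n r ^ (2 * p))"
      using D(4) n r by (intro mult_left_mono) auto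
    finally show "mom n (2 * p) (\<lambda>s. c * Y n r s - c * y) \<le> ennreal (c ^ (2 * p) * D * scale_eps n r ^ (2 * p))"
      using D(1) by (simp add: ennreal_mult[symmetric] zero_le_even_power mult.assoc)
  qed
  then show "\<exists>C n0. small p C n0 R (\<lambda>n r s. c * Y n r s) (c * y)"
    by blast
qed

lemma good_diff: "good R X x \<Longrightarrow> good R Y y \<Longrightarrow> good R (\<lambda>n r s. X n r s - Y n r s) (x - y)"
  using good_add[of R X x "\<lambda>n r s. (-1) * Y n r s" "(-1) * y"] good_cmult[of R Y y "-1"] by simp

text \<open>The product of two deviations is of the order of the squared scale, and one factor is
  given away by \<open>scale_eps n r \<le> 2\<close>. The factors may be dependent: the product is
  bounded by the sum of squares, at the cost of doubling the order of the moments.\<close>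

lemma good_mult0:
  assumes X: "good R X 0" and Y: "good R Y 0" and R: "\<And>n. R n \<subseteq> {..n}"
  shows "good R (\<lambda>n r s. X n r s * Y n r s) 0"
proof (rule goodI)
  fix p
  obtain C n0 where C: "0 \<le> C" "1 \<le> n0" "\<And>n r. n \<ge> n0 \<Longrightarrow> r \<in> R n \<Longrightarrow> X n r \<in> borel_measurable (P n)"
    "\<And>n r. n \<ge> n0 \<Longrightarrow> r \<in> R n \<Longrightarrow>
       mom n (2 * (2 * p)) (\<lambda>s. X n r s - 0) \<le> ennreal (C * scale_eps n r ^ (2 * (2 * p)))"
    using X by (rule goodE[where p = "2 * p"]) blast
  obtain D n1 where D: "0 \<le> D" "1 \<le> n1" "\<And>n r. n \<ge> n1 \<Longrightarrow> r \<in> R n \<Longrightarrow> Y n r \<in> borel_measurable (P n)"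
    "\<And>n r. n \<ge> n1 \<Longrightarrow> r \<in> R n \<Longrightarrow>
       mom n (2 * (2 * p)) (\<lambda>s. Y n r s - 0) \<le> ennreal (D * scale_eps n r ^ (2 * (2 * p)))"
    using Y by (rule goodE[where p = "2 * p"]) blast
  have "(\<lambda>s. X n r s * Y n r s) \<in> borel_measurable (P n) \<and>
     mom n (2 * p) (\<lambda>s. X n r s * Y n r s - 0) \<le> ennreal (4 ^ p * (C + D) * scale_eps n r ^ (2 * p))"
    if n: "n \<ge> max n0 n1" and r: "r \<in> R n" for n r
  proof
    have [measurable]: "X n r \<in> borel_measurable (P n)" "Y n r \<in> borel_measurable (P n)" using C(3) D(3) n r by auto
    show "(\<lambda>s. X n r s * Y n r s) \<in> borel_measurable (P n)" by measurable
    have n1: "1 \<le> n" using n C(2) by simp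
    have eps: "0 < scale_eps n r" "scale_eps n r \<le> 2" using scale_eps_pos[OF n1] scale_eps_le[OF n1] r R by auto
    have e: "0 \<le> scale_eps n r ^ (2 * p)" by (simp add: zero_le_even_power)
    have e4: "scale_eps n r ^ (2 * (2 * p)) \<le> 4 ^ p * scale_eps n r ^ (2 * p)"
    proof -
      have "scale_eps n r ^ (2 * (2 * p)) = scale_eps n r ^ (2 * p) * scale_eps n r ^ (2 * p)" by (simp flip: power_add add: mult_2)
      also have "\<dots> \<le> 2 ^ (2 * p) * scale_eps n r ^ (2 * p)"
        using eps e by (intro mult_right_mono power_mono) auto
      finally show ?thesis by (simp add: power_mult)
    qed
    have "mom n (2 * p) (\<lambda>s. X n r s * Y n r s - 0)
      \<le> (\<integral>\<^sup>+s. ennreal ((X n r s - 0) ^ (2 * (2 * p))) + ennreal ((Y n r s - 0) ^ (2 * (2 * p))) \<partial>P n)"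
    proof (rule nn_integral_mono)
      fix s
      define x y where "x = X n r s ^ (2 * p)" and "y = Y n r s ^ (2 * p)"
      have xy: "0 \<le> x" "0 \<le> y" by (simp_all add: x_def y_def zero_le_even_power)
      have "x * y \<le> x\<^sup>2 + y\<^sup>2" using sum_squares_bound[of x y] mult_nonneg_nonneg[OF xy] by linarith
      moreover have "(X n r s * Y n r s) ^ (2 * p) = x * y" by (simp add: x_def y_def power_mult_distrib)
      moreover have "X n r s ^ (2 * (2 * p)) = x\<^sup>2" "Y n r s ^ (2 * (2 * p)) = y\<^sup>2"
        by (simp_all add: x_def y_def power_mult[symmetric] mult_ac)
      ultimately show "ennreal ((X n r s * Y n r s - 0) ^ (2 * p)) \<le> ennreal ((X n r s - 0) ^ (2 * (2 * p))) + ennreal ((Y n r s - 0) ^ (2 * (2 * p)))"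
        by (simp add: ennreal_leI flip: ennreal_plus)
    qed
    also have "\<dots> = mom n (2 * (2 * p)) (\<lambda>s. X n r s - 0) + mom n (2 * (2 * p)) (\<lambda>s. Y n r s - 0)"
      by (rule nn_integral_add) measurable
    also have "\<dots> \<le> ennreal (C * scale_eps n r ^ (2 * (2 * p))) + ennreal (D * scale_eps n r ^ (2 * (2 * p)))"
      using C(4) D(4) n r by (intro add_mono) auto
    also have "\<dots> = ennreal ((C + D) * scale_eps n r ^ (2 * (2 * p)))"
      using C(1) D(1) by (simp add: distrib_right zero_le_even_power flip: ennreal_plus)
    also have "\<dots> \<le> ennreal ((C + D) * (4 ^ p * scale_eps n r ^ (2 * p)))"
      using C(1) D(1) e4 by (intro ennreal_leI mult_left_mono) auto
    finally show "mom n (2 * p) (\<lambda>s. X n r s * Y n r s - 0) \<le> ennreal (4 ^ p * (C + D) * scale_eps n r ^ (2 * p))"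
      by (simp add: mult_ac)
  qed
  then show "\<exists>C n0. small p C n0 R (\<lambda>n r s. X n r s * Y n r s) 0"
    by blast
qed

lemma good_mult:
  assumes X: "good R X x" and Y: "good R Y y" and R: "\<And>n. R n \<subseteq> {..n}"
  shows "good R (\<lambda>n r s. X n r s * Y n r s) (x * y)"
proof -
  have X0: "good R (\<lambda>n r s. X n r s - x) 0" using good_diff[OF X good_const[of R x]] by simp
  have Y0: "good R (\<lambda>n r s. Y n r s - y) 0" using good_diff[OF Y good_const[of R y]] by simp
  have "good R (\<lambda>n r s. ((X n r s - x) * (Y n r s - y) + x * (Y n r s - y) + y * (X n r s - x)) + x * y)
     (((0 + x * 0) + y * 0) + x * y)"
    by (intro good_add good_mult0 good_cmult X0 Y0 R good_const)
  moreover have "((X n r s - x) * (Y n r s - y) + x * (Y n r s - y) + y * (X n r s - x)) + x * y = X n r s * Y n r s" for n r s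
    by (simp add: algebra_simps)
  ultimately show ?thesis by simp
qed

lemma good_sum:
  assumes "\<And>i. i \<in> S \<Longrightarrow> good R (Y i) (y i)" 
  shows "good R (\<lambda>n r s. \<Sum>i\<in>S. Y i n r s) (\<Sum>i\<in>S. y i)"
  using assms by (induction S rule: infinite_finite_induct) (auto intro: good_const good_add)

lemma good_prod:
  assumes "\<And>i. i \<in> S \<Longrightarrow> good R (Y i) (y i)" "\<And>n. R n \<subseteq> {..n}"
  shows "good R (\<lambda>n r s. \<Prod>i\<in>S. Y i n r s) (\<Prod>i\<in>S. y i)"
  using assms by (induction S rule: infinite_finite_induct) (auto intro: good_const intro!: good_mult)

text \<open>Closeness to a nonzero constant in all moments does not control the inverse near zero;
  this is the additional input of \<open>good_inverse\<close>.\<close>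

definition inv_bounded :: "(nat \<Rightarrow> nat set) \<Rightarrow> (nat \<Rightarrow> nat \<Rightarrow> 'w \<Rightarrow> real) \<Rightarrow> bool" where
  "inv_bounded R Y \<longleftrightarrow> (\<forall>p. \<exists>C n0. \<forall>n\<ge>n0. \<forall>r\<in>R n.
     mom n (2 * p) (\<lambda>s. inverse (Y n r s)) \<le> ennreal C)"

lemma good_inverse:
  assumes Y: "good R Y y" and y: "y \<noteq> 0" and inv: "inv_bounded R Y"
  shows "good R (\<lambda>n r s. inverse (Y n r s)) (inverse y)"
proof (rule goodI)
  fix p
  obtain C n0 where C: "0 \<le> C" "1 \<le> n0" "\<And>n r. n \<ge> n0 \<Longrightarrow> r \<in> R n \<Longrightarrow> Y n r \<in> borel_measurable (P n)"
    "\<And>n r. n \<ge> n0 \<Longrightarrow> r \<in> R n \<Longrightarrow>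
       mom n (2 * (2 * p)) (\<lambda>s. Y n r s - y) \<le> ennreal (C * scale_eps n r ^ (2 * (2 * p)))"
    using Y by (rule goodE[where p = "2 * p"]) blast
  obtain C' n1 where C': "0 \<le> C'" "1 \<le> n1" "\<And>n r. n \<ge> n1 \<Longrightarrow> r \<in> R n \<Longrightarrow> Y n r \<in> borel_measurable (P n)"
    "\<And>n r. n \<ge> n1 \<Longrightarrow> r \<in> R n \<Longrightarrow>
       mom n (2 * p) (\<lambda>s. Y n r s - y) \<le> ennreal (C' * scale_eps n r ^ (2 * p))"
    using Y by (rule goodE[where p = p]) blast
  obtain D0 n2 where D0: "\<And>n r. n \<ge> n2 \<Longrightarrow> r \<in> R n \<Longrightarrow> mom n (2 * (2 * p)) (\<lambda>s. inverse (Y n r s)) \<le> ennreal D0"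
    using inv unfolding inv_bounded_def by blast
  define D where "D = max D0 0"
  have D: "0 \<le> D" "\<And>n r. n \<ge> n2 \<Longrightarrow> r \<in> R n \<Longrightarrow> mom n (2 * (2 * p)) (\<lambda>s. inverse (Y n r s)) \<le> ennreal D"
    using order_trans[OF D0 ennreal_leI[of D0 "max D0 0"]] unfolding D_def by simp_all
  define K where "K = inverse y ^ (2 * p) * 4 ^ p"
  have K: "0 \<le> K" by (simp add: K_def zero_le_even_power)
  define w where "w = inverse y ^ (2 * p)"
  have w: "0 \<le> w" by (simp add: w_def zero_le_even_power)
  have "(\<lambda>s. inverse (Y n r s)) \<in> borel_measurable (P n) \<and>
     mom n (2 * p) (\<lambda>s. inverse (Y n r s) - inverse y) \<le> ennreal (K * (C + D + w * C') * scale_eps n r ^ (2 * p))"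
    if n: "n \<ge> max n0 (max n1 n2)" and r: "r \<in> R n" for n r
  proof
    have [measurable]: "Y n r \<in> borel_measurable (P n)" using C(3) n r by auto
    show "(\<lambda>s. inverse (Y n r s)) \<in> borel_measurable (P n)" by measurable
    define e where "e = scale_eps n r ^ (2 * p)"
    have e: "0 < e" unfolding e_def using scale_eps_pos[of n r] n C(2) by simp
    have ee: "scale_eps n r ^ (2 * (2 * p)) = e * e" by (simp add: e_def mult_2 flip: power_add)
    have "mom n (2 * p) (\<lambda>s. inverse (Y n r s) - inverse y)
      \<le> (\<integral>\<^sup>+s. ennreal K * (ennreal (1 / e) * ennreal ((Y n r s - y) ^ (2 * (2 * p))) + ennreal e * ennreal (inverse (Y n r s) ^ (2 * (2 * p)))
         + ennreal w * ennreal ((Y n r s - y) ^ (2 * p))) \<partial>P n)"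
    proof (rule nn_integral_mono)
      fix s
      define x z where "x = (Y n r s - y) ^ (2 * p)" and "z = inverse (Y n r s) ^ (2 * p)"
      have xz: "0 \<le> x" "0 \<le> z" by (simp_all add: x_def z_def zero_le_even_power)
      have "\<bar>inverse (Y n r s) - inverse y\<bar> \<le> \<bar>inverse y\<bar> * (\<bar>Y n r s - y\<bar> * (\<bar>inverse (Y n r s)\<bar> + \<bar>inverse y\<bar>))"
      proof (cases "Y n r s = 0")
        case False
        have "inverse (Y n r s) - inverse y = - (inverse y * ((Y n r s - y) * inverse (Y n r s)))"
          using False y by (simp add: field_simps)
        then have "\<bar>inverse (Y n r s) - inverse y\<bar> = \<bar>inverse y\<bar> * (\<bar>Y n r s - y\<bar> * \<bar>inverse (Y n r s)\<bar>)" by (simp add: abs_mult)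
        also have "\<dots> \<le> \<bar>inverse y\<bar> * (\<bar>Y n r s - y\<bar> * (\<bar>inverse (Y n r s)\<bar> + \<bar>inverse y\<bar>))"
          by (intro mult_left_mono) auto
        finally show ?thesis .
      qed (use y in simp)
      then have "\<bar>inverse (Y n r s) - inverse y\<bar> ^ (2 * p) \<le> (\<bar>inverse y\<bar> * (\<bar>Y n r s - y\<bar> * (\<bar>inverse (Y n r s)\<bar> + \<bar>inverse y\<bar>))) ^ (2 * p)"
        by (intro power_mono) auto
      also have "\<dots> = w * (x * (\<bar>inverse (Y n r s)\<bar> + \<bar>inverse y\<bar>) ^ (2 * p))"
        by (simp add: power_mult_distrib w_def x_def power_even_abs flip: abs_inverse)
      also have "\<dots> \<le> w * (x * (4 ^ p * (z + w)))"
        using even_power_add_le[of "\<bar>inverse (Y n r s)\<bar>" "\<bar>inverse y\<bar>" p] xz w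
        by (intro mult_left_mono) (auto simp: z_def w_def power_even_abs simp flip: abs_inverse)
      also have "\<dots> = K * (x * z + w * x)" by (simp add: K_def w_def algebra_simps)
      \<comment> \<open>The weights \<open>1 / e\<close> and \<open>e\<close> balance the mean of
        \<open>x^2\<close>, which is of order \<open>e^2\<close>, against the mean of
        \<open>z^2\<close>, which is merely bounded; both terms become of order
        \<open>e\<close>.\<close>
      also have "\<dots> \<le> K * ((1 / e * x\<^sup>2 + e * z\<^sup>2) + w * x)"
      proof (intro mult_left_mono add_right_mono K)
        have "2 * (x / sqrt e) * (sqrt e * z) \<le> (x / sqrt e)\<^sup>2 + (sqrt e * z)\<^sup>2" by (rule sum_squares_bound)
        also have "\<dots> = 1 / e * x\<^sup>2 + e * z\<^sup>2" using e by (simp add: power_divide power_mult_distrib)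
        also have "2 * (x / sqrt e) * (sqrt e * z) = 2 * (x * z)" using e by simp
        finally show "x * z \<le> 1 / e * x\<^sup>2 + e * z\<^sup>2" using mult_nonneg_nonneg[OF xz] by linarith
      qed
      finally have fin: "(inverse (Y n r s) - inverse y) ^ (2 * p) \<le> K * ((1 / e * x\<^sup>2 + e * z\<^sup>2) + w * x)"
        by (simp add: power_even_abs)
      have "(Y n r s - y) ^ (2 * (2 * p)) = x\<^sup>2" "inverse (Y n r s) ^ (2 * (2 * p)) = z\<^sup>2"
        by (simp_all add: x_def z_def mult_ac flip: power_mult)
      then show "ennreal ((inverse (Y n r s) - inverse y) ^ (2 * p)) \<le> ennreal K * (ennreal (1 / e) * ennreal ((Y n r s - y) ^ (2 * (2 * p))) + ennreal e * ennreal (inverse (Y n r s) ^ (2 * (2 * p)))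
         + ennreal w * ennreal ((Y n r s - y) ^ (2 * p)))"
        using ennreal_leI[OF fin] K w e xz unfolding x_def[symmetric]
        by (simp add: ennreal_mult[symmetric] ennreal_plus[symmetric] del: ennreal_plus)
    qed
    also have "\<dots> = ennreal K * (ennreal (1 / e) * mom n (2 * (2 * p)) (\<lambda>s. Y n r s - y)
        + ennreal e * mom n (2 * (2 * p)) (\<lambda>s. inverse (Y n r s)) + ennreal w * mom n (2 * p) (\<lambda>s. Y n r s - y))"
      by (simp add: nn_integral_cmult nn_integral_add)
    also have "\<dots> \<le> ennreal K * (ennreal (1 / e) * ennreal (C * (e * e)) + ennreal e * ennreal D + ennreal w * ennreal (C' * e))"
      using C(4) C'(4) D(2) n r unfolding ee[symmetric] unfolding e_def by (intro mult_left_mono add_mono) auto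
    also have "\<dots> = ennreal (K * (1 / e * (C * (e * e)) + e * D + w * (C' * e)))"
      using K C C' D w e by (simp add: ennreal_mult[symmetric] ennreal_plus[symmetric] del: ennreal_plus)
    also have "K * (1 / e * (C * (e * e)) + e * D + w * (C' * e)) = K * (C + D + w * C') * scale_eps n r ^ (2 * p)"
      using e unfolding e_def[symmetric] by (simp add: field_simps)
    finally show "mom n (2 * p) (\<lambda>s. inverse (Y n r s) - inverse y) \<le> ennreal (K * (C + D + w * C') * scale_eps n r ^ (2 * p))" .
  qed
  then show "\<exists>C n0. small p C n0 R (\<lambda>n r s. inverse (Y n r s)) (inverse y)"
    by blast
qed

text \<open>At a fixed depth the drift \<open>i / n\<close> is dominated by the fluctuation
  \<open>1 / sqrt n\<close>.\<close>

lemma good_at: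
  assumes Y: "good (\<lambda>n. {..<n}) Y y"
  shows "good (\<lambda>n. {0}) (\<lambda>n r. Y n i) y"
proof (rule goodI)
  fix p
  obtain C n0 where C: "0 \<le> C" "1 \<le> n0" "\<And>n r. n \<ge> n0 \<Longrightarrow> r \<in> {..<n} \<Longrightarrow> Y n r \<in> borel_measurable (P n)"
    "\<And>n r. n \<ge> n0 \<Longrightarrow> r \<in> {..<n} \<Longrightarrow>
       mom n (2 * p) (\<lambda>s. Y n r s - y) \<le> ennreal (C * scale_eps n r ^ (2 * p))"
    using Y by (rule goodE[where p = p]) blast
  have "Y n i \<in> borel_measurable (P n) \<and> mom n (2 * p) (\<lambda>s. Y n i s - y)
     \<le> ennreal (C * (1 + real i) ^ (2 * p) * scale_eps n 0 ^ (2 * p))" if n: "n \<ge> max n0 (Suc i)" for n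
  proof
    show "Y n i \<in> borel_measurable (P n)" using C(3)[of n i] n by auto
    have "mom n (2 * p) (\<lambda>s. Y n i s - y) \<le> ennreal (C * scale_eps n i ^ (2 * p))"
      using C(4)[of n i] n by auto
    also have "\<dots> \<le> ennreal (C * ((1 + real i) * scale_eps n 0) ^ (2 * p))"
      using C(1) scale_eps_at[of n i] scale_eps_pos[of n i] n C(2)
      by (intro ennreal_leI mult_left_mono power_mono) auto
    finally show "mom n (2 * p) (\<lambda>s. Y n i s - y)
     \<le> ennreal (C * (1 + real i) ^ (2 * p) * scale_eps n 0 ^ (2 * p))"
      by (simp add: power_mult_distrib mult.assoc)
  qed
  then show "\<exists>C n0. small p C n0 (\<lambda>n. {0}) (\<lambda>n r. Y n i) y"
    by blast
qed

lemma good_shift: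
  assumes Y: "good (\<lambda>n. {..n}) Y y"
  shows "good (\<lambda>n. {..<n}) (\<lambda>n r. Y n (Suc r)) y"
proof (rule goodI)
  fix p
  obtain C n0 where C: "0 \<le> C" "1 \<le> n0" "\<And>n r. n \<ge> n0 \<Longrightarrow> r \<in> {..n} \<Longrightarrow> Y n r \<in> borel_measurable (P n)"
    "\<And>n r. n \<ge> n0 \<Longrightarrow> r \<in> {..n} \<Longrightarrow>
       mom n (2 * p) (\<lambda>s. Y n r s - y) \<le> ennreal (C * scale_eps n r ^ (2 * p))"
    using Y by (rule goodE[where p = p]) blast
  have "Y n (Suc r) \<in> borel_measurable (P n) \<and> mom n (2 * p) (\<lambda>s. Y n (Suc r) s - y)
     \<le> ennreal (C * 4 ^ p * scale_eps n r ^ (2 * p))" if n: "n \<ge> n0" and r: "r \<in> {..<n}" for n r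
  proof
    show "Y n (Suc r) \<in> borel_measurable (P n)" using C(3)[of n "Suc r"] n r by auto
    have n1: "1 \<le> n" using n C(2) by simp
    have "scale_eps n (Suc r) \<le> (1 + 1 / sqrt (real n)) * scale_eps n r" by (rule scale_eps_Suc[OF n1])
    also have "\<dots> \<le> 2 * scale_eps n r" using n1 scale_eps_pos[OF n1, of r] by (intro mult_right_mono) auto
    finally have e: "scale_eps n (Suc r) \<le> 2 * scale_eps n r" .
    have "mom n (2 * p) (\<lambda>s. Y n (Suc r) s - y) \<le> ennreal (C * scale_eps n (Suc r) ^ (2 * p))"
      using C(4)[of n "Suc r"] n r by auto
    also have "\<dots> \<le> ennreal (C * (2 * scale_eps n r) ^ (2 * p))"
      using C(1) e scale_eps_pos[OF n1, of "Suc r"] by (intro ennreal_leI mult_left_mono power_mono) auto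
    finally show "mom n (2 * p) (\<lambda>s. Y n (Suc r) s - y) \<le> ennreal (C * 4 ^ p * scale_eps n r ^ (2 * p))"
      by (simp add: power_mult_distrib power_mult mult.assoc)
  qed
  then show "\<exists>C n0. small p C n0 (\<lambda>n. {..<n}) (\<lambda>n r. Y n (Suc r)) y"
    by blast
qed

text \<open>At \<open>r = n\<close> the scale is at least 1, so a constant with the wrong value is
  an admissible error there.\<close>

lemma good_extend:
  assumes Y: "good (\<lambda>n. {..<n}) Y y" and c: "\<And>n s. Y n n s = c"
  shows "good (\<lambda>n. {..n}) Y y"
proof (rule goodI)
  fix p
  obtain C n0 where C: "0 \<le> C" "1 \<le> n0" "\<And>n r. n \<ge> n0 \<Longrightarrow> r \<in> {..<n} \<Longrightarrow> Y n r \<in> borel_measurable (P n)"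
    "\<And>n r. n \<ge> n0 \<Longrightarrow> r \<in> {..<n} \<Longrightarrow>
       mom n (2 * p) (\<lambda>s. Y n r s - y) \<le> ennreal (C * scale_eps n r ^ (2 * p))"
    using Y by (rule goodE[where p = p]) blast
  define D where "D = max C ((c - y) ^ (2 * p))"
  have "Y n r \<in> borel_measurable (P n) \<and> mom n (2 * p) (\<lambda>s. Y n r s - y)
     \<le> ennreal (D * scale_eps n r ^ (2 * p))" if n: "n \<ge> n0" and r: "r \<in> {..n}" for n r
  proof (cases "r = n")
    case False
    have "C * scale_eps n r ^ (2 * p) \<le> D * scale_eps n r ^ (2 * p)"
      by (intro mult_right_mono) (auto simp: D_def zero_le_even_power)
    then show ?thesis using C(3)[of n r] order_trans[OF C(4)[of n r] ennreal_leI] n r False by simp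
  next
    case True
    have n1: "1 \<le> n" using n C(2) by simp
    have Yc: "Y n n = (\<lambda>s. c)" using c by auto
    have "(c - y) ^ (2 * p) * 1 \<le> D * scale_eps n n ^ (2 * p)"
      using scale_eps_ge_1[OF n1] C(1) by (intro mult_mono one_le_power) (auto simp: D_def zero_le_even_power max_def)
    then show ?thesis using True Yc prob_space.emeasure_space_1[OF prob] by (simp add: ennreal_leI)
  qed
  then show "\<exists>C n0. small p C n0 (\<lambda>n. {..n}) Y y"
    by blast
qed

text \<open>A downward recursion in \<open>r\<close> whose random factor \<open>q\<close> is independent of the next level
  (assumption \<open>ind\<close>) and contracts in every even moment.\<close>

lemma good_contraction:
  assumes \<eta>: "good (\<lambda>n. {..<n}) \<eta> 0" and c: "\<And>n s. Y n n s = c"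
    and rec: "\<And>n r s. 1 \<le> n \<Longrightarrow> r < n \<Longrightarrow> Y n r s - y = q n r s * (Y n (Suc r) s - y) + \<eta> n r s"
    and \<rho>: "0 < \<rho>" "\<rho> < 1"
    and Ym: "\<And>n r. 1 \<le> n \<Longrightarrow> r \<le> n \<Longrightarrow> Y n r \<in> borel_measurable (P n)"
    and qm: "\<And>n r. 1 \<le> n \<Longrightarrow> r < n \<Longrightarrow> q n r \<in> borel_measurable (P n)"
    and ind: "\<And>n r p. 1 \<le> n \<Longrightarrow> r < n \<Longrightarrow>
      (\<integral>\<^sup>+s. ennreal (q n r s ^ (2 * p)) * ennreal ((Y n (Suc r) s - y) ^ (2 * p)) \<partial>P n)
       = mom n (2 * p) (\<lambda>s. q n r s) * mom n (2 * p) (\<lambda>s. Y n (Suc r) s - y)"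
    and qb: "\<And>p. \<exists>n0. \<forall>n\<ge>n0. \<forall>r<n. mom n (2 * p) (\<lambda>s. q n r s) \<le> ennreal (\<rho> ^ (2 * p))"
  shows "good (\<lambda>n. {..n}) Y y"
proof (rule goodI)
  fix p0 :: nat
  show "\<exists>C n0. small p0 C n0 (\<lambda>n. {..n}) Y y"
  \<comment> \<open>The exponent 0 admits no contraction; in that case the claim only concerns the
    total mass.\<close>
  proof (cases p0)
    case 0
    then show ?thesis using Ym prob_space.emeasure_space_1[OF prob]
      by (intro exI[of _ 1]) auto
  next
    case (Suc p')
    define p where "p = Suc p'"
    have p0: "0 < p" by (simp add: p_def)
    obtain C n0 where C: "0 \<le> C" "1 \<le> n0" "\<And>n r. n \<ge> n0 \<Longrightarrow> r \<in> {..<n} \<Longrightarrow> \<eta> n r \<in> borel_measurable (P n)"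
      "\<And>n r. n \<ge> n0 \<Longrightarrow> r \<in> {..<n} \<Longrightarrow>
         mom n (2 * p) (\<lambda>s. \<eta> n r s - 0) \<le> ennreal (C * scale_eps n r ^ (2 * p))"
      using \<eta> by (rule goodE[where p = p]) blast
    obtain n1 where n1: "\<And>n r. n \<ge> n1 \<Longrightarrow> r < n \<Longrightarrow> mom n (2 * p) (\<lambda>s. q n r s) \<le> ennreal (\<rho> ^ (2 * p))"
      using qb[of p] by blast
    \<comment> \<open>Two intermediate factors below 1. The first is spent on separating the
      inhomogeneous term, with \<open>t\<close> such that \<open>(1 + t) * \<rho> = \<rho>1\<close>;
      the passage from \<open>\<rho>1\<close> to \<open>\<rho>2\<close> pays for the growth of the
      scale from one level to the next.\<close>
    define \<rho>1 where "\<rho>1 = (1 + \<rho>) / 2"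
    define t where "t = \<rho>1 / \<rho> - 1"
    define \<rho>2 where "\<rho>2 = (1 + \<rho>1) / 2"
    have r1: "\<rho> < \<rho>1" "\<rho>1 < 1" "\<rho>1 < \<rho>2" "\<rho>2 < 1" "0 < \<rho>1" "0 < \<rho>2" using \<rho> by (auto simp: \<rho>1_def \<rho>2_def field_simps)
    have t: "0 < t" "(1 + t) * \<rho> = \<rho>1" using \<rho> r1 by (auto simp: t_def field_simps)
    have "(\<lambda>n. \<rho>1 * (1 + 1 / sqrt (real n))) \<longlonglongrightarrow> \<rho>1 * (1 + 0)"
      by (intro tendsto_intros) real_asymp
    then have "\<forall>\<^sub>F n in sequentially. \<rho>1 * (1 + 1 / sqrt (real n)) < \<rho>2"
      using r1 by (intro order_tendstoD(2)[of _ "\<rho>1 * (1 + 0)"]) auto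
    then obtain n2 where n2: "\<And>n. n \<ge> n2 \<Longrightarrow> \<rho>1 * (1 + 1 / sqrt (real n)) < \<rho>2"
      by (auto simp: eventually_sequentially)
    define K where "K = (1 + 1 / t) ^ (2 * p) * C"
    have K: "0 \<le> K" using C t by (simp add: K_def)
    have r2p: "\<rho>2 ^ (2 * p) < 1" using r1 p0 power_less_one_iff[of \<rho>2 "2 * p"] by auto
    \<comment> \<open>Large enough for the boundary value at \<open>r = n\<close>, and such that the
      induction reproduces the same constant.\<close>
    define A where "A = max ((c - y) ^ (2 * p)) (K / (1 - \<rho>2 ^ (2 * p)))"
    have A: "0 \<le> A" using K r2p unfolding A_def by (simp add: le_max_iff_disj)
    have "K / (1 - \<rho>2 ^ (2 * p)) \<le> A" by (simp add: A_def)
    then have AK: "\<rho>2 ^ (2 * p) * A + K \<le> A" using r2p by (simp add: field_simps)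
    have "mom n (2 * p) (\<lambda>s. Y n r s - y) \<le> ennreal (A * scale_eps n r ^ (2 * p))"
      if n: "n \<ge> max n0 (max n1 n2)" and "r \<le> n" for n r
      using that(2)
    proof (induction rule: inc_induct)
      case base
      have "(c - y) ^ (2 * p) * 1 \<le> A * scale_eps n n ^ (2 * p)"
        using scale_eps_ge_1[of n] n C(2) A by (intro mult_mono one_le_power) (auto simp: A_def)
      then show ?case using c prob_space.emeasure_space_1[OF prob] by (simp add: ennreal_leI)
    next
      case (step r)
      have nn: "1 \<le> n" using n C(2) by simp
      have [measurable]: "\<eta> n r \<in> borel_measurable (P n)" "q n r \<in> borel_measurable (P n)" "Y n (Suc r) \<in> borel_measurable (P n)"
        using C(3)[of n r] qm[of n r] Ym[of n "Suc r"] n step nn by auto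
      define e where "e = scale_eps n r ^ (2 * p)"
      have e: "0 \<le> e" unfolding e_def by (simp add: zero_le_even_power)
      have "mom n (2 * p) (\<lambda>s. Y n r s - y)
        \<le> (\<integral>\<^sup>+s. ennreal ((1 + t) ^ (2 * p)) * (ennreal (q n r s ^ (2 * p)) * ennreal ((Y n (Suc r) s - y) ^ (2 * p)))
           + ennreal ((1 + 1 / t) ^ (2 * p)) * ennreal ((\<eta> n r s - 0) ^ (2 * p)) \<partial>P n)"
      proof (rule nn_integral_mono)
        fix s
        have "(Y n r s - y) ^ (2 * p) \<le> (1 + t) ^ (2 * p) * (q n r s * (Y n (Suc r) s - y)) ^ (2 * p) + (1 + 1 / t) ^ (2 * p) * \<eta> n r s ^ (2 * p)"
          unfolding rec[OF nn step(2)] by (rule even_power_add_le'[OF t(1)])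
        from ennreal_leI[OF this]
        show "ennreal ((Y n r s - y) ^ (2 * p)) \<le> ennreal ((1 + t) ^ (2 * p)) * (ennreal (q n r s ^ (2 * p)) * ennreal ((Y n (Suc r) s - y) ^ (2 * p)))
           + ennreal ((1 + 1 / t) ^ (2 * p)) * ennreal ((\<eta> n r s - 0) ^ (2 * p))"
          by (simp add: power_mult_distrib zero_le_even_power ennreal_mult[symmetric] ennreal_plus[symmetric] del: ennreal_plus)
      qed
      also have "\<dots> = ennreal ((1 + t) ^ (2 * p)) * (mom n (2 * p) (\<lambda>s. q n r s) * mom n (2 * p) (\<lambda>s. Y n (Suc r) s - y))
           + ennreal ((1 + 1 / t) ^ (2 * p)) * mom n (2 * p) (\<lambda>s. \<eta> n r s - 0)"
        unfolding ind[OF nn step(2), symmetric] by (subst nn_integral_add) (auto simp: nn_integral_cmult)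
      also have "\<dots> \<le> ennreal ((1 + t) ^ (2 * p)) * (ennreal (\<rho> ^ (2 * p)) * ennreal (A * scale_eps n (Suc r) ^ (2 * p)))
           + ennreal ((1 + 1 / t) ^ (2 * p)) * ennreal (C * e)"
        using n1[of n r] step C(4)[of n r] n unfolding e_def by (intro add_mono mult_left_mono mult_mono) auto
      also have "\<dots> = ennreal (((1 + t) * \<rho>) ^ (2 * p) * (A * scale_eps n (Suc r) ^ (2 * p)) + K * e)"
        using A C(1) e t(1) \<rho> unfolding K_def
        by (simp add: ennreal_mult[symmetric] ennreal_plus[symmetric] zero_le_even_power power_mult_distrib mult_ac del: ennreal_plus)
      also have "\<dots> \<le> ennreal (A * e)"
      proof (rule ennreal_leI)
        have "\<rho>1 * scale_eps n (Suc r) \<le> \<rho>1 * ((1 + 1 / sqrt (real n)) * scale_eps n r)"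
          using r1 scale_eps_Suc[OF nn] by (intro mult_left_mono) auto
        also have "\<dots> \<le> \<rho>2 * scale_eps n r"
          using n2[of n] n scale_eps_pos[OF nn, of r] unfolding mult.assoc[symmetric] by (intro mult_right_mono) auto
        finally have "(\<rho>1 * scale_eps n (Suc r)) ^ (2 * p) \<le> (\<rho>2 * scale_eps n r) ^ (2 * p)"
          using r1 scale_eps_pos[OF nn, of "Suc r"] by (intro power_mono) auto
        then have "A * (\<rho>1 * scale_eps n (Suc r)) ^ (2 * p) \<le> A * (\<rho>2 * scale_eps n r) ^ (2 * p)"
          using A by (intro mult_left_mono) auto
        then have "((1 + t) * \<rho>) ^ (2 * p) * (A * scale_eps n (Suc r) ^ (2 * p)) + K * e \<le> (\<rho>2 ^ (2 * p) * A + K) * e"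
          unfolding t(2) e_def by (simp add: power_mult_distrib algebra_simps)
        also have "\<dots> \<le> A * e" using AK e by (intro mult_right_mono) auto
        finally show "((1 + t) * \<rho>) ^ (2 * p) * (A * scale_eps n (Suc r) ^ (2 * p)) + K * e \<le> A * e" .
      qed
      finally show ?case unfolding e_def .
    qed
    then show ?thesis using Ym C(2) unfolding Suc p_def[symmetric]
      by (intro exI[of _ A] exI[of _ "max n0 (max n1 n2)"]) auto
  qed
qed

end

lemma jac_inv_cong:
  "(\<And>i. r \<le> i \<Longrightarrow> i < r + N \<Longrightarrow> a i = a' i \<and> s i = s' i) \<Longrightarrow> jac_inv a s r N j = jac_inv a' s' r N j"
proof (induction N arbitrary: r j)
  case (Suc N)
  have IH: "jac_inv a s (Suc r) N i = jac_inv a' s' (Suc r) N i" for i using Suc by simp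
  show ?case
  proof (induction j rule: less_induct)
    case (less j)
    show ?case
    proof (cases j)
      case (Suc i)
      have "(\<Sum>t<Suc i. jac_inv a s r (Suc N) t * jac_inv a s (Suc r) N (Suc i - t))
        = (\<Sum>t<Suc i. jac_inv a' s' r (Suc N) t * jac_inv a' s' (Suc r) N (Suc i - t))"
        by (rule sum.cong) (use less Suc IH in auto)
      then show ?thesis unfolding Suc jac_inv.simps(3)[of _ _ r N i] using less[of i] Suc Suc.prems by simp
    qed simp
  qed
qed simp

lemma jac_inv_measurable:
  "(\<And>i. r \<le> i \<Longrightarrow> i < r + N \<Longrightarrow> (\<lambda>x. a x i) \<in> borel_measurable M \<and> (\<lambda>x. s x i) \<in> borel_measurable M) \<Longrightarrow>
    (\<lambda>x. jac_inv (a x) (s x) r N j) \<in> borel_measurable M"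
proof (induction N arbitrary: r j)
  case (Suc N)
  have IH [measurable]: "(\<lambda>x. jac_inv (a x) (s x) (Suc r) N i) \<in> borel_measurable M" for i
    by (rule Suc.IH) (use Suc.prems in auto)
  have [measurable]: "(\<lambda>x. a x r) \<in> borel_measurable M" "(\<lambda>x. s x r) \<in> borel_measurable M" using Suc.prems[of r] by auto
  show ?case
  proof (induction j rule: less_induct)
    case (less j)
    show ?case
    proof (cases j)
      case (Suc i)
      have [measurable]: "(\<lambda>x. jac_inv (a x) (s x) r (Suc N) t) \<in> borel_measurable M" if "t < Suc i" for t using less Suc that by simp
      have [measurable]: "(\<lambda>x. jac_inv (a x) (s x) r (Suc N) i) \<in> borel_measurable M" by simp
      have [measurable]: "(\<lambda>x. \<Sum>t<Suc i. jac_inv (a x) (s x) r (Suc N) t * jac_inv (a x) (s x) (Suc r) N (Suc i - t)) \<in> borel_measurable M"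
        by (intro borel_measurable_sum borel_measurable_times) auto
      show ?thesis unfolding Suc jac_inv.simps(3)[of _ _ r N i] by measurable
    qed simp
  qed
qed simp

lemma chi_mom_le: "0 \<le> N \<Longrightarrow> chi_mom N q \<le> (N + 2 * real q) ^ q \<and> 0 \<le> chi_mom N q"
proof -
  assume N: "0 \<le> N"
  have "i \<le> q \<Longrightarrow> chi_mom N i \<le> (N + 2 * real q) ^ i \<and> 0 \<le> chi_mom N i" for i
  proof (induction i)
    case (Suc i)
    then have "chi_mom N (Suc i) \<le> (N + 2 * real q) * (N + 2 * real q) ^ i" unfolding chi_mom_Suc
      using N by (intro mult_mono) auto
    then show ?case using Suc N by (simp add: chi_mom_Suc)
  qed (simp add: chi_mom_def)
  then show ?thesis by blast
qed

text \<open>For negative \<open>q\<close>, where \<open>sqrt\<close> is odd, the difference of roots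
  is a sum; the constant 2 in place of 1 covers this case. No sign condition then has to be carried
  along for the random quadratic form.\<close>

lemma sqrt_diff_le: "0 < a \<Longrightarrow> \<bar>sqrt q - sqrt a\<bar> \<le> 2 / sqrt a * \<bar>q - a\<bar>"
proof (cases "0 \<le> q")
  assume a: "0 < a"
  case True
  have "\<bar>q - a\<bar> = \<bar>sqrt q - sqrt a\<bar> * (sqrt q + sqrt a)"
  proof -
    have "q - a = (sqrt q - sqrt a) * (sqrt q + sqrt a)" using True a by (simp add: algebra_simps)
    then show ?thesis using True a by (simp add: abs_mult)
  qed
  then have "\<bar>sqrt q - sqrt a\<bar> * sqrt a \<le> 2 * \<bar>q - a\<bar>" using True a by (simp add: distrib_left)
  then show ?thesis using a by (simp add: field_simps)
next
  assume a: "0 < a"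
  case False
  define u where "u = sqrt (- q)"
  have "u\<^sup>2 = - q" using False unfolding u_def by (intro real_sqrt_pow2) simp
  then have u: "0 \<le> u" "q = - u\<^sup>2" "sqrt q = - u" using False by (auto simp: u_def real_sqrt_minus)
  define v where "v = sqrt a"
  have v: "0 < v" "a = v\<^sup>2" using a by (auto simp: v_def)
  have "x + z \<le> 2 * (y + z)" if "2 * x \<le> y + z" "0 \<le> y" "0 \<le> z" for x y z :: real using that by simp
  from this[of "u * v" "u\<^sup>2" "v\<^sup>2"] have "(u + v) * v \<le> 2 * (u\<^sup>2 + v\<^sup>2)"
    using sum_squares_bound[of u v] by (simp add: distrib_right mult.assoc power2_eq_square[of v])
  then have "u + v \<le> 2 / v * (u\<^sup>2 + v\<^sup>2)" using v(1) by (simp add: field_simps)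
  then show ?thesis unfolding v_def[symmetric] u(3) using u(1,2) v by (simp add: v_def[symmetric] add.commute)
qed

lemma jac_poly_degree: "degree (jac_poly a s k) \<le> k"
proof (induction a s k rule: jac_poly.induct)
  case (3 a s k)
  have "degree ([:a (Suc k) + s k, -1:] * jac_poly a s (Suc k)) \<le> Suc (Suc k)"
    by (rule order_trans[OF degree_mult_le]) (use 3 in simp)
  moreover have "degree (Polynomial.smult (a k * s k) (jac_poly a s k)) \<le> Suc (Suc k)"
    by (rule order_trans[OF degree_smult_le]) (use 3 in simp)
  ultimately show ?case unfolding jac_poly.simps(3) by (rule degree_diff_le)
qed auto

section \<open>The entries of the bidiagonal Wishart factor\<close>

locale wishart_limit =
  fixes \<beta> :: nat and d :: real
  assumes beta: "\<beta> \<in> {1, 2}" and d: "0 < d" "d \<le> 1"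
begin

definition m :: "nat \<Rightarrow> nat" where "m n = wishart_cols d n"
definition I :: "nat \<Rightarrow> (nat \<times> nat \<times> nat) set" where "I n = {..<\<beta>} \<times> {..<n} \<times> {..<m n}"
definition RI :: "nat \<Rightarrow> nat \<Rightarrow> (nat \<times> nat \<times> nat) set" where "RI n r = {..<\<beta>} \<times> {r} \<times> {r..<m n}"
definition CI :: "nat \<Rightarrow> nat \<Rightarrow> (nat \<times> nat \<times> nat) set" where "CI n r = {..<\<beta>} \<times> {r<..<n} \<times> {r}"
definition \<kappa> :: "nat \<Rightarrow> real" where "\<kappa> n = 1 / (real \<beta> * real (m n))"

sublocale G: gauss_space "I n" for n by unfold_locales (simp add: I_def)

text \<open>Squared diagonal and subdiagonal entries of the bidiagonal reduction of the Gaussian matrix.\<close>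

definition A :: "nat \<Rightarrow> nat \<Rightarrow> (nat \<times> nat \<times> nat \<Rightarrow> real) \<Rightarrow> real" where "A n r w = \<kappa> n * G.sq (RI n r) w"
definition S :: "nat \<Rightarrow> nat \<Rightarrow> (nat \<times> nat \<times> nat \<Rightarrow> real) \<Rightarrow> real" where "S n r w = \<kappa> n * G.sq (CI n r) w"

lemma m_bounds: "real (m n) \<le> real n / d" "real n < d * real (m n) + d" "n \<le> m n"
proof -
  have "0 \<le> \<lfloor>real n / d\<rfloor>" using d by simp
  then have e: "real (m n) = of_int \<lfloor>real n / d\<rfloor>" by (simp add: m_def wishart_cols_def)
  show 1: "real (m n) \<le> real n / d" unfolding e by linarith
  have "real n / d < real (m n) + 1" unfolding e by linarith
  then show "real n < d * real (m n) + d" using d by (simp add: field_simps)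
  have "real n \<le> real n / d" using d by (simp add: field_simps mult_left_le_one_le)
  then have "int n \<le> \<lfloor>real n / d\<rfloor>" by (simp add: le_floor_iff)
  then show "n \<le> m n" by (simp add: m_def wishart_cols_def)
qed

lemma m_lower: "d * real (m n) \<le> real n" using m_bounds(1)[of n] d by (simp add: field_simps)

lemma beta_pos: "1 \<le> real \<beta>" using beta by auto

lemma subsets: "r < n \<Longrightarrow> RI n r \<subseteq> I n" "r < n \<Longrightarrow> CI n r \<subseteq> I n"
  using m_bounds(3)[of n] by (auto simp: RI_def CI_def I_def)

lemma cards: "r < n \<Longrightarrow> real (card (RI n r)) = real \<beta> * (real (m n) - real r)"
  "r < n \<Longrightarrow> real (card (CI n r)) = real \<beta> * (real n - 1 - real r)"
  using m_bounds(3)[of n] by (auto simp: RI_def CI_def card_cartesian_product of_nat_diff)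

lemma A_measurable: "r < n \<Longrightarrow> A n r \<in> borel_measurable (gauss_on (I n))"
  unfolding A_def[abs_def] using G.sq_measurable[OF subsets(1)] by simp
lemma S_measurable: "r < n \<Longrightarrow> S n r \<in> borel_measurable (gauss_on (I n))"
  unfolding S_def[abs_def] using G.sq_measurable[OF subsets(2)] by simp

sublocale prob_family "\<lambda>n. gauss_on (I n)" by unfold_locales

text \<open>A scaled chi-square variable differs from \<open>y\<close> by its fluctuation and by the
  bias of its mean. The fluctuation is of order \<open>1 / sqrt n\<close>, because
  \<open>\<kappa> n\<close> is at most \<open>1 / n\<close> and the mean at most 1; the bias is
  within the scale by assumption.\<close>

lemma good_sq:
  assumes J: "\<And>n r. r < n \<Longrightarrow> J n r \<subseteq> I n" and c: "\<And>n r. r < n \<Longrightarrow> real (card (J n r)) \<le> real \<beta> * real (m n)"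
    and y: "\<And>n r. r < n \<Longrightarrow> \<bar>\<kappa> n * real (card (J n r)) - y\<bar> \<le> 2 * scale_eps n r"
  shows "good (\<lambda>n. {..<n}) (\<lambda>n r w. \<kappa> n * G.sq (J n r) w) y"
proof (rule goodI)
  fix p
  obtain C where C: "0 \<le> C" "\<And>N. 1 \<le> N \<Longrightarrow> \<bar>chi_central N (2 * p)\<bar> \<le> C * N ^ p"
    using chi_central_bound[of "2 * p"] by auto
  have "mom n (2 * p) (\<lambda>w. \<kappa> n * G.sq (J n r) w - y) \<le> ennreal (4 ^ p * (C + 1 + 4 ^ p) * scale_eps n r ^ (2 * p))"
    if r: "r < n" for n r
  proof -
    define N where "N = real (card (J n r))"
    define e where "e = scale_eps n r ^ (2 * p)"
    have n: "1 \<le> n" using r by simp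
    have se: "0 < scale_eps n r" by (rule scale_eps_pos[OF n])
    have e: "0 \<le> e" unfolding e_def using se by simp
    have bm: "real n \<le> real \<beta> * real (m n)" using mult_mono[OF beta_pos, of "real n" "real (m n)"] m_bounds(3)[of n] by simp
    note [measurable] = G.sq_measurable[OF J[OF r]]
    have cc: "\<kappa> n ^ (2 * p) * \<bar>chi_central N (2 * p)\<bar> \<le> (C + 1) * e"
    \<comment> \<open>The last column has no entries below the diagonal, and the bound on the
      central moments requires at least one degree of freedom.\<close>
    proof (cases "card (J n r) = 0")
      case True
      have N0: "lin_ev (chi_mom 0) ([:0, 1:] ^ q) = (if q = 0 then 1 else 0)" for q :: nat
      proof (cases q)
        case (Suc i)
        have "chi_mom 0 (Suc j) = 0" for j by (simp add: chi_mom_def pochhammer_rec)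
        then show ?thesis using lin_ev_linear_mult[of "chi_mom 0" 0 1 "[:0, 1:] ^ i"] Suc by (simp add: lin_ev_def)
      qed (simp add: lin_ev_def chi_mom_def)
      show ?thesis using N0[of "2 * p"] e C(1) by (cases "p = 0") (auto simp: N_def True chi_central_def e_def)
    next
      case False
      have k: "\<kappa> n * N \<le> 1" "0 \<le> \<kappa> n" "\<kappa> n \<le> 1 / real n"
        using c[OF r] bm n beta_pos unfolding N_def \<kappa>_def by (auto simp: divide_le_eq intro!: divide_left_mono)
      have "\<kappa> n ^ (2 * p) * \<bar>chi_central N (2 * p)\<bar> \<le> \<kappa> n ^ (2 * p) * (C * N ^ p)"
        using C(2)[of N] False k by (intro mult_left_mono) (auto simp: N_def)
      also have "\<dots> = C * (\<kappa> n ^ p * (\<kappa> n * N) ^ p)" by (simp add: mult_2 power_add power_mult_distrib)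
      also have "\<dots> \<le> C * ((1 / real n) ^ p * 1 ^ p)"
        using k C(1) by (intro mult_left_mono mult_mono power_mono) (auto simp: N_def)
      also have "(1 / real n) ^ p = (1 / sqrt (real n)) ^ (2 * p)" by (simp add: power_mult power_divide)
      also have "C * ((1 / sqrt (real n)) ^ (2 * p) * 1 ^ p) \<le> C * e"
        unfolding e_def using C(1) scale_eps_ge_sqrt[of n r] by (auto intro!: mult_left_mono power_mono)
      also have "\<dots> \<le> (C + 1) * e" using e by (simp add: algebra_simps)
      finally show ?thesis .
    qed
    have "mom n (2 * p) (\<lambda>w. \<kappa> n * G.sq (J n r) w - y)
      \<le> (\<integral>\<^sup>+w. ennreal (4 ^ p * \<kappa> n ^ (2 * p)) * ennreal ((G.sq (J n r) w - N) ^ (2 * p)) + ennreal (4 ^ p * (4 ^ p * e)) \<partial>gauss_on (I n))"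
    proof (rule nn_integral_mono)
      fix w
      have "(\<kappa> n * N - y) ^ (2 * p) \<le> (2 * scale_eps n r) ^ (2 * p)"
        using power_mono[OF y[OF r], of "2 * p"] by (simp add: N_def power_even_abs)
      then have yy: "(\<kappa> n * N - y) ^ (2 * p) \<le> 4 ^ p * e" by (simp add: e_def power_mult_distrib power_mult)
      have "(\<kappa> n * G.sq (J n r) w - y) ^ (2 * p) = (\<kappa> n * (G.sq (J n r) w - N) + (\<kappa> n * N - y)) ^ (2 * p)" by (simp add: algebra_simps)
      also have "\<dots> \<le> 4 ^ p * ((\<kappa> n * (G.sq (J n r) w - N)) ^ (2 * p) + (\<kappa> n * N - y) ^ (2 * p))" by (rule even_power_add_le)
      also have "\<dots> \<le> 4 ^ p * (\<kappa> n ^ (2 * p) * (G.sq (J n r) w - N) ^ (2 * p) + 4 ^ p * e)"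
        using yy by (intro mult_left_mono add_mono) (auto simp: power_mult_distrib)
      finally show "ennreal ((\<kappa> n * G.sq (J n r) w - y) ^ (2 * p)) \<le> ennreal (4 ^ p * \<kappa> n ^ (2 * p)) * ennreal ((G.sq (J n r) w - N) ^ (2 * p)) + ennreal (4 ^ p * (4 ^ p * e))"
        using e by (simp add: ennreal_mult[symmetric] ennreal_plus[symmetric] zero_le_even_power ennreal_leI algebra_simps del: ennreal_plus)
    qed
    also have "\<dots> = ennreal (4 ^ p * \<kappa> n ^ (2 * p)) * ennreal (chi_central N (2 * p)) + ennreal (4 ^ p * (4 ^ p * e))"
      using G.sq_central[OF J[OF r], of p] G.P.emeasure_space_1[of n] by (simp add: nn_integral_add nn_integral_cmult N_def)
    also have "\<dots> \<le> ennreal (4 ^ p * \<kappa> n ^ (2 * p)) * ennreal \<bar>chi_central N (2 * p)\<bar> + ennreal (4 ^ p * (4 ^ p * e))"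
      by (intro add_right_mono mult_left_mono ennreal_leI) auto
    also have "\<dots> = ennreal (4 ^ p * (\<kappa> n ^ (2 * p) * \<bar>chi_central N (2 * p)\<bar>) + 4 ^ p * (4 ^ p * e))"
      using e by (simp add: ennreal_mult[symmetric] ennreal_plus[symmetric] zero_le_even_power mult.assoc del: ennreal_plus)
    also have "\<dots> \<le> ennreal (4 ^ p * ((C + 1) * e) + 4 ^ p * (4 ^ p * e))"
      using cc by (intro ennreal_leI add_right_mono mult_left_mono) auto
    finally show ?thesis by (simp add: e_def algebra_simps)
  qed
  then show "\<exists>C n0. \<forall>n\<ge>n0. \<forall>r\<in>{..<n}. (\<lambda>w. \<kappa> n * G.sq (J n r) w) \<in> borel_measurable (gauss_on (I n)) \<and>
     mom n (2 * p) (\<lambda>w. \<kappa> n * G.sq (J n r) w - y) \<le> ennreal (C * scale_eps n r ^ (2 * p))"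
    using G.sq_measurable[OF J] by (intro exI[of _ "4 ^ p * (C + 1 + 4 ^ p)"] exI[of _ 0]) auto
qed

lemma \<kappa>_mult: "\<kappa> n * (real \<beta> * x) = x / real (m n)"
  using beta_pos by (simp add: \<kappa>_def)

lemma good_A: "good (\<lambda>n. {..<n}) A 1"
proof -
  have "\<bar>\<kappa> n * real (card (RI n r)) - 1\<bar> \<le> 2 * scale_eps n r" if "r < n" for n r
  proof -
    have m0: "0 < m n" using that m_bounds(3)[of n] by simp
    have "\<kappa> n * real (card (RI n r)) - 1 = - (real r / real (m n))"
      unfolding cards(1)[OF that] \<kappa>_mult using m0 by (simp add: field_simps)
    moreover have "real r / real (m n) \<le> real r / real n"
      using that m_bounds(3)[of n] by (intro divide_left_mono) auto
    moreover have "real r / real n \<le> 2 * scale_eps n r"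
      by (simp add: scale_eps_def add_increasing divide_right_mono)
    ultimately show ?thesis by simp
  qed
  moreover have "real (card (RI n r)) \<le> real \<beta> * real (m n)" if "r < n" for n r
    unfolding cards(1)[OF that] by (intro mult_left_mono) auto
  ultimately show ?thesis unfolding A_def by (intro good_sq subsets) auto
qed

lemma good_S: "good (\<lambda>n. {..<n}) S d"
proof -
  have "\<bar>\<kappa> n * real (card (CI n r)) - d\<bar> \<le> 2 * scale_eps n r" if "r < n" for n r
  proof -
    have m0: "0 < m n" "real n \<le> real (m n)" using that m_bounds(3)[of n] by auto
    have n1: "1 \<le> sqrt (real n)" using that by simp
    have "\<kappa> n * real (card (CI n r)) - d = (real n - d * real (m n) - (1 + real r)) / real (m n)"
      unfolding cards(2)[OF that] \<kappa>_mult using m0 by (simp add: field_simps)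
    also have "\<bar>\<dots>\<bar> = \<bar>real n - d * real (m n) - (1 + real r)\<bar> / real (m n)" by simp
    also have "\<dots> \<le> (2 + real r) / real (m n)"
      using m_lower[of n] m_bounds(2)[of n] d by (intro divide_right_mono) auto
    also have "\<dots> \<le> (2 + real r) / real n" using m0 that by (intro divide_left_mono) auto
    also have "\<dots> \<le> 2 / sqrt (real n) + real r / real n"
    proof -
      have "sqrt (real n) * 1 \<le> sqrt (real n) * sqrt (real n)" using n1 by (intro mult_left_mono) auto
      then have "2 / real n \<le> 2 / sqrt (real n)" using that by (intro divide_left_mono) auto
      then show ?thesis by (simp add: add_divide_distrib)
    qed
    also have "\<dots> \<le> 2 * scale_eps n r" by (simp add: scale_eps_def divide_right_mono)
    finally show ?thesis .
  qed
  moreover have "real (card (CI n r)) \<le> real \<beta> * real (m n)" if "r < n" for n r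
    unfolding cards(2)[OF that] using m_bounds(3)[of n] by (intro mult_left_mono) auto
  ultimately show ?thesis unfolding S_def by (intro good_sq subsets) auto
qed

lemma inv_sq:
  assumes J: "J \<subseteq> I n" and c: "0 < c" "0 < m n" "c * (real \<beta> * real (m n)) \<le> real (card J) - 4 * real p"
  shows "mom n (2 * p) (\<lambda>w. inverse (\<kappa> n * G.sq J w)) \<le> ennreal ((1 / c) ^ (2 * p))"
proof -
  note [measurable] = G.sq_measurable[OF J]
  have bm: "0 < real \<beta> * real (m n)" using beta_pos c(2) by simp
  have "0 < c * (real \<beta> * real (m n))" using c(1) bm by (rule mult_pos_pos)
  then have p4: "2 * (2 * p) < card J" using c(3) by linarith
  have "mom n (2 * p) (\<lambda>w. inverse (\<kappa> n * G.sq J w))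
     = (\<integral>\<^sup>+w. ennreal ((real \<beta> * real (m n)) ^ (2 * p)) * ennreal (inverse (G.sq J w) ^ (2 * p)) \<partial>gauss_on (I n))"
    by (simp add: ennreal_mult[symmetric] zero_le_even_power \<kappa>_def power_mult_distrib power_inverse power_divide divide_simps)
  also have "\<dots> = ennreal ((real \<beta> * real (m n)) ^ (2 * p)) * mom n (2 * p) (\<lambda>w. inverse (G.sq J w))"
    by (rule nn_integral_cmult) measurable
  also have "\<dots> \<le> ennreal ((real \<beta> * real (m n)) ^ (2 * p)) * ennreal ((1 / (real (card J) - 2 * real (2 * p))) ^ (2 * p))"
    by (intro mult_left_mono G.sq_inverse J p4) simp
  also have "\<dots> = ennreal ((real \<beta> * real (m n) / (real (card J) - 4 * real p)) ^ (2 * p))"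
    by (simp add: ennreal_mult[symmetric] zero_le_even_power power_divide)
  also have "\<dots> \<le> ennreal ((1 / c) ^ (2 * p))"
  proof (intro ennreal_leI power_mono)
    show "real \<beta> * real (m n) / (real (card J) - 4 * real p) \<le> 1 / c"
      using c(1,3) bm p4 by (simp add: field_simps)
    show "0 \<le> real \<beta> * real (m n) / (real (card J) - 4 * real p)" using bm p4 by (intro divide_nonneg_nonneg) auto
  qed
  finally show ?thesis .
qed

text \<open>For \<open>d < 1\<close> every row keeps about the proportion \<open>1 - d\<close> of
  its entries on and to the right of the diagonal. Half of this proportion is the constant
  \<open>c\<close>; for large \<open>n\<close> the other half absorbs the loss \<open>4 p\<close>
  caused by the order of the moment.\<close>

lemma inv_bounded_A:
  assumes "d < 1"
  shows "inv_bounded (\<lambda>n. {..<n}) A"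
  unfolding inv_bounded_def
proof
  fix p
  define c where "c = (1 - d) / 2"
  have c: "0 < c" using assms by (simp add: c_def)
  obtain n0 :: nat where n0: "(d + 4 * real p) / c \<le> real n0" using real_arch_simple by blast
  have "mom n (2 * p) (\<lambda>w. inverse (A n r w)) \<le> ennreal ((1 / c) ^ (2 * p))"
    if n: "n \<ge> n0" and r: "r < n" for n r
    unfolding A_def
  proof (rule inv_sq[OF subsets(1)[OF r] c])
    show "0 < m n" using r m_bounds(3)[of n] by simp
    have "(d + 4 * real p) / c \<le> real (m n)" using n0 n m_bounds(3)[of n] by linarith
    then have "d + 4 * real p \<le> c * real (m n)" using c by (simp add: field_simps)
    moreover have "real (m n) - real r \<ge> 2 * (c * real (m n)) - d"
    proof -
      have "real r \<le> d + d * real (m n)" using r m_bounds(2)[of n] by linarith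
      then show ?thesis by (simp add: c_def field_simps)
    qed
    ultimately have a: "c * real (m n) + 4 * real p \<le> real (m n) - real r" by linarith
    have "c * (real \<beta> * real (m n)) + 4 * real p \<le> real \<beta> * (c * real (m n) + 4 * real p)"
      using mult_right_mono[OF beta_pos, of "4 * real p"] by (simp add: algebra_simps)
    also have "\<dots> \<le> real \<beta> * (real (m n) - real r)" using a by (intro mult_left_mono) auto
    finally show "c * (real \<beta> * real (m n)) \<le> real (card (RI n r)) - 4 * real p" unfolding cards(1)[OF r] by simp
  qed
  then show "\<exists>C n0. \<forall>n\<ge>n0. \<forall>r\<in>{..<n}. mom n (2 * p) (\<lambda>w. inverse (A n r w)) \<le> ennreal C"
    by (intro exI[of _ "(1 / c) ^ (2 * p)"] exI[of _ n0]) auto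
qed

text \<open>At a fixed depth the number of degrees of freedom grows with \<open>n\<close> even for
  \<open>d = 1\<close>. This version serves the denominator \<open>p_k(0)\<close>, which involves
  only the first \<open>k\<close> diagonal entries.\<close>

lemma inv_bounded_A_at: "inv_bounded (\<lambda>n. {0}) (\<lambda>n r. A n i)"
  unfolding inv_bounded_def
proof
  fix p
  have "mom n (2 * p) (\<lambda>w. inverse (A n i w)) \<le> ennreal ((1 / (1 / 2)) ^ (2 * p))"
    if n: "n \<ge> 2 * i + 8 * p + 1" for n
    unfolding A_def
  proof (rule inv_sq[OF subsets(1)])
    show i: "i < n" using n by simp
    show "0 < m n" using i m_bounds(3)[of n] by simp
    have "real (2 * i + 8 * p + 1) \<le> real (m n)" using n m_bounds(3)[of n] by linarith
    then have a: "1 / 2 * real (m n) + 4 * real p \<le> real (m n) - real i" by simp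
    have "1 / 2 * (real \<beta> * real (m n)) + 4 * real p \<le> real \<beta> * (1 / 2 * real (m n) + 4 * real p)"
      using mult_right_mono[OF beta_pos, of "4 * real p"] by (simp add: algebra_simps)
    also have "\<dots> \<le> real \<beta> * (real (m n) - real i)" using a by (intro mult_left_mono) auto
    finally show "1 / 2 * (real \<beta> * real (m n)) \<le> real (card (RI n i)) - 4 * real p" unfolding cards(1)[OF i] by simp
  qed simp
  then show "\<exists>C n0. \<forall>n\<ge>n0. \<forall>r\<in>{0}. mom n (2 * p) (\<lambda>w. inverse (A n i w)) \<le> ennreal C"
    by (intro exI[of _ "(1 / (1 / 2)) ^ (2 * p)"] exI[of _ "2 * i + 8 * p + 1"]) auto
qed

text \<open>The coefficient with which an inverse moment of the next trailing block enters the
  inverse moment of the same order.\<close>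

definition ratio :: "nat \<Rightarrow> nat \<Rightarrow> (nat \<times> nat \<times> nat \<Rightarrow> real) \<Rightarrow> real" where
  "ratio n r w = S n r w * inverse (A n r w)"

lemma ratio_eq: "r < n \<Longrightarrow> ratio n r w = G.sq (CI n r) w * inverse (G.sq (RI n r) w)"
  using beta_pos m_bounds(3)[of n] by (simp add: ratio_def S_def A_def \<kappa>_def field_simps)

text \<open>The degrees of freedom satisfy \<open>C \<le> d * R\<close> at every depth, so the drift
  of the means does not weaken the contraction. Enlarging \<open>d\<close> to
  \<open>(1 + d) / 2\<close> absorbs the corrections \<open>4 p\<close> of the numerator and the
  denominator.\<close>

lemma ratio_moments:
  assumes "d < 1"
  shows "\<exists>n0. \<forall>n\<ge>n0. \<forall>r<n. mom n (2 * p) (\<lambda>w. ratio n r w) \<le> ennreal (((1 + d) / 2) ^ (2 * p))"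
proof -
  obtain n0 :: nat where n0: "(16 * real p + 1) / (1 - d) + d \<le> (1 - d) * real n0"
    using reals_Archimedean3[of "1 - d"] assms by (metis diff_gt_0_iff_gt less_imp_le mult.commute)
  have "mom n (2 * p) (\<lambda>w. ratio n r w) \<le> ennreal (((1 + d) / 2) ^ (2 * p))"
    if n: "n \<ge> n0" and r: "r < n" for n r
  proof -
    define C R where "C = real (card (CI n r))" and "R = real (card (RI n r))"
    note [measurable] = G.sq_measurable[OF subsets(1)[OF r]] G.sq_measurable[OF subsets(2)[OF r]]
    have "real n0 \<le> real (m n)" using n m_bounds(3)[of n] by linarith
    then have "(1 - d) * real n0 \<le> (1 - d) * real (m n)" using assms by (intro mult_left_mono) auto
    then have "(16 * real p + 1) / (1 - d) \<le> real (m n) - real r"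
      using n0 m_bounds(2)[of n] r by (simp add: algebra_simps)
    also have "\<dots> \<le> R" unfolding R_def cards(1)[OF r]
      using mult_right_mono[OF beta_pos, of "real (m n) - real r"] r m_bounds(3)[of n] by simp
    finally have R: "16 * real p + 1 \<le> (1 - d) * R" using assms by (simp add: field_simps)
    have R4: "4 * real p < R"
    proof -
      have "(1 - d) * R \<le> 1 * R" using d by (intro mult_right_mono) (auto simp: R_def)
      then show ?thesis using R by linarith
    qed
    have "real n - 1 - real r \<le> d * (real (m n) - real r)"
    proof -
      have "d * real r \<le> 1 * real r" using d by (intro mult_right_mono) auto
      then show ?thesis using m_bounds(2)[of n] d by (simp add: algebra_simps)
    qed
    then have C: "C \<le> d * R" unfolding C_def R_def cards[OF r]
      using mult_left_mono[of "real n - 1 - real r" "d * (real (m n) - real r)" "real \<beta>"] by (simp add: mult_ac)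
    have le: "(C + 4 * real p) / (R - 4 * real p) \<le> (1 + d) / 2"
    proof -
      have "(1 + d) / 2 * (4 * real p) \<le> 1 * (4 * real p)" using d by (intro mult_right_mono) auto
      moreover have "(1 + d) / 2 * (R - 4 * real p) = d * R + (1 - d) * R / 2 - (1 + d) / 2 * (4 * real p)" by (simp add: field_simps)
      ultimately have "C + 4 * real p \<le> (1 + d) / 2 * (R - 4 * real p)" using C R by linarith
      then show ?thesis using R4 by (simp add: divide_le_eq)
    qed
    have "mom n (2 * p) (\<lambda>w. ratio n r w)
      = (\<integral>\<^sup>+w. ennreal (G.sq (CI n r) w ^ (2 * p)) * ennreal (inverse (G.sq (RI n r) w) ^ (2 * p)) \<partial>gauss_on (I n))"
      by (simp add: ratio_eq[OF r] power_mult_distrib ennreal_mult zero_le_even_power)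
    also have "\<dots> = mom n (2 * p) (\<lambda>w. G.sq (CI n r) w) * mom n (2 * p) (\<lambda>w. inverse (G.sq (RI n r) w))"
    proof (rule G.nn_integral_indep[OF subsets(2)[OF r] subsets(1)[OF r]])
      show "CI n r \<inter> RI n r = {}" by (auto simp: CI_def RI_def)
      show "G.dep (CI n r) (\<lambda>w. ennreal (G.sq (CI n r) w ^ (2 * p)))" by (rule G.dep_sq)
      show "G.dep (RI n r) (\<lambda>w. ennreal (inverse (G.sq (RI n r) w) ^ (2 * p)))" by (rule G.dep_sq)
    qed measurable
    also have "\<dots> \<le> ennreal (chi_mom C (2 * p)) * ennreal ((1 / (R - 2 * real (2 * p))) ^ (2 * p))"
      unfolding C_def R_def using R4 by (intro mult_mono G.sq_inverse eq_refl[OF G.sq_moment] subsets r) (auto simp: R_def)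
    also have "\<dots> \<le> ennreal ((C + 2 * real (2 * p)) ^ (2 * p)) * ennreal ((1 / (R - 2 * real (2 * p))) ^ (2 * p))"
      using chi_mom_le[of C "2 * p"] by (intro mult_right_mono ennreal_leI) (auto simp: C_def)
    also have "\<dots> = ennreal (((C + 4 * real p) / (R - 4 * real p)) ^ (2 * p))"
      by (simp add: ennreal_mult[symmetric] zero_le_even_power power_divide)
    also have "\<dots> \<le> ennreal (((1 + d) / 2) ^ (2 * p))"
      using le R4 by (intro ennreal_leI power_mono divide_nonneg_nonneg) (auto simp: C_def)
    finally show ?thesis .
  qed
  then show ?thesis by blast
qed

end

context wishart_limit
begin

section \<open>Convergence of the spectral moments and of the error norm\<close>

abbreviation "Mom j n r w \<equiv> jac_mom (\<lambda>i. A n i w) (\<lambda>i. S n i w) r (n - r) j"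
abbreviation "Inv j n r w \<equiv> jac_inv (\<lambda>i. A n i w) (\<lambda>i. S n i w) r (n - r) j"

lemma less_subset: "{..<n} \<subseteq> {..n::nat}" by auto

lemma good_lessI: "good (\<lambda>n. {..n}) Y y \<Longrightarrow> good (\<lambda>n. {..<n}) Y y"
  by (rule good_subset) auto

text \<open>The recursion involves only lower orders, at the depths \<open>r\<close> and
  \<open>Suc r\<close>. Induction on the order therefore closes, provided that the claim is made for
  all depths simultaneously.\<close>

lemma good_Mom: "good (\<lambda>n. {..n}) (Mom j) (mp_pos d j)"
proof (induction j rule: less_induct)
  case (less j)
  show ?case
  proof (cases j)
    case 0
    have "Mom 0 n r w = 1" for n r w by (cases "n - r") auto
    then show ?thesis using good_const[of "\<lambda>n. {..n}" 1] 0 by simp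
  next
    case (Suc i)
    have "good (\<lambda>n. {..<n}) (\<lambda>n r w. A n r w * Mom i n r w + S n r w * (\<Sum>t<i. Mom (Suc t) n r w * Mom (i - Suc t) n (Suc r) w))
      (1 * mp_pos d i + d * (\<Sum>t<i. mp_pos d (Suc t) * mp_pos d (i - Suc t)))"
      using less Suc by (intro good_add good_mult good_sum good_A good_S less_subset good_lessI good_shift[where Y = "Mom _"]) auto
    then have "good (\<lambda>n. {..<n}) (Mom j) (1 * mp_pos d i + d * (\<Sum>t<i. mp_pos d (Suc t) * mp_pos d (i - Suc t)))"
    proof (rule good_cong)
      fix n r :: nat and w assume "r \<in> {..<n}"
      then have "n - r = Suc (n - Suc r)" by auto
      then show "A n r w * Mom i n r w + S n r w * (\<Sum>t<i. Mom (Suc t) n r w * Mom (i - Suc t) n (Suc r) w) = Mom j n r w"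
        by (simp add: Suc jac_mom.simps(3)[of _ _ r "n - Suc r" i])
    qed
    then have "good (\<lambda>n. {..n}) (Mom j) (1 * mp_pos d i + d * (\<Sum>t<i. mp_pos d (Suc t) * mp_pos d (i - Suc t)))"
      by (rule good_extend[where c = 0]) (simp add: Suc)
    then show ?thesis by (simp add: Suc mp_pos.simps(2)[of d i])
  qed
qed

lemma Inv_measurable: "Inv j n r \<in> borel_measurable (gauss_on (I n))"
  by (rule jac_inv_measurable) (auto intro: A_measurable S_measurable)

lemma ratio_measurable: "r < n \<Longrightarrow> ratio n r \<in> borel_measurable (gauss_on (I n))"
  unfolding ratio_def[abs_def] using A_measurable S_measurable by simp

text \<open>The multiplier sees row \<open>r\<close> and column \<open>r\<close> of the Gaussian
  matrix, the next level only entries with both indices beyond \<open>r\<close>.\<close>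

lemma Inv_ratio_indep:
  assumes "r < n"
  shows "(\<integral>\<^sup>+w. ennreal (ratio n r w ^ p) * ennreal ((Inv j n (Suc r) w - y) ^ p) \<partial>gauss_on (I n))
    = mom n p (\<lambda>w. ratio n r w) * mom n p (\<lambda>w. Inv j n (Suc r) w - y)"
proof (rule G.nn_integral_indep)
  let ?K = "{..<\<beta>} \<times> {Suc r..<n} \<times> {Suc r..<m n}"
  show "RI n r \<union> CI n r \<subseteq> I n" "?K \<subseteq> I n" using subsets[OF assms] by (auto simp: I_def)
  show "(RI n r \<union> CI n r) \<inter> ?K = {}" by (auto simp: RI_def CI_def)
  have sq: "G.sq J x = G.sq J y" if "\<forall>q\<in>J. x q = y q" for J :: "(nat \<times> nat \<times> nat) set" and x y
    unfolding G.sq_def by (rule sum.cong) (use that in auto)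
  have "ratio n r x = ratio n r y" if "\<forall>q\<in>RI n r \<union> CI n r. x q = y q" for x y
    using sq[of "RI n r" x y] sq[of "CI n r" x y] that by (simp add: ratio_def A_def S_def)
  then show "G.dep (RI n r \<union> CI n r) (\<lambda>w. ennreal (ratio n r w ^ p))" unfolding G.dep_def by metis
  have "Inv j n (Suc r) x = Inv j n (Suc r) y" if "\<forall>q\<in>?K. x q = y q" for x y
  proof -
    have 1: "A n i x = A n i y" "S n i x = S n i y" if i: "Suc r \<le> i" "i < n" for i
      using sq[of "RI n i" x y] sq[of "CI n i" x y] \<open>\<forall>q\<in>?K. x q = y q\<close> i m_bounds(3)[of n]
      by (auto simp: A_def S_def RI_def CI_def)
    show ?thesis by (rule jac_inv_cong) (use 1 in auto)
  qed
  then show "G.dep ?K (\<lambda>w. ennreal ((Inv j n (Suc r) w - y) ^ p))" unfolding G.dep_def by metis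
  have [measurable]: "Inv j n (Suc r) \<in> borel_measurable (gauss_on (I n))" by (rule Inv_measurable)
  have [measurable]: "ratio n r \<in> borel_measurable (gauss_on (I n))" by (rule ratio_measurable[OF assms])
  show "(\<lambda>w. ennreal (ratio n r w ^ p)) \<in> borel_measurable (gauss_on (I n))"
    "(\<lambda>w. ennreal ((Inv j n (Suc r) w - y) ^ p)) \<in> borel_measurable (gauss_on (I n))" by measurable
qed

text \<open>The first term of the convolution contains the same order at the next depth, so
  induction on the order alone does not close. That term is treated as a contraction; everything
  else, together with the centering, is collected in \<open>\<eta>\<close>.\<close>

lemma good_Inv:
  assumes d1: "d < 1"
  shows "good (\<lambda>n. {..n}) (Inv j) (mp_neg d j)"
proof (induction j rule: less_induct)
  case (less j)
  have one: "Inv 0 n r w = 1" for n r w by (cases "n - r") auto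
  show ?case
  proof (cases j)
    case 0
    then show ?thesis using good_const[of "\<lambda>n. {..n}" 1] one by simp
  next
    case (Suc i)
    define y where "y = mp_neg d (Suc i)"
    define \<Sigma> where "\<Sigma> = (\<Sum>t<i. mp_neg d (Suc t) * mp_neg d (i - t))"
    have y: "y * (1 - d) = mp_neg d i + d * \<Sigma>" unfolding y_def \<Sigma>_def mp_neg.simps(2)[of d i] using d1 by simp
    define B where "B n r w = inverse (A n r w)" for n r w
    have gB: "good (\<lambda>n. {..<n}) B 1"
      unfolding B_def using good_inverse[OF good_A _ inv_bounded_A[OF d1]] by simp
    have ratio: "ratio n r w = S n r w * B n r w" for n r w by (simp add: ratio_def B_def)
    define \<eta> where "\<eta> n r w = S n r w * B n r w * y - y
      + (Inv i n r w + S n r w * (\<Sum>t<i. Inv (Suc t) n r w * Inv (i - t) n (Suc r) w)) * B n r w" for n r w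
    have "good (\<lambda>n. {..<n}) \<eta> (d * 1 * y - y + (mp_neg d i + d * \<Sigma>) * 1)"
      unfolding \<eta>_def \<Sigma>_def using less Suc
      by (intro good_add good_diff good_mult good_sum good_const gB good_S less_subset good_lessI good_shift[where Y = "Inv _"]) auto
    \<comment> \<open>The recursion of \<open>mp_neg\<close> is the fixed-point equation for
      \<open>y\<close>, so the limits of the terms of \<open>\<eta>\<close> cancel.\<close>
    then have \<eta>: "good (\<lambda>n. {..<n}) \<eta> 0" unfolding y[symmetric] by (simp add: algebra_simps)
    have "good (\<lambda>n. {..n}) (Inv (Suc i)) y"
    proof (rule good_contraction[OF \<eta>])
      show "Inv (Suc i) n n w = 0" for n w by simp
      show "Inv (Suc i) n r w - y = ratio n r w * (Inv (Suc i) n (Suc r) w - y) + \<eta> n r w"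
        if "r < n" for n r w
      proof -
        have nr: "n - r = Suc (n - Suc r)" using that by auto
        have e: "Inv (Suc i) n r w = (Inv i n r w + S n r w * (Inv (Suc i) n (Suc r) w +
          (\<Sum>t<i. Inv (Suc t) n r w * Inv (i - t) n (Suc r) w))) * B n r w"
          unfolding nr jac_inv.simps(3)[of _ _ r "n - Suc r" i] sum.lessThan_Suc_shift B_def by (simp add: divide_inverse)
        show ?thesis unfolding e ratio \<eta>_def by (simp add: algebra_simps)
      qed
      show "0 < (1 + d) / 2" "(1 + d) / 2 < 1" using d d1 by auto
      show "\<exists>n0. \<forall>n\<ge>n0. \<forall>r<n. mom n (2 * p) (\<lambda>w. ratio n r w) \<le> ennreal (((1 + d) / 2) ^ (2 * p))" for p
        by (rule ratio_moments[OF d1])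
    qed (simp_all add: Inv_measurable ratio_measurable Inv_ratio_indep)
    then show ?thesis by (simp add: Suc y_def)
  qed
qed

lemma zero_subset: "{0} \<subseteq> {..n::nat}" by auto

lemma good_jac_poly: "good (\<lambda>n. {0}) (\<lambda>n r w. coeff (jac_poly (\<lambda>i. A n i w) (\<lambda>i. S n i w) k) i)
  (coeff (jac_poly (\<lambda>_. 1) (\<lambda>_. d) k) i)"
proof (induction k arbitrary: i rule: induct_nat_012)
  case 0
  then show ?case by (simp add: good_const)
next
  case 1
  then show ?case using good_at[OF good_A, of 0] good_const[of "\<lambda>n. {0}"]
    by (cases i; cases "i - 1") (auto simp: coeff_pCons)
next
  case (ge2 k)
  have lin: "coeff ([:c, -1:] * f) i = c * coeff f i - (case i of 0 \<Rightarrow> 0 | Suc t \<Rightarrow> coeff f t)" for c :: real and f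
    by (simp add: coeff_pCons split: nat.split)
  have "good (\<lambda>n. {0}) (\<lambda>n r w. case i of 0 \<Rightarrow> 0 | Suc t \<Rightarrow> coeff (jac_poly (\<lambda>i. A n i w) (\<lambda>i. S n i w) (Suc k)) t)
    (case i of 0 \<Rightarrow> 0 | Suc t \<Rightarrow> coeff (jac_poly (\<lambda>_. 1) (\<lambda>_. d) (Suc k)) t)"
    using ge2 by (cases i) (simp_all add: good_const)
  then show ?case unfolding jac_poly.simps(3) coeff_diff coeff_smult lin
    by (intro good_diff good_mult good_add zero_subset good_at[OF good_A] good_at[OF good_S] ge2)
qed

text \<open>The squared error norm. The division by \<open>p_k(0)^2\<close> is written as a product
  of inverses, to which \<open>good_inverse\<close> applies one factor at a time.\<close>

definition cg_quad :: "int \<Rightarrow> nat \<Rightarrow> nat \<Rightarrow> (nat \<times> nat \<times> nat \<Rightarrow> real) \<Rightarrow> real" where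
  "cg_quad l k n w = lin_ev (\<lambda>t. jac_moment (\<lambda>i. A n i w) (\<lambda>i. S n i w) n (l - 2 + int t)) ((jac_poly (\<lambda>i. A n i w) (\<lambda>i. S n i w) k)\<^sup>2)
     * (\<Prod>i<k. inverse (A n i w) * inverse (A n i w))"

text \<open>No denominator appears, since \<open>p_k(0) = 1\<close> for the limiting
  entries.\<close>

definition cg_lim :: "int \<Rightarrow> nat \<Rightarrow> real" where
  "cg_lim l k = lin_ev (\<lambda>t. mp_moment d (l - 2 + int t)) ((jac_poly (\<lambda>_. 1) (\<lambda>_. d) k)\<^sup>2)"

text \<open>Provides a summation range for \<open>lin_ev\<close> that does not mention the random
  entries.\<close>

lemma sq_degree: "degree ((jac_poly a s k)\<^sup>2) \<le> 2 * k"
  by (rule order_trans[OF degree_power_le]) (use jac_poly_degree[of a s k] in simp)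

lemma good_cg_quad:
  assumes "0 \<le> l - 2 \<or> d < 1"
  shows "good (\<lambda>n. {0}) (\<lambda>n r. cg_quad l k n) (cg_lim l k)"
proof -
  have mom: "good (\<lambda>n. {0}) (\<lambda>n r w. jac_moment (\<lambda>i. A n i w) (\<lambda>i. S n i w) n (l - 2 + int t)) (mp_moment d (l - 2 + int t))" for t
  proof (cases "0 \<le> l - 2 + int t")
    case True
    then show ?thesis using good_at[where i = 0, OF good_lessI[OF good_Mom[of "nat (l - 2 + int t)"]]]
      by (simp add: jac_moment_def mp_moment_def)
  next
    case False
    then have "d < 1" using assms by auto
    then show ?thesis using good_at[where i = 0, OF good_lessI[OF good_Inv[of "nat (- (l - 2 + int t))"]]] False
      by (simp add: jac_moment_def mp_moment_def)
  qed
  have "good (\<lambda>n. {0}) (\<lambda>n r w. (\<Sum>i\<le>2 * k. (\<Sum>t\<le>i. coeff (jac_poly (\<lambda>i. A n i w) (\<lambda>i. S n i w) k) t * coeff (jac_poly (\<lambda>i. A n i w) (\<lambda>i. S n i w) k) (i - t))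
       * jac_moment (\<lambda>i. A n i w) (\<lambda>i. S n i w) n (l - 2 + int i)) * (\<Prod>i<k. inverse (A n i w) * inverse (A n i w)))
     ((\<Sum>i\<le>2 * k. (\<Sum>t\<le>i. coeff (jac_poly (\<lambda>_. 1) (\<lambda>_. d) k) t * coeff (jac_poly (\<lambda>_. 1) (\<lambda>_. d) k) (i - t))
       * mp_moment d (l - 2 + int i)) * (\<Prod>i<k. inverse 1 * inverse 1))"
    by (intro good_mult good_sum good_prod zero_subset good_jac_poly mom good_inverse[OF good_at[OF good_A]] inv_bounded_A_at) auto
  then show ?thesis unfolding cg_quad_def cg_lim_def lin_ev_ge[OF sq_degree] unfolding power2_eq_square coeff_mult by simp
qed

lemma limit_error_eq:
  assumes "0 \<le> l - 2 \<or> d < 1"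
  shows "limit_error l k d = sqrt (cg_lim l k)" "0 < cg_lim l k"
proof -
  let ?p = "jac_poly (\<lambda>_. 1) (\<lambda>_. d) k"
  have "has_bochner_integral (marchenko_pastur d) (\<lambda>x. x powi (l - 2) * poly (?p\<^sup>2) x) (cg_lim l k)"
    using mp_poly_integral[OF d assms, of "?p\<^sup>2"] by (simp add: cg_lim_def lin_ev_def)
  then have "(\<integral>x. x powi (l - 2) * (poly ?p x)\<^sup>2 \<partial>marchenko_pastur d) = cg_lim l k"
    by (simp add: has_bochner_integral_integral_eq)
  then show "limit_error l k d = sqrt (cg_lim l k)" unfolding limit_error_def using det_jacobi_block[of d k] d by simp
  have "?p \<noteq> 0" using jac_poly_0[of "\<lambda>_. 1" "\<lambda>_. d" k] by auto
  then show "0 < cg_lim l k" using mp_poly_integral_pos[OF d assms] unfolding cg_lim_def lin_ev_def by simp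
qed

text \<open>A single Gaussian entry of the row, the diagonal one, is almost surely nonzero, and its
  square is one of the summands.\<close>

lemma AE_A_pos: "AE w in gauss_on (I n). \<forall>i<n. 0 < A n i w"
proof -
  have "AE w in gauss_on (I n). 0 < A n i w" if i: "i < n" for i
  proof -
    have q: "(0, i, i) \<in> RI n i" "(0, i, i) \<in> I n" using i beta m_bounds(3)[of n] by (auto simp: RI_def I_def)
    have "(\<integral>\<^sup>+w. indicator {0} (w (0, i, i)) \<partial>gauss_on (I n)) = (\<integral>\<^sup>+x. indicator {0} x \<partial>gauss)"
      by (rule G.nn_integral_coord[OF q(2)]) auto
    also have "\<dots> = (\<integral>\<^sup>+x. ennreal (std_normal_density x) * indicator {0} x \<partial>lborel)" by (rule nn_integral_gauss) auto
    also have "\<dots> = 0" by (intro nn_integral_null_set finite_imp_null_set_lborel) simp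
    finally have "AE w in gauss_on (I n). indicator {0} (w (0, i, i)) = (0::ennreal)"
      using G.coord_measurable[OF q(2)] by (subst (asm) nn_integral_0_iff_AE) auto
    then show ?thesis
    proof eventually_elim
      case (elim w)
      then have "0 < (w (0, i, i))\<^sup>2" by (auto simp: indicator_def split: if_splits)
      also have "\<dots> \<le> G.sq (RI n i) w" unfolding G.sq_def by (rule member_le_sum[OF q(1)]) (auto simp: RI_def)
      finally show ?case unfolding A_def \<kappa>_def using beta_pos i m_bounds(3)[of n] by auto
    qed
  qed
  then show ?thesis by (simp add: AE_all_countable AE_ball_countable' flip: lessThan_iff)
qed

definition cg_err :: "int \<Rightarrow> nat \<Rightarrow> nat \<Rightarrow> (nat \<times> nat \<times> nat \<Rightarrow> real) \<Rightarrow> real" where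
  "cg_err l k n w = cg_error_norm \<beta> l (jac_mat (\<lambda>i. A n i w) (\<lambda>i. S n i w) n) (unit_vec n 0) k"

lemma jacobi_data_AS: "0 < n \<Longrightarrow> \<forall>i<n. 0 < A n i w \<Longrightarrow> jacobi_data (\<lambda>i. A n i w) (\<lambda>i. S n i w) n"
proof (unfold_locales, goal_cases)
  case (4)
  then have "CI n (n - 1) = {}" by (auto simp: CI_def)
  then show ?case by (simp add: S_def G.sq_def)
qed (auto simp: S_def \<kappa>_def G.sq_nonneg)

lemma cg_err_eq:
  assumes "0 < n" "k \<le> n" "\<forall>i<n. 0 < A n i w"
  shows "cg_err l k n w = sqrt (cg_quad l k n w)"
proof -
  interpret jacobi_data "\<lambda>i. A n i w" "\<lambda>i. S n i w" n by (rule jacobi_data_AS) (use assms in auto)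
  define p where "p = (\<Prod>i<k. A n i w)"
  have "0 < p" unfolding p_def using assms by (intro prod_pos) auto
  then have "sqrt (inverse (p\<^sup>2)) = inverse p" by (simp add: real_sqrt_inverse)
  moreover have "(\<Prod>i<k. inverse (A n i w) * inverse (A n i w)) = inverse (p\<^sup>2)"
    by (simp add: p_def prod.distrib power2_eq_square flip: prod_inversef)
  ultimately show ?thesis unfolding cg_err_def cg_quad_def cg_error_norm_jacobi[OF assms(2)] p_def[symmetric]
    by (simp add: real_sqrt_mult divide_inverse)
qed

text \<open>Because the limit of the squared norm is positive, the deviation of the root is bounded
  by a multiple of the deviation of the square; only its second and fourth moments are used.\<close>

lemma cg_err_moments:
  assumes "0 \<le> l - 2 \<or> d < 1"
  shows "\<exists>C n0. 0 \<le> C \<and> 1 \<le> n0 \<and> (\<forall>n\<ge>n0.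
     (\<integral>\<^sup>+w. ennreal \<bar>cg_err l k n w - limit_error l k d\<bar> \<partial>gauss_on (I n)) \<le> ennreal (C / sqrt (real n)) \<and>
     mom n 4 (\<lambda>w. cg_err l k n w - limit_error l k d) \<le> ennreal (C / (real n)\<^sup>2))"
proof -
  define a where "a = cg_lim l k"
  note L = limit_error_eq[OF assms, of k, folded a_def]
  define c where "c = 2 / sqrt a"
  have c: "0 < c" using L by (simp add: c_def)
  obtain C1 n1 where C1: "0 \<le> C1" "1 \<le> n1" "\<And>n r. n \<ge> n1 \<Longrightarrow> r \<in> {0} \<Longrightarrow> cg_quad l k n \<in> borel_measurable (gauss_on (I n))"
     "\<And>n r. n \<ge> n1 \<Longrightarrow> r \<in> {0} \<Longrightarrow> mom n (2 * 1) (\<lambda>w. cg_quad l k n w - a) \<le> ennreal (C1 * scale_eps n r ^ (2 * 1))"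
    using good_cg_quad[OF assms, of k, folded a_def] by (rule goodE[where p = 1]) blast
  obtain C2 n2 where C2: "0 \<le> C2" "1 \<le> n2" "\<And>n r. n \<ge> n2 \<Longrightarrow> r \<in> {0} \<Longrightarrow> cg_quad l k n \<in> borel_measurable (gauss_on (I n))"
     "\<And>n r. n \<ge> n2 \<Longrightarrow> r \<in> {0} \<Longrightarrow> mom n (2 * 2) (\<lambda>w. cg_quad l k n w - a) \<le> ennreal (C2 * scale_eps n r ^ (2 * 2))"
    using good_cg_quad[OF assms, of k, folded a_def] by (rule goodE[where p = 2]) blast
  define C where "C = max (c * (C1 + 1)) (c ^ 4 * C2)"
  have main: "(\<integral>\<^sup>+w. ennreal \<bar>cg_err l k n w - limit_error l k d\<bar> \<partial>gauss_on (I n)) \<le> ennreal (C / sqrt (real n)) \<and>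
     mom n 4 (\<lambda>w. cg_err l k n w - limit_error l k d) \<le> ennreal (C / (real n)\<^sup>2)"
    if n: "n \<ge> max (max n1 n2) (max k 1)" for n
  proof -
    have [measurable]: "cg_quad l k n \<in> borel_measurable (gauss_on (I n))" using C1(3)[of n 0] n by auto
    define u where "u = sqrt (real n)"
    have u: "0 < u" "u\<^sup>2 = real n" using n by (auto simp: u_def)
    have s0: "scale_eps n 0 = 1 / u" by (simp add: scale_eps_def u_def)
    have ae: "AE w in gauss_on (I n). \<bar>cg_err l k n w - limit_error l k d\<bar> \<le> c * \<bar>cg_quad l k n w - a\<bar>"
      using AE_A_pos[of n]
    proof eventually_elim
      case (elim w)
      show ?case unfolding cg_err_eq[of n k w l, OF _ _ elim] L(1) c_def
        using sqrt_diff_le[OF L(2)] n cg_err_eq[of n k w l, OF _ _ elim] by simp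
    qed
    have "(\<integral>\<^sup>+w. ennreal \<bar>cg_err l k n w - limit_error l k d\<bar> \<partial>gauss_on (I n))
      \<le> (\<integral>\<^sup>+w. ennreal (c * u) * ennreal ((cg_quad l k n w - a) ^ (2 * 1)) + ennreal (c / u) \<partial>gauss_on (I n))"
      using ae
    proof (intro nn_integral_mono_AE, eventually_elim)
      case (elim w)
      obtain z where z_def: "z = \<bar>cg_quad l k n w - a\<bar>" by blast
      \<comment> \<open>Bounding \<open>z\<close> by \<open>u z^2 + 1 / u\<close> with
        \<open>u = sqrt n\<close> takes the place of Cauchy-Schwarz; both terms have mean of order
        \<open>1 / sqrt n\<close>.\<close>
      have "2 * (u * z) * 1 \<le> (u * z)\<^sup>2 + 1\<^sup>2" by (rule sum_squares_bound)
      moreover have "0 \<le> u * z" using u(1) by (simp add: z_def)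
      ultimately have "u * z \<le> u * (u * z\<^sup>2 + 1 / u)" using u(1) by (simp add: distrib_left power_mult_distrib power2_eq_square mult_ac)
      then have "z \<le> u * z\<^sup>2 + 1 / u" using u(1) by simp
      then have "c * z \<le> c * (u * z\<^sup>2 + 1 / u)" using c by (intro mult_left_mono) auto
      then have "\<bar>cg_err l k n w - limit_error l k d\<bar> \<le> c * u * (cg_quad l k n w - a)\<^sup>2 + c / u"
        using elim unfolding z_def by (simp add: algebra_simps)
      from ennreal_leI[OF this] show ?case using c u(1)
        by (simp add: ennreal_mult ennreal_plus)
    qed
    also have "\<dots> = ennreal (c * u) * mom n (2 * 1) (\<lambda>w. cg_quad l k n w - a) + ennreal (c / u)"
      using G.P.emeasure_space_1[of n] by (simp add: nn_integral_add nn_integral_cmult)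
    also have "\<dots> \<le> ennreal (c * u) * ennreal (C1 * scale_eps n 0 ^ (2 * 1)) + ennreal (c / u)"
      using n by (intro add_mono mult_left_mono C1(4)) auto
    also have "\<dots> = ennreal (c * u * (C1 * (1 / u)\<^sup>2) + c / u)"
      using c u C1(1) unfolding s0 by (simp add: ennreal_mult[symmetric] ennreal_plus[symmetric] del: ennreal_plus)
    also have "c * u * (C1 * (1 / u)\<^sup>2) + c / u = c * (C1 + 1) / u"
      using u(1) by (simp add: field_simps power2_eq_square)
    also have "ennreal (c * (C1 + 1) / u) \<le> ennreal (C / u)"
      using u(1) by (intro ennreal_leI divide_right_mono) (auto simp: C_def)
    finally have 1: "(\<integral>\<^sup>+w. ennreal \<bar>cg_err l k n w - limit_error l k d\<bar> \<partial>gauss_on (I n)) \<le> ennreal (C / u)" .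
    have "mom n 4 (\<lambda>w. cg_err l k n w - limit_error l k d)
      \<le> (\<integral>\<^sup>+w. ennreal (c ^ 4) * ennreal ((cg_quad l k n w - a) ^ (2 * 2)) \<partial>gauss_on (I n))"
      using ae
    proof (intro nn_integral_mono_AE, eventually_elim)
      case (elim w)
      then have "\<bar>cg_err l k n w - limit_error l k d\<bar> ^ 4 \<le> (c * \<bar>cg_quad l k n w - a\<bar>) ^ 4" by (intro power_mono) auto
      then have "(cg_err l k n w - limit_error l k d) ^ 4 \<le> c ^ 4 * (cg_quad l k n w - a) ^ 4"
        by (simp add: power_mult_distrib power_even_abs)
      from ennreal_leI[OF this] show ?case using c by (simp add: ennreal_mult)
    qed
    also have "\<dots> = ennreal (c ^ 4) * mom n (2 * 2) (\<lambda>w. cg_quad l k n w - a)"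
      by (rule nn_integral_cmult) measurable
    also have "\<dots> \<le> ennreal (c ^ 4) * ennreal (C2 * scale_eps n 0 ^ (2 * 2))"
      using n by (intro mult_left_mono C2(4)) auto
    also have "\<dots> = ennreal (c ^ 4 * C2 / (u\<^sup>2)\<^sup>2)"
      using c u(1) C2(1) unfolding s0 by (simp add: ennreal_mult[symmetric] power_divide power_mult[symmetric])
    also have "\<dots> \<le> ennreal (C / (u\<^sup>2)\<^sup>2)" by (intro ennreal_leI divide_right_mono) (auto simp: C_def)
    finally show ?thesis using 1 unfolding u(2) by (simp add: u_def)
  qed
  have "0 \<le> C" using c C2(1) by (simp add: C_def le_max_iff_disj)
  then show ?thesis using main by (intro exI[of _ C] exI[of _ "max (max n1 n2) (max k 1)"]) auto
qed

end

subsection \<open>Integrability for small dimensions\<close>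

context gauss_space
begin

text \<open>For \<open>t\<close> up to \<open>1 / x\<close> the exponential is at least
  \<open>exp (- 1)\<close>, and the remaining integral is explicit. Exponentials are convenient
  because their Gaussian means are known; the power one half is the relevant one, as the first
  inverse moment of a chi-square variable with two degrees of freedom is infinite.\<close>

lemma rsqrt_kernel:
  assumes "0 < x"
  shows "ennreal (inverse (sqrt x)) \<le> 1 + ennreal (exp 1) * (\<integral>\<^sup>+t\<in>{0..}. ennreal ((1 + 2 * t) powr (- 1 / 2) * exp (- t * x)) \<partial>lborel)"
proof -
  have "ennreal (exp (- 1) * (sqrt (1 + 2 * (1 / x)) - sqrt (1 + 2 * 0)))
     = (\<integral>\<^sup>+t\<in>{0..1/x}. ennreal (exp (- 1) * ((1 + 2 * t) powr (- 1 / 2))) \<partial>lborel)"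
    unfolding right_diff_distrib
  proof (rule nn_integral_FTC_Icc[where F = "\<lambda>t. exp (- 1) * sqrt (1 + 2 * t)", symmetric])
    show "((\<lambda>t. exp (- 1) * sqrt (1 + 2 * t)) has_real_derivative exp (- 1) * (1 + 2 * t) powr (- 1 / 2)) (at t)"
      if "t \<in> {0..1/x}" for t
    proof -
      have "((\<lambda>t. sqrt (1 + 2 * t)) has_real_derivative (1 + 2 * t) powr (- 1 / 2)) (at t)"
        using that by (auto intro!: derivative_eq_intros simp: powr_minus_divide powr_half_sqrt inverse_eq_divide)
      from DERIV_cmult[OF this, of "exp (- 1)"] show ?thesis .
    qed
  qed (use assms in auto)
  also have "\<dots> \<le> (\<integral>\<^sup>+t\<in>{0..}. ennreal ((1 + 2 * t) powr (- 1 / 2) * exp (- t * x)) \<partial>lborel)"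
  proof (intro nn_integral_mono)
    fix t
    have "exp (- 1) * ((1 + 2 * t) powr (- 1 / 2)) \<le> (1 + 2 * t) powr (- 1 / 2) * exp (- t * x)" if "t \<le> 1 / x"
    proof -
      have "t * x \<le> 1" using that assms by (simp add: field_simps)
      then have "exp (- 1) \<le> exp (- t * x)" by simp
      then show ?thesis using mult_right_mono[of "exp (- 1)" "exp (- t * x)" "(1 + 2 * t) powr (- 1 / 2)"] by (simp add: mult.commute)
    qed
    then show "ennreal (exp (- 1) * ((1 + 2 * t) powr (- 1 / 2))) * indicator {0..1/x} t
      \<le> ennreal ((1 + 2 * t) powr (- 1 / 2) * exp (- t * x)) * indicator {0..} t"
      by (auto simp: indicator_def intro!: ennreal_leI)
  qed
  finally have K: "ennreal (exp (- 1) * (sqrt (1 + 2 / x) - 1)) \<le> (\<integral>\<^sup>+t\<in>{0..}. ennreal ((1 + 2 * t) powr (- 1 / 2) * exp (- t * x)) \<partial>lborel)"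
    by simp
  have "inverse (sqrt x) \<le> sqrt (1 + 2 / x)"
    using assms by (subst real_sqrt_inverse[symmetric]) (simp add: field_simps)
  then have "inverse (sqrt x) \<le> 1 + exp 1 * (exp (- 1) * (sqrt (1 + 2 / x) - 1))" by (simp flip: mult.assoc exp_add)
  then have "ennreal (inverse (sqrt x)) \<le> ennreal (1 + exp 1 * (exp (- 1) * (sqrt (1 + 2 / x) - 1)))" by (rule ennreal_leI)
  also have "\<dots> = 1 + ennreal (exp 1) * ennreal (exp (- 1) * (sqrt (1 + 2 / x) - 1))"
    using assms by (subst ennreal_plus) (auto simp: ennreal_mult)
  also have "\<dots> \<le> 1 + ennreal (exp 1) * (\<integral>\<^sup>+t\<in>{0..}. ennreal ((1 + 2 * t) powr (- 1 / 2) * exp (- t * x)) \<partial>lborel)"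
    by (intro add_left_mono mult_left_mono K) auto
  finally show ?thesis .
qed

text \<open>The Gaussian mean of the kernel is \<open>1 + 2 * t\<close> raised to a power that is at
  most \<open>-3 / 2\<close> as soon as \<open>2 \<le> card J\<close>, hence integrable at
  infinity.\<close>

lemma sq_rsqrt_finite:
  assumes J: "J \<subseteq> I" "2 \<le> card J"
  shows "(\<integral>\<^sup>+w. ennreal (inverse (sqrt (sq J w))) \<partial>gauss_on I) < \<top>"
proof -
  note [measurable] = sq_measurable[OF J(1)]
  let ?k = "\<lambda>t w. ennreal ((1 + 2 * t) powr (- 1 / 2) * exp (- t * sq J w))"
  have "(\<integral>\<^sup>+w. ennreal (inverse (sqrt (sq J w))) \<partial>gauss_on I)
    \<le> (\<integral>\<^sup>+w. 1 + ennreal (exp 1) * (\<integral>\<^sup>+t. ?k t w * indicator {0..} t \<partial>lborel) \<partial>gauss_on I)"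
  proof (rule nn_integral_mono)
    fix w
    show "ennreal (inverse (sqrt (sq J w))) \<le> 1 + ennreal (exp 1) * (\<integral>\<^sup>+t. ?k t w * indicator {0..} t \<partial>lborel)"
      using rsqrt_kernel[of "sq J w"] sq_nonneg[of J w] by (cases "sq J w = 0") auto
  qed
  also have "\<dots> = 1 + ennreal (exp 1) * (\<integral>\<^sup>+w. \<integral>\<^sup>+t. ?k t w * indicator {0..} t \<partial>lborel \<partial>gauss_on I)"
    using P.emeasure_space_1 by (simp add: nn_integral_add nn_integral_cmult)
  also have "(\<integral>\<^sup>+w. \<integral>\<^sup>+t. ?k t w * indicator {0..} t \<partial>lborel \<partial>gauss_on I) = (\<integral>\<^sup>+t. \<integral>\<^sup>+w. ?k t w * indicator {0..} t \<partial>gauss_on I \<partial>lborel)"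
  proof -
    interpret Q: pair_sigma_finite "gauss_on I" lborel
      by (simp add: pair_sigma_finite_def P.sigma_finite_measure_axioms lborel.sigma_finite_measure_axioms)
    show ?thesis by (rule Q.Fubini'[symmetric]) measurable
  qed
  also have "\<dots> \<le> (\<integral>\<^sup>+t\<in>{0..}. ennreal ((1 + 2 * t) powr (- 3 / 2)) \<partial>lborel)"
  proof (rule nn_integral_mono)
    fix t :: real
    show "(\<integral>\<^sup>+w. ?k t w * indicator {0..} t \<partial>gauss_on I) \<le> ennreal ((1 + 2 * t) powr (- 3 / 2)) * indicator {0..} t"
    proof (cases "0 \<le> t")
      case True
      have "(\<integral>\<^sup>+w. ?k t w * indicator {0..} t \<partial>gauss_on I) = ennreal ((1 + 2 * t) powr (- 1 / 2)) * (\<integral>\<^sup>+w. ennreal (exp (- t * sq J w)) \<partial>gauss_on I)"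
        using True by (simp add: ennreal_mult nn_integral_cmult)
      also have "\<dots> = ennreal ((1 + 2 * t) powr (- 1 / 2 + - real (card J) / 2))"
        unfolding sq_laplace[OF J(1) True] by (simp add: ennreal_mult[symmetric] flip: powr_add)
      also have "\<dots> \<le> ennreal ((1 + 2 * t) powr (- 3 / 2))"
        using True J(2) by (intro ennreal_leI powr_mono) auto
      finally show ?thesis using True by simp
    qed simp
  qed
  also have "\<dots> = ennreal (0 - (- ((1 + 2 * 0) powr (- 1 / 2))))"
  proof (rule nn_integral_FTC_atLeast)
    show "((\<lambda>t. - ((1 + 2 * t) powr (- 1 / 2))) has_real_derivative (1 + 2 * t) powr (- 3 / 2)) (at t)" if "0 \<le> t" for t :: real
      using that by (auto intro!: derivative_eq_intros)
    show "((\<lambda>t::real. - ((1 + 2 * t) powr (- 1 / 2))) \<longlongrightarrow> 0) at_top" by real_asymp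
  qed auto
  finally have "(\<integral>\<^sup>+w. ennreal (inverse (sqrt (sq J w))) \<partial>gauss_on I) \<le> 1 + ennreal (exp 1) * 1"
    by (simp add: add_left_mono mult_left_mono)
  then show ?thesis by (rule order.strict_trans1) (simp add: ennreal_mult_less_top)
qed

lemma sq_poly_finite:
  assumes "J \<subseteq> I" "0 \<le> c"
  shows "(\<integral>\<^sup>+w. ennreal ((1 + c * sq J w) ^ q) \<partial>gauss_on I) < \<top>"
proof -
  have "integrable (gauss_on I) (\<lambda>w. (1 + c * sq J w) ^ q)"
    using sq_poly_integral[OF assms(1), of "[:1, c:] ^ q"] by (simp add: has_bochner_integral_iff mult.commute)
  then show ?thesis using assms(2) sq_nonneg by (subst nn_integral_eq_integral) auto
qed

text \<open>The two difficulties separate at 1: above it the inverse root is at most 1, below it the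
  polynomial is at most \<open>5 ^ q\<close>.\<close>

lemma sq_rsqrt_poly_finite:
  assumes "J \<subseteq> I" "2 \<le> card J" "0 < c"
  shows "(\<integral>\<^sup>+w. ennreal ((1 + 4 * (c * sq J w)) ^ q * inverse (sqrt (c * sq J w))) \<partial>gauss_on I) < \<top>"
proof -
  note [measurable] = sq_measurable[OF assms(1)]
  have "(\<integral>\<^sup>+w. ennreal ((1 + 4 * (c * sq J w)) ^ q * inverse (sqrt (c * sq J w))) \<partial>gauss_on I)
    \<le> (\<integral>\<^sup>+w. ennreal ((1 + 4 * c * sq J w) ^ q) + ennreal (5 ^ q * inverse (sqrt c)) * ennreal (inverse (sqrt (sq J w))) \<partial>gauss_on I)"
  proof (rule nn_integral_mono)
    fix w
    define x where "x = c * sq J w"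
    have x: "0 \<le> x" using assms(3) sq_nonneg[of J w] by (simp add: x_def)
    have "(1 + 4 * x) ^ q * inverse (sqrt x) \<le> (1 + 4 * x) ^ q + 5 ^ q * inverse (sqrt x)"
    proof (cases "1 \<le> x")
      case True
      then have "inverse (sqrt x) \<le> 1" by (simp add: field_simps)
      then have "(1 + 4 * x) ^ q * inverse (sqrt x) \<le> (1 + 4 * x) ^ q * 1" using x by (intro mult_left_mono) auto
      moreover have "0 \<le> 5 ^ q * inverse (sqrt x)" using x by simp
      ultimately show ?thesis by linarith
    next
      case False
      then have "(1 + 4 * x) ^ q * inverse (sqrt x) \<le> 5 ^ q * inverse (sqrt x)"
        using x by (intro mult_right_mono power_mono) auto
      moreover have "0 \<le> (1 + 4 * x) ^ q" using x by simp
      ultimately show ?thesis by linarith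
    qed
    from ennreal_leI[OF this]
    show "ennreal ((1 + 4 * (c * sq J w)) ^ q * inverse (sqrt (c * sq J w))) \<le> ennreal ((1 + 4 * c * sq J w) ^ q) + ennreal (5 ^ q * inverse (sqrt c)) * ennreal (inverse (sqrt (sq J w)))"
      using x assms(3) sq_nonneg[of J w] unfolding x_def
      by (simp add: ennreal_mult[symmetric] ennreal_plus[symmetric] real_sqrt_mult mult_ac del: ennreal_plus)
  qed
  also have "\<dots> = (\<integral>\<^sup>+w. ennreal ((1 + 4 * c * sq J w) ^ q) \<partial>gauss_on I) + ennreal (5 ^ q * inverse (sqrt c)) * (\<integral>\<^sup>+w. ennreal (inverse (sqrt (sq J w))) \<partial>gauss_on I)"
    by (simp add: nn_integral_add nn_integral_cmult)
  also have "\<dots> < \<top>" using sq_poly_finite[OF assms(1), of "4 * c" q] sq_rsqrt_finite[OF assms(1,2)] assms(3)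
    by (simp add: ennreal_mult_less_top)
  finally show ?thesis .
qed

lemma nn_integral_prod_indep:
  fixes h :: "nat \<Rightarrow> ('i \<Rightarrow> real) \<Rightarrow> ennreal"
  assumes "\<And>i. i < N \<Longrightarrow> B i \<subseteq> I" "\<And>i j. i < j \<Longrightarrow> j < N \<Longrightarrow> B i \<inter> B j = {}"
    "\<And>i. i < N \<Longrightarrow> h i \<in> borel_measurable (gauss_on I)" "\<And>i. i < N \<Longrightarrow> dep (B i) (h i)"
  shows "(\<integral>\<^sup>+w. (\<Prod>i<N. h i w) \<partial>gauss_on I) = (\<Prod>i<N. \<integral>\<^sup>+w. h i w \<partial>gauss_on I)"
  using assms
proof (induction N)
  case 0
  then show ?case using P.emeasure_space_1 by simp
next
  case (Suc N)
  have "(\<integral>\<^sup>+w. (\<Prod>i<N. h i w) * h N w \<partial>gauss_on I) = (\<integral>\<^sup>+w. (\<Prod>i<N. h i w) \<partial>gauss_on I) * (\<integral>\<^sup>+w. h N w \<partial>gauss_on I)"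
  proof (rule nn_integral_indep)
    show "(\<Union>i<N. B i) \<subseteq> I" "B N \<subseteq> I" using Suc.prems(1) by (auto simp: less_Suc_eq)
    show "(\<Union>i<N. B i) \<inter> B N = {}" using Suc.prems(2)[of _ N] by blast
    show "(\<lambda>w. \<Prod>i<N. h i w) \<in> borel_measurable (gauss_on I)" by (intro borel_measurable_prod_ennreal Suc.prems(3)) auto
    have "h i x = h i y" if "i < N" "\<forall>q\<in>(\<Union>i<N. B i). x q = y q" for i x y
      using Suc.prems(4)[of i] that unfolding dep_def by auto
    then show "dep (\<Union>i<N. B i) (\<lambda>w. \<Prod>i<N. h i w)" unfolding dep_def by (auto intro!: prod.cong)
  qed (use Suc.prems in auto)
  then show ?case using Suc by (simp add: mult.commute)
qed

end

lemma one_plus_sum_le_prod: "(\<And>i. i < n \<Longrightarrow> 0 \<le> f i) \<Longrightarrow> 1 + (\<Sum>i<n. f i) \<le> (\<Prod>i<n. 1 + f i :: real)" for n :: nat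
proof (induction n)
  case (Suc n)
  have "1 + (\<Sum>i<Suc n. f i) \<le> (1 + (\<Sum>i<n. f i)) * (1 + f n)"
    using mult_nonneg_nonneg[OF Suc.prems[of n] sum_nonneg[of "{..<n}" f]] Suc.prems by (simp add: algebra_simps)
  also have "\<dots> \<le> (\<Prod>i<n. 1 + f i) * (1 + f n)" using Suc by (intro mult_right_mono) auto
  finally show ?case by simp
qed simp

context wishart_limit
begin

text \<open>By \<open>moment_poly_sq_bound\<close> the only singularities of the error norm are the
  inverse roots of the first \<open>k\<close> diagonal entries. The sum \<open>jac_size\<close> is
  majorized by a product, so that the bound factorizes over independent variables.\<close>

lemma cg_err_bound:
  assumes "2 \<le> l" "0 < n" "k < n" "\<forall>i<n. 0 < A n i w"
  shows "\<bar>cg_err l k n w\<bar> \<le> (\<Prod>i<n. ((1 + 4 * A n i w) ^ nat (l - 2) * (if i < k then inverse (sqrt (A n i w)) else 1))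
     * (1 + 4 * S n i w) ^ Suc (nat (l - 2)))"
proof -
  define q where "q = nat (l - 2)"
  define a where "a i = A n i w" for i
  define s where "s i = S n i w" for i
  interpret jacobi_data a s n unfolding a_def s_def by (rule jacobi_data_AS) (use assms in auto)
  have l: "l - 2 = int q" using assms by (simp add: q_def)
  have ap: "0 < a i" if "i < n" for i using a that by simp
  have sp: "0 \<le> s i" if "i < n" for i using s that by simp
  define x where "x = lin_ev (\<lambda>t. c (int q + int t)) ((jac_poly a s k)\<^sup>2)"
  define p where "p = (\<Prod>i<k. a i)"
  have p: "0 < p" unfolding p_def using ap assms(3) by (intro prod_pos) auto
  define r where "r = (\<Prod>i<k. s i)"
  have r: "0 \<le> r" unfolding r_def using sp assms(3) by (intro prod_nonneg) auto
  define z where "z = (\<Prod>i<n. 1 + 4 * a i) * (\<Prod>i<n. 1 + 4 * s i)"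
  have pa: "1 \<le> (\<Prod>i<n. 1 + 4 * a i)" and ps: "1 \<le> (\<Prod>i<n. 1 + 4 * s i)"
    using ap sp by (auto intro!: prod_ge_1 simp: less_imp_le)
  have z1: "1 + 4 * jac_size \<le> z"
  proof -
    have "1 + 4 * jac_size = 1 + (\<Sum>i<n. 4 * a i) + (\<Sum>i<n. 4 * s i)" by (simp add: jac_size_def sum.distrib flip: sum_distrib_left)
    also have "\<dots> \<le> (1 + (\<Sum>i<n. 4 * a i)) * (1 + (\<Sum>i<n. 4 * s i))"
    proof -
      have "0 \<le> (\<Sum>i<n. 4 * a i) * (\<Sum>i<n. 4 * s i)" using ap sp by (intro mult_nonneg_nonneg sum_nonneg) (auto simp: less_imp_le)
      then show ?thesis by (simp add: algebra_simps)
    qed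
    also have "\<dots> \<le> z" unfolding z_def using ap sp
      by (intro mult_mono one_plus_sum_le_prod add_nonneg_nonneg sum_nonneg) (auto simp: less_imp_le intro!: prod_nonneg add_nonneg_nonneg)
    finally show ?thesis .
  qed
  have z: "1 \<le> z" using z1 jac_size_nonneg by linarith
  have "\<bar>x\<bar> \<le> (4 * jac_size) ^ q * (\<Prod>i<k. a i * s i)" unfolding x_def by (rule moment_poly_sq_bound) (use assms in simp)
  also have "\<dots> \<le> z ^ q * (p * r)"
    using z1 jac_size_nonneg p r unfolding prod.distrib p_def r_def
    by (intro mult_mono power_mono) (auto simp: less_imp_le)
  \<comment> \<open>Since \<open>z ^ q\<close> is at least 1, squaring it only enlarges the bound,
    and the square root then leaves an integer power.\<close>
  also have "\<dots> \<le> (z ^ q)\<^sup>2 * (p * r)"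
    using z p r one_le_power[OF z, of q] by (intro mult_right_mono) (auto simp: power2_eq_square)
  finally have "sqrt \<bar>x\<bar> \<le> sqrt ((z ^ q)\<^sup>2 * (p * r))" by (rule real_sqrt_le_mono)
  also have "\<dots> = z ^ q * (sqrt p * sqrt r)" using z by (simp add: real_sqrt_mult)
  finally have "sqrt \<bar>x\<bar> / p \<le> z ^ q * (sqrt p * sqrt r) / p" using p by (intro divide_right_mono) auto
  also have "\<dots> = z ^ q * (inverse (sqrt p) * sqrt r)"
  proof -
    have "sqrt p / p = inverse (sqrt p)" using p real_sqrt_mult_self[of p] by (simp add: field_simps)
    then show ?thesis by (simp add: divide_inverse mult_ac)
  qed
  also have "\<dots> \<le> z ^ q * (inverse (sqrt p) * (\<Prod>i<n. 1 + 4 * s i))"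
  proof (intro mult_left_mono)
    have "sqrt r = (\<Prod>i<k. sqrt (s i))" unfolding r_def by (induction k) (auto simp: real_sqrt_mult)
    also have "\<dots> \<le> (\<Prod>i<k. 1 + 4 * s i)"
    proof (rule prod_mono)
      fix i assume "i \<in> {..<k}"
      then have i: "0 \<le> s i" using sp assms(3) by auto
      have "sqrt (s i) \<le> sqrt ((1 + s i)\<^sup>2)" using i by (intro real_sqrt_le_mono) (simp add: power2_eq_square algebra_simps)
      then show "0 \<le> sqrt (s i) \<and> sqrt (s i) \<le> 1 + 4 * s i" using i by simp
    qed
    also have "\<dots> \<le> (\<Prod>i<n. 1 + 4 * s i)"
      using sp assms(3) by (intro prod_mono2) auto
    finally show "sqrt r \<le> (\<Prod>i<n. 1 + 4 * s i)" .
  qed (use z p in auto)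
  also have "inverse (sqrt p) = (\<Prod>i<n. if i < k then inverse (sqrt (a i)) else 1)"
  proof -
    have "inverse (sqrt p) = (\<Prod>i<k. inverse (sqrt (a i)))" unfolding p_def by (induction k) (auto simp: real_sqrt_mult)
    also have "\<dots> = (\<Prod>i<n. if i < k then inverse (sqrt (a i)) else 1)"
      using assms(3) by (intro prod.mono_neutral_cong_left) auto
    finally show ?thesis .
  qed
  also have "z ^ q * ((\<Prod>i<n. if i < k then inverse (sqrt (a i)) else 1) * (\<Prod>i<n. 1 + 4 * s i))
    = (\<Prod>i<n. ((1 + 4 * a i) ^ q * (if i < k then inverse (sqrt (a i)) else 1)) * (1 + 4 * s i) ^ Suc q)"
    unfolding z_def by (simp add: prod.distrib prod_power_distrib power_mult_distrib mult_ac)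
  also have "sqrt \<bar>x\<bar> / p = \<bar>cg_err l k n w\<bar>"
  proof -
    have "cg_err l k n w = sqrt x / p"
      using cg_error_norm_jacobi[of k \<beta> l] assms(3) unfolding cg_err_def x_def p_def l a_def s_def by simp
    moreover have "\<bar>sqrt x\<bar> = sqrt \<bar>x\<bar>" by (simp add: abs_if real_sqrt_minus)
    ultimately show ?thesis using p by simp
  qed
  finally show ?thesis unfolding q_def a_def s_def .
qed

text \<open>For \<open>k \<ge> n\<close> the error vanishes almost surely. For
  \<open>i < k < n\<close> the row with index \<open>i\<close> retains at least two entries, which
  is just what the inverse root requires.\<close>

lemma cg_err_finite:
  assumes "2 \<le> l" "0 < n"
  shows "(\<integral>\<^sup>+w. ennreal \<bar>cg_err l k n w - L\<bar> \<partial>gauss_on (I n)) < \<top>"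
proof -
  obtain g where [measurable]: "g \<in> borel_measurable (gauss_on (I n))" and
    g: "AE w in gauss_on (I n). ennreal \<bar>cg_err l k n w\<bar> \<le> g w" "(\<integral>\<^sup>+w. g w \<partial>gauss_on (I n)) < \<top>"
  proof (cases "k < n")
    case False
    have "AE w in gauss_on (I n). ennreal \<bar>cg_err l k n w\<bar> \<le> 0"
      using AE_A_pos[of n]
    proof eventually_elim
      case (elim w)
      interpret jacobi_data "\<lambda>i. A n i w" "\<lambda>i. S n i w" n by (rule jacobi_data_AS) (use elim assms in auto)
      show ?case unfolding cg_err_def using cg_error_norm_jacobi_large[of k \<beta> l] False by simp
    qed
    then show ?thesis by (intro that[of "\<lambda>_. 0"]) auto
  next
    case True
    define q where "q = nat (l - 2)"
    define f where "f i w = (1 + 4 * A n i w) ^ q * (if i < k then inverse (sqrt (A n i w)) else 1)" for i w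
    define g where "g i w = (1 + 4 * S n i w) ^ Suc q" for i w
    have mp: "0 < m n" using True m_bounds(3)[of n] by simp
    have kp: "0 < \<kappa> n" using beta_pos mp by (simp add: \<kappa>_def)
    have nn: "0 \<le> A n i w" "0 \<le> S n i w" for i w using kp by (simp_all add: A_def S_def G.sq_nonneg)
    have fg: "0 \<le> f i w" "0 \<le> g i w" for i w using nn[of i w] by (auto simp: f_def g_def)
    have fm: "(\<lambda>w. ennreal (f i w)) \<in> borel_measurable (gauss_on (I n))" "(\<lambda>w. ennreal (g i w)) \<in> borel_measurable (gauss_on (I n))"
      if "i < n" for i
      using A_measurable[OF that] S_measurable[OF that] unfolding f_def g_def by (cases "i < k"; measurable)+
    have fd: "G.dep (RI n i) (\<lambda>w. ennreal (f i w))" "G.dep (CI n i) (\<lambda>w. ennreal (g i w))" for i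
      unfolding f_def g_def A_def S_def by (rule G.dep_sq)+
    have ff: "(\<integral>\<^sup>+w. ennreal (f i w) \<partial>gauss_on (I n)) < \<top>" if "i < n" for i
    proof (cases "i < k")
      case True
      have "2 \<le> real \<beta> * (real (m n) - real i)"
      proof -
        have "2 \<le> real (m n) - real i" using True \<open>k < n\<close> m_bounds(3)[of n] by linarith
        then show ?thesis using mult_mono[OF beta_pos, of 2 "real (m n) - real i"] by simp
      qed
      then have "2 \<le> card (RI n i)" unfolding cards(1)[OF that, symmetric] by simp
      from G.sq_rsqrt_poly_finite[OF subsets(1)[OF that] this kp, of q] show ?thesis using True by (simp add: f_def A_def)
    next
      case False
      then show ?thesis using G.sq_poly_finite[OF subsets(1)[OF that], of "4 * \<kappa> n" q] kp by (simp add: f_def A_def mult.assoc)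
    qed
    have gf: "(\<integral>\<^sup>+w. ennreal (g i w) \<partial>gauss_on (I n)) < \<top>" if "i < n" for i
      using G.sq_poly_finite[OF subsets(2)[OF that], of "4 * \<kappa> n" "Suc q"] kp by (simp add: g_def S_def mult.assoc)
    have le: "AE w in gauss_on (I n). ennreal \<bar>cg_err l k n w\<bar> \<le> (\<Prod>i<n. ennreal (f i w) * ennreal (g i w))"
      using AE_A_pos[of n]
    proof eventually_elim
      case (elim w)
      have "\<bar>cg_err l k n w\<bar> \<le> (\<Prod>i<n. f i w * g i w)"
        unfolding f_def g_def q_def by (rule cg_err_bound) (use assms True elim in auto)
      then have "ennreal \<bar>cg_err l k n w\<bar> \<le> ennreal (\<Prod>i<n. f i w * g i w)" by (rule ennreal_leI)
      also have "\<dots> = (\<Prod>i<n. ennreal (f i w) * ennreal (g i w))"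
        using fg by (simp add: prod_ennreal[symmetric] ennreal_mult)
      finally show ?case .
    qed
    have "(\<integral>\<^sup>+w. (\<Prod>i<n. ennreal (f i w) * ennreal (g i w)) \<partial>gauss_on (I n)) = (\<Prod>i<n. \<integral>\<^sup>+w. ennreal (f i w) * ennreal (g i w) \<partial>gauss_on (I n))"
    proof (rule G.nn_integral_prod_indep)
      show "RI n i \<union> CI n i \<subseteq> I n" if "i < n" for i using subsets that by auto
      show "(RI n i \<union> CI n i) \<inter> (RI n j \<union> CI n j) = {}" if "i < j" "j < n" for i j using that by (auto simp: RI_def CI_def)
      show "(\<lambda>w. ennreal (f i w) * ennreal (g i w)) \<in> borel_measurable (gauss_on (I n))" if "i < n" for i
        using fm[OF that] by measurable
      show "G.dep (RI n i \<union> CI n i) (\<lambda>w. ennreal (f i w) * ennreal (g i w))" for i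
        using fd[of i] unfolding G.dep_def by (metis UnCI)
    qed
    also have "\<dots> = (\<Prod>i<n. (\<integral>\<^sup>+w. ennreal (f i w) \<partial>gauss_on (I n)) * (\<integral>\<^sup>+w. ennreal (g i w) \<partial>gauss_on (I n)))"
    proof (rule prod.cong[OF refl])
      fix i assume "i \<in> {..<n}"
      then have i: "i < n" by simp
      show "(\<integral>\<^sup>+w. ennreal (f i w) * ennreal (g i w) \<partial>gauss_on (I n)) = (\<integral>\<^sup>+w. ennreal (f i w) \<partial>gauss_on (I n)) * (\<integral>\<^sup>+w. ennreal (g i w) \<partial>gauss_on (I n))"
        by (rule G.nn_integral_indep[OF subsets(1)[OF i] subsets(2)[OF i] _ fm(1)[OF i] fd(1) fm(2)[OF i] fd(2)]) (auto simp: RI_def CI_def)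
    qed
    also have "\<dots> < \<top>"
    proof -
      have "(\<Prod>i<N. (\<integral>\<^sup>+w. ennreal (f i w) \<partial>gauss_on (I n)) * (\<integral>\<^sup>+w. ennreal (g i w) \<partial>gauss_on (I n))) < \<top>" if "N \<le> n" for N
        using that by (induction N) (auto simp: ennreal_mult_less_top ff gf)
      then show ?thesis by simp
    qed
    finally show ?thesis using le fm by (intro that) (auto intro!: borel_measurable_prod_ennreal)
  qed
  have "(\<integral>\<^sup>+w. ennreal \<bar>cg_err l k n w - L\<bar> \<partial>gauss_on (I n)) \<le> (\<integral>\<^sup>+w. g w + ennreal \<bar>L\<bar> \<partial>gauss_on (I n))"
    using g(1)
  proof (intro nn_integral_mono_AE, eventually_elim)
    case (elim w)
    have "ennreal \<bar>cg_err l k n w - L\<bar> \<le> ennreal \<bar>cg_err l k n w\<bar> + ennreal \<bar>L\<bar>"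
      by (simp add: ennreal_plus[symmetric] ennreal_leI del: ennreal_plus)
    also have "\<dots> \<le> g w + ennreal \<bar>L\<bar>" using elim by (intro add_mono) auto
    finally show ?case .
  qed
  also have "\<dots> = (\<integral>\<^sup>+w. g w \<partial>gauss_on (I n)) + ennreal \<bar>L\<bar>"
    using G.P.emeasure_space_1[of n] by (simp add: nn_integral_add)
  also have "\<dots> < \<top>" using g(2) by simp
  finally show ?thesis .
qed

end

subsection \<open>Independence of the model\<close>

lemma nn_integral_distr':
  "T \<in> measurable M N \<Longrightarrow> f \<in> borel_measurable N \<Longrightarrow> (\<integral>\<^sup>+x. f x \<partial>distr M N T) = (\<integral>\<^sup>+x. f (T x) \<partial>M)"
  by (simp add: nn_integral_distr)

context wishart_limit
begin

lemma cg_law_canonical: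
  assumes n: "1 \<le> n" and b: "b \<in> carrier_vec n" "\<And>i. i < n \<Longrightarrow> b $ i \<in> scalars \<beta>" "L2_set (\<lambda>i. cmod (b $ i)) {..<n} = 1"
    and H: "H \<in> borel_measurable (borel :: real measure)"
  shows "(\<integral>\<^sup>+u. H (cg_error_norm \<beta> l (wishart \<beta> (m n) (mat n (m n) (gauss_entry \<beta> u))) b k) \<partial>gauss_on (I n))
     = (\<integral>\<^sup>+u. (H (cg_err l k n u) :: ennreal) \<partial>gauss_on (I n))"
proof -
  have mp: "0 < m n" using n m_bounds(3)[of n] by simp
  interpret GG: gauss_gram \<beta> n "m n" "\<kappa> n"
    using beta n m_bounds(3)[of n] beta_pos mp by unfold_locales (auto simp: \<kappa>_def)
  have 1: "GG.gram (GG.full u) = wishart \<beta> (m n) (mat n (m n) (gauss_entry \<beta> u))" for u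
    unfolding GG.gram_def GG.full_def wishart_def \<kappa>_def[symmetric] by (simp add: case_prod_unfold)
  have 2: "(\<lambda>i. \<kappa> n * GG.row_sq u i) = (\<lambda>i. A n i u)" "(\<lambda>i. \<kappa> n * GG.col_sq u i) = (\<lambda>i. S n i u)" for u
    by (simp_all add: GG.row_sq_def GG.col_sq_def A_def S_def G.sq_def RI_def CI_def)
  have 3: "GG.I = I n" by (simp add: GG.I_def I_def)
  show ?thesis using GG.cg_law[OF b H, of l k] unfolding 1 2 3 cg_err_def .
qed

text \<open>Condition on \<open>b\<close> and use the unitary invariance of the Gaussian matrix.\<close>

lemma cg_model_law:
  assumes M: "prob_space M" and n: "1 \<le> n" and X: "gaussian_matrix M \<beta> n (m n) X"
    and W: "\<And>u. u \<in> space M \<Longrightarrow> W u = wishart \<beta> (m n) (X u)"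
    and b: "\<And>u. u \<in> space M \<Longrightarrow> b u \<in> carrier_vec n" "\<And>u i. u \<in> space M \<Longrightarrow> i < n \<Longrightarrow> b u $ i \<in> scalars \<beta>"
    and b1: "AE u in M. L2_set (\<lambda>i. cmod (b u $ i)) {..<n} = 1"
    and bm: "\<And>i. i < n \<Longrightarrow> (\<lambda>u. b u $ i) \<in> borel_measurable M"
    and ind: "prob_space.indep_set M
          (sets (vimage_algebra (space M) (\<lambda>u. restrict (\<lambda>(i, j). W u $$ (i, j)) ({..<n} \<times> {..<n}))
             (PiM ({..<n} \<times> {..<n}) (\<lambda>_. borel))))
          (sets (vimage_algebra (space M) (\<lambda>u. restrict (\<lambda>i. b u $ i) {..<n}) (PiM {..<n} (\<lambda>_. borel))))"
  shows "(\<lambda>u. cg_error_norm \<beta> l (W u) (b u) k) \<in> borel_measurable M"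
    and "H \<in> borel_measurable (borel :: real measure) \<Longrightarrow>
      (\<integral>\<^sup>+u. H (cg_error_norm \<beta> l (W u) (b u) k) \<partial>M) = (\<integral>\<^sup>+u. (H (cg_err l k n u) :: ennreal) \<partial>gauss_on (I n))"
proof -
  interpret M: prob_space M by (rule M)
  have mp: "0 < m n" using n m_bounds(3)[of n] by simp
  interpret GG: gauss_gram \<beta> n "m n" "\<kappa> n"
    using beta n m_bounds(3)[of n] beta_pos mp by unfold_locales (auto simp: \<kappa>_def)
  have GGI: "GG.I = I n" by (simp add: GG.I_def I_def)
  define part where "part = (\<lambda>(p, i, j) u. if p = (0::nat) then Re (X u $$ (i, j)) else Im (X u $$ (i, j)))"
  define Z where "Z u = (\<lambda>q\<in>I n. part q u)" for u
  have iv: "M.indep_vars (\<lambda>_. borel) part (I n)" and dist: "\<And>q. q \<in> I n \<Longrightarrow> distributed M lborel (part q) std_normal_density"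
    and Xc: "\<And>u. u \<in> space M \<Longrightarrow> X u \<in> carrier_mat n (m n)"
    and Xs: "\<And>u i j. u \<in> space M \<Longrightarrow> i < n \<Longrightarrow> j < m n \<Longrightarrow> X u $$ (i, j) \<in> scalars \<beta>"
    using X unfolding gaussian_matrix_def part_def I_def Let_def by auto
  have pm: "part q \<in> borel_measurable M" if "q \<in> I n" for q
    using distributed_measurable[OF dist[OF that]] by simp
  have Zm: "Z \<in> measurable M (PiM (I n) (\<lambda>_. borel))" unfolding Z_def[abs_def] by (rule measurable_restrict) (rule pm)
  have "(0, 0, 0) \<in> I n" using beta n mp by (auto simp: I_def)
  then have Ine: "I n \<noteq> {}" by blast
  have Zd: "distr M (PiM (I n) (\<lambda>_. borel)) Z = gauss_on (I n)"
  proof -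
    have "distr M (PiM (I n) (\<lambda>_. borel)) Z = PiM (I n) (\<lambda>q. distr M borel (part q))"
      using iv unfolding Z_def[abs_def] using M.indep_vars_iff_distr_eq_PiM'[OF Ine pm] by simp
    also have "\<dots> = gauss_on (I n)"
    proof (rule PiM_cong[OF refl])
      fix q assume "q \<in> I n"
      have "distr M borel (part q) = distr M lborel (part q)" by (rule distr_cong) auto
      then show "distr M borel (part q) = gauss" using distributed_distr_eq_density[OF dist[OF \<open>q \<in> I n\<close>]] by simp
    qed
    finally show ?thesis .
  qed
  have XZ: "X u = mat n (m n) (gauss_entry \<beta> (Z u))" if u: "u \<in> space M" for u
  proof (rule eq_matI)
    fix i j assume "i < dim_row (mat n (m n) (gauss_entry \<beta> (Z u)))" "j < dim_col (mat n (m n) (gauss_entry \<beta> (Z u)))"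
    then have ij: "i < n" "j < m n" by auto
    have s: "X u $$ (i, j) \<in> scalars \<beta>" by (rule Xs[OF u ij])
    have inI: "(p, i, j) \<in> I n" if "p < \<beta>" for p using ij that by (simp add: I_def)
    have "X u $$ (i, j) = gauss_entry \<beta> (Z u) (i, j)"
    proof (cases "\<beta> = 2")
      case True
      then show ?thesis using inI[of 0] inI[of 1] by (simp add: gauss_entry_def Z_def part_def complex_eq_iff)
    next
      case False
      then have "\<beta> = 1" using beta by simp
      then have "Im (X u $$ (i, j)) = 0" using s by (simp add: scalars_def complex_is_Real_iff)
      then show ?thesis using False beta inI[of 0] by (simp add: gauss_entry_def Z_def part_def complex_eq_iff)
    qed
    then show "X u $$ (i, j) = mat n (m n) (gauss_entry \<beta> (Z u)) $$ (i, j)" using ij by simp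
  qed (use Xc[OF u] in auto)
  \<comment> \<open>The Wishart matrix as a deterministic function of the Gaussian coordinates, to
    which the canonical law applies.\<close>
  define Wc where "Wc z = wishart \<beta> (m n) (mat n (m n) (gauss_entry \<beta> z))" for z
  have Wg: "Wc z = GG.gram (GG.full z)" for z
    unfolding Wc_def GG.gram_def GG.full_def wishart_def \<kappa>_def[symmetric] by (simp add: case_prod_unfold)
  have WZ: "W u = Wc (Z u)" if "u \<in> space M" for u using W[OF that] XZ[OF that] by (simp add: Wc_def)
  have full_s: "GG.full z i j \<in> scalars \<beta>" for z i j unfolding GG.full_def by (rule gauss_entry_scalars[OF beta])
  have Wc_c: "Wc z \<in> carrier_mat n n" for z unfolding Wg by (rule GG.gram_carrier)
  have cg: "cg_error_norm \<beta> l (Wc z) v k = cg_formula l k n (Wc z) v"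
    if "v \<in> carrier_vec n" "\<And>i. i < n \<Longrightarrow> v $ i \<in> scalars \<beta>" for z v
    unfolding Wg by (rule GG.cg_gram_formula[OF full_s that])
  have Wcm: "meas_mat (gauss_on (I n)) Wc n n"
    unfolding Wg[abs_def] by (rule GG.meas_gram[of _ "gauss_on (I n)"]) (use GG.gauss_entry_measurable in \<open>simp add: GG.full_def GGI\<close>)
  have Zg: "Z \<in> measurable M (gauss_on (I n))" using Zm by (simp cong: measurable_cong_sets sets_PiM_cong)
  let ?NW = "PiM ({..<n} \<times> {..<n}) (\<lambda>_. borel) :: (nat \<times> nat \<Rightarrow> complex) measure"
  let ?NB = "PiM {..<n} (\<lambda>_. borel) :: (nat \<Rightarrow> complex) measure"
  \<comment> \<open>The model makes \<open>b\<close> independent of \<open>W\<close>, not of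
    \<open>X\<close>; the joint law is therefore split at the level of the entries of
    \<open>W\<close>.\<close>
  define fW where "fW u = restrict (\<lambda>(i, j). W u $$ (i, j)) ({..<n} \<times> {..<n})" for u
  define fB where "fB u = restrict (\<lambda>i. b u $ i) {..<n}" for u
  have fBm: "fB \<in> measurable M ?NB" unfolding fB_def[abs_def] by (rule measurable_restrict) (use bm in auto)
  have fWm: "fW \<in> measurable M ?NW"
    unfolding fW_def[abs_def]
  proof (rule measurable_restrict)
    fix ij :: "nat \<times> nat" assume "ij \<in> {..<n} \<times> {..<n}"
    then have "(\<lambda>u. Wc (Z u) $$ ij) \<in> borel_measurable M"
      using measurable_compose[OF Zg meas_matD(2)[OF Wcm, of "fst ij" "snd ij"]] by auto
    then show "(\<lambda>u. case ij of (i, j) \<Rightarrow> W u $$ (i, j)) \<in> borel_measurable M"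
      using WZ by (cases ij) (simp cong: measurable_cong)
  qed
  \<comment> \<open>The explicit formula is measurable on all pairs of entry families and equals the
    error norm on those that occur.\<close>
  define \<Phi> where "\<Phi> wv = cg_formula l k n (mat n n (fst wv)) (vec n (snd wv))" for wv
  have \<Phi>m: "\<Phi> \<in> borel_measurable (?NW \<Otimes>\<^sub>M ?NB)"
    unfolding \<Phi>_def[abs_def]
  proof (rule meas_cg_formula)
    have "(\<lambda>wv. fst wv (i, j)) \<in> borel_measurable (?NW \<Otimes>\<^sub>M ?NB)" if "i < n" "j < n" for i j
      using that by (intro measurable_compose[OF measurable_fst measurable_component_singleton]) auto
    then show "meas_mat (?NW \<Otimes>\<^sub>M ?NB) (\<lambda>wv. mat n n (fst wv)) n n" by (simp add: meas_mat_def)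
    have "(\<lambda>wv. snd wv i) \<in> borel_measurable (?NW \<Otimes>\<^sub>M ?NB)" if "i < n" for i
      using that by (intro measurable_compose[OF measurable_snd measurable_component_singleton]) auto
    then show "meas_vec (?NW \<Otimes>\<^sub>M ?NB) (\<lambda>wv. vec n (snd wv)) n" by (simp add: meas_vec_def)
  qed
  have fB_eq: "vec n (fB u) = b u" if "u \<in> space M" for u
    using b(1)[OF that] by (intro eq_vecI) (auto simp: fB_def)
  have fW_eq: "mat n n (fW u) = Wc (Z u)" if "u \<in> space M" for u
    using Wc_c[of "Z u"] WZ[OF that] by (intro eq_matI) (auto simp: fW_def)
  have err: "\<Phi> (fW u, fB u') = cg_error_norm \<beta> l (Wc (Z u)) (b u') k" if "u \<in> space M" "u' \<in> space M" for u u'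
    using cg[OF b(1)[OF that(2)] b(2)[OF that(2)], of "Z u"] by (simp add: \<Phi>_def fB_eq fW_eq that)
  have pairm: "(\<lambda>u. (fW u, fB u)) \<in> measurable M (?NW \<Otimes>\<^sub>M ?NB)" using fWm fBm by (rule measurable_Pair)
  have eq: "cg_error_norm \<beta> l (W u) (b u) k = \<Phi> (fW u, fB u)" if "u \<in> space M" for u
    using err[OF that that] WZ[OF that] by simp
  show "(\<lambda>u. cg_error_norm \<beta> l (W u) (b u) k) \<in> borel_measurable M"
    using measurable_compose[OF pairm \<Phi>m] eq by (simp cong: measurable_cong)
  assume H: "H \<in> borel_measurable (borel :: real measure)"
  have H\<Phi>: "(\<lambda>wv. H (\<Phi> wv)) \<in> borel_measurable (?NW \<Otimes>\<^sub>M ?NB)" by (rule measurable_compose[OF \<Phi>m H])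
  interpret A: prob_space "distr M ?NW fW" by (rule M.prob_space_distr[OF fWm])
  interpret B: prob_space "distr M ?NB fB" by (rule M.prob_space_distr[OF fBm])
  interpret AB: pair_sigma_finite "distr M ?NW fW" "distr M ?NB fB" ..
  have prod: "distr M ?NW fW \<Otimes>\<^sub>M distr M ?NB fB = distr M (?NW \<Otimes>\<^sub>M ?NB) (\<lambda>u. (fW u, fB u))"
  proof (rule pair_measure_eqI)
    fix P Q assume "P \<in> sets (distr M ?NW fW)" "Q \<in> sets (distr M ?NB fB)"
    then have P: "P \<in> sets ?NW" and Q: "Q \<in> sets ?NB" by simp_all
    have "M.prob ((fW -` P \<inter> space M) \<inter> (fB -` Q \<inter> space M)) = M.prob (fW -` P \<inter> space M) * M.prob (fB -` Q \<inter> space M)"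
      using ind unfolding fW_def[symmetric] fB_def[symmetric]
      by (rule M.indep_setD) (intro in_vimage_algebra P Q)+
    moreover have "(fW -` P \<inter> space M) \<inter> (fB -` Q \<inter> space M) = (\<lambda>u. (fW u, fB u)) -` (P \<times> Q) \<inter> space M" by auto
    ultimately show "emeasure (distr M ?NW fW) P * emeasure (distr M ?NB fB) Q = emeasure (distr M (?NW \<Otimes>\<^sub>M ?NB) (\<lambda>u. (fW u, fB u))) (P \<times> Q)"
      using P Q by (simp add: emeasure_distr fWm fBm pairm M.emeasure_eq_measure ennreal_mult)
  qed (use A.sigma_finite_measure_axioms B.sigma_finite_measure_axioms in \<open>simp_all cong: sets_pair_measure_cong\<close>)
  let ?c = "\<integral>\<^sup>+u. (H (cg_err l k n u) :: ennreal) \<partial>gauss_on (I n)"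
  have "(\<integral>\<^sup>+u. H (cg_error_norm \<beta> l (W u) (b u) k) \<partial>M) = (\<integral>\<^sup>+u. H (\<Phi> (fW u, fB u)) \<partial>M)"
    using eq by (intro nn_integral_cong) simp
  also have "\<dots> = (\<integral>\<^sup>+wv. H (\<Phi> wv) \<partial>(distr M ?NW fW \<Otimes>\<^sub>M distr M ?NB fB))"
    unfolding prod by (rule nn_integral_distr'[OF pairm H\<Phi>, symmetric])
  also have "\<dots> = (\<integral>\<^sup>+v. \<integral>\<^sup>+w. H (\<Phi> (w, v)) \<partial>distr M ?NW fW \<partial>distr M ?NB fB)"
    by (rule AB.nn_integral_snd[symmetric]) (use H\<Phi> in \<open>simp cong: measurable_cong_sets sets_pair_measure_cong\<close>)
  also have "\<dots> = (\<integral>\<^sup>+u'. \<integral>\<^sup>+w. H (\<Phi> (w, fB u')) \<partial>distr M ?NW fW \<partial>M)"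
  proof (rule nn_integral_distr'[OF fBm])
    show "(\<lambda>v. \<integral>\<^sup>+w. H (\<Phi> (w, v)) \<partial>distr M ?NW fW) \<in> borel_measurable ?NB"
      using A.borel_measurable_nn_integral[of "\<lambda>v w. H (\<Phi> (w, v))" ?NB] measurable_compose[OF measurable_pair_swap' H\<Phi>]
      by (simp add: case_prod_unfold cong: measurable_cong_sets sets_pair_measure_cong)
  qed
  also have "\<dots> = (\<integral>\<^sup>+u'. ?c \<partial>M)"
  \<comment> \<open>With \<open>b\<close> frozen at a unit vector, the inner integral no longer
    depends on it.\<close>
  proof (rule nn_integral_cong_AE)
    show "AE u' in M. (\<integral>\<^sup>+w. H (\<Phi> (w, fB u')) \<partial>distr M ?NW fW) = ?c"
      using b1 AE_space
    proof eventually_elim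
      case (elim u')
      have sB: "fB u' \<in> space ?NB" using measurable_space[OF fBm elim(2)] .
      have "(\<integral>\<^sup>+w. H (\<Phi> (w, fB u')) \<partial>distr M ?NW fW) = (\<integral>\<^sup>+u. H (\<Phi> (fW u, fB u')) \<partial>M)"
        by (rule nn_integral_distr'[OF fWm measurable_compose[OF measurable_Pair2'[OF sB] H\<Phi>]])
      also have "\<dots> = (\<integral>\<^sup>+u. H (cg_error_norm \<beta> l (Wc (Z u)) (b u') k) \<partial>M)"
        using err elim(2) by (intro nn_integral_cong) simp
      also have "\<dots> = (\<integral>\<^sup>+z. H (cg_error_norm \<beta> l (Wc z) (b u') k) \<partial>distr M (PiM (I n) (\<lambda>_. borel)) Z)"
      proof (rule nn_integral_distr'[OF Zm, symmetric])
        have "meas_vec (gauss_on (I n)) (\<lambda>_. b u') n" using b(1)[OF elim(2)] by (simp add: meas_vec_def)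
        then have "(\<lambda>z. cg_formula l k n (Wc z) (b u')) \<in> borel_measurable (gauss_on (I n))" by (rule meas_cg_formula[OF Wcm])
        then have "(\<lambda>z. H (cg_error_norm \<beta> l (Wc z) (b u') k)) \<in> borel_measurable (gauss_on (I n))"
          using cg[OF b(1)[OF elim(2)] b(2)[OF elim(2)]] by (simp add: measurable_compose[OF _ H])
        then show "(\<lambda>z. H (cg_error_norm \<beta> l (Wc z) (b u') k)) \<in> borel_measurable (PiM (I n) (\<lambda>_. borel))"
          by (simp cong: measurable_cong_sets sets_PiM_cong)
      qed
      also have "\<dots> = ?c" unfolding Zd Wc_def
        by (rule cg_law_canonical[OF n b(1)[OF elim(2)] b(2)[OF elim(2)] elim(1) H])
      finally show ?case .
    qed
  qed
  also have "\<dots> = ?c" using M.emeasure_space_1 by simp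
  finally show "(\<integral>\<^sup>+u. H (cg_error_norm \<beta> l (W u) (b u) k) \<partial>M) = ?c" .
qed

end

text \<open>For \<open>l < 2\<close> and small \<open>n\<close> the mean of the error norm can be
  infinite, through the inverse moments of a nearly square Wishart matrix; this is why integrability
  is stated separately. The constant can precede the probability space because all bounds refer to
  the canonical Gaussian law.\<close>

theorem corollary3p2p1:
  fixes \<beta> :: nat and d :: real and l :: int and k :: nat
  assumes "\<beta> \<in> {1, 2}"
    and "0 < d"
    and "d < 1 \<or> d = 1 \<and> 2 \<le> l"
  shows "\<exists>C > 0. \<forall>(M :: 'a measure) X W b. wishart_cg_model M \<beta> d X W b \<longrightarrow>
    (AE \<omega> in M. (\<lambda>n. cg_error_norm \<beta> l (W n \<omega>) (b n \<omega>) k) \<longlonglongrightarrow> limit_error l k d) \<and>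
    (let err = (\<lambda>n \<omega>. \<bar>cg_error_norm \<beta> l (W n \<omega>) (b n \<omega>) k - limit_error l k d\<bar>) in
       (\<forall>n>1. integrable M (err n) \<longrightarrow>
          prob_space.expectation M (err n) \<le> C * (ln (real n) / sqrt (real n))) \<and>
       (\<forall>\<^sub>F n in sequentially. integrable M (err n)) \<and>
       (2 \<le> l \<longrightarrow> (\<forall>n>1. integrable M (err n))))"
proof -
  interpret wishart_limit \<beta> d using assms by unfold_locales auto
  define L where "L = limit_error l k d"
  have "0 \<le> l - 2 \<or> d < 1" using assms by auto
  from cg_err_moments[OF this, of k] obtain D n0 where D: "0 \<le> D" "1 \<le> n0"
    "\<And>n. n \<ge> n0 \<Longrightarrow> (\<integral>\<^sup>+u. ennreal \<bar>cg_err l k n u - L\<bar> \<partial>gauss_on (I n)) \<le> ennreal (D / sqrt (real n))"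
    "\<And>n. n \<ge> n0 \<Longrightarrow> mom n 4 (\<lambda>u. cg_err l k n u - L) \<le> ennreal (D / (real n)\<^sup>2)"
    unfolding L_def by blast
  define E where "E n = (\<integral>\<^sup>+u. ennreal \<bar>cg_err l k n u - L\<bar> \<partial>gauss_on (I n))" for n
  \<comment> \<open>Covers the finitely many dimensions below \<open>n0\<close>. An infinite mean
    becomes 0 under \<open>enn2real\<close>; this is harmless, as such dimensions are excluded by
    integrability.\<close>
  define T where "T = (\<Sum>n<n0. enn2real (E n))"
  define Q where "Q = D + T * sqrt (real n0)"
  \<comment> \<open>For \<open>n > 1\<close> the logarithm is at least \<open>ln 2\<close>, so a
    bound of order \<open>1 / sqrt n\<close> can be divided by it; the summand 1 makes the constant
    positive.\<close>
  define C where "C = Q / ln 2 + 1"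
  have T: "0 \<le> T" by (simp add: T_def sum_nonneg)
  have C: "0 < C" unfolding C_def Q_def using D(1) T by (intro add_nonneg_pos divide_nonneg_nonneg add_nonneg_nonneg mult_nonneg_nonneg) auto
  have E_le: "enn2real (E n) \<le> C * (ln (real n) / sqrt (real n))" if n: "1 < n" for n
  proof -
    have "enn2real (E n) * sqrt (real n) \<le> Q"
    proof (cases "n0 \<le> n")
      case True
      have "enn2real (E n) \<le> D / sqrt (real n)"
        using enn2real_mono[OF D(3)[OF True]] D(1) by (simp add: E_def)
      then have "enn2real (E n) * sqrt (real n) \<le> D" using n by (simp add: field_simps)
      also have "\<dots> \<le> Q" using T by (simp add: Q_def)
      finally show ?thesis .
    next
      case False
      then have "enn2real (E n) \<le> T" unfolding T_def by (intro member_le_sum) auto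
      then have "enn2real (E n) * sqrt (real n) \<le> T * sqrt (real n0)" using False T by (intro mult_mono) auto
      then show ?thesis using D(1) by (simp add: Q_def)
    qed
    also have "\<dots> \<le> C * ln 2" by (simp add: C_def distrib_right)
    also have "\<dots> \<le> C * ln (real n)" using C n by (intro mult_left_mono) auto
    finally show ?thesis using n by (simp add: pos_le_divide_eq)
  qed
  show ?thesis
  proof (intro exI[of _ C] conjI C allI impI)
    fix M :: "'a measure" and X W b
    assume model: "wishart_cg_model M \<beta> d X W b"
    then interpret M: prob_space M by (simp add: wishart_cg_model_def)
    define e where "e n u = cg_error_norm \<beta> l (W n u) (b n u) k" for n u
    have em: "e n \<in> borel_measurable M" and eH: "H \<in> borel_measurable borel \<Longrightarrow>
        (\<integral>\<^sup>+u. H (e n u) \<partial>M) = (\<integral>\<^sup>+u. H (cg_err l k n u) \<partial>gauss_on (I n))" if n: "1 \<le> n" for n and H :: "real \<Rightarrow> ennreal"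
    proof -
      have "prob_space M" "gaussian_matrix M \<beta> n (m n) (X n)" "\<And>u. u \<in> space M \<Longrightarrow> W n u = wishart \<beta> (m n) (X n u)"
        "\<And>u. u \<in> space M \<Longrightarrow> b n u \<in> carrier_vec n" "\<And>u i. u \<in> space M \<Longrightarrow> i < n \<Longrightarrow> b n u $ i \<in> scalars \<beta>"
        "AE u in M. L2_set (\<lambda>i. cmod (b n u $ i)) {..<n} = 1" "\<And>i. i < n \<Longrightarrow> (\<lambda>u. b n u $ i) \<in> borel_measurable M"
        "M.indep_set (sets (vimage_algebra (space M) (\<lambda>u. restrict (\<lambda>(i, j). W n u $$ (i, j)) ({..<n} \<times> {..<n}))
             (PiM ({..<n} \<times> {..<n}) (\<lambda>_. borel))))
          (sets (vimage_algebra (space M) (\<lambda>u. restrict (\<lambda>i. b n u $ i) {..<n}) (PiM {..<n} (\<lambda>_. borel))))"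
        using model n unfolding wishart_cg_model_def m_def by blast+
      note h = this(1) n this(2-8)
      show "e n \<in> borel_measurable M" unfolding e_def[abs_def] by (rule cg_model_law(1)[OF h])
      show "H \<in> borel_measurable borel \<Longrightarrow> (\<integral>\<^sup>+u. H (e n u) \<partial>M) = (\<integral>\<^sup>+u. H (cg_err l k n u) \<partial>gauss_on (I n))"
        unfolding e_def by (rule cg_model_law(2)[OF h])
    qed
    have eE: "(\<integral>\<^sup>+u. ennreal \<bar>e n u - L\<bar> \<partial>M) = E n" if "1 \<le> n" for n
      unfolding E_def by (rule eH[OF that, of "\<lambda>x. ennreal \<bar>x - L\<bar>"]) measurable
    have int: "integrable M (\<lambda>u. \<bar>e n u - L\<bar>)" if "1 \<le> n" "E n < \<top>" for n
      using em[OF that(1)] eE[OF that(1)] that(2) by (intro integrableI_nonneg) auto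
    have lim: "AE u in M. (\<lambda>n. e n u) \<longlonglongrightarrow> L"
    proof -
      \<comment> \<open>The fourth powers have means of order \<open>1 / n^2\<close>. Their series
        therefore has a finite mean and converges almost surely, whatever the dependence between
        different \<open>n\<close>.\<close>
      let ?f = "\<lambda>n u. (e (n + n0) u - L) ^ 4"
      have fm: "(\<lambda>u. ennreal (?f n u)) \<in> borel_measurable M" for n
      proof -
        have [measurable]: "e (n + n0) \<in> borel_measurable M" using em[of "n + n0"] D(2) by simp
        show ?thesis by measurable
      qed
      have "(\<integral>\<^sup>+u. (\<Sum>n. ennreal (?f n u)) \<partial>M) = (\<Sum>n. \<integral>\<^sup>+u. ennreal (?f n u) \<partial>M)"
        by (rule nn_integral_suminf) (rule fm)
      also have "\<dots> \<le> (\<Sum>n. ennreal (D / (real (n + n0))\<^sup>2))"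
      proof (intro suminf_le summableI)
        fix n
        have "(\<integral>\<^sup>+u. ennreal (?f n u) \<partial>M) = (\<integral>\<^sup>+u. ennreal ((cg_err l k (n + n0) u - L) ^ 4) \<partial>gauss_on (I (n + n0)))"
          by (rule eH[of "n + n0" "\<lambda>x. ennreal ((x - L) ^ 4)"]) (use D(2) in auto)
        then show "(\<integral>\<^sup>+u. ennreal (?f n u) \<partial>M) \<le> ennreal (D / (real (n + n0))\<^sup>2)" using D(4)[of "n + n0"] by simp
      qed
      also have "\<dots> = ennreal (\<Sum>n. D / (real (n + n0))\<^sup>2)"
      proof (rule suminf_ennreal2)
        have "summable (\<lambda>n. inverse (real n ^ 2))" by (rule inverse_power_summable) simp
        then have "summable (\<lambda>n. inverse (real (n + n0) ^ 2))" by (rule summable_ignore_initial_segment)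
        from summable_mult[OF this, of D] show "summable (\<lambda>n. D / (real (n + n0))\<^sup>2)" by (simp add: divide_inverse)
      qed (use D(1) in simp)
      finally have "(\<integral>\<^sup>+u. (\<Sum>n. ennreal (?f n u)) \<partial>M) \<noteq> \<top>" by (auto simp: top_unique)
      then have "AE u in M. (\<Sum>n. ennreal (?f n u)) \<noteq> \<top>"
        using nn_integral_PInf_AE[OF borel_measurable_suminf_order, of "\<lambda>n u. ennreal (?f n u)" M] fm unfolding infinity_ennreal_def by blast
      then show ?thesis
      proof eventually_elim
        case (elim u)
        have "summable (\<lambda>n. ?f n u)" by (rule summable_suminf_not_top[OF _ elim]) (simp add: zero_le_even_power)
        then have "(\<lambda>n. ?f n u) \<longlonglongrightarrow> 0" by (rule summable_LIMSEQ_zero)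
        then have "(\<lambda>n. root 4 (?f n u)) \<longlonglongrightarrow> root 4 0" by (rule tendsto_real_root)
        moreover have "root 4 (x ^ 4) = \<bar>x\<bar>" for x :: real
          using real_root_power_cancel[of 4 "\<bar>x\<bar>"] by (simp add: power_even_abs)
        ultimately have "(\<lambda>n. \<bar>e (n + n0) u - L\<bar>) \<longlonglongrightarrow> 0" by simp
        then have "(\<lambda>n. e (n + n0) u) \<longlonglongrightarrow> L" by (simp add: tendsto_rabs_zero_iff LIM_zero_iff)
        then show ?case by (rule LIMSEQ_offset)
      qed
    qed
    show "AE u in M. (\<lambda>n. cg_error_norm \<beta> l (W n u) (b n u) k) \<longlonglongrightarrow> limit_error l k d"
      using lim unfolding e_def L_def .
    have bound: "(\<integral>u. \<bar>e n u - L\<bar> \<partial>M) \<le> C * (ln (real n) / sqrt (real n))" if "1 < n" for n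
      using E_le[OF that] em[of n] eE[of n] that by (subst integral_eq_nn_integral) auto
    have ev: "\<forall>\<^sub>F n in sequentially. integrable M (\<lambda>u. \<bar>e n u - L\<bar>)"
      unfolding eventually_sequentially
    proof (intro exI[of _ n0] allI impI)
      fix n assume n: "n0 \<le> n"
      have "E n < \<top>" unfolding E_def by (rule order.strict_trans1[OF D(3)[OF n]]) simp
      then show "integrable M (\<lambda>u. \<bar>e n u - L\<bar>)" using n D(2) by (intro int) auto
    qed
    have "integrable M (\<lambda>u. \<bar>e n u - L\<bar>)" if "2 \<le> l" "1 < n" for n
      using that cg_err_finite[of l n k L] by (intro int) (auto simp: E_def)
    with bound ev show "let err = (\<lambda>n u. \<bar>cg_error_norm \<beta> l (W n u) (b n u) k - limit_error l k d\<bar>) in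
       (\<forall>n>1. integrable M (err n) \<longrightarrow>
          prob_space.expectation M (err n) \<le> C * (ln (real n) / sqrt (real n))) \<and>
       (\<forall>\<^sub>F n in sequentially. integrable M (err n)) \<and>
       (2 \<le> l \<longrightarrow> (\<forall>n>1. integrable M (err n)))"
      unfolding Let_def e_def L_def by blast
  qed
qed

end
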